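(* Let $\Omega\subset\mathbb R^d$ ($d\ge2$) be a uniformly convex domain with nodal set $\mathcal N_h=\mathcal N_h^0\cup\mathcal N_h^\partial$. Let $\mathcal N_h^0$ be translation invariant and let $\mathcal T_h$ be a mesh with nodes $\mathcal N_h$ and translation invariant basis of piecewise linear hat functions $\{\phi_i\}$. Let $x_i\in\mathcal N_h^0$, $0<\lambda\le\Lambda$, $R=\frac\Lambda\lambda\sigma^2$, $B_i:=B_{Rh}(x_i)$, and suppose $\operatorname{dist}(x_i,\partial\Omega_h)\ge Rh$. Let $u:\overline\Omega\to\mathbb R$ be a continuous convex function with $\lambda I\le D^2u\le\Lambda I$ in $B_i$, and let $N_hu$ be the nodal function $N_hu(x_j)=u(x_j)$, $x_j\in\mathcal N_h$. (i) If $u\in C^{2,\alpha}(\overline{B_i})$ with $0<\alpha\le1$, then $$\left||\partial N_hu(x_i)|-\int_\Omega\phi_i(x)\det D^2u(x)\,dx\right|\le C\,h^\alpha\,|u|_{C^{2,\alpha}(\overline{B_i})}\int_\Omega\phi_i(x)\,dx,$$ where $C=C(d,\lambda,\Lambda)$. (ii) If instead $u\in W^s_q(B_i)$ with $s-\frac dq>2$, $s\le3$, then, again with some $C=C(d,\lambda,\Lambda)$, $$\left||\partial N_hu(x_i)|-\int_\Omega\phi_i(x)\det D^2u(x)\,dx\right|\le C\,h^{s-2-\frac dq}\,|u|_{W^s_q(B_i)}\int_\Omega\phi_i(x)\,dx.$$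
   Context: Nodes and mesh. $\mathcal N_h=\mathcal N_h^0\cup\mathcal N_h^\partial$ is a finite set with interior nodes $\mathcal N_h^0=\{x_i\}_{i=1}^n\subset\Omega$ and boundary nodes $\mathcal N_h^\partial\subset\partial\Omega$. $\mathcal T_h$ is a conforming simplicial mesh with vertex set $\mathcal N_h$, and $\Omega_h=\bigcup_{T\in\mathcal T_h}T\subset\overline\Omega$. With $h_T=\operatorname{diam}T$, $\rho_T$ the diameter of the largest ball inscribed in $T$, and $h_i=\max\{h_T:x_i\in T\}$, it is assumed throughout that $\mathcal N_h$ is quasi-uniform ($\gamma h\le h_i\le h$ for $1\le i\le n$, with $0<\gamma\le1$, $h>0$) and shape-regular with constant $\sigma$ ($h_T/\rho_T\le\sigma$ for all $T$). The constants $\gamma,\sigma$ are fixed, and generic constants may depend on them. Translation invariance. $\mathcal N_h^0$ is translation invariant if there is a basis $\{e_j\}_{j=1}^d$ of $\mathbb R^d$ with $|e_j|\le1$ such that $\mathcal N_h^0=\{h\sum_{j}k_je_j:k_j\in\mathbb Z\}\cap\Omega$; the boundary nodes are only required to satisfy $\partial\Omega\subset\bigcup_{x_i\in\mathcal N_h^\partial}B_{h/2}(x_i)$. The hat function $\phi_i$ is the continuous piecewise linear function over $\mathcal T_h$ equal to $1$ at $x_i$ and $0$ at all other nodes. The basis is translation invariant if $\phi_i(x+x_i)=\phi_j(x+x_j)$ for all $x\in\mathbb R^d$ whenever $x_i,x_j\in\mathcal N_h^0$ have distance $>h$ to $\partial\Omega_h$. The subdifferential of a nodal function $u_h:\mathcal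 N_h\to\mathbb R$ is $\partial u_h(x_i)=\{v\in\mathbb R^d:u_h(x_j)\ge u_h(x_i)+v\cdot(x_j-x_i)\ \forall x_j\in\mathcal N_h\}$, and $|\cdot|$ of a set is $d$-dimensional Lebesgue measure. $|u|_{C^{2,\alpha}}$ is the $\alpha$-Hölder seminorm of $D^2u$; $|u|_{W^s_q}$ is the (fractional, Sobolev–Slobodeckij if $s\notin\mathbb N$) Sobolev seminorm of order $s$. *)

theory Defs
  imports "HOL-Analysis.Analysis" "HOL-Probability.Essential_Supremum"
begin

section \<open>Domain, nodes and mesh\<close>

text \<open>Uniform convexity is the enclosing ball condition: at every boundary point there is a
  supporting ball of one fixed radius that contains the domain. No smoothness of the boundary is
  required; a bounded domain of class \<open>C\<^sup>2\<close> with principal curvatures bounded below by a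
  positive constant satisfies the condition.\<close>

definition uniformly_convex_domain :: "'a::euclidean_space set \<Rightarrow> bool" where
  "uniformly_convex_domain \<Omega> \<longleftrightarrow>
     open \<Omega> \<and> bounded \<Omega> \<and> \<Omega> \<noteq> {} \<and> convex \<Omega> \<and>
     (\<exists>\<rho>>0. \<forall>z\<in>frontier \<Omega>. \<exists>c. \<Omega> \<subseteq> ball c \<rho> \<and> dist c z = \<rho>)"

definition nodal_set :: "'a::euclidean_space set \<Rightarrow> 'a set \<Rightarrow> 'a set \<Rightarrow> bool" where
  "nodal_set \<Omega> N0 Nb \<longleftrightarrow> finite N0 \<and> finite Nb \<and> N0 \<subseteq> \<Omega> \<and> Nb \<subseteq> frontier \<Omega>"

definition conforming_mesh :: "'a::euclidean_space set \<Rightarrow> 'a set \<Rightarrow> 'a set set \<Rightarrow> bool" where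
  "conforming_mesh \<Omega> N \<T> \<longleftrightarrow>
     triangulation \<T> \<and> (\<forall>T\<in>\<T>. int DIM('a) simplex T) \<and>
     {v. \<exists>T\<in>\<T>. v extreme_point_of T} = N \<and> \<Union>\<T> \<subseteq> closure \<Omega>"

definition inball_diameter :: "'a::euclidean_space set \<Rightarrow> real" where
  "inball_diameter T = Sup {diameter (cball c r) |c r. 0 \<le> r \<and> cball c r \<subseteq> T}"

definition local_mesh_size :: "'a::euclidean_space set set \<Rightarrow> 'a \<Rightarrow> real" where
  "local_mesh_size \<T> z = Max (diameter ` {T \<in> \<T>. z \<in> T})"

definition quasi_uniform :: "real \<Rightarrow> real \<Rightarrow> 'a::euclidean_space set \<Rightarrow> 'a set set \<Rightarrow> bool" where
  "quasi_uniform \<gamma> h N0 \<T> \<longleftrightarrow>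
     (\<forall>z\<in>N0. \<gamma> * h \<le> local_mesh_size \<T> z \<and> local_mesh_size \<T> z \<le> h)"

definition shape_regular :: "real \<Rightarrow> 'a::euclidean_space set set \<Rightarrow> bool" where
  "shape_regular \<sigma> \<T> \<longleftrightarrow> (\<forall>T\<in>\<T>. diameter T / inball_diameter T \<le> \<sigma>)"

definition translation_invariant_nodes ::
    "(real^'n) set \<Rightarrow> real \<Rightarrow> (real^'n) set \<Rightarrow> (real^'n) set \<Rightarrow> bool" where
  "translation_invariant_nodes \<Omega> h N0 Nb \<longleftrightarrow>
     (\<exists>e :: 'n \<Rightarrow> real^'n.
        inj e \<and> independent (range e) \<and> span (range e) = UNIV \<and> (\<forall>j. norm (e j) \<le> 1) \<and>
        N0 = {h *\<^sub>R (\<Sum>j\<in>UNIV. real_of_int (k j) *\<^sub>R e j) |k. True} \<inter> \<Omega>) \<and>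
     frontier \<Omega> \<subseteq> (\<Union>z\<in>Nb. ball z (h / 2))"

text \<open>Hat functions are extended by zero outside the meshed region, so that they are functions on
  the whole space.\<close>

definition hat_function ::
    "'a::euclidean_space set set \<Rightarrow> 'a set \<Rightarrow> 'a \<Rightarrow> ('a \<Rightarrow> real) \<Rightarrow> bool" where
  "hat_function \<T> N z f \<longleftrightarrow>
     continuous_on (\<Union>\<T>) f \<and> (\<forall>T\<in>\<T>. \<exists>a b. \<forall>x\<in>T. f x = a \<bullet> x + b) \<and>
     f z = 1 \<and> (\<forall>y\<in>N - {z}. f y = 0) \<and> (\<forall>x. x \<notin> \<Union>\<T> \<longrightarrow> f x = 0)"

definition translation_invariant_basis ::
    "'a::euclidean_space set set \<Rightarrow> real \<Rightarrow> 'a set \<Rightarrow> ('a \<Rightarrow> 'a \<Rightarrow> real) \<Rightarrow> bool" where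
  "translation_invariant_basis \<T> h N0 \<phi> \<longleftrightarrow>
     (\<forall>z\<in>N0. \<forall>w\<in>N0. infdist z (frontier (\<Union>\<T>)) > h \<and> infdist w (frontier (\<Union>\<T>)) > h \<longrightarrow>
        (\<forall>x. \<phi> z (x + z) = \<phi> w (x + w)))"

definition nodal_subdifferential ::
    "'a::euclidean_space set \<Rightarrow> ('a \<Rightarrow> real) \<Rightarrow> 'a \<Rightarrow> 'a set" where
  "nodal_subdifferential N w z = {v. \<forall>y\<in>N. w y \<ge> w z + v \<bullet> (y - z)}"


section \<open>Classical derivatives and Hoelder spaces\<close>

definition partial :: "'n::finite \<Rightarrow> (real^'n \<Rightarrow> real) \<Rightarrow> real^'n \<Rightarrow> real" where
  "partial i f x = frechet_derivative f (at x) (axis i 1)"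

definition grad :: "(real^'n::finite \<Rightarrow> real) \<Rightarrow> real^'n \<Rightarrow> real^'n" where
  "grad f x = (\<chi> i. partial i f x)"

definition hessian :: "(real^'n::finite \<Rightarrow> real) \<Rightarrow> real^'n \<Rightarrow> real^'n^'n" where
  "hessian f x = matrix (frechet_derivative (grad f) (at x))"

definition loewner_le :: "real^'n::finite^'n \<Rightarrow> real^'n^'n \<Rightarrow> bool" where
  "loewner_le A B \<longleftrightarrow> (\<forall>v. v \<bullet> (A *v v) \<le> v \<bullet> (B *v v))"

text \<open>For a bounded open set \<open>S\<close>, the space \<open>C\<^sup>2\<^sup>,\<^sup>\<alpha>\<close> over the closure of \<open>S\<close>: the derivatives up to
  order two exist in \<open>S\<close> and extend continuously to the closure, which for bounded \<open>S\<close> is uniform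
  continuity on \<open>S\<close>. By continuity the supremum over \<open>S\<close> in the seminorm is the one over the
  closure.\<close>

definition holder_quotients :: "real \<Rightarrow> (real^'n::finite) set \<Rightarrow> (real^'n \<Rightarrow> real) \<Rightarrow> real set" where
  "holder_quotients \<alpha> S u =
     {norm (hessian u x - hessian u y) / dist x y powr \<alpha> |x y. x \<in> S \<and> y \<in> S \<and> x \<noteq> y}"

definition C2_holder :: "real \<Rightarrow> (real^'n::finite) set \<Rightarrow> (real^'n \<Rightarrow> real) \<Rightarrow> bool" where
  "C2_holder \<alpha> S u \<longleftrightarrow>
     (\<forall>x\<in>S. u differentiable (at x)) \<and> (\<forall>x\<in>S. grad u differentiable (at x)) \<and>
     uniformly_continuous_on S u \<and> uniformly_continuous_on S (grad u) \<and>
     uniformly_continuous_on S (hessian u) \<and> bdd_above (holder_quotients \<alpha> S u)"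

definition C2_holder_seminorm :: "real \<Rightarrow> (real^'n::finite) set \<Rightarrow> (real^'n \<Rightarrow> real) \<Rightarrow> real" where
  "C2_holder_seminorm \<alpha> S u = Sup (holder_quotients \<alpha> S u)"


section \<open>Weak derivatives and Sobolev--Slobodeckij spaces\<close>

text \<open>A list \<open>[i\<^sub>1, \<dots>, i\<^sub>k]\<close> of coordinates stands for the derivative of order \<open>k\<close> in these
  coordinates, so the lists of length \<open>k\<close> index the components of the tensor of \<open>k\<close>-th derivatives.\<close>

definition partials :: "'n::finite list \<Rightarrow> (real^'n \<Rightarrow> real) \<Rightarrow> real^'n \<Rightarrow> real" where
  "partials is f = foldr partial is f"

definition test_function :: "(real^'n::finite) set \<Rightarrow> (real^'n \<Rightarrow> real) \<Rightarrow> bool" where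
  "test_function S \<psi> \<longleftrightarrow>
     (\<forall>is x. partials is \<psi> differentiable (at x)) \<and>
     compact (closure {x. \<psi> x \<noteq> 0}) \<and> closure {x. \<psi> x \<noteq> 0} \<subseteq> S"

definition locally_integrable_on :: "(real^'n::finite) set \<Rightarrow> (real^'n \<Rightarrow> real) \<Rightarrow> bool" where
  "locally_integrable_on S f \<longleftrightarrow> (\<forall>K. compact K \<and> K \<subseteq> S \<longrightarrow> set_integrable lebesgue K f)"

definition is_weak_deriv ::
    "(real^'n::finite) set \<Rightarrow> (real^'n \<Rightarrow> real) \<Rightarrow> 'n list \<Rightarrow> (real^'n \<Rightarrow> real) \<Rightarrow> bool" where
  "is_weak_deriv S u is v \<longleftrightarrow>
     locally_integrable_on S u \<and> locally_integrable_on S v \<and>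
     (\<forall>\<psi>. test_function S \<psi> \<longrightarrow>
        (LINT x:S|lebesgue. u x * partials is \<psi> x)
          = (- 1) ^ length is * (LINT x:S|lebesgue. v x * \<psi> x))"

text \<open>Weak derivatives are unique only up to null sets; one representative is chosen, and nothing
  below depends on the choice.\<close>

definition weak_deriv ::
    "(real^'n::finite) set \<Rightarrow> (real^'n \<Rightarrow> real) \<Rightarrow> 'n list \<Rightarrow> real^'n \<Rightarrow> real" where
  "weak_deriv S u is = (SOME v. is_weak_deriv S u is v)"

definition weak_hessian ::
    "(real^'n::finite) set \<Rightarrow> (real^'n \<Rightarrow> real) \<Rightarrow> real^'n \<Rightarrow> real^'n^'n" where
  "weak_hessian S u x = (\<chi> i j. weak_deriv S u [i, j] x)"

text \<open>The Lebesgue norm for exponents \<open>1 \<le> q \<le> \<infinity>\<close>.\<close>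

definition Lq_norm :: "ennreal \<Rightarrow> 'a measure \<Rightarrow> ('a \<Rightarrow> real) \<Rightarrow> ennreal" where
  "Lq_norm q M f =
     (if q = \<infinity> then esssup M (\<lambda>x. ennreal \<bar>f x\<bar>)
      else let I = (\<integral>\<^sup>+ x. ennreal (\<bar>f x\<bar> powr enn2real q) \<partial>M)
           in if I = \<infinity> then \<infinity> else ennreal (enn2real I powr (1 / enn2real q)))"

text \<open>With \<open>k\<close> the integer part of \<open>s\<close> and \<open>\<theta> = s - k\<close>, the seminorm of order \<open>s\<close> is the \<open>L\<^sup>q\<close> norm of
  the Euclidean length of the tensor of \<open>k\<close>-th weak derivatives if \<open>\<theta> = 0\<close>; otherwise it is the
  \<open>L\<^sup>q\<close> norm over \<open>S \<times> S\<close> of the difference of this tensor at two points divided by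
  \<open>dist x y powr (d/q + \<theta>)\<close>, where \<open>d/\<infinity> = 0\<close>.\<close>

definition sobolev_seminorm ::
    "real \<Rightarrow> ennreal \<Rightarrow> (real^'n::finite) set \<Rightarrow> (real^'n \<Rightarrow> real) \<Rightarrow> ennreal" where
  "sobolev_seminorm s q S u =
     (let k = nat \<lfloor>s\<rfloor>; \<theta> = s - real k in
      if \<theta> = 0 then
        Lq_norm q (lebesgue_on S) (\<lambda>x. L2_set (\<lambda>is. weak_deriv S u is x) {is. length is = k})
      else
        Lq_norm q (lebesgue_on S \<Otimes>\<^sub>M lebesgue_on S)
          (\<lambda>(x, y). L2_set (\<lambda>is. weak_deriv S u is x - weak_deriv S u is y) {is. length is = k}
             / dist x y powr (enn2real (of_nat CARD('n) / q) + \<theta>)))"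

definition in_sobolev ::
    "real \<Rightarrow> ennreal \<Rightarrow> (real^'n::finite) set \<Rightarrow> (real^'n \<Rightarrow> real) \<Rightarrow> bool" where
  "in_sobolev s q S u \<longleftrightarrow>
     (\<forall>is. length is \<le> nat \<lfloor>s\<rfloor> \<longrightarrow>
        (\<exists>v. is_weak_deriv S u is v) \<and> Lq_norm q (lebesgue_on S) (weak_deriv S u is) < \<infinity>) \<and>
     sobolev_seminorm s q S u < \<infinity>"

end

theory Submission
  imports Defs "HOL-Computational_Algebra.Polynomial"
begin

text \<open>After subtraction of an affine function, \<open>u\<close> agrees near \<open>xi\<close> with a quadratic form
  \<open>y \<bullet> M y / 2\<close> up to an error \<open>\<epsilon> h\<^sup>2\<close>. For the quadratic form itself and lattice nodes, \<open>M w\<close> is a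
  subgradient iff \<open>w\<close> lies in the Voronoi cell of the origin for the metric \<open>y \<bullet> M y\<close>. This cell and
  the hat function both tile the space under the lattice, so the cell has volume \<open>\<integral> \<phi>\<close> and the
  subdifferential has measure \<open>det M * \<integral> \<phi>\<close>. Lattice points have distance at least a constant times
  \<open>h\<close>, hence the error \<open>\<epsilon> h\<^sup>2\<close> only dilates the cell by factors \<open>1 + O(\<epsilon>)\<close>; distant nodes impose
  no constraint, by convexity and the quadratic growth of \<open>u\<close> in the ball of radius \<open>R h\<close>.

  In the Hoelder case \<open>M\<close> is the Hessian at \<open>xi\<close>. In the Sobolev case \<open>M\<close> is the value of the weak
  Hessian at a point where its oscillation is at most twice the average. Hoelder's inequality, combined
  for \<open>s = 3\<close> with the fundamental theorem of calculus along segments, bounds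
  the \<open>L\<^sup>d\<close> mean oscillation of the Hessian by \<open>h powr (s - 2 - d / q)\<close> times the seminorm, and
  integrating the weak Taylor formula over a ball turns the \<open>L\<^sup>d\<close> bound into a uniform bound on \<open>u\<close>
  minus the quadratic polynomial.\<close>

section \<open>Simplices\<close>

text \<open>Everything hinges on \<open>R = Lam / lam * \<sigma>\<^sup>2\<close> being at least 3.
  In dimension at least 2 the diameter of a simplex is at least sqrt 3 times its inball diameter,
  with equality for the equilateral triangle, so \<open>\<sigma>\<^sup>2 \<ge> 3\<close>. The ball
  then has room for the lattice vectors of length below \<open>2 * h\<close> that meet in the
  partition of unity, for the lattice points within \<open>5 / 2 * h\<close> that bound a
  subgradient, and, through \<open>3 * Lam \<le> lam * R\<close>, for the growth that disarms
  distant nodes. The hat functions are translates of each other only near \<open>xi\<close>, and the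
  mesh is bounded. The tiling of the space is therefore built from local information: translates of
  the recentred hat function sum to one where that function is not small, and the lattice carries
  this everywhere. In both cases the error is cut off at a fixed multiple of \<open>Lam\<close>
  before cells are compared, since powers of \<open>1 + O(\<epsilon>)\<close> are linear in
  \<epsilon> only for bounded \<epsilon>. The constants thus depend on d, \<open>lam\<close>,
  \<open>Lam\<close>, \<gamma>, \<sigma>, but not on \<alpha>, s or q.\<close>

lemma simplex_facet_normal:
  fixes C :: "'a::euclidean_space set"
  assumes "finite C" "card C = DIM('a) + 1" "v \<in> C"
  obtains n where "norm n = 1" "\<And>w w'. \<lbrakk>w \<in> C - {v}; w' \<in> C - {v}\<rbrakk> \<Longrightarrow> n \<bullet> (w - w') = 0"
proof -
  have "card (C - {v}) = DIM('a)"
    using assms by simp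
  then obtain w0 where w0: "w0 \<in> C - {v}"
    by (metis DIM_positive all_not_in_conv card.empty less_numeral_extra(3))
  let ?S = "(\<lambda>w. w - w0) ` (C - {v} - {w0})"
  have fin: "finite ?S"
    using assms by simp
  have "dim (span ?S) \<le> card ?S"
    using fin by (simp add: dim_le_card')
  also have "\<dots> \<le> card (C - {v} - {w0})"
    using assms by (simp add: card_image_le)
  also have "\<dots> < DIM('a)"
    using w0 assms \<open>card (C - {v}) = DIM('a)\<close> by (metis DIM_positive Suc_pred card_Diff_singleton diff_Suc_1 finite_Diff lessI)
  finally have "dim ?S < DIM('a)"
    by simp
  then obtain a where a: "a \<noteq> 0" "\<And>y. y \<in> span ?S \<Longrightarrow> orthogonal a y"
    using orthogonal_to_subspace_exists by blast
  define n where "n = a /\<^sub>R norm a"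
  have *: "n \<bullet> (w - w0) = 0" if "w \<in> C - {v}" for w
  proof (cases "w = w0")
    case False
    then have "w - w0 \<in> span ?S"
      using that by (intro span_base) auto
    then show ?thesis
      using a(2) by (simp add: n_def orthogonal_def)
  qed simp
  show thesis
  proof
    show "norm n = 1"
      using a(1) by (simp add: n_def)
    show "n \<bullet> (w - w') = 0" if "w \<in> C - {v}" "w' \<in> C - {v}" for w w'
      using *[OF that(1)] *[OF that(2)] by (simp add: inner_diff_right)
  qed
qed

text \<open>Push the centre of the ball by \<open>r\<close> towards the facet opposite to
  \<open>v\<close>: the point stays in the simplex, so its barycentric coordinate at
  \<open>v\<close> is still nonnegative, while its distance to the facet is that coordinate times
  the height over \<open>v\<close>. The weights \<open>t\<close> are the barycentric coordinates of
  the centre; as they sum to one, the heights bound \<open>r\<close>.\<close>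

lemma inball_heights:
  fixes C :: "'a::euclidean_space set"
  assumes C: "finite C" "card C = DIM('a) + 1" and sub: "cball c r \<subseteq> convex hull C" and r: "r \<ge> 0"
  obtains t where "\<And>v. v \<in> C \<Longrightarrow> 0 \<le> t v" "sum t C = 1"
    "\<And>v. v \<in> C \<Longrightarrow> \<exists>n. norm n = 1 \<and>
       (\<forall>w\<in>C - {v}. \<forall>w'\<in>C - {v}. n \<bullet> (w - w') = 0) \<and> (\<forall>w\<in>C - {v}. r \<le> t v * (n \<bullet> (v - w)))"
proof -
  have "c \<in> convex hull C"
    using sub r by auto
  then obtain t where t: "\<And>v. v \<in> C \<Longrightarrow> 0 \<le> t v" "sum t C = 1" "(\<Sum>v\<in>C. t v *\<^sub>R v) = c"
    using C by (auto simp: convex_hull_finite)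
  have "\<exists>n. norm n = 1 \<and> (\<forall>w\<in>C - {v}. \<forall>w'\<in>C - {v}. n \<bullet> (w - w') = 0) \<and>
      (\<forall>w\<in>C - {v}. r \<le> t v * (n \<bullet> (v - w)))" if v: "v \<in> C" for v
  proof -
    obtain n0 where n0: "norm n0 = 1" "\<And>w w'. \<lbrakk>w \<in> C - {v}; w' \<in> C - {v}\<rbrakk> \<Longrightarrow> n0 \<bullet> (w - w') = 0"
      using simplex_facet_normal[OF C v] by blast
    have "card (C - {v}) = DIM('a)"
      using C v by simp
    then obtain w0 where w0: "w0 \<in> C - {v}"
      by (metis DIM_positive all_not_in_conv card.empty less_numeral_extra(3))
    define n where "n = (if n0 \<bullet> (v - w0) \<ge> 0 then n0 else - n0)"
    have n: "norm n = 1" "\<And>w w'. \<lbrakk>w \<in> C - {v}; w' \<in> C - {v}\<rbrakk> \<Longrightarrow> n \<bullet> (w - w') = 0"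
      "n \<bullet> (v - w0) \<ge> 0"
      using n0 by (auto simp: n_def)
    \<comment> \<open>An affine function that vanishes on the facet sees only the coordinate at
      \<open>v\<close>.\<close>
    have slab: "n \<bullet> ((\<Sum>x\<in>C. s x *\<^sub>R x) - w0) = s v * (n \<bullet> (v - w0))" if "sum s C = 1" for s
    proof -
      have "(\<Sum>x\<in>C. s x *\<^sub>R x) - w0 = (\<Sum>x\<in>C. s x *\<^sub>R (x - w0))"
        using that by (simp add: scaleR_diff_right sum_subtractf flip: scaleR_left.sum)
      then have "n \<bullet> ((\<Sum>x\<in>C. s x *\<^sub>R x) - w0) = (\<Sum>x\<in>C. s x * (n \<bullet> (x - w0)))"
        by (simp add: inner_sum_right)
      also have "\<dots> = s v * (n \<bullet> (v - w0)) + (\<Sum>x\<in>C - {v}. s x * (n \<bullet> (x - w0)))"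
        using C v by (simp add: sum.remove)
      also have "(\<Sum>x\<in>C - {v}. s x * (n \<bullet> (x - w0))) = 0"
        using n(2) w0 by (intro sum.neutral) auto
      finally show ?thesis by simp
    qed
    have "c - r *\<^sub>R n \<in> convex hull C"
      using sub r n(1) by (auto simp: subset_iff dist_norm)
    then obtain s where s: "\<And>v. v \<in> C \<Longrightarrow> 0 \<le> s v" "sum s C = 1" "(\<Sum>v\<in>C. s v *\<^sub>R v) = c - r *\<^sub>R n"
      using C by (auto simp: convex_hull_finite)
    have "0 \<le> s v * (n \<bullet> (v - w0))"
      using s(1)[OF v] n(3) by simp
    also have "\<dots> = n \<bullet> (c - w0) - r"
    proof -
      have "n \<bullet> n = 1"
        using n(1) by (simp add: dot_square_norm)
      then show ?thesis
        using slab[OF s(2)] s(3) by (simp add: inner_diff_right)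
    qed
    also have "n \<bullet> (c - w0) = t v * (n \<bullet> (v - w0))"
      using slab[OF t(2)] t(3) by simp
    finally have "r \<le> t v * (n \<bullet> (v - w0))" by simp
    moreover have "n \<bullet> (v - w) = n \<bullet> (v - w0)" if "w \<in> C - {v}" for w
      using n(2)[OF that w0] by (simp add: inner_diff_right)
    ultimately show ?thesis
      using n by (metis (no_types, lifting))
  qed
  with t that show thesis by blast
qed

text \<open>The right side is the Gram determinant of \<open>p\<close> and \<open>t\<close>, the
  squared area of their parallelogram; the left side is a squared product of base and height. Remove
  from \<open>p\<close> its component along \<open>n\<close> and apply Cauchy-Schwarz.\<close>

lemma bessel_two:
  fixes n p t :: "'a::real_inner"
  assumes "norm n = 1" "n \<bullet> t = 0"
  shows "(n \<bullet> p)\<^sup>2 * (norm t)\<^sup>2 \<le> (norm p)\<^sup>2 * (norm t)\<^sup>2 - (p \<bullet> t)\<^sup>2"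
proof -
  define q where "q = p - (n \<bullet> p) *\<^sub>R n"
  have nn: "n \<bullet> n = 1"
    using assms by (simp add: dot_square_norm)
  have "q \<bullet> t = p \<bullet> t"
    using assms by (simp add: q_def inner_diff_left)
  moreover have "q \<bullet> q = p \<bullet> p - (n \<bullet> p)\<^sup>2"
    by (simp add: q_def inner_diff_left inner_diff_right nn inner_commute power2_eq_square)
  moreover have "(q \<bullet> t)\<^sup>2 \<le> (q \<bullet> q) * (t \<bullet> t)"
    by (rule Cauchy_Schwarz_ineq)
  ultimately have "(p \<bullet> t)\<^sup>2 \<le> (p \<bullet> p - (n \<bullet> p)\<^sup>2) * (t \<bullet> t)"
    by simp
  then show ?thesis
    by (simp add: power2_norm_eq_inner left_diff_distrib)
qed

text \<open>\<open>G\<close> stands for four times the squared area of a triangle with sides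
  \<open>a\<close>, \<open>b\<close>, \<open>c\<close>, so the formula for \<open>G\<close> is
  Heron's, and the last hypothesis compares \<open>r\<close> times the perimeter with twice the
  area. The inequality of arithmetic and geometric means for \<open>X\<close>, \<open>Y\<close>,
  \<open>Z\<close> gives the bound, which is sharp for the equilateral triangle.\<close>

lemma heron_ineq:
  fixes a b c D r G :: real
  assumes "0 < a" "0 < b" "0 < c" "a \<le> D" "b \<le> D" "c \<le> D" "a \<le> b + c" "b \<le> a + c" "c \<le> a + b" "0 \<le> r"
    and G: "4 * G = (a + b + c) * (b + c - a) * (a + c - b) * (a + b - c)"
    and le: "r * (a + b + c) \<le> sqrt G"
  shows "12 * r\<^sup>2 \<le> D\<^sup>2"
proof -
  define P X Y Z where "P = a + b + c" and "X = b + c - a" and "Y = a + c - b" and "Z = a + b - c"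
  have pos: "P > 0" "X \<ge> 0" "Y \<ge> 0" "Z \<ge> 0" and PXYZ: "P = X + Y + Z" and P3: "P \<le> 3 * D"
    using assms by (auto simp: P_def X_def Y_def Z_def)
  have "4 * G = P * X * Y * Z"
    using G by (simp add: P_def X_def Y_def Z_def)
  moreover have "P * X * Y * Z \<ge> 0"
    using pos by simp
  ultimately have "G \<ge> 0" by linarith
  have "(r * P)\<^sup>2 \<le> (sqrt G)\<^sup>2"
    using le pos assms(10) by (intro power_mono) (auto simp: P_def)
  then have "(r * P)\<^sup>2 \<le> G"
    using \<open>G \<ge> 0\<close> by simp
  then have "4 * r\<^sup>2 * P * P \<le> (X * Y * Z) * P"
    using \<open>4 * G = P * X * Y * Z\<close> by (simp add: power2_eq_square mult.commute mult.left_commute)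
  then have 1: "4 * r\<^sup>2 * P \<le> X * Y * Z"
    using pos(1) by (rule mult_right_le_imp_le)
  have 2: "27 * (X * Y * Z) \<le> P ^ 3"
  proof -
    \<comment> \<open>Arithmetic and geometric mean: the difference is displayed as a sum of
      nonnegative terms.\<close>
    have "P ^ 3 - 27 * (X * Y * Z) = (X + Y + Z) ^ 3 - 27 * (X * Y * Z)"
      by (simp add: PXYZ)
    also have "\<dots> = (X + Y + Z) / 2 * ((X - Y)\<^sup>2 + (Y - Z)\<^sup>2 + (X - Z)\<^sup>2) + 3 * (X * (Y - Z)\<^sup>2 + Y * (X - Z)\<^sup>2 + Z * (X - Y)\<^sup>2)"
      by algebra
    finally have "P ^ 3 - 27 * (X * Y * Z) \<ge> 0"
      using pos by simp
    then show ?thesis by simp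
  qed
  have "108 * r\<^sup>2 * P \<le> P\<^sup>2 * P"
    using 1 2 by (simp add: power2_eq_square power3_eq_cube)
  then have "108 * r\<^sup>2 \<le> P\<^sup>2"
    using pos(1) by (rule mult_right_le_imp_le)
  also have "\<dots> \<le> (3 * D)\<^sup>2"
    using pos P3 by (intro power_mono) auto
  finally show ?thesis
    by (simp add: power2_eq_square)
qed

text \<open>Heights are at most \<open>D\<close>, so summing \<open>inball_heights\<close> over the
  vertices gives \<open>(d + 1) * r \<le> D\<close>. From dimension 3 on this suffices, since 16
  exceeds 12. In the plane it yields only 9, and the sharp constant needs all three heights at once,
  through the area.\<close>

lemma simplex_inradius_le:
  fixes C :: "'a::euclidean_space set"
  assumes C: "finite C" "card C = DIM('a) + 1" and sub: "cball c r \<subseteq> convex hull C" and r: "r \<ge> 0"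
    and D: "\<And>v w. \<lbrakk>v \<in> C; w \<in> C\<rbrakk> \<Longrightarrow> dist v w \<le> D" and dim: "DIM('a) \<ge> 2"
  shows "12 * r\<^sup>2 \<le> D\<^sup>2"
proof -
  obtain t where t: "\<And>v. v \<in> C \<Longrightarrow> 0 \<le> t v" "sum t C = 1"
    and nt: "\<And>v. v \<in> C \<Longrightarrow> \<exists>n. norm n = 1 \<and>
       (\<forall>w\<in>C - {v}. \<forall>w'\<in>C - {v}. n \<bullet> (w - w') = 0) \<and> (\<forall>w\<in>C - {v}. r \<le> t v * (n \<bullet> (v - w)))"
    using inball_heights[OF C sub r] by blast
  have ne: "C - {v} \<noteq> {}" if "v \<in> C" for v
    using C dim that by (metis Suc_eq_plus1 card.empty card_Diff_singleton diff_Suc_1 not_numeral_le_zero)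
  have D0: "D \<ge> 0"
    using D C dim by (metis add_is_0 card.empty dist_self equals0I one_neq_zero)
  have 1: "r \<le> t v * D" if v: "v \<in> C" for v
  proof -
    obtain w where w: "w \<in> C - {v}"
      using ne[OF v] by blast
    obtain n where n: "norm n = 1" "r \<le> t v * (n \<bullet> (v - w))"
      using nt[OF v] w by blast
    have "n \<bullet> (v - w) \<le> norm n * norm (v - w)"
      by (rule norm_cauchy_schwarz)
    also have "\<dots> \<le> D"
      using D[OF v, of w] w n by (simp add: dist_norm)
    finally show ?thesis
      using n(2) t(1)[OF v] by (meson mult_left_mono order_trans)
  qed
  show ?thesis
  proof (cases "DIM('a) = 2")
    case False
    have "(\<Sum>v\<in>C. r) \<le> (\<Sum>v\<in>C. t v * D)"
      using 1 by (rule sum_mono)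
    also have "\<dots> = D"
      using t(2) by (simp flip: sum_distrib_right)
    finally have "(real (DIM('a)) + 1) * r \<le> D"
      using C by (simp add: add.commute)
    moreover have "4 * r \<le> (real (DIM('a)) + 1) * r"
      using False dim r by (intro mult_right_mono) auto
    ultimately have "4 * r \<le> D" by simp
    then have "(4 * r)\<^sup>2 \<le> D\<^sup>2"
      using r by (intro power_mono) auto
    then show ?thesis
      by (simp add: power2_eq_square) (smt (verit) zero_le_square)
  next
    case True
    then have "card C = 3" using C by simp
    then obtain u v w where uvw: "C = {u, v, w}" "u \<noteq> v" "u \<noteq> w" "v \<noteq> w"
      by (auto simp: card_3_iff)
    define a b c where "a = norm (v - w)" and "b = norm (u - w)" and "c = norm (u - v)"
    define G where "G = (a\<^sup>2 * b\<^sup>2) - ((a\<^sup>2 + b\<^sup>2 - c\<^sup>2) / 2)\<^sup>2"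
    \<comment> \<open>\<open>sqrt G\<close> is twice the area of the triangle, so it bounds the
      product of a side and the height over it.\<close>
    have key: "r * norm (y - z) \<le> t x * sqrt G"
      if C': "C = {x, y, z}" "x \<noteq> y" "x \<noteq> z" "y \<noteq> z"
        and G': "(norm (x - y))\<^sup>2 * (norm (y - z))\<^sup>2 - ((x - y) \<bullet> (y - z))\<^sup>2 = G" for x y z
    proof -
      have x: "x \<in> C" using C' by simp
      obtain n where n: "norm n = 1" "n \<bullet> (y - z) = 0" "r \<le> t x * (n \<bullet> (x - y))"
        using nt[OF x] C' by auto
      have "(n \<bullet> (x - y) * norm (y - z))\<^sup>2 \<le> G"
        using bessel_two[OF n(1,2), of "x - y"] G' by (simp add: power_mult_distrib)
      then have "n \<bullet> (x - y) * norm (y - z) \<le> sqrt G"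
        by (rule real_le_rsqrt)
      then have "t x * (n \<bullet> (x - y) * norm (y - z)) \<le> t x * sqrt G"
        using t(1)[OF x] by (rule mult_left_mono)
      moreover have "r * norm (y - z) \<le> t x * (n \<bullet> (x - y)) * norm (y - z)"
        using n(3) by (rule mult_right_mono) simp
      ultimately show ?thesis by (simp add: mult.assoc)
    qed
    have polar: "(x - y) \<bullet> (y - z) = ((norm (x - z))\<^sup>2 - (norm (x - y))\<^sup>2 - (norm (y - z))\<^sup>2) / 2" for x y z :: 'a
      by (simp add: power2_norm_eq_inner algebra_simps inner_commute)
    have comm: "norm (w - v) = a" "norm (w - u) = b" "norm (v - u) = c"
      by (simp_all add: a_def b_def c_def norm_minus_commute)
    have "r * norm (v - w) \<le> t u * sqrt G"
      by (rule key) (use uvw in \<open>auto simp: polar G_def comm a_def[symmetric] b_def[symmetric] c_def[symmetric] power2_eq_square field_simps\<close>)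
    moreover have "r * norm (u - w) \<le> t v * sqrt G"
      by (rule key) (use uvw in \<open>auto simp: polar G_def comm a_def[symmetric] b_def[symmetric] c_def[symmetric] power2_eq_square field_simps\<close>)
    moreover have "r * norm (u - v) \<le> t w * sqrt G"
      by (rule key) (use uvw in \<open>auto simp: polar G_def comm a_def[symmetric] b_def[symmetric] c_def[symmetric] power2_eq_square field_simps\<close>)
    ultimately have "r * (a + b + c) \<le> (t u + t v + t w) * sqrt G"
      by (simp add: a_def b_def c_def algebra_simps)
    moreover have "t u + t v + t w = 1"
      using t(2) uvw by simp
    ultimately have le: "r * (a + b + c) \<le> sqrt G"
      by simp
    show ?thesis
    proof (rule heron_ineq[OF _ _ _ _ _ _ _ _ _ r _ le])
      show "0 < a" "0 < b" "0 < c"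
        using uvw by (auto simp: a_def b_def c_def)
      show "a \<le> D" "b \<le> D" "c \<le> D"
        using D uvw(1) by (auto simp: a_def b_def c_def dist_norm)
      show "a \<le> b + c"
        using norm_triangle_ineq[of "v - u" "u - w"] comm by (simp add: a_def b_def)
      show "b \<le> a + c"
        using norm_triangle_ineq[of "u - v" "v - w"] comm by (simp add: a_def b_def c_def)
      show "c \<le> a + b"
        using norm_triangle_ineq[of "u - w" "w - v"] comm by (simp add: a_def b_def c_def)
      show "4 * G = (a + b + c) * (b + c - a) * (a + c - b) * (a + b - c)"
        by (simp add: G_def power2_eq_square field_simps)
    qed
  qed
qed

section \<open>Hat functions of a translation invariant mesh\<close>

lemma conforming_mesh_simplex:
  fixes \<T> :: "'a::euclidean_space set set"
  assumes "conforming_mesh \<Omega> N \<T>" "T \<in> \<T>"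
  obtains C where "finite C" "card C = DIM('a) + 1" "T = convex hull C" "C \<subseteq> N" "interior T \<noteq> {}"
proof -
  have "int DIM('a) simplex T"
    using assms by (simp add: conforming_mesh_def)
  then obtain C where C: "\<not> affine_dependent C" "int (card C) = int DIM('a) + 1" "T = convex hull C"
    unfolding simplex_def by blast
  have fin: "finite C"
    by (rule ccontr) (use C(2) in auto)
  have "v extreme_point_of T" if "v \<in> C" for v
    using that C by (simp add: extreme_point_of_convex_hull_affine_independent)
  then have "C \<subseteq> N"
    using assms by (auto simp: conforming_mesh_def)
  moreover have "interior T \<noteq> {}"
  proof -
    have "card C = DIM('a) + 1"
      using C(2) by linarith
    then show ?thesis
      using C fin interior_convex_hull_eq_empty[of C] by simp
  qed
  ultimately show thesis
    using that[of C] C fin by simp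
qed

text \<open>An affine function on a simplex is determined by its values at the vertices, and a hat
  function vanishes at all nodes but its own.\<close>

lemma hat_function_barycentric:
  assumes hat: "hat_function \<T> N z f" and T: "T \<in> \<T>" "T = convex hull C" "finite C" "C \<subseteq> N"
    and t: "\<And>v. v \<in> C \<Longrightarrow> 0 \<le> t v" "sum t C = 1"
  shows "f (\<Sum>v\<in>C. t v *\<^sub>R v) = (if z \<in> C then t z else 0)"
proof -
  have "\<exists>a b. \<forall>x\<in>T. f x = a \<bullet> x + b"
    using hat T(1) by (simp add: hat_function_def)
  then obtain a b where ab: "\<And>x. x \<in> T \<Longrightarrow> f x = a \<bullet> x + b"
    by blast
  have inT: "(\<Sum>v\<in>C. t v *\<^sub>R v) \<in> T" "\<And>v. v \<in> C \<Longrightarrow> v \<in> T"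
  proof -
    show "(\<Sum>v\<in>C. t v *\<^sub>R v) \<in> T"
      unfolding T(2) convex_hull_finite[OF T(3)] using t by blast
    show "\<And>v. v \<in> C \<Longrightarrow> v \<in> T"
      unfolding T(2) by (rule hull_inc)
  qed
  have "f (\<Sum>v\<in>C. t v *\<^sub>R v) = (\<Sum>v\<in>C. t v * (a \<bullet> v)) + b * sum t C"
    using ab[OF inT(1)] t(2) by (simp add: inner_sum_right)
  also have "\<dots> = (\<Sum>v\<in>C. t v * (a \<bullet> v + b))"
    by (simp add: sum_distrib_left sum.distrib algebra_simps)
  also have "\<dots> = (\<Sum>v\<in>C. t v * f v)"
    using ab inT(2) by simp
  also have "\<dots> = (\<Sum>v\<in>C. if v = z then t z else 0)"
    using hat T(4) by (intro sum.cong) (auto simp: hat_function_def)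
  also have "\<dots> = (if z \<in> C then t z else 0)"
    using T(3) by simp
  finally show ?thesis .
qed

text \<open>A ball of radius \<open>r\<close> has diameter \<open>2 * r\<close>, which turns the 12
  of the inradius bound into 3. The last claim supplies balls of almost maximal size in place of a
  maximal one.\<close>

lemma inball_diameter_bounds:
  fixes \<T> :: "'a::euclidean_space set set"
  assumes mesh: "conforming_mesh \<Omega> N \<T>" "T \<in> \<T>" and dim: "DIM('a) \<ge> 2"
  shows "0 < inball_diameter T" "3 * (inball_diameter T)\<^sup>2 \<le> (diameter T)\<^sup>2"
    and "\<And>s. s < inball_diameter T \<Longrightarrow> \<exists>c r. 0 \<le> r \<and> cball c r \<subseteq> T \<and> s < 2 * r"
proof -
  obtain C where C: "finite C" "card C = DIM('a) + 1" "T = convex hull C" "interior T \<noteq> {}"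
    using conforming_mesh_simplex[OF mesh] by metis
  have bT: "bounded T"
    using C by (simp add: finite_imp_bounded_convex_hull)
  have D: "dist v w \<le> diameter T" if "v \<in> C" "w \<in> C" for v w
    using that diameter_bounded_bound[OF bT] C(3) hull_inc by metis
  have D0: "diameter T \<ge> 0"
    by (simp add: bT diameter_ge_0)
  let ?S = "{diameter (cball c r) |c r. 0 \<le> r \<and> cball c r \<subseteq> T}"
  have le: "s \<le> diameter T / sqrt 3" if s: "s \<in> ?S" for s
  proof -
    obtain c r where cr: "s = 2 * r" "0 \<le> r" "cball c r \<subseteq> T"
      using s by auto
    have "12 * r\<^sup>2 \<le> (diameter T)\<^sup>2"
      using simplex_inradius_le[OF C(1,2) _ cr(2) D dim] cr C by blast
    then have "(s * sqrt 3)\<^sup>2 \<le> (diameter T)\<^sup>2"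
      by (simp add: cr power_mult_distrib)
    then have "s * sqrt 3 \<le> diameter T"
      using D0 power2_le_imp_le by blast
    then show ?thesis
      by (simp add: field_simps)
  qed
  then have bdd: "bdd_above ?S"
    by (meson bdd_aboveI)
  obtain x e where xe: "e > 0" "cball x e \<subseteq> T"
    using C(4) by (metis all_not_in_conv interior_subset open_contains_cball open_interior order_trans)
  then have mem: "2 * e \<in> ?S"
    by (intro CollectI exI[of _ x] exI[of _ e]) auto
  have "2 * e \<le> inball_diameter T"
    unfolding inball_diameter_def using mem bdd by (rule cSup_upper)
  then show pos: "0 < inball_diameter T"
    using xe by simp
  have "inball_diameter T \<le> diameter T / sqrt 3"
    unfolding inball_diameter_def using mem le by (intro cSup_least) auto
  then have "inball_diameter T * sqrt 3 \<le> diameter T"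
    by (simp add: field_simps)
  then have "(inball_diameter T * sqrt 3)\<^sup>2 \<le> (diameter T)\<^sup>2"
    using pos by (intro power_mono) auto
  then show "3 * (inball_diameter T)\<^sup>2 \<le> (diameter T)\<^sup>2"
    by (simp add: power_mult_distrib)
  show "\<exists>c r. 0 \<le> r \<and> cball c r \<subseteq> T \<and> s < 2 * r" if "s < inball_diameter T" for s
  proof -
    have "\<exists>y\<in>?S. s < y"
      using that mem less_cSup_iff[OF _ bdd] unfolding inball_diameter_def by blast
    then obtain c r where "0 \<le> r" "cball c r \<subseteq> T" "s < diameter (cball c r)"
      by blast
    then show ?thesis
      by (intro exI[of _ c] exI[of _ r]) simp
  qed
qed

text \<open>A quotient with denominator zero has the value zero and would bound nothing, so
  positivity of the inball diameter precedes the use of \<open>shape_regular\<close>. The bound on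
  \<open>\<sigma>\<^sup>2\<close> is the source of \<open>R \<ge> 3\<close>.\<close>

lemma shape_regular_ge:
  fixes \<T> :: "'a::euclidean_space set set"
  assumes mesh: "conforming_mesh \<Omega> N \<T>" "T \<in> \<T>" and dim: "DIM('a) \<ge> 2" and sh: "shape_regular \<sigma> \<T>"
  shows "\<sigma> > 0" "\<sigma>\<^sup>2 \<ge> 3" "diameter T \<le> \<sigma> * inball_diameter T"
proof -
  note b = inball_diameter_bounds[OF mesh dim]
  show le: "diameter T \<le> \<sigma> * inball_diameter T"
    using sh mesh(2) b(1) unfolding shape_regular_def by (metis pos_divide_le_eq)
  have "diameter T \<noteq> 0"
    using b(1,2) by auto
  moreover have "diameter T \<ge> 0"
    using conforming_mesh_simplex[OF mesh] by (metis diameter_ge_0 finite_imp_bounded_convex_hull)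
  ultimately have "0 < \<sigma> * inball_diameter T"
    using le by linarith
  then show "\<sigma> > 0"
    using b(1) zero_less_mult_pos2 by blast
  have "3 * (inball_diameter T)\<^sup>2 \<le> (\<sigma> * inball_diameter T)\<^sup>2"
    using b(2) power_mono[OF le \<open>diameter T \<ge> 0\<close>, of 2] by linarith
  then show "\<sigma>\<^sup>2 \<ge> 3"
    using b(1) by (simp add: power_mult_distrib)
qed

text \<open>The lattice enters as a set \<open>L\<close> closed under differences; that it is
  discrete will follow from the finiteness of the nodal set.\<close>

locale translation_invariant_mesh =
  fixes \<Omega> :: "'a::euclidean_space set" and N0 Nb L :: "'a set" and \<T> :: "'a set set"
    and \<phi> :: "'a \<Rightarrow> 'a \<Rightarrow> real" and h R \<gamma> \<sigma> :: real and xi :: 'a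
  assumes dim: "DIM('a) \<ge> 2" and h: "h > 0" and R: "R \<ge> 3" and \<gamma>: "\<gamma> > 0"
    and \<Omega>: "open \<Omega>" "convex \<Omega>"
    and nodes: "nodal_set \<Omega> N0 Nb" and mesh: "conforming_mesh \<Omega> (N0 \<union> Nb) \<T>"
    and quasi: "quasi_uniform \<gamma> h N0 \<T>" and shape: "shape_regular \<sigma> \<T>"
    and lattice: "N0 = L \<inter> \<Omega>" "\<And>k l. \<lbrakk>k \<in> L; l \<in> L\<rbrakk> \<Longrightarrow> k - l \<in> L"
    and hat: "\<And>z. z \<in> N0 \<union> Nb \<Longrightarrow> hat_function \<T> (N0 \<union> Nb) z (\<phi> z)"
    and basis: "translation_invariant_basis \<T> h N0 \<phi>"
    and xi: "xi \<in> N0" and far: "infdist xi (frontier (\<Union>\<T>)) \<ge> R * h"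
begin

text \<open>The hat function moved to the origin, where the lattice vectors act on it by
  translation.\<close>

definition "g x = \<phi> xi (x + xi)"

lemma finT: "finite \<T>"
  using mesh by (simp add: conforming_mesh_def triangulation_def)

lemma L0: "0 \<in> L" and Lminus: "k \<in> L \<Longrightarrow> - k \<in> L" and Lplus: "\<lbrakk>k \<in> L; l \<in> L\<rbrakk> \<Longrightarrow> k + l \<in> L"
proof -
  show 0: "0 \<in> L"
    using lattice(2)[of xi xi] xi lattice(1) by auto
  show m: "- k \<in> L" if "k \<in> L" for k
    using lattice(2)[OF 0 that] by simp
  show "k + l \<in> L" if "k \<in> L" "l \<in> L"
    using lattice(2)[OF that(1) m[OF that(2)]] by simp
qed

lemma compactT: "T \<in> \<T> \<Longrightarrow> compact T"
  by (metis compact_convex_hull conforming_mesh_simplex finite_imp_compact mesh)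

lemma star_nonempty: "z \<in> N0 \<union> Nb \<Longrightarrow> \<exists>T\<in>\<T>. z \<in> T"
  using mesh by (auto simp: conforming_mesh_def extreme_point_of_def)

lemma diameter_star:
  assumes "z \<in> N0" "T \<in> \<T>" "z \<in> T" "x \<in> T" "y \<in> T"
  shows "dist x y \<le> h"
proof -
  have "dist x y \<le> diameter T"
    using assms compactT compact_imp_bounded diameter_bounded_bound by blast
  also have "\<dots> \<le> local_mesh_size \<T> z"
    unfolding local_mesh_size_def using assms finT by (intro Max_ge) auto
  also have "\<dots> \<le> h"
    using quasi assms by (simp add: quasi_uniform_def)
  finally show ?thesis .
qed

text \<open>The ball is connected, meets the mesh and misses its frontier, hence lies inside. The
  interior of the mesh lies in the interior of \<open>closure \<Omega>\<close>, which is
  \<open>\<Omega>\<close> because \<open>\<Omega>\<close> is open and convex.\<close>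

lemma ball_subset: "ball xi (R * h) \<subseteq> interior (\<Union>\<T>)" "interior (\<Union>\<T>) \<subseteq> \<Omega>" "ball xi (R * h) \<subseteq> \<Omega>"
proof -
  let ?B = "ball xi (R * h)"
  have xiB: "xi \<in> ?B" using h R by simp
  have "?B \<inter> frontier (\<Union>\<T>) = {}"
  proof (rule ccontr)
    assume "?B \<inter> frontier (\<Union>\<T>) \<noteq> {}"
    then obtain y where "y \<in> frontier (\<Union>\<T>)" "dist xi y < R * h" by auto
    then show False
      using infdist_le[of y "frontier (\<Union>\<T>)" xi] far by linarith
  qed
  moreover have "?B \<inter> \<Union>\<T> \<noteq> {}"
    using star_nonempty[of xi] xi xiB by blast
  ultimately have "?B \<subseteq> \<Union>\<T>"
    using connected_Int_frontier[OF convex_connected[OF convex_ball], of xi "R * h" "\<Union>\<T>"] by blast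
  then show 1: "?B \<subseteq> interior (\<Union>\<T>)"
    by (simp add: interior_maximal)
  have "interior (\<Union>\<T>) \<subseteq> interior (closure \<Omega>)"
    using mesh by (intro interior_mono) (simp add: conforming_mesh_def)
  then show 2: "interior (\<Union>\<T>) \<subseteq> \<Omega>"
    using convex_interior_closure[OF \<Omega>(2)] \<Omega>(1) by (simp add: interior_open)
  show "?B \<subseteq> \<Omega>" using 1 2 by blast
qed

lemma interior_node: "\<lbrakk>z \<in> N0 \<union> Nb; z \<in> \<Omega>\<rbrakk> \<Longrightarrow> z \<in> N0"
  using nodes \<Omega>(1) by (auto simp: nodal_set_def frontier_def interior_open)

text \<open>Boundary nodes lie on the frontier of the open set \<open>\<Omega>\<close>, so none of
  them is in the ball.\<close>

lemma ball_lattice: "(N0 \<union> Nb) \<inter> ball xi (R * h) = L \<inter> ball xi (R * h)"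
  using ball_subset(3) interior_node lattice(1) by auto

lemma finite_lattice_ball: "finite (L \<inter> ball xi (R * h))"
  using nodes ball_lattice by (metis finite_Int finite_Un nodal_set_def)

lemma infdist_node:
  assumes "dist xi z < (R - 1) * h"
  shows "infdist z (frontier (\<Union>\<T>)) > h"
  using infdist_triangle[of xi "frontier (\<Union>\<T>)" z] far assms by (simp add: algebra_simps)

lemma translate:
  assumes "z \<in> N0" "dist xi z < (R - 1) * h"
  shows "\<phi> z x = g (x - z)"
proof -
  have "infdist xi (frontier (\<Union>\<T>)) > h" 
    using h R by (intro infdist_node) simp
  then have "\<phi> z (x - z + z) = \<phi> xi (x - z + xi)"
    using basis assms infdist_node xi unfolding translation_invariant_basis_def by blast
  then show ?thesis by (simp add: g_def)
qed

lemma barycentric: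
  assumes "y \<in> \<Union>\<T>"
  obtains T C t where "T \<in> \<T>" "y \<in> T" "C \<subseteq> T" "finite C" "card C = DIM('a) + 1" "C \<subseteq> N0 \<union> Nb"
    "\<And>v. v \<in> C \<Longrightarrow> 0 \<le> t v" "sum t C = 1" "y = (\<Sum>v\<in>C. t v *\<^sub>R v)"
    "\<And>z. z \<in> N0 \<union> Nb \<Longrightarrow> \<phi> z y = (if z \<in> C then t z else 0)"
proof -
  obtain T where T: "T \<in> \<T>" "y \<in> T" using assms by blast
  obtain C where C: "finite C" "card C = DIM('a) + 1" "T = convex hull C" "C \<subseteq> N0 \<union> Nb"
    using conforming_mesh_simplex[OF mesh T(1)] by metis
  obtain t where t: "\<And>v. v \<in> C \<Longrightarrow> 0 \<le> t v" "sum t C = 1" "(\<Sum>v\<in>C. t v *\<^sub>R v) = y"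
    using T(2) C by (auto simp: convex_hull_finite)
  have "\<phi> z y = (if z \<in> C then t z else 0)" if "z \<in> N0 \<union> Nb" for z
    using hat_function_barycentric[OF hat[OF that] T(1) C(3,1,4) t(1,2)] t(3) by simp
  moreover have "C \<subseteq> T"
    unfolding C(3) by (rule hull_subset)
  ultimately show thesis
    using that[of T C t] T C t by blast
qed

lemma hat_bounds: "z \<in> N0 \<union> Nb \<Longrightarrow> 0 \<le> \<phi> z y" "z \<in> N0 \<union> Nb \<Longrightarrow> \<phi> z y \<le> 1"
proof -
  have "0 \<le> \<phi> z y \<and> \<phi> z y \<le> 1" if z: "z \<in> N0 \<union> Nb" for z
  proof (cases "y \<in> \<Union>\<T>")
    case True
    show ?thesis
    proof (rule barycentric[OF True])
      fix T C t
      assume C: "finite C" "\<And>v. v \<in> C \<Longrightarrow> 0 \<le> t v" "sum t C = (1::real)"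
        and \<phi>: "\<And>z. z \<in> N0 \<union> Nb \<Longrightarrow> \<phi> z y = (if z \<in> C then t z else 0)"
      have "t z \<le> 1" if "z \<in> C"
        using member_le_sum[of z C t] C that by auto
      then show ?thesis
        using \<phi>[OF z] C by auto
    qed
  next
    case False
    then have "\<phi> z y = 0"
      using hat[OF z] by (simp add: hat_function_def)
    then show ?thesis by simp
  qed
  then show "z \<in> N0 \<union> Nb \<Longrightarrow> 0 \<le> \<phi> z y" "z \<in> N0 \<union> Nb \<Longrightarrow> \<phi> z y \<le> 1" by auto
qed

lemma g_bounds: "0 \<le> g x" "g x \<le> 1"
  using hat_bounds[of xi] xi by (simp_all add: g_def)

lemma g0: "g 0 = 1"
  using hat[of xi] xi by (simp add: g_def hat_function_def)

text \<open>A point of the support lies in a cell with vertex \<open>xi\<close>. Such a cell has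
  diameter at most \<open>h\<close>, so all its vertices are interior nodes within reach of the
  translation invariance.\<close>

lemma g_nonzero:
  assumes "g x \<noteq> 0"
  obtains C t where "finite C" "card C = DIM('a) + 1" "C \<subseteq> N0" "xi \<in> C" "\<And>v. v \<in> C \<Longrightarrow> dist xi v \<le> h"
    "\<And>v. v \<in> C \<Longrightarrow> 0 \<le> t v" "sum t C = 1" "x + xi = (\<Sum>v\<in>C. t v *\<^sub>R v)" "norm x \<le> (1 - t xi) * h"
    "\<And>z. z \<in> N0 \<union> Nb \<Longrightarrow> \<phi> z (x + xi) = (if z \<in> C then t z else 0)"
proof -
  have y: "x + xi \<in> \<Union>\<T>"
    using assms hat[of xi] xi by (auto simp: g_def hat_function_def)
  show thesis
  proof (rule barycentric[OF y])
    fix T C t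
    assume C: "T \<in> \<T>" "x + xi \<in> T" "C \<subseteq> T" "finite C" "card C = DIM('a) + 1" "C \<subseteq> N0 \<union> Nb"
      and t: "\<And>v. v \<in> C \<Longrightarrow> 0 \<le> t v" "sum t C = 1" "x + xi = (\<Sum>v\<in>C. t v *\<^sub>R v)"
      and \<phi>: "\<And>z. z \<in> N0 \<union> Nb \<Longrightarrow> \<phi> z (x + xi) = (if z \<in> C then t z else (0::real))"
    have xiC: "xi \<in> C"
      using assms \<phi>[of xi] xi by (auto simp: g_def split: if_splits)
    have d: "dist xi v \<le> h" if "v \<in> C" for v
      using diameter_star[OF xi C(1)] xiC C(3) that by blast
    have "C \<subseteq> N0"
    proof
      fix v assume v: "v \<in> C"
      have "h < R * h" using h R by simp
      then have "v \<in> ball xi (R * h)" using d[OF v] by simp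
      then show "v \<in> N0"
        using v C(6) ball_subset(3) interior_node by blast
    qed
    moreover have "norm x \<le> (1 - t xi) * h"
    proof -
      \<comment> \<open>The vertex \<open>xi\<close> contributes nothing to \<open>x\<close>, which
        leaves the total weight \<open>1 - t xi\<close>. For \<open>t xi > 0\<close> the bound is
        strictly below \<open>h\<close>.\<close>
      have "x = (\<Sum>v\<in>C. t v *\<^sub>R (v - xi))"
        using t(2,3) by (simp add: scaleR_diff_right sum_subtractf eq_diff_eq flip: scaleR_left.sum)
      also have "\<dots> = (\<Sum>v\<in>C - {xi}. t v *\<^sub>R (v - xi))"
        using xiC C(4) by (simp add: sum.remove)
      also have "norm \<dots> \<le> (\<Sum>v\<in>C - {xi}. t v * h)"
        using t(1) d by (intro sum_norm_le) (auto simp: dist_norm norm_minus_commute mult_left_mono)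
      also have "\<dots> = (1 - t xi) * h"
        using t(2) xiC C(4) by (simp add: sum.remove flip: sum_distrib_right)
      finally show ?thesis .
    qed
    ultimately show thesis
      using that[of C t] C t \<phi> xiC d by blast
  qed
qed

lemma g_support: "g x \<noteq> 0 \<Longrightarrow> norm x \<le> h"
proof (erule g_nonzero)
  fix C t
  assume "xi \<in> C" "\<And>v. v \<in> C \<Longrightarrow> 0 \<le> t v" "norm x \<le> (1 - t xi) * h"
  then show "norm x \<le> h"
    using h by (smt (verit, best) mult_left_le_one_le mult_right_mono mult_1)
qed

text \<open>Continuity is given on the meshed region only, and outside the function is zero by
  convention. As the support lies well inside the shifted mesh, two open sets cover the space on
  each of which \<open>g\<close> is continuous.\<close>

lemma continuous_g: "continuous_on UNIV g"
proof -
  let ?I = "(\<lambda>x. x - xi) ` interior (\<Union>\<T>)"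
  have op: "open ?I" using open_translation_subtract by blast
  have "continuous_on ?I g"
  proof -
    have "continuous_on (interior (\<Union>\<T>)) (\<phi> xi)"
    proof (rule continuous_on_subset[OF _ interior_subset])
      show "continuous_on (\<Union>\<T>) (\<phi> xi)"
        using hat[of xi] xi by (simp add: hat_function_def)
    qed
    then show ?thesis
      unfolding g_def by (rule continuous_on_compose2[of _ "\<phi> xi"]) (auto intro!: continuous_intros)
  qed
  moreover have "continuous_on (- cball 0 h) g"
    by (rule continuous_on_eq[of _ "\<lambda>x. 0"]) (use g_support in \<open>force+\<close>)
  ultimately have "continuous_on (?I \<union> - cball 0 h) g"
    using op by (intro continuous_on_open_Un) auto
  moreover have "?I \<union> - cball 0 h = UNIV"
  proof -
    have "x \<in> ?I" if "norm x \<le> h" for x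
    proof -
      have "h < R * h" using h R by simp
      then have "x + xi \<in> ball xi (R * h)" using that by (simp add: dist_norm)
      then show ?thesis
        using ball_subset(1) by (intro image_eqI[of _ _ "x + xi"]) auto
    qed
    then show ?thesis by auto
  qed
  ultimately show ?thesis by simp
qed

lemma g_shift:
  assumes "v \<in> N0" "dist xi v \<le> h"
  shows "g (x - (v - xi)) = \<phi> v (x + xi)"
proof -
  have "h < (R - 1) * h" using h R by simp
  then have "\<phi> v (x + xi) = g (x + xi - v)"
    using assms translate by simp
  then show ?thesis by (simp add: algebra_simps)
qed

text \<open>Among \<open>d + 1\<close> barycentric coordinates with sum one, some coordinate is at
  least \<open>1 / (d + 1)\<close>. Translation to its vertex moves \<open>x\<close> to a place
  where \<open>g\<close> has a lower bound that does not depend on \<open>x\<close>.\<close>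

lemma near_vertex:
  assumes "g x \<noteq> 0"
  obtains k where "k \<in> L" "g (x - k) \<ge> 1 / (real DIM('a) + 1)"
proof (rule g_nonzero[OF assms])
  fix C t
  assume C: "finite C" "card C = DIM('a) + 1" "C \<subseteq> N0" "\<And>v. v \<in> C \<Longrightarrow> dist xi v \<le> h" "sum t C = 1"
    "\<And>z. z \<in> N0 \<union> Nb \<Longrightarrow> \<phi> z (x + xi) = (if z \<in> C then t z else 0)"
  have "\<exists>v\<in>C. t v \<ge> 1 / (real DIM('a) + 1)"
  proof (rule ccontr)
    assume "\<not> ?thesis"
    then have "sum t C < (\<Sum>v\<in>C. 1 / (real DIM('a) + 1))"
      using C(1,2) by (intro sum_strict_mono) auto
    then show False
      using C(2,5) by (simp add: field_simps)
  qed
  then obtain v where v: "v \<in> C" "t v \<ge> 1 / (real DIM('a) + 1)" by blast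
  have "g (x - (v - xi)) = t v"
    using g_shift[of v x] C v by auto
  moreover have "v - xi \<in> L"
    using v C(3) xi lattice by auto
  ultimately show thesis
    using that v(2) by metis
qed

text \<open>The barycentric coordinates in the cell of \<open>x + xi\<close> sum to one and are
  values of translates of \<open>g\<close>. The point is that no lattice vector outside this cell
  contributes.\<close>

lemma partition_local:
  assumes gx: "g x \<ge> 1 / (real DIM('a) + 1)"
  shows "finite {k \<in> L. g (x - k) \<noteq> 0} \<and> (\<Sum>k\<in>{k \<in> L. g (x - k) \<noteq> 0}. g (x - k)) = 1"
proof -
  have "0 < 1 / (real DIM('a) + 1)" by simp
  then have gx0: "g x \<noteq> 0" using gx by linarith
  show ?thesis
  proof (rule g_nonzero[OF gx0])
    fix C t
    assume C: "finite C" "card C = DIM('a) + 1" "C \<subseteq> N0" "xi \<in> C" "\<And>v. v \<in> C \<Longrightarrow> dist xi v \<le> h"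
      and t: "\<And>v. v \<in> C \<Longrightarrow> 0 \<le> t v" "sum t C = 1" "norm x \<le> (1 - t xi) * h"
      and \<phi>: "\<And>z. z \<in> N0 \<union> Nb \<Longrightarrow> \<phi> z (x + xi) = (if z \<in> C then t z else 0)"
    have gv: "g (x - (v - xi)) = t v" if "v \<in> C" for v
      using g_shift[of v x] C \<phi> that by auto
    have "t xi > 0"
      using gx gv[OF C(4)] \<open>0 < 1 / (real DIM('a) + 1)\<close> by (metis cancel_comm_monoid_add_class.diff_cancel diff_zero less_le_trans)
    then have nx: "norm x < h"
      using t(3) h by (smt (verit) mult_less_cancel_right1 mult_le_cancel_right1)
    have eq: "{k \<in> L. g (x - k) \<noteq> 0} = (\<lambda>v. v - xi) ` {v \<in> C. t v \<noteq> 0}"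
    proof (intro equalityI subsetI)
      fix k assume k: "k \<in> {k \<in> L. g (x - k) \<noteq> 0}"
      define z where "z = xi + k"
      have "norm (x - k) \<le> h" using k g_support by auto
      then have "norm k < 2 * h"
        using nx norm_triangle_ineq4[of x "x - k"] by simp
      \<comment> \<open>A contributing lattice vector is strictly shorter than \<open>2 * h\<close>,
        and translation invariance reaches up to \<open>(R - 1) * h\<close>: here
        \<open>R \<ge> 3\<close> is exactly enough.\<close>
      also have "2 * h \<le> (R - 1) * h" using h R by simp
      finally have z1: "dist xi z < (R - 1) * h" by (simp add: z_def dist_norm)
      moreover have "(R - 1) * h \<le> R * h" using h by simp
      ultimately have "z \<in> \<Omega>" using ball_subset(3) by (auto simp: subset_iff)
      moreover have "z \<in> L"
        using k xi lattice Lplus by (auto simp: z_def)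
      ultimately have zN: "z \<in> N0" using lattice by blast
      have "\<phi> z (x + xi) = g (x - k)"
        using translate[OF zN z1, of "x + xi"] by (simp add: z_def)
      then have "z \<in> C \<and> t z \<noteq> 0"
        using k \<phi>[of z] zN by (auto split: if_splits)
      then show "k \<in> (\<lambda>v. v - xi) ` {v \<in> C. t v \<noteq> 0}"
        by (intro image_eqI[of _ _ z]) (auto simp: z_def)
    next
      fix k assume "k \<in> (\<lambda>v. v - xi) ` {v \<in> C. t v \<noteq> 0}"
      then obtain v where v: "v \<in> C" "t v \<noteq> 0" "k = v - xi" by blast
      then show "k \<in> {k \<in> L. g (x - k) \<noteq> 0}"
        using gv[OF v(1)] C(3) xi lattice by auto
    qed
    have "(\<Sum>k\<in>{k \<in> L. g (x - k) \<noteq> 0}. g (x - k)) = (\<Sum>v\<in>{v \<in> C. t v \<noteq> 0}. g (x - (v - xi)))"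
      unfolding eq by (subst sum.reindex) (auto simp: inj_on_def)
    also have "\<dots> = (\<Sum>v\<in>{v \<in> C. t v \<noteq> 0}. t v)"
      using gv by (intro sum.cong) auto
    also have "\<dots> = sum t C"
      using C(1) by (intro sum.mono_neutral_left) auto
    finally show ?thesis
      using t(2) C(1) by (simp add: eq)
  qed
qed

text \<open>The supports of the translates of \<open>g\<close> cover the space: their union is open, and it contains a
  ball of fixed radius about each of its points because every point is seen by some translate with
  weight at least \<open>1 / (d + 1)\<close>.\<close>

lemma cover: "\<exists>k\<in>L. g (x - k) > 0"
proof -
  let ?\<eta> = "1 / (real DIM('a) + 1)"
  define W where "W = {x. \<exists>k\<in>L. g (x - k) > 0}"
  have "compact {x. g x \<ge> ?\<eta>}"
  proof (rule compact_eq_bounded_closed[THEN iffD2], intro conjI)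
    have "0 < ?\<eta>" by simp
    then have "{x. g x \<ge> ?\<eta>} \<subseteq> cball 0 h"
      using g_support by force
    then show "bounded {x. g x \<ge> ?\<eta>}"
      using bounded_cball bounded_subset by blast
    show "closed {x. g x \<ge> ?\<eta>}"
      using continuous_g by (intro closed_Collect_le continuous_on_const)
  qed
  moreover have "open {x. g x > 0}"
    using continuous_g by (intro open_Collect_less continuous_on_const)
  moreover have "{x. g x \<ge> ?\<eta>} \<subseteq> {x. g x > 0}"
  proof -
    have "0 < ?\<eta>" by simp
    then show ?thesis using less_le_trans[of 0 ?\<eta>] by blast
  qed
  ultimately obtain e where e: "e > 0" "(\<Union>x\<in>{x. g x \<ge> ?\<eta>}. ball x e) \<subseteq> {x. g x > 0}"
    using compact_subset_open_imp_ball_epsilon_subset by metis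
  have W: "ball x e \<subseteq> W" if xW: "x \<in> W" for x
  proof
    fix y assume y: "y \<in> ball x e"
    obtain k where k: "k \<in> L" "g (x - k) > 0" using xW W_def by blast
    obtain l where l: "l \<in> L" "g (x - k - l) \<ge> ?\<eta>"
      using near_vertex[of "x - k"] k by (metis less_irrefl)
    have "y - k - l \<in> ball (x - k - l) e"
      using y by (simp add: dist_norm)
    then have "g (y - k - l) > 0" using e l by blast
    then show "y \<in> W"
      using Lplus[OF k(1) l(1)] by (auto simp: W_def algebra_simps)
  qed
  have "open W"
    using W e(1) by (meson open_contains_ball)
  moreover have "closed W"
    unfolding closed_def open_contains_ball
  proof
    fix x assume "x \<in> - W"
    then have "ball x e \<subseteq> - W"
      using W by (auto simp: subset_iff dist_commute)
    then show "\<exists>e>0. ball x e \<subseteq> - W" using e(1) by blast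
  qed
  ultimately have "W = {} \<or> W = UNIV" using clopen by blast
  moreover have "0 \<in> W"
    using L0 g0 by (auto simp: W_def intro!: bexI[of _ 0])
  ultimately show ?thesis unfolding W_def by blast
qed

text \<open>A lattice vector \<open>m\<close> moves \<open>x\<close> to a point where the local
  statement applies, and shifting the summation index by \<open>m\<close> does not change the
  sum.\<close>

lemma partition: "finite {k \<in> L. g (x - k) \<noteq> 0}" "(\<Sum>k\<in>{k \<in> L. g (x - k) \<noteq> 0}. g (x - k)) = 1"
proof -
  obtain k where k: "k \<in> L" "g (x - k) > 0" using cover by blast
  obtain l where l: "l \<in> L" "g (x - k - l) \<ge> 1 / (real DIM('a) + 1)"
    using near_vertex[of "x - k"] k by (metis less_irrefl)
  define m where "m = k + l"
  have m: "m \<in> L" using k l Lplus by (simp add: m_def)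
  have "g (x - m) \<ge> 1 / (real DIM('a) + 1)"
    using l(2) by (simp add: m_def algebra_simps)
  note p = partition_local[OF this]
  have eq: "{j \<in> L. g (x - j) \<noteq> 0} = (\<lambda>j. j + m) ` {j \<in> L. g (x - m - j) \<noteq> 0}"
  proof (intro equalityI subsetI)
    fix j assume "j \<in> {j \<in> L. g (x - j) \<noteq> 0}"
    then show "j \<in> (\<lambda>j. j + m) ` {j \<in> L. g (x - m - j) \<noteq> 0}"
      using lattice(2)[OF _ m] by (intro image_eqI[of _ _ "j - m"]) auto
  next
    fix j assume "j \<in> (\<lambda>j. j + m) ` {j \<in> L. g (x - m - j) \<noteq> 0}"
    then show "j \<in> {j \<in> L. g (x - j) \<noteq> 0}"
      using m Lplus by (auto simp: algebra_simps)
  qed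
  show "finite {k \<in> L. g (x - k) \<noteq> 0}"
    unfolding eq using p by blast
  have "(\<Sum>j\<in>{j \<in> L. g (x - j) \<noteq> 0}. g (x - j)) = (\<Sum>j\<in>{j \<in> L. g (x - m - j) \<noteq> 0}. g (x - (j + m)))"
    unfolding eq by (subst sum.reindex) (auto simp: inj_on_def)
  then show "(\<Sum>k\<in>{k \<in> L. g (x - k) \<noteq> 0}. g (x - k)) = 1"
    using p by (simp add: algebra_simps)
qed

text \<open>Some cell at \<open>xi\<close> has diameter at least \<open>\<gamma> * h\<close>, so it
  contains a ball of radius above \<open>\<gamma> * h / (4 * \<sigma>)\<close>. Contract this ball
  towards \<open>xi\<close> by one half: on the cell the hat function is affine, one at
  \<open>xi\<close> and nonnegative at the other end, hence at least one half at the
  midpoint.\<close>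

lemma big_ball: "\<exists>c. ball c (\<gamma> * h / (8 * \<sigma>)) \<subseteq> {x. g x \<ge> 1 / 2}"
proof -
  let ?TT = "{T \<in> \<T>. xi \<in> T}"
  have "?TT \<noteq> {}" using star_nonempty[of xi] xi by auto
  then have "local_mesh_size \<T> xi \<in> diameter ` ?TT"
    unfolding local_mesh_size_def using finT by (intro Max_in) auto
  then obtain T where T: "T \<in> \<T>" "xi \<in> T" "diameter T = local_mesh_size \<T> xi" by auto
  then have dT: "\<gamma> * h \<le> diameter T"
    using quasi xi by (simp add: quasi_uniform_def)
  note s = shape_regular_ge[OF mesh T(1) dim shape]
  have "\<gamma> * h \<le> \<sigma> * inball_diameter T" using dT s(3) by linarith
  then have "\<gamma> * h / \<sigma> \<le> inball_diameter T"
    using s(1) by (simp add: field_simps)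
  moreover have "\<gamma> * h / (2 * \<sigma>) < \<gamma> * h / \<sigma>"
    using s(1) h \<gamma> by (simp add: field_simps)
  ultimately obtain c r where cr: "0 \<le> r" "cball c r \<subseteq> T" "\<gamma> * h / (2 * \<sigma>) < 2 * r"
    using inball_diameter_bounds(3)[OF mesh T(1) dim, of "\<gamma> * h / (2 * \<sigma>)"] by auto
  have "\<exists>a b. \<forall>x\<in>T. \<phi> xi x = a \<bullet> x + b"
    using hat[of xi] xi T(1) by (simp add: hat_function_def)
  then obtain a b where ab: "\<And>x. x \<in> T \<Longrightarrow> \<phi> xi x = a \<bullet> x + b"
    by blast
  have "convex T"
    using conforming_mesh_simplex[OF mesh T(1)] by (metis convex_convex_hull)
  have "g x \<ge> 1 / 2" if x: "x \<in> ball ((c - xi) /\<^sub>R 2) (\<gamma> * h / (8 * \<sigma>))" for x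
  proof -
    define p where "p = 2 *\<^sub>R x + xi"
    have "norm ((c - xi) /\<^sub>R 2 - x) < \<gamma> * h / (8 * \<sigma>)" using x by (simp add: dist_norm)
    then have "norm (2 *\<^sub>R ((c - xi) /\<^sub>R 2 - x)) \<le> 2 * (\<gamma> * h / (8 * \<sigma>))" by simp
    also have "2 *\<^sub>R ((c - xi) /\<^sub>R 2 - x) = c - p"
      by (simp add: p_def scaleR_diff_right)
    also have "2 * (\<gamma> * h / (8 * \<sigma>)) \<le> r" using cr(3) by (simp add: field_simps)
    finally have "p \<in> T" using cr(2) by (auto simp: dist_norm)
    have q: "x + xi = (1/2) *\<^sub>R xi + (1/2) *\<^sub>R p"
      by (simp add: p_def scaleR_add_right flip: scaleR_add_left)
    then have "x + xi \<in> T"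
      using \<open>convex T\<close> T(2) \<open>p \<in> T\<close> by (auto intro!: convexD)
    then have "g x = a \<bullet> (x + xi) + b" by (simp add: g_def ab)
    also have "\<dots> = (a \<bullet> xi + b) / 2 + (a \<bullet> p + b) / 2"
      by (simp only: q) (simp add: inner_add_right field_simps)
    also have "\<dots> = \<phi> xi xi / 2 + \<phi> xi p / 2"
      using ab T(2) \<open>p \<in> T\<close> by simp
    finally show ?thesis
      using hat_bounds(1)[of xi p] xi g0 by (simp add: g_def)
  qed
  then show ?thesis by blast
qed

end

section \<open>Lattice partitions of unity\<close>

lemma nn_integral_lborel_translate:
  fixes F :: "'a::euclidean_space \<Rightarrow> ennreal"
  assumes [measurable]: "F \<in> borel_measurable borel"
  shows "(\<integral>\<^sup>+x. F (x + k) \<partial>lborel) = (\<integral>\<^sup>+x. F x \<partial>lborel)"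
proof -
  have "(\<integral>\<^sup>+x. F x \<partial>lborel) = (\<integral>\<^sup>+x. F x \<partial>distr lborel borel ((+) k))"
    by (simp add: lborel_distr_plus)
  also have "\<dots> = (\<integral>\<^sup>+x. F (k + x) \<partial>lborel)"
    by (rule nn_integral_distr) simp_all
  finally show ?thesis by (simp add: add.commute)
qed

text \<open>Unfolding: multiply \<open>F\<close> by the partition made from \<open>G\<close>,
  exchange sum and integral, translate each term by \<open>k\<close>, and collect the partition made
  from \<open>F\<close>. The opposite signs of \<open>k\<close> in the two hypotheses make the
  translations match.\<close>

lemma nn_integral_eq_of_lattice_partitions:
  fixes F G :: "'a::euclidean_space \<Rightarrow> ennreal"
  assumes [measurable]: "F \<in> borel_measurable borel" "G \<in> borel_measurable borel" and L: "countable L"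
    and F1: "AE x in lborel. (\<integral>\<^sup>+k. F (x - k) \<partial>count_space L) = 1"
    and G1: "AE x in lborel. (\<integral>\<^sup>+k. G (x + k) \<partial>count_space L) = 1"
  shows "(\<integral>\<^sup>+x. F x \<partial>lborel) = (\<integral>\<^sup>+x. G x \<partial>lborel)"
proof -
  have "(\<integral>\<^sup>+x. F x \<partial>lborel) = (\<integral>\<^sup>+x. F x * (\<integral>\<^sup>+k. G (x + k) \<partial>count_space L) \<partial>lborel)"
    using G1 by (intro nn_integral_cong_AE) auto
  also have "\<dots> = (\<integral>\<^sup>+x. (\<integral>\<^sup>+k. F x * G (x + k) \<partial>count_space L) \<partial>lborel)"
    by (simp add: nn_integral_cmult)
  also have "\<dots> = (\<integral>\<^sup>+k. (\<integral>\<^sup>+x. F x * G (x + k) \<partial>lborel) \<partial>count_space L)"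
    using L by (intro nn_integral_count_space_nn_integral) measurable
  also have "\<dots> = (\<integral>\<^sup>+k. (\<integral>\<^sup>+x. F (x - k) * G x \<partial>lborel) \<partial>count_space L)"
  proof (rule nn_integral_cong)
    fix k
    show "(\<integral>\<^sup>+x. F x * G (x + k) \<partial>lborel) = (\<integral>\<^sup>+x. F (x - k) * G x \<partial>lborel)"
      using nn_integral_lborel_translate[of "\<lambda>x. F (x - k) * G x" k] by simp
  qed
  also have "\<dots> = (\<integral>\<^sup>+x. (\<integral>\<^sup>+k. F (x - k) * G x \<partial>count_space L) \<partial>lborel)"
    using L by (intro nn_integral_count_space_nn_integral[symmetric]) measurable
  also have "\<dots> = (\<integral>\<^sup>+x. (\<integral>\<^sup>+k. F (x - k) \<partial>count_space L) * G x \<partial>lborel)"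
    by (simp add: nn_integral_multc)
  also have "\<dots> = (\<integral>\<^sup>+x. G x \<partial>lborel)"
    using F1 by (intro nn_integral_cong_AE) auto
  finally show ?thesis .
qed

text \<open>What the tiling argument uses of a mesh. The ball of radius \<open>b * h\<close> bounds
  the integral of \<open>g\<close> from below and thereby, through packing, the density of the
  lattice from above.\<close>

locale lattice_partition =
  fixes L :: "'a::euclidean_space set" and g :: "'a \<Rightarrow> real" and h b :: real and c0 :: 'a
  assumes L0: "0 \<in> L" and Ldiff: "\<And>k l. \<lbrakk>k \<in> L; l \<in> L\<rbrakk> \<Longrightarrow> k - l \<in> L"
    and countL: "countable L" and discrete: "\<exists>e>0. finite (L \<inter> ball 0 e)"
    and g_cont: "continuous_on UNIV g" and g_bounds: "\<And>x. 0 \<le> g x" "\<And>x. g x \<le> 1"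
    and g_support: "\<And>x. g x \<noteq> 0 \<Longrightarrow> norm x \<le> h"
    and partition: "\<And>x. finite {k \<in> L. g (x - k) \<noteq> 0}" "\<And>x. (\<Sum>k\<in>{k \<in> L. g (x - k) \<noteq> 0}. g (x - k)) = 1"
    and h: "h > 0" and b: "b > 0" and big: "ball c0 (b * h) \<subseteq> {x. g x \<ge> 1 / 2}"
begin

definition "I = (\<integral>x. g x \<partial>lborel)"

lemma Lminus: "k \<in> L \<Longrightarrow> - k \<in> L" and Lplus: "\<lbrakk>k \<in> L; l \<in> L\<rbrakk> \<Longrightarrow> k + l \<in> L"
proof -
  show m: "- k \<in> L" if "k \<in> L" for k
    using Ldiff[OF L0 that] by simp
  show "k + l \<in> L" if "k \<in> L" "l \<in> L"
    using Ldiff[OF that(1) m[OF that(2)]] by simp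
qed

lemma finite_lattice_ball: "finite (L \<inter> cball x r)"
proof -
  obtain e where e: "e > 0" "finite (L \<inter> ball 0 e)" using discrete by blast
  \<comment> \<open>Two lattice points in a ball of radius \<open>e / 2\<close> differ by a lattice
    vector shorter than \<open>e\<close>.\<close>
  have fin: "finite (L \<inter> ball z (e / 2))" for z
  proof (cases "L \<inter> ball z (e / 2) = {}")
    case False
    then obtain l where l: "l \<in> L" "dist z l < e / 2" by auto
    have "L \<inter> ball z (e / 2) \<subseteq> (\<lambda>k. k + l) ` (L \<inter> ball 0 e)"
    proof
      fix k assume k: "k \<in> L \<inter> ball z (e / 2)"
      then have "dist l k < e"
        using l dist_triangle_half_r[of z l e k] by auto
      then have "k - l \<in> L \<inter> ball 0 e"
        using k l Ldiff by (auto simp: dist_norm)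
      then show "k \<in> (\<lambda>k. k + l) ` (L \<inter> ball 0 e)"
        by (intro image_eqI[of _ _ "k - l"]) auto
    qed
    then show ?thesis using e(2) finite_surj by blast
  qed simp
  have "compact (cball x r)" by simp
  moreover have "cball x r \<subseteq> (\<Union>z\<in>cball x r. ball z (e / 2))" using e(1) by auto
  ultimately obtain Z where Z: "finite Z" "cball x r \<subseteq> (\<Union>z\<in>Z. ball z (e / 2))"
    using compactE_image[of "cball x r" "cball x r" "\<lambda>z. ball z (e / 2)"] by (metis open_ball)
  then have "L \<inter> cball x r \<subseteq> (\<Union>z\<in>Z. L \<inter> ball z (e / 2))" by blast
  then show ?thesis
    using Z(1) fin by (meson finite_UN finite_subset)
qed

lemma g_measurable [measurable]: "g \<in> borel_measurable borel"
  using g_cont by (rule borel_measurable_continuous_onI)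

lemma g_integrable: "integrable lborel g"
proof (rule Bochner_Integration.integrable_bound)
  show "integrable lborel (indicat_real (cball (0::'a) h))"
    using emeasure_bounded_finite[OF bounded_cball] emeasure_bounded_finite[OF bounded_ball]
      by (simp add: integrable_indicator_iff)
  show "AE x in lborel. norm (g x) \<le> norm (indicat_real (cball 0 h) x)"
  proof (rule AE_I2)
    fix x
    show "norm (g x) \<le> norm (indicat_real (cball 0 h) x)"
      using g_support[of x] g_bounds[of x] by (cases "g x = 0") (auto simp: indicator_def)
  qed
qed simp

lemma nn_integral_g: "(\<integral>\<^sup>+x. ennreal (g x) \<partial>lborel) = ennreal I"
  unfolding I_def using g_integrable g_bounds by (intro nn_integral_eq_integral) auto

lemma covering: obtains k where "k \<in> L" "norm (x - k) \<le> h"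
proof -
  have "{k \<in> L. g (x - k) \<noteq> 0} \<noteq> {}"
    using partition(2)[of x] by (metis sum.empty zero_neq_one)
  then show thesis using that g_support by blast
qed

lemma I_lower: "I \<ge> measure lborel (ball (0::'a) 1) * (b * h) ^ DIM('a) / 2" and I_pos: "I > 0"
proof -
  have bh: "b * h > 0" using b h by simp
  have "(\<integral>x. indicat_real (ball c0 (b * h)) x / 2 \<partial>lborel) \<le> I"
    unfolding I_def
  proof (rule integral_mono)
    show "integrable lborel (\<lambda>x. indicat_real (ball c0 (b * h)) x / 2)"
using emeasure_bounded_finite[OF bounded_ball]
      by (intro integrable_divide) (simp add: integrable_indicator_iff)
    show "indicat_real (ball c0 (b * h)) x / 2 \<le> g x" for x
      using big g_bounds(1)[of x] by (auto simp: indicator_def)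
  qed (rule g_integrable)
  then show 1: "I \<ge> measure lborel (ball (0::'a) 1) * (b * h) ^ DIM('a) / 2"
    using content_ball_conv_unit_ball[of "b * h" c0] bh by (simp add: mult.commute)
  have "measure lborel (ball (0::'a) 1) * (b * h) ^ DIM('a) > 0"
    using content_ball_pos[of 1 "0::'a"] bh by simp
  then show "I > 0" using 1 by linarith
qed

text \<open>Packing: the translates of \<open>g\<close> by the multiples \<open>j k\<close> with \<open>\<bar>j k\<bar> \<le> h\<close> all live in the ball of
  radius \<open>2 h\<close> and sum up to at most \<open>1\<close>, so there are not too many of them.\<close>

lemma lattice_separated:
  assumes k: "k \<in> L" "k \<noteq> 0"
  shows "h \<le> 2 * (2 / b) ^ DIM('a) * norm k"
proof -
  define m where "m = nat \<lfloor>h / norm k\<rfloor>"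
  have nk: "norm k > 0" using k by simp
  have m: "real m * norm k \<le> h" "h < (real m + 1) * norm k"
  proof -
    have "real m \<le> h / norm k" "h / norm k < real m + 1"
      using h nk unfolding m_def by (simp_all add: of_nat_nat)
    then show "real m * norm k \<le> h" "h < (real m + 1) * norm k"
      using nk by (simp_all add: field_simps)
  qed
  have jk: "real j *\<^sub>R k \<in> L" for j
  proof (induction j)
    case (Suc j)
    then show ?case using Lplus[OF k(1)] by (simp add: scaleR_left_distrib)
  qed (simp add: L0)
  let ?J = "(\<lambda>j. real j *\<^sub>R k) ` {..m}"
  have inj: "inj_on (\<lambda>j. real j *\<^sub>R k) {..m}"
    using k(2) by (auto simp: inj_on_def)
  have le: "(\<Sum>j\<le>m. g (x - real j *\<^sub>R k)) \<le> indicat_real (cball 0 (2 * h)) x" for x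
  proof -
    have "(\<Sum>j\<le>m. g (x - real j *\<^sub>R k)) = (\<Sum>l\<in>?J. g (x - l))"
      using inj by (simp add: sum.reindex)
    also have "\<dots> = (\<Sum>l\<in>?J \<inter> {k \<in> L. g (x - k) \<noteq> 0}. g (x - l))"
      using jk by (intro sum.mono_neutral_right) auto
    also have "\<dots> \<le> (\<Sum>l\<in>{k \<in> L. g (x - k) \<noteq> 0}. g (x - l))"
      using partition(1) g_bounds by (intro sum_mono2) auto
    finally have 1: "(\<Sum>j\<le>m. g (x - real j *\<^sub>R k)) \<le> 1"
      using partition(2) by simp
    show ?thesis
    proof (cases "norm x \<le> 2 * h")
      case False
      have "g (x - real j *\<^sub>R k) = 0" if "j \<le> m" for j
      proof (rule ccontr)
        assume "g (x - real j *\<^sub>R k) \<noteq> 0"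
        then have "norm (x - real j *\<^sub>R k) \<le> h" using g_support by blast
        moreover have "norm (real j *\<^sub>R k) \<le> h"
          using order_trans[OF mult_right_mono m(1), of "real j"] that by simp
        ultimately show False
          using False norm_triangle_ineq2[of x "real j *\<^sub>R k"] by linarith
      qed
      then show ?thesis by simp
    qed (use 1 in simp)
  qed
  have int: "integrable lborel (\<lambda>x. g (x - l))" "(\<integral>x. g (x - l) \<partial>lborel) = I" for l
  proof -
    have "integrable (distr lborel borel ((+) (- l))) g"
      using g_integrable by (simp add: lborel_distr_plus)
    then show "integrable lborel (\<lambda>x. g (x - l))"
      by (simp add: integrable_distr_eq)
    have "I = (\<integral>x. g x \<partial>distr lborel borel ((+) (- l)))"
      by (simp add: I_def lborel_distr_plus)
    also have "\<dots> = (\<integral>x. g (x - l) \<partial>lborel)"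
      by (simp add: integral_distr)
    finally show "(\<integral>x. g (x - l) \<partial>lborel) = I" ..
  qed
  have "(\<integral>x. (\<Sum>j\<le>m. g (x - real j *\<^sub>R k)) \<partial>lborel) \<le> (\<integral>x. indicat_real (cball (0::'a) (2 * h)) x \<partial>lborel)"
    using le int emeasure_bounded_finite[OF bounded_cball]
    by (intro integral_mono) (auto simp: integrable_indicator_iff)
  moreover have "(\<integral>x. (\<Sum>j\<le>m. g (x - real j *\<^sub>R k)) \<partial>lborel) = (real m + 1) * I"
    using int by (subst Bochner_Integration.integral_sum) auto
  moreover have "(\<integral>x. indicat_real (cball (0::'a) (2 * h)) x \<partial>lborel) = measure lborel (ball (0::'a) 1) * (2 * h) ^ DIM('a)"
    using content_cball[of "2 * h" "0::'a"] content_ball[of 1 "0::'a"] h by (simp add: mult.commute)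
  ultimately have "(real m + 1) * I \<le> measure lborel (ball (0::'a) 1) * (2 * h) ^ DIM('a)"
    by simp
  moreover have "(real m + 1) * (measure lborel (ball (0::'a) 1) * (b * h) ^ DIM('a) / 2) \<le> (real m + 1) * I"
    using I_lower by (intro mult_left_mono) auto
  ultimately have "(real m + 1) * (measure lborel (ball (0::'a) 1) * (b * h) ^ DIM('a) / 2)
      \<le> measure lborel (ball (0::'a) 1) * (2 * h) ^ DIM('a)"
    by linarith
  then have "measure lborel (ball (0::'a) 1) * ((real m + 1) * (b * h) ^ DIM('a) / 2) \<le> measure lborel (ball (0::'a) 1) * (2 * h) ^ DIM('a)"
    by (simp add: field_simps)
  moreover have "measure lborel (ball (0::'a) 1) > 0"
    by (rule content_ball_pos) simp
  ultimately have "(real m + 1) * (b * h) ^ DIM('a) / 2 \<le> (2 * h) ^ DIM('a)"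
    by (simp only: mult_le_cancel_left_pos)
  moreover have "(2 * h) ^ DIM('a) = (2 / b) ^ DIM('a) * (b * h) ^ DIM('a)"
    unfolding power_mult_distrib[symmetric] using b by simp
  ultimately have "((real m + 1) / 2) * (b * h) ^ DIM('a) \<le> (2 / b) ^ DIM('a) * (b * h) ^ DIM('a)"
    by simp
  then have "(real m + 1) / 2 \<le> (2 / b) ^ DIM('a)"
    using b h by (simp only: mult_le_cancel_right_pos zero_less_power mult_pos_pos)
  then have "(real m + 1) * norm k \<le> (2 * (2 / b) ^ DIM('a)) * norm k"
    by (intro mult_right_mono) auto
  then show ?thesis using m(2) by linarith
qed

text \<open>Walk from the origin in the direction of \<open>v\<close> a little further than
  \<open>h\<close>. Some lattice point \<open>k\<close> lies within \<open>h\<close> of the endpoint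
  \<open>x\<close>, so \<open>x\<close> is closer to \<open>k\<close> than to the origin; the
  constraint at \<open>k\<close>, scaled from \<open>v\<close> to \<open>x\<close>, says the
  opposite.\<close>

lemma subgradient_bound:
  assumes c: "c > 0" and v: "\<And>k. \<lbrakk>k \<in> L; norm k < 5 / 2 * h\<rbrakk> \<Longrightarrow> v \<bullet> k \<le> c * (norm k)\<^sup>2 / 2"
  shows "norm v \<le> c * h"
proof (rule ccontr)
  assume "\<not> norm v \<le> c * h"
  then have nv: "c * h < norm v" by simp
  moreover have "0 < c * h" using c h by simp
  ultimately have nv0: "norm v > 0" by linarith
  \<comment> \<open>The first entry makes \<open>x\<close> no longer than \<open>v\<close> divided
    by \<open>c\<close>. The cap \<open>5 / 4 * h\<close> keeps \<open>k\<close> within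
    \<open>9 / 4 * h\<close>, so that only constraints below \<open>5 / 2 * h\<close> are
    used.\<close>
  define s where "s = min (norm v / c) (5 / 4 * h)"
  have s: "s > h" "s < 3 / 2 * h" "s / norm v \<le> 1 / c"
  proof -
    show "s > h" "s < 3 / 2 * h"
      using nv h c nv0 by (auto simp: s_def field_simps)
    have "s \<le> norm v / c" by (simp add: s_def)
    then show "s / norm v \<le> 1 / c"
      using c nv0 by (simp add: field_simps)
  qed
  define x where "x = (s / norm v) *\<^sub>R v"
  have nx: "norm x = s" using s(1) h nv0 by (simp add: x_def)
  obtain k where k: "k \<in> L" "norm (x - k) \<le> h" using covering by blast
  have "norm k < 5 / 2 * h"
    using norm_triangle_ineq4[of x "x - k"] k nx s(2) by simp
  then have vk: "v \<bullet> k \<le> c * (norm k)\<^sup>2 / 2" using v k by blast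
  have "x \<bullet> k \<le> (norm k)\<^sup>2 / 2"
  proof (cases "v \<bullet> k \<ge> 0")
    case True
    have "x \<bullet> k = s / norm v * (v \<bullet> k)" by (simp add: x_def)
    also have "\<dots> \<le> 1 / c * (v \<bullet> k)" using s(3) True by (rule mult_right_mono)
    also have "\<dots> \<le> 1 / c * (c * (norm k)\<^sup>2 / 2)" using vk c by (intro mult_left_mono) auto
    finally show ?thesis using c by simp
  next
    case False
    then have "x \<bullet> k \<le> 0"
      using s(1) h nv0 by (simp add: x_def divide_nonpos_pos mult_nonneg_nonpos)
    then show ?thesis by (smt (verit) zero_le_power2 divide_nonneg_pos)
  qed
  then have "(norm x)\<^sup>2 \<le> (norm (x - k))\<^sup>2"
    by (simp add: power2_norm_eq_inner algebra_simps inner_commute)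
  then have "norm x \<le> norm (x - k)" by (rule power2_le_imp_le) simp
  then show False using nx s(1) k(2) by linarith
qed

text \<open>The Voronoi cell of the origin with respect to the metric \<open>x \<bullet> M x\<close> tiles the space just as
  the hat function does, so both have the same integral.\<close>

lemma emeasure_voronoi:
  fixes M :: "'a \<Rightarrow> 'a"
  assumes M: "linear M" and sym: "\<And>x y. x \<bullet> M y = y \<bullet> M x"
    and lam: "lam > 0" "\<And>x. lam * (norm x)\<^sup>2 \<le> x \<bullet> M x"
  shows "closed {y. \<forall>k\<in>L. y \<bullet> M k \<le> k \<bullet> M k / 2}"
    and "emeasure lborel {y. \<forall>k\<in>L. y \<bullet> M k \<le> k \<bullet> M k / 2} = ennreal I"
proof -
  define q where "q x = x \<bullet> M x" for x
  define V where "V = {y. \<forall>k\<in>L. y \<bullet> M k \<le> k \<bullet> M k / 2}"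
  have qdiff: "q (x - y) = q x - 2 * (x \<bullet> M y) + q y" for x y
    using sym[of y x] by (simp add: q_def linear_diff[OF M] inner_diff_left inner_diff_right)
  \<comment> \<open>In the metric of \<open>q\<close> the origin is a nearest lattice point to
    \<open>y\<close>.\<close>
  have V_iff: "y \<in> V \<longleftrightarrow> (\<forall>k\<in>L. q y \<le> q (y - k))" for y
    by (auto simp: V_def qdiff q_def[symmetric])
  have "V = (\<Inter>k\<in>L. {y. M k \<bullet> y \<le> k \<bullet> M k / 2})"
    by (auto simp: V_def inner_commute)
  moreover have "closed (\<Inter>k\<in>L. {y. M k \<bullet> y \<le> k \<bullet> M k / 2})"
    by (intro closed_INT ballI closed_halfspace_le)
  ultimately have "closed V" by simp
  then show cl: "closed {y. \<forall>k\<in>L. y \<bullet> M k \<le> k \<bullet> M k / 2}"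
    unfolding V_def .
  have [measurable]: "V \<in> sets borel"
    using cl unfolding V_def by simp
  have M0: "M a \<noteq> 0" if "a \<noteq> 0" for a
    using lam(2)[of a] lam(1) that by (auto simp: zero_less_mult_iff mult_le_0_iff)
  \<comment> \<open>A nearest lattice point exists, because positive definiteness leaves only
    finitely many candidates at least as close as the origin.\<close>
  have ex: "\<exists>k\<in>L. x - k \<in> V" for x
  proof -
    let ?S = "{k \<in> L. q (x - k) \<le> q x}"
    have "?S \<subseteq> L \<inter> cball x (sqrt (q x / lam))"
    proof
      fix k assume k: "k \<in> ?S"
      then have "lam * (norm (x - k))\<^sup>2 \<le> q x"
        using lam(2)[of "x - k"] by (simp add: q_def)
      then have "(norm (x - k))\<^sup>2 \<le> q x / lam"
        using lam(1) by (simp add: field_simps)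
      then show "k \<in> L \<inter> cball x (sqrt (q x / lam))"
        using k by (simp add: dist_norm real_le_rsqrt)
    qed
    then have fin: "finite ?S"
      using finite_lattice_ball finite_subset by blast
    moreover have "0 \<in> ?S" using L0 by simp
    ultimately obtain k where k: "k \<in> ?S" "\<And>l. l \<in> ?S \<Longrightarrow> q (x - k) \<le> q (x - l)"
      using arg_min_if_finite(1,2)[of ?S "\<lambda>l. q (x - l)"] by (metis (no_types, lifting) empty_iff linorder_not_less)
    have "q (x - k) \<le> q (x - l)" if "l \<in> L" for l
      using k that by (cases "l \<in> ?S") auto
    then have "x - k \<in> V"
      using Lplus k(1) unfolding V_iff by (simp add: diff_diff_eq)
    then show ?thesis using k(1) by blast
  qed
  \<comment> \<open>Two lattice points are equidistant only on a hyperplane. There are countably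
    many pairs, so almost every point lies in exactly one translate of \<open>V\<close>.\<close>
  have null: "AE x in lborel. q (x - k) \<noteq> q (x - l)" if "k \<noteq> l" for k l
  proof -
    have "q (x - k) = q (x - l) \<longleftrightarrow> (2 *\<^sub>R M (l - k)) \<bullet> x = q l - q k" for x
      using linear_diff[OF M] by (auto simp: qdiff inner_diff_right inner_diff_left inner_commute)
    moreover have "negligible {x. (2 *\<^sub>R M (l - k)) \<bullet> x = q l - q k}"
      using M0[of "l - k"] that by (intro negligible_hyperplane) auto
    moreover have "closed {x. (2 *\<^sub>R M (l - k)) \<bullet> x = q l - q k}"
      by (rule closed_hyperplane)
    ultimately have "{x. q (x - k) = q (x - l)} \<in> null_sets lborel"
      by (auto simp: negligible_iff_null_sets null_sets_completion_iff)
    then show ?thesis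
      by (intro AE_I'[of "{x. q (x - k) = q (x - l)}"]) auto
  qed
  have "AE x in lborel. \<forall>k\<in>L. \<forall>l\<in>L. k \<noteq> l \<longrightarrow> q (x - k) \<noteq> q (x - l)"
    using countL null by (subst AE_ball_countable[OF countL])+ auto
  then have one: "AE x in lborel. (\<integral>\<^sup>+k. indicator V (x - k) \<partial>count_space L) = 1"
  proof (rule AE_mp, intro AE_I2 impI)
    fix x assume u: "\<forall>k\<in>L. \<forall>l\<in>L. k \<noteq> l \<longrightarrow> q (x - k) \<noteq> q (x - l)"
    obtain k where k: "k \<in> L" "x - k \<in> V" using ex by blast
    have "x - l \<notin> V" if l: "l \<in> L" "l \<noteq> k" for l
    proof
      assume "x - l \<in> V"
      then have "q (x - l) \<le> q (x - l - (k - l))" using Ldiff[OF k(1) l(1)] V_iff by blast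
      moreover have "q (x - k) \<le> q (x - k - (l - k))" using Ldiff[OF l(1) k(1)] V_iff k(2) by blast
      ultimately have "q (x - l) = q (x - k)" by simp
      then show False using u l k by metis
    qed
    then have "(\<integral>\<^sup>+k. indicator V (x - k) \<partial>count_space L) = (\<Sum>j\<in>{k}. indicator V (x - j) :: ennreal)"
      using k by (intro nn_integral_count_space') (auto simp: indicator_def)
    then show "(\<integral>\<^sup>+k. indicator V (x - k) \<partial>count_space L) = 1"
      using k by simp
  qed
  have "(\<integral>\<^sup>+k. ennreal (g (x + k)) \<partial>count_space L) = 1" for x
  proof -
    \<comment> \<open>The unfolding lemma wants the shifts \<open>x + k\<close> for its second
      function; the lattice is symmetric under negation.\<close>
    have bij: "bij_betw uminus L L"
      using Lminus by (intro bij_betwI[of _ _ _ uminus]) auto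
    have "(\<integral>\<^sup>+k. ennreal (g (x + k)) \<partial>count_space L) = (\<integral>\<^sup>+k. ennreal (g (x - k)) \<partial>count_space L)"
      using nn_integral_bij_count_space[OF bij, of "\<lambda>k. ennreal (g (x + k))"] by simp
    also have "\<dots> = (\<Sum>k\<in>{k \<in> L. g (x - k) \<noteq> 0}. ennreal (g (x - k)))"
      using partition(1) by (intro nn_integral_count_space') auto
    also have "\<dots> = 1"
      using partition(2)[of x] g_bounds by (simp add: sum_ennreal)
    finally show ?thesis .
  qed
  then have "(\<integral>\<^sup>+x. indicator V x \<partial>lborel) = (\<integral>\<^sup>+x. ennreal (g x) \<partial>lborel)"
    using one countL by (intro nn_integral_eq_of_lattice_partitions[of _ _ L]) auto
  then show "emeasure lborel {y. \<forall>k\<in>L. y \<bullet> M k \<le> k \<bullet> M k / 2} = ennreal I"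
    unfolding V_def[symmetric] by (simp add: nn_integral_g)
qed

end

section \<open>Cells of perturbed quadratic functions\<close>

definition scales_volume :: "(real^'n::finite \<Rightarrow> real^'n) \<Rightarrow> bool" where
  "scales_volume f \<longleftrightarrow> (\<forall>S\<in>lmeasurable. f ` S \<in> lmeasurable \<and>
     measure lebesgue (f ` S) = \<bar>det (matrix f)\<bar> * measure lebesgue S)"

lemma scales_volume_comp:
  fixes f g :: "real^'n::finite \<Rightarrow> real^'n"
  assumes "linear f" "linear g" "scales_volume f" "scales_volume g"
  shows "scales_volume (f \<circ> g)"
  unfolding scales_volume_def
proof (intro ballI)
  fix S :: "(real^'n) set" assume S: "S \<in> lmeasurable"
  then have gS: "g ` S \<in> lmeasurable" "measure lebesgue (g ` S) = \<bar>det (matrix g)\<bar> * measure lebesgue S"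
    using assms(4) by (auto simp: scales_volume_def)
  then have "f ` g ` S \<in> lmeasurable" "measure lebesgue (f ` g ` S) = \<bar>det (matrix f)\<bar> * measure lebesgue (g ` S)"
    using assms(3) by (auto simp: scales_volume_def)
  then show "(f \<circ> g) ` S \<in> lmeasurable \<and>
      measure lebesgue ((f \<circ> g) ` S) = \<bar>det (matrix (f \<circ> g))\<bar> * measure lebesgue S"
    using gS(2) matrix_compose[OF assms(2,1)] by (simp add: image_comp det_mul abs_mult)
qed

lemma scales_volume_stretch: "scales_volume (\<lambda>x::real^'n::finite. \<chi> i. c i * x $ i)"
proof -
  have "det (matrix (\<lambda>x::real^'n. \<chi> i. c i * x $ i)) = prod c UNIV"
    by (subst det_diagonal) (auto simp: matrix_def axis_def)
  then show ?thesis
    by (simp add: scales_volume_def measurable_stretch measure_stretch)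
qed

lemma linear_stretch: "linear (\<lambda>x::real^'n::finite. \<chi> i. c i * x $ i)"
  by (rule linearI) (auto simp: vec_eq_iff algebra_simps)

lemma linear_shear: "linear (\<lambda>x::real^'n::finite. \<chi> i. if i = m then x $ m + x $ n else x $ i)"
  by (rule linearI) (auto simp: vec_eq_iff algebra_simps)

lemma scales_volume_shear:
  fixes m n :: "'n::finite"
  assumes mn: "m \<noteq> n"
  shows "scales_volume (\<lambda>x::real^'n. \<chi> i. if i = m then x $ m + x $ n else x $ i)" (is "scales_volume ?h")
proof -
  note lin = linear_shear[of m n]
  have "matrix ?h = (\<chi> k. if k = m then row m (mat 1) + 1 *s row n (mat 1) else row k (mat 1 :: real^'n^'n))"
    using mn by (auto simp: matrix_def mat_def row_def axis_def vec_eq_iff)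
  then have det: "det (matrix ?h) = 1"
    using det_row_operation[OF mn, of "mat 1 :: real^'n^'n" 1] by simp
  have box: "measure lebesgue (?h ` cbox a b) = 1 * measure lebesgue (cbox a b)" for a b
  proof (cases "cbox a b = {}")
    case False
    \<comment> \<open>The box is moved so that its \<open>n\<close>-th lower bound becomes zero,
      since \<open>measure_shear_interval\<close> asks for a nonnegative one.\<close>
    define w :: "real^'n" where "w = (\<chi> i. if i = n then a $ n else 0)"
    have ab: "cbox a b = (+) w ` cbox (a - w) (b - w)"
      using cbox_translation[of w "a - w" "b - w"] by simp
    have im: "?h ` cbox a b = (+) (?h w) ` ?h ` cbox (a - w) (b - w)"
      unfolding ab image_image linear_add[OF lin] ..
    have "measure lebesgue (?h ` cbox a b) = measure lebesgue (?h ` cbox (a - w) (b - w))"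
      unfolding im by (rule measure_translation)
    also have "\<dots> = measure lebesgue (cbox (a - w) (b - w))"
      using mn False ab by (intro measure_shear_interval) (auto simp: w_def)
    also have "\<dots> = measure lebesgue (cbox a b)"
      using measure_translation[of w "cbox (a - w) (b - w)"] by (simp only: ab[symmetric])
    finally show ?thesis by simp
  qed simp
  show ?thesis
    unfolding scales_volume_def det
  proof (intro ballI)
    fix S :: "(real^'n) set" assume S: "S \<in> lmeasurable"
    show "?h ` S \<in> lmeasurable \<and> measure lebesgue (?h ` S) = \<bar>1\<bar> * measure lebesgue S"
      using measure_linear_sufficient[OF lin S box] by simp
  qed
qed

text \<open>A transposition of coordinates is a product of shears and reflections.\<close>

lemma scales_volume_swap:
  fixes m n :: "'n::finite"
  assumes mn: "m \<noteq> n"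
  shows "scales_volume (\<lambda>x::real^'n. \<chi> i. x $ Transposition.transpose m n i)"
proof -
  define S where "S p q = (\<lambda>x::real^'n. \<chi> i. if i = p then x $ p + x $ q else x $ i)" for p q :: 'n
  define F where "F c = (\<lambda>x::real^'n. \<chi> i. c i * x $ i)" for c :: "'n \<Rightarrow> real"
  have lin: "linear (S p q)" "linear (F c)" for p q c
    unfolding S_def F_def by (rule linear_shear linear_stretch)+
  have sc: "scales_volume (S m n)" "scales_volume (S n m)" "scales_volume (F c)" for c
    unfolding S_def F_def using mn by (auto intro: scales_volume_shear scales_volume_stretch)
  have "(\<lambda>x::real^'n. \<chi> i. x $ Transposition.transpose m n i)
      = F (\<lambda>i. if i = n then -1 else 1) \<circ> (S m n \<circ> (F (\<lambda>i. if i = m then -1 else 1) \<circ> (S n m \<circ> (F (\<lambda>i. if i = m then -1 else 1) \<circ> S m n))))"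
    using mn by (auto simp: S_def F_def vec_eq_iff fun_eq_iff Transposition.transpose_def)
  then show ?thesis
    by (simp only:) (intro scales_volume_comp linear_compose lin sc)
qed

text \<open>The property is stable under composition, so elementary maps suffice. A map that
  annihilates a coordinate has determinant zero, and its image lies in a coordinate
  hyperplane.\<close>

lemma scales_volume_linear:
  fixes f :: "real^'n::finite \<Rightarrow> real^'n"
  assumes "linear f"
  shows "scales_volume f"
proof (rule induct_linear_elementary[OF assms])
  fix f :: "real^'n \<Rightarrow> real^'n" and i
  assume f: "linear f" "\<And>x. f x $ i = 0"
  have "row i (matrix f) = 0"
    using f(2) by (simp add: row_def matrix_def vec_eq_iff)
  then have "det (matrix f) = 0" by (rule det_zero_row)
  moreover have "negligible (f ` S)" for S
  proof (rule negligible_subset)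
    show "negligible {x::real^'n. x $ i = 0}"
      by (rule negligible_standard_hyperplane_cart)
  qed (use f(2) in auto)
  ultimately show "scales_volume f"
    by (simp add: scales_volume_def negligible_iff_measure)
qed (rule scales_volume_comp scales_volume_stretch scales_volume_shear scales_volume_swap; assumption)+

lemma power_one_plus_le:
  fixes d :: real
  assumes "d \<ge> 0"
  shows "(1 + d) ^ n - 1 \<le> real n * d * (1 + d) ^ n"
proof (induction n)
  case (Suc n)
  have "1 \<le> (1 + d) ^ n" using assms by simp
  have "(1 + d) ^ Suc n - 1 = ((1 + d) ^ n - 1) + d * (1 + d) ^ n"
    by (simp add: algebra_simps)
  also have "\<dots> \<le> real (Suc n) * d * (1 + d) ^ n"
    using Suc by (simp add: algebra_simps)
  also have "\<dots> \<le> real (Suc n) * d * (1 + d) ^ Suc n"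
    using assms by (intro mult_left_mono) (auto simp: algebra_simps)
  finally show ?case .
qed simp

lemma inner_matrix_vector_commute:
  fixes M :: "real^'n::finite^'n"
  assumes "transpose M = M"
  shows "x \<bullet> (M *v y) = y \<bullet> (M *v x)"
  by (metis assms dot_lmul_matrix inner_commute transpose_matrix_vector)

text \<open>Deform the identity linearly into \<open>M\<close>. All matrices on the way are positive
  definite, so the determinant never vanishes and keeps the sign it has at the identity.\<close>

lemma positive_definite_det_pos:
  fixes M :: "real^'n::finite^'n"
  assumes lam: "lam > 0" and M: "\<And>x. lam * (norm x)\<^sup>2 \<le> x \<bullet> (M *v x)"
  shows "det M > 0"
proof -
  define A where "A t = (1 - t) *\<^sub>R mat 1 + t *\<^sub>R M" for t :: real
  have cont: "continuous_on {0..1} (\<lambda>t. det (A t))"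
    unfolding det_def A_def by (simp add: mat_def) (intro continuous_intros)
  have nz: "det (A t) \<noteq> 0" if t: "0 \<le> t" "t \<le> 1" for t
  proof
    assume "det (A t) = 0"
    then obtain x where x: "x \<noteq> 0" "A t *v x = 0"
      by (metis invertible_det_nz invertible_left_inverse matrix_left_invertible_ker)
    have "0 = x \<bullet> (A t *v x)" using x by simp
    also have "\<dots> = (1 - t) * (norm x)\<^sup>2 + t * (x \<bullet> (M *v x))"
      by (simp add: A_def matrix_vector_mult_add_rdistrib inner_add_right power2_norm_eq_inner flip: scaleR_matrix_vector_assoc)
    also have "\<dots> \<ge> (1 - t) * (norm x)\<^sup>2 + t * (lam * (norm x)\<^sup>2)"
      using M t by (intro add_left_mono mult_left_mono) auto
    finally have "((1 - t) + t * lam) * (norm x)\<^sup>2 \<le> 0"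
      by (simp add: algebra_simps)
    moreover have "(1 - t) + t * lam > 0"
      using t lam by (cases "t = 1") (auto intro: add_pos_nonneg)
    ultimately show False
      using x(1) by (simp add: mult_le_0_iff)
  qed
  show ?thesis
  proof (rule ccontr)
    assume "\<not> det M > 0"
    then have "\<exists>t\<ge>0. t \<le> 1 \<and> det (A t) = 0"
      using cont by (intro IVT2') (auto simp: A_def)
    then show False using nz by blast
  qed
qed

text \<open>With \<open>a = 2 / (lam * s\<^sup>2)\<close> and \<open>\<delta> = a * eps\<close>, the
  first summand bounds \<open>(1 + \<delta>) ^ n - 1\<close> linearly in \<open>eps\<close>. The
  other two serve large errors, \<open>a * eps \<ge> 1\<close> or \<open>eps > lam / 2\<close>, for
  which the lower bound becomes trivial.\<close>

definition cell_const :: "nat \<Rightarrow> real \<Rightarrow> real \<Rightarrow> real \<Rightarrow> real" where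
  "cell_const n lam s epsmax =
     2 / (lam * s\<^sup>2) * real n * (1 + 2 * epsmax / (lam * s\<^sup>2)) ^ n + 2 / (lam * s\<^sup>2) + 2 / lam"

lemma cell_const_nonneg: "\<lbrakk>lam > 0; epsmax \<ge> 0\<rbrakk> \<Longrightarrow> cell_const n lam s epsmax \<ge> 0"
  by (simp add: cell_const_def)

locale lattice_partition_cart = lattice_partition L g h b c0
  for L :: "(real^'n::finite) set" and g h b c0
begin

definition sub_cell :: "real^'n^'n \<Rightarrow> (real^'n) set" where
  "sub_cell M = {v. \<forall>k\<in>L. v \<bullet> k \<le> k \<bullet> (M *v k) / 2}"

text \<open>The substitution \<open>v = M *v y\<close> turns this cell into the Voronoi cell of the
  metric \<open>y \<bullet> (M *v y)\<close>, whose volume is \<open>I\<close> for every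
  \<open>M\<close>.\<close>

lemma measure_sub_cell:
  assumes sym: "transpose M = M" and lam: "lam > 0" "\<And>x. lam * (norm x)\<^sup>2 \<le> x \<bullet> (M *v x)"
  shows "sub_cell M \<in> lmeasurable" "measure lebesgue (sub_cell M) = det M * I"
proof -
  define V where "V = {y. \<forall>k\<in>L. y \<bullet> (M *v k) \<le> k \<bullet> (M *v k) / 2}"
  note comm = inner_matrix_vector_commute[OF sym]
  have lin: "linear ((*v) M)" by simp
  have "inj ((*v) M)"
  proof (rule linear_injective_0[OF lin, THEN iffD2], intro allI impI)
    fix x assume "M *v x = 0"
    then have "lam * (norm x)\<^sup>2 \<le> 0" using lam(2)[of x] by simp
    then show "x = 0" using lam(1) by (simp add: mult_le_0_iff)
  qed
  then have surj: "surj ((*v) M)"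
    by (rule linear_inj_imp_surj[OF lin])
  have image: "sub_cell M = (*v) M ` V"
  proof (intro equalityI subsetI)
    fix v assume v: "v \<in> sub_cell M"
    obtain y where y: "v = M *v y" using surj by (metis surjD)
    have "y \<in> V"
      using v comm[of y] by (auto simp: sub_cell_def V_def y inner_commute)
    then show "v \<in> (*v) M ` V" using y by blast
  next
    fix v assume "v \<in> (*v) M ` V"
    then show "v \<in> sub_cell M"
      using comm by (auto simp: sub_cell_def V_def inner_commute)
  qed
  note e = emeasure_voronoi[OF lin comm lam, folded V_def]
  have V: "V \<in> lmeasurable"
    using e by (intro fmeasurableI) auto
  have mV: "measure lebesgue V = I"
    using e I_pos by (simp add: measure_def)
  show "sub_cell M \<in> lmeasurable"
    using scales_volume_linear[OF lin] V unfolding image scales_volume_def by blast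
  have "measure lebesgue (sub_cell M) = \<bar>det (matrix ((*v) M))\<bar> * measure lebesgue V"
    using scales_volume_linear[OF lin] V unfolding image scales_volume_def by blast
  then show "measure lebesgue (sub_cell M) = det M * I"
    using positive_definite_det_pos[OF lam] mV by simp
qed

lemma measure_sub_cell_scaleR:
  assumes sym: "transpose M = M" and lam: "lam > 0" "\<And>x. lam * (norm x)\<^sup>2 \<le> x \<bullet> (M *v x)" and c: "c > 0"
  shows "sub_cell (c *\<^sub>R M) \<in> lmeasurable" "measure lebesgue (sub_cell (c *\<^sub>R M)) = c ^ CARD('n) * (det M * I)"
proof -
  have 1: "transpose (c *\<^sub>R M) = c *\<^sub>R M"
    using sym by (simp add: transpose_def vec_eq_iff)
  have 2: "c * lam * (norm x)\<^sup>2 \<le> x \<bullet> ((c *\<^sub>R M) *v x)" for x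
    using mult_left_mono[OF lam(2)[of x], of c] c by (simp flip: scaleR_matrix_vector_assoc)
  have 3: "det (c *\<^sub>R M) = c ^ CARD('n) * det M"
  proof -
    have "c *\<^sub>R M = matrix ((*\<^sub>R) c) ** M"
      by (simp add: matrix_def matrix_matrix_mult_def vec_eq_iff axis_def mult.assoc if_distrib[of "\<lambda>x. x * _"] if_distrib[of "(*) c"] sum.delta cong: if_cong flip: sum_distrib_left)
    then show ?thesis by (simp add: det_mul)
  qed
  show "sub_cell (c *\<^sub>R M) \<in> lmeasurable" "measure lebesgue (sub_cell (c *\<^sub>R M)) = c ^ CARD('n) * (det M * I)"
    using measure_sub_cell[OF 1 _ 2] c lam(1) 3 by (simp_all add: mult.assoc)
qed

text \<open>The cell is squeezed between those of \<open>(1 - \<delta>) *\<^sub>R M\<close> and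
  \<open>(1 + \<delta>) *\<^sub>R M\<close>, whose volumes are exact multiples of
  \<open>det M * I\<close>. Nonzero lattice points keep the distance \<open>s * h\<close> from the
  origin, so the absolute error \<open>eps * h\<^sup>2\<close> is a relative error
  \<open>\<delta>\<close> of the quadratic form.\<close>

theorem measure_node_cell:
  fixes N :: "(real^'n) set" and f :: "real^'n \<Rightarrow> real"
  assumes sym: "transpose M = M" and lam: "lam > 0" "\<And>x. lam * (norm x)\<^sup>2 \<le> x \<bullet> (M *v x)"
    and Lam: "\<And>x. x \<bullet> (M *v x) \<le> Lam * (norm x)\<^sup>2" "Lam > 0"
    and s: "s > 0" "\<And>k. \<lbrakk>k \<in> L; k \<noteq> 0\<rbrakk> \<Longrightarrow> s * h \<le> norm k"
    and \<rho>: "5 / 2 * h \<le> \<rho>" "Lam * h \<le> lam * \<rho> / 2"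
    and N: "\<And>k. norm k < \<rho> \<Longrightarrow> k \<in> N \<longleftrightarrow> k \<in> L"
    and eps: "0 \<le> eps" "eps \<le> epsmax"
    and f: "\<And>k. \<lbrakk>k \<in> N; norm k < \<rho>; k \<noteq> 0\<rbrakk> \<Longrightarrow> \<bar>f k - k \<bullet> (M *v k) / 2\<bar> \<le> eps * h\<^sup>2" "f 0 = 0"
    and out: "\<And>k. \<lbrakk>eps \<le> lam / 2; k \<in> N; \<rho> \<le> norm k\<rbrakk> \<Longrightarrow> Lam * h * norm k \<le> f k"
  shows "\<bar>measure lebesgue {v. \<forall>k\<in>N. v \<bullet> k \<le> f k} - det M * I\<bar>
    \<le> cell_const CARD('n) lam s epsmax
        * eps * (det M * I)"
proof -
  define J where "J = {v. \<forall>k\<in>N. v \<bullet> k \<le> f k}"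
  define \<delta> where "\<delta> = 2 * eps / (lam * s\<^sup>2)"
  define a where "a = 2 / (lam * s\<^sup>2)"
  define n where "n = CARD('n)"
  have \<delta>: "\<delta> \<ge> 0" using eps lam(1) by (simp add: \<delta>_def)
  have a: "a > 0" and \<delta>a: "\<delta> = a * eps" "\<delta> \<le> a * epsmax"
    using lam(1) s(1) eps by (auto simp: a_def \<delta>_def divide_right_mono)
  have D: "det M * I > 0"
    using positive_definite_det_pos[OF lam] I_pos by simp
  have err: "eps * h\<^sup>2 \<le> \<delta> * (k \<bullet> (M *v k) / 2)" if k: "k \<in> L" "k \<noteq> 0" for k
  proof -
    have "s\<^sup>2 * h\<^sup>2 \<le> (norm k)\<^sup>2"
      using power_mono[OF s(2)[OF k], of 2] s(1) h by (simp add: power_mult_distrib)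
    then have "lam * (s\<^sup>2 * h\<^sup>2) \<le> lam * (norm k)\<^sup>2" using lam(1) by simp
    also have "\<dots> \<le> k \<bullet> (M *v k)" by (rule lam(2))
    finally have "(eps / (lam * s\<^sup>2)) * (lam * (s\<^sup>2 * h\<^sup>2)) \<le> (eps / (lam * s\<^sup>2)) * (k \<bullet> (M *v k))"
      using eps(1) lam(1) by (intro mult_left_mono) auto
    then show ?thesis using lam(1) s(1) by (simp add: \<delta>_def)
  qed
  have upper: "J \<subseteq> sub_cell ((1 + \<delta>) *\<^sub>R M)"
  proof
    fix v assume v: "v \<in> J"
    have near: "v \<bullet> k \<le> (1 + \<delta>) * (k \<bullet> (M *v k) / 2)" if k: "k \<in> L" "norm k < \<rho>" for k
    proof (cases "k = 0")
      case False
      have kN: "k \<in> N" using N k by blast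
      have "v \<bullet> k \<le> f k" using v kN by (simp add: J_def)
      also have "\<dots> \<le> k \<bullet> (M *v k) / 2 + eps * h\<^sup>2"
        using f(1)[OF kN k(2) False] by linarith
      also have "\<dots> \<le> k \<bullet> (M *v k) / 2 + \<delta> * (k \<bullet> (M *v k) / 2)"
        using err[OF k(1) False] by linarith
      finally show ?thesis by (simp add: algebra_simps)
    qed simp
    \<comment> \<open>The constraints near the origin already bound \<open>v\<close>. By
      \<open>Lam * h \<le> lam * \<rho> / 2\<close> this bound implies the constraints of all
      lattice points beyond \<open>\<rho>\<close>.\<close>
    have nv: "norm v \<le> ((1 + \<delta>) * Lam) * h"
    proof (rule subgradient_bound)
      fix k assume k: "k \<in> L" "norm k < 5 / 2 * h"
      then have "v \<bullet> k \<le> (1 + \<delta>) * (k \<bullet> (M *v k) / 2)" using near \<rho>(1) by auto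
      also have "\<dots> \<le> (1 + \<delta>) * (Lam * (norm k)\<^sup>2 / 2)"
        using Lam(1)[of k] \<delta> by (intro mult_left_mono) auto
      finally show "v \<bullet> k \<le> (1 + \<delta>) * Lam * (norm k)\<^sup>2 / 2" by simp
    qed (use \<delta> Lam in auto)
    have "v \<bullet> k \<le> k \<bullet> (((1 + \<delta>) *\<^sub>R M) *v k) / 2" if k: "k \<in> L" for k
    proof -
      have "v \<bullet> k \<le> (1 + \<delta>) * (k \<bullet> (M *v k) / 2)"
      proof (cases "norm k < \<rho>")
        case False
        have "v \<bullet> k \<le> norm v * norm k" by (rule norm_cauchy_schwarz)
        also have "\<dots> \<le> ((1 + \<delta>) * (Lam * h)) * norm k"
          using nv by (intro mult_right_mono) auto
        also have "\<dots> \<le> ((1 + \<delta>) * (lam * norm k / 2)) * norm k"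
        proof (intro mult_right_mono mult_left_mono)
          have "lam * \<rho> \<le> lam * norm k" using False lam(1) by simp
          then show "Lam * h \<le> lam * norm k / 2" using \<rho>(2) by linarith
        qed (use \<delta> in auto)
        also have "\<dots> = (1 + \<delta>) * (lam * (norm k)\<^sup>2 / 2)"
          by (simp add: power2_eq_square)
        also have "\<dots> \<le> (1 + \<delta>) * (k \<bullet> (M *v k) / 2)"
          using lam(2)[of k] \<delta> by (intro mult_left_mono) auto
        finally show ?thesis .
      qed (use near k in auto)
      then show ?thesis by (simp flip: scaleR_matrix_vector_assoc)
    qed
    then show "v \<in> sub_cell ((1 + \<delta>) *\<^sub>R M)" by (simp add: sub_cell_def)
  qed
  have "J = (\<Inter>k\<in>N. {v. k \<bullet> v \<le> f k})"
    by (auto simp: J_def inner_commute)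
  moreover have "closed (\<Inter>k\<in>N. {v. k \<bullet> v \<le> f k})"
    by (intro closed_INT ballI closed_halfspace_le)
  ultimately have "closed J" by simp
  then have setsJ: "J \<in> sets lebesgue" by (intro sets_completionI_sets) simp
  note mU = measure_sub_cell_scaleR[OF sym lam, of "1 + \<delta>"]
  have JU: "measure lebesgue J \<le> (1 + \<delta>) ^ n * (det M * I)"
    using measure_mono_fmeasurable[OF upper setsJ] mU \<delta> by (simp add: n_def)
  have J: "J \<in> lmeasurable"
    using fmeasurableI2[OF mU(1) upper setsJ] \<delta> by simp
  have "(1 + \<delta>) ^ n - 1 \<le> real n * \<delta> * (1 + \<delta>) ^ n"
    by (rule power_one_plus_le[OF \<delta>])
  also have "\<dots> \<le> real n * \<delta> * (1 + a * epsmax) ^ n"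
    using \<delta> \<delta>a by (intro mult_left_mono power_mono) auto
  finally have "((1 + \<delta>) ^ n - 1) * (det M * I) \<le> (real n * \<delta> * (1 + a * epsmax) ^ n) * (det M * I)"
    using D by (intro mult_right_mono) auto
  then have "measure lebesgue J - det M * I \<le> (real n * \<delta> * (1 + a * epsmax) ^ n) * (det M * I)"
    using JU by (simp add: left_diff_distrib)
  moreover have "det M * I - measure lebesgue J \<le> ((real n * \<delta> * (1 + a * epsmax) ^ n) + a * eps + 2 / lam * eps) * (det M * I)"
  proof -
    have n0: "0 \<le> real n * \<delta> * (1 + a * epsmax) ^ n" "0 \<le> a * eps" "0 \<le> 2 / lam * eps"
      using \<delta> \<delta>a a eps lam(1) by auto
    have "1 \<le> (1 + a * epsmax) ^ n"
      using a eps by simp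
    then have nd: "real n * \<delta> \<le> real n * \<delta> * (1 + a * epsmax) ^ n"
      using \<delta> mult_left_mono[of 1 "(1 + a * epsmax) ^ n" "real n * \<delta>"] by simp
    \<comment> \<open>Once the factor reaches one, the lower bound says no more than that a measure
      is nonnegative.\<close>
    have crude: "det M * I - measure lebesgue J \<le> K * (det M * I)" if "1 \<le> K" for K
    proof -
      have "det M * I \<le> K * (det M * I)"
        using mult_right_mono[OF that, of "det M * I"] D by simp
      then show ?thesis using measure_nonneg[of lebesgue J] by linarith
    qed
    \<comment> \<open>\<open>\<delta> < 1\<close> keeps \<open>(1 - \<delta>) *\<^sub>R M\<close>
      positive definite, and \<open>eps \<le> lam / 2\<close> gives access to \<open>out\<close> for
      the distant nodes.\<close>
    have fine: "det M * I - measure lebesgue J \<le> (real n * \<delta>) * (det M * I)" if small: "\<delta> < 1" "eps \<le> lam / 2"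
    proof -
      have lower: "sub_cell ((1 - \<delta>) *\<^sub>R M) \<subseteq> J"
      proof
        fix v assume "v \<in> sub_cell ((1 - \<delta>) *\<^sub>R M)"
        then have v: "v \<bullet> k \<le> (1 - \<delta>) * (k \<bullet> (M *v k) / 2)" if "k \<in> L" for k
          using that by (simp add: sub_cell_def flip: scaleR_matrix_vector_assoc)
        have nv: "norm v \<le> Lam * h"
        proof (rule subgradient_bound[OF Lam(2)])
          fix k assume k: "k \<in> L" "norm k < 5 / 2 * h"
          have "v \<bullet> k \<le> (1 - \<delta>) * (k \<bullet> (M *v k) / 2)" by (rule v[OF k(1)])
          also have "\<dots> \<le> 1 * (k \<bullet> (M *v k) / 2)"
            using lam(2)[of k] lam(1) \<delta> order_trans[of 0 "lam * (norm k)\<^sup>2" "k \<bullet> (M *v k)"]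
            by (intro mult_right_mono) auto
          finally show "v \<bullet> k \<le> Lam * (norm k)\<^sup>2 / 2" using Lam(1)[of k] by simp
        qed
        have "v \<bullet> k \<le> f k" if k: "k \<in> N" for k
        proof (cases "norm k < \<rho>")
          case True
          show ?thesis
          proof (cases "k = 0")
            case False
            have kL: "k \<in> L" using N True k by blast
            show ?thesis
              using v[OF kL] err[OF kL False] f(1)[OF k True False] by (simp add: algebra_simps)
          qed (use f(2) in simp)
        next
          case False
          have "v \<bullet> k \<le> norm v * norm k" by (rule norm_cauchy_schwarz)
          also have "\<dots> \<le> Lam * h * norm k" using nv by (intro mult_right_mono) auto
          also have "\<dots> \<le> f k" using out[OF small(2) k] False by simp
          finally show ?thesis .
        qed
        then show "v \<in> J" by (simp add: J_def)
      qed
      note mL = measure_sub_cell_scaleR[OF sym lam, of "1 - \<delta>"]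
      have "(1 - \<delta>) ^ n * (det M * I) \<le> measure lebesgue J"
        using measure_mono_fmeasurable[OF lower _ J] mL small by (simp add: n_def fmeasurableD)
      moreover have "1 - real n * \<delta> \<le> (1 - \<delta>) ^ n"
        using Bernoulli_inequality[of "- \<delta>" n] small by simp
      then have "(1 - real n * \<delta>) * (det M * I) \<le> (1 - \<delta>) ^ n * (det M * I)"
        using D by (intro mult_right_mono) auto
      ultimately show ?thesis by (simp add: left_diff_distrib)
    qed
    consider "\<delta> < 1 \<and> eps \<le> lam / 2" | "\<not> \<delta> < 1" | "\<not> eps \<le> lam / 2"
      by blast
    then show ?thesis
    proof cases
      case 1
      have "(real n * \<delta>) * (det M * I)
          \<le> ((real n * \<delta> * (1 + a * epsmax) ^ n) + a * eps + 2 / lam * eps) * (det M * I)"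
        using n0 nd D by (intro mult_right_mono) linarith+
      then show ?thesis using fine 1 by linarith
    next
      case 2
      then have "1 \<le> a * eps" using \<delta>a by simp
      then show ?thesis using n0 by (intro crude) linarith
    next
      case 3
      then have "1 \<le> 2 / lam * eps" using lam(1) by (simp add: field_simps)
      then show ?thesis using n0 by (intro crude) linarith
    qed
  qed
  moreover have "0 \<le> (a * eps + 2 / lam * eps) * (det M * I)"
    using a eps lam(1) D by simp
  ultimately have "\<bar>measure lebesgue J - det M * I\<bar> \<le> ((real n * \<delta> * (1 + a * epsmax) ^ n) + a * eps + 2 / lam * eps) * (det M * I)"
    by (simp add: abs_le_iff algebra_simps)
  also have "\<dots> = (a * real n * (1 + a * epsmax) ^ n + a + 2 / lam) * eps * (det M * I)"
    by (simp add: \<delta>a(1) algebra_simps)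
  finally show ?thesis
    by (simp add: J_def n_def a_def cell_const_def)
qed

end

section \<open>Nodal subdifferentials on a lattice mesh\<close>

lemma nodal_subdifferential_restrict:
  assumes "z \<in> N"
  shows "nodal_subdifferential N (restrict w N) z = {v. \<forall>y\<in>N. w z + v \<bullet> (y - z) \<le> w y}"
  using assms by (auto simp: nodal_subdifferential_def)

locale lattice_mesh = translation_invariant_mesh \<Omega> N0 Nb L \<T> \<phi> h R \<gamma> \<sigma> xi
  for \<Omega> :: "(real^'n::finite) set" and N0 Nb L \<T> \<phi> h R \<gamma> \<sigma> xi +
  assumes countable_L: "countable L"
begin

lemma sigma: "\<sigma> > 0"
proof -
  obtain T where "T \<in> \<T>" using star_nonempty[of xi] xi by blast
  then show ?thesis using shape_regular_ge(1)[OF mesh _ dim shape] by blast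
qed

text \<open>The estimates depend on the radius of the ball from \<open>big_ball\<close> and not on
  its centre, so the centre is an arbitrary choice. Finiteness of the lattice near \<open>xi\<close>
  is carried to the origin by a lattice translation.\<close>

sublocale lat: lattice_partition_cart L g h "\<gamma> / (8 * \<sigma>)" "SOME c. ball c (\<gamma> * h / (8 * \<sigma>)) \<subseteq> {x. g x \<ge> 1 / 2}"
proof unfold_locales
  show "\<exists>e>0. finite (L \<inter> ball 0 e)"
  proof (intro exI conjI)
    show "R * h > 0" using h R by simp
    have "L \<inter> ball 0 (R * h) \<subseteq> (\<lambda>k. k - xi) ` (L \<inter> ball xi (R * h))"
    proof
      fix k assume k: "k \<in> L \<inter> ball 0 (R * h)"
      then have "k + xi \<in> L \<inter> ball xi (R * h)"
        using Lplus xi lattice(1) by (auto simp: dist_norm)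
      then show "k \<in> (\<lambda>k. k - xi) ` (L \<inter> ball xi (R * h))"
        by (intro image_eqI[of _ _ "k + xi"]) auto
    qed
    then show "finite (L \<inter> ball 0 (R * h))"
      using finite_lattice_ball finite_surj by blast
  qed
  show "\<gamma> / (8 * \<sigma>) > 0" using \<gamma> sigma by simp
  show "ball (SOME c. ball c (\<gamma> * h / (8 * \<sigma>)) \<subseteq> {x. g x \<ge> 1 / 2}) (\<gamma> / (8 * \<sigma>) * h) \<subseteq> {x. g x \<ge> 1 / 2}"
    using someI_ex[OF big_ball] by (simp add: mult.commute)
qed (use L0 lattice(2) countable_L continuous_g g_bounds g_support partition h in auto)

lemma phi_eq: "\<phi> xi x = g (x - xi)"
  by (simp add: g_def)

lemma phi_bounds: "0 \<le> \<phi> xi x" "\<phi> xi x \<le> 1"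
  by (simp_all add: phi_eq g_bounds)

lemma phi_support: "x \<notin> cball xi h \<Longrightarrow> \<phi> xi x = 0"
  using g_support[of "x - xi"] by (auto simp: phi_eq dist_norm norm_minus_commute)

lemma phi_measurable: "\<phi> xi \<in> borel_measurable borel"
proof -
  have "(\<lambda>x. g (x - xi)) \<in> borel_measurable borel" by measurable
  then show ?thesis by (simp add: phi_eq[abs_def])
qed

lemma phi_integral: "integrable lborel (\<phi> xi)" "(\<integral>x. \<phi> xi x \<partial>lborel) = lat.I"
proof -
  have "integrable (distr lborel borel ((+) (- xi))) g"
    using lat.g_integrable by (simp add: lborel_distr_plus)
  then show "integrable lborel (\<phi> xi)"
    by (simp add: integrable_distr_eq phi_eq[abs_def])
  have "lat.I = (\<integral>x. g x \<partial>distr lborel borel ((+) (- xi)))"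
    by (simp add: lat.I_def lborel_distr_plus)
  also have "\<dots> = (\<integral>x. \<phi> xi x \<partial>lborel)"
    by (simp add: integral_distr phi_eq)
  finally show "(\<integral>x. \<phi> xi x \<partial>lborel) = lat.I" ..
qed

lemma cball_subset: "cball xi h \<subseteq> ball xi (R * h)" "cball xi h \<subseteq> \<Omega>"
proof -
  have "h < R * h" using h R by simp
  then show 1: "cball xi h \<subseteq> ball xi (R * h)" by auto
  then show "cball xi h \<subseteq> \<Omega>" using ball_subset(3) by blast
qed

lemma phi_outside: "x \<notin> \<Omega> \<Longrightarrow> \<phi> xi x = 0"
  using phi_support cball_subset(2) by blast

lemma phi_lint:
  "(LINT x:\<Omega>|lebesgue. \<phi> xi x * F x) = (LINT x:cball xi h|lebesgue. \<phi> xi x * F x)"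
  unfolding set_lebesgue_integral_def
proof (rule Bochner_Integration.integral_cong)
  fix x
  show "indicat_real \<Omega> x *\<^sub>R (\<phi> xi x * F x) = indicat_real (cball xi h) x *\<^sub>R (\<phi> xi x * F x)"
    using phi_support[of x] phi_outside[of x] by (cases "\<phi> xi x = 0") (auto simp: indicator_def)
qed simp

lemma phi_lint_one: "(LINT x:\<Omega>|lebesgue. \<phi> xi x) = lat.I"
proof -
  have "(LINT x:\<Omega>|lebesgue. \<phi> xi x) = (\<integral>x. \<phi> xi x \<partial>lebesgue)"
    unfolding set_lebesgue_integral_def
    using phi_outside by (intro Bochner_Integration.integral_cong) (auto simp: indicator_def)
  then show ?thesis
    using phi_integral(2) phi_measurable by (simp add: integral_completion)
qed

text \<open>Serves to replace the determinant of the Hessian under the integral by the constant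
  \<open>det M\<close>. The support of the hat function confines everything to
  \<open>cball xi h\<close>.\<close>

lemma phi_error:
  assumes F: "set_integrable lebesgue (cball xi h) F"
  shows "set_integrable lebesgue (cball xi h) (\<lambda>x. \<phi> xi x * \<bar>F x - c\<bar>)"
    and "\<bar>(LINT x:\<Omega>|lebesgue. \<phi> xi x * F x) - c * lat.I\<bar> \<le> (LINT x:cball xi h|lebesgue. \<phi> xi x * \<bar>F x - c\<bar>)"
proof -
  have [measurable]: "\<phi> xi \<in> borel_measurable lebesgue"
    using phi_measurable by (intro measurable_completion) simp
  have cb: "set_integrable lebesgue (cball xi h) (\<lambda>x. c)"
    using emeasure_bounded_finite[OF bounded_cball, of xi h]
    by (simp add: set_integrable_def integrable_completion integrable_indicator_iff)
  have Fc: "set_integrable lebesgue (cball xi h) (\<lambda>x. F x - c)"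
    using F cb by (rule set_integral_diff)
  have mult: "set_integrable lebesgue (cball xi h) (\<lambda>x. \<phi> xi x * G x)"
    if G: "set_integrable lebesgue (cball xi h) G" for G
    unfolding set_integrable_def
  proof (rule Bochner_Integration.integrable_bound)
    show "integrable lebesgue (\<lambda>x. indicator (cball xi h) x *\<^sub>R G x)"
      using G by (simp add: set_integrable_def)
    have "(\<lambda>x. \<phi> xi x * (indicator (cball xi h) x *\<^sub>R G x)) \<in> borel_measurable lebesgue"
      using borel_measurable_integrable[OF G[unfolded set_integrable_def]] by measurable
    then show "(\<lambda>x. indicator (cball xi h) x *\<^sub>R (\<phi> xi x * G x)) \<in> borel_measurable lebesgue"
      by (simp add: mult.left_commute)
    show "AE x in lebesgue. norm (indicator (cball xi h) x *\<^sub>R (\<phi> xi x * G x)) \<le> norm (indicator (cball xi h) x *\<^sub>R G x)"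
    proof (rule AE_I2)
      fix x
      have "\<bar>\<phi> xi x\<bar> * \<bar>G x\<bar> \<le> 1 * \<bar>G x\<bar>"
        using phi_bounds[of x] by (intro mult_right_mono) auto
      then show "norm (indicator (cball xi h) x *\<^sub>R (\<phi> xi x * G x)) \<le> norm (indicator (cball xi h) x *\<^sub>R G x)"
        by (simp add: abs_mult indicator_def)
    qed
  qed
  show "set_integrable lebesgue (cball xi h) (\<lambda>x. \<phi> xi x * \<bar>F x - c\<bar>)"
    by (intro mult set_integrable_abs Fc)
  have one: "(LINT x:cball xi h|lebesgue. \<phi> xi x) = lat.I"
    using phi_lint[of "\<lambda>x. 1"] phi_lint_one by simp
  have "(LINT x:cball xi h|lebesgue. \<phi> xi x * c) = c * lat.I"
    unfolding set_integral_mult_left one by (rule mult.commute)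
  then have "(LINT x:\<Omega>|lebesgue. \<phi> xi x * F x) - c * lat.I
      = (LINT x:cball xi h|lebesgue. \<phi> xi x * F x) - (LINT x:cball xi h|lebesgue. \<phi> xi x * c)"
    by (simp only: phi_lint[of F])
  also have "\<dots> = (LINT x:cball xi h|lebesgue. \<phi> xi x * (F x - c))"
    using set_integral_diff(2)[OF mult[OF F] mult[OF cb]] by (simp add: right_diff_distrib)
  finally have "\<bar>(LINT x:\<Omega>|lebesgue. \<phi> xi x * F x) - c * lat.I\<bar> = \<bar>LINT x:cball xi h|lebesgue. \<phi> xi x * (F x - c)\<bar>"
    by simp
  also have "\<dots> \<le> (LINT x:cball xi h|lebesgue. \<bar>\<phi> xi x * (F x - c)\<bar>)"
    using set_integral_norm_bound[OF mult[OF Fc]] by simp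
  also have "\<dots> = (LINT x:cball xi h|lebesgue. \<phi> xi x * \<bar>F x - c\<bar>)"
    using phi_bounds by (simp add: abs_mult)
  finally show "\<bar>(LINT x:\<Omega>|lebesgue. \<phi> xi x * F x) - c * lat.I\<bar> \<le> (LINT x:cball xi h|lebesgue. \<phi> xi x * \<bar>F x - c\<bar>)" .
qed

text \<open>The separation of lattice points in units of \<open>h\<close>, from
  \<open>lattice_separated\<close> with \<open>b = \<gamma> / (8 * \<sigma>)\<close>.\<close>

definition "sep = 1 / (2 * (16 * \<sigma> / \<gamma>) ^ CARD('n))"

text \<open>Subtracting the affine part translates the subdifferential by \<open>p\<close>, which
  preserves its measure. Beyond the radius of the Taylor estimate, convexity along the segment from
  \<open>xi\<close> transports outwards the growth reached on the sphere of radius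
  \<open>\<rho>\<close>.\<close>

lemma measure_subdifferential:
  assumes u: "convex_on (closure \<Omega>) u"
    and sym: "transpose M = M" and lam: "lam > 0" "\<And>x. lam * (norm x)\<^sup>2 \<le> x \<bullet> (M *v x)"
    and Lam: "\<And>x. x \<bullet> (M *v x) \<le> Lam * (norm x)\<^sup>2" "lam \<le> Lam" "3 * Lam \<le> lam * R"
    and eps: "0 \<le> eps" "eps \<le> epsmax"
    and f: "\<And>y. norm y \<le> 9 / 10 * R * h \<Longrightarrow> \<bar>u (xi + y) - u xi - p \<bullet> y - y \<bullet> (M *v y) / 2\<bar> \<le> eps * h\<^sup>2"
  shows "\<bar>measure lebesgue (nodal_subdifferential (N0 \<union> Nb) (restrict u (N0 \<union> Nb)) xi) - det M * lat.I\<bar>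
    \<le> cell_const CARD('n) lam sep epsmax
        * eps * (det M * lat.I)"
proof -
  \<comment> \<open>The factor \<open>9 / 10\<close> leaves a margin inside the ball, because the
    weak Taylor estimate is available only on smaller balls. With \<open>R \<ge> 3\<close> the
    radius is at least \<open>27 / 10 * h\<close>, still above the \<open>5 / 2 * h\<close> that
    bounds subgradients.\<close>
  define \<rho> where "\<rho> = 9 / 10 * R * h"
  define N where "N = {k. xi + k \<in> N0 \<union> Nb}"
  define w where "w k = u (xi + k) - u xi - p \<bullet> k" for k
  have \<rho>h: "\<rho> \<ge> 27 / 10 * h" using h R by (simp add: \<rho>_def)
  then have \<rho>0: "\<rho> > 0" using h by simp
  have Lam\<rho>: "27 / 10 * (Lam * h) \<le> lam * \<rho>"
  proof -
    have "3 * Lam * h \<le> lam * R * h" using Lam(3) h by (intro mult_right_mono) auto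
    then show ?thesis by (simp add: \<rho>_def mult_ac)
  qed
  have "nodal_subdifferential (N0 \<union> Nb) (restrict u (N0 \<union> Nb)) xi = {v. \<forall>y\<in>N0 \<union> Nb. u xi + v \<bullet> (y - xi) \<le> u y}"
    using xi by (intro nodal_subdifferential_restrict) auto
  also have "\<dots> = (+) p ` {v. \<forall>k\<in>N. v \<bullet> k \<le> w k}"
  proof (intro equalityI subsetI)
    fix v assume v: "v \<in> {v. \<forall>y\<in>N0 \<union> Nb. u xi + v \<bullet> (y - xi) \<le> u y}"
    have "v - p \<in> {v. \<forall>k\<in>N. v \<bullet> k \<le> w k}"
    proof (intro CollectI ballI)
      fix k assume "k \<in> N"
      then have "u xi + v \<bullet> (xi + k - xi) \<le> u (xi + k)"
        using v unfolding N_def by blast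
      then show "(v - p) \<bullet> k \<le> w k"
        by (simp add: w_def inner_diff_left)
    qed
    then show "v \<in> (+) p ` {v. \<forall>k\<in>N. v \<bullet> k \<le> w k}"
      by (intro image_eqI[of _ _ "v - p"]) auto
  next
    fix v assume "v \<in> (+) p ` {v. \<forall>k\<in>N. v \<bullet> k \<le> w k}"
    then obtain v' where v': "v = p + v'" "\<And>k. k \<in> N \<Longrightarrow> v' \<bullet> k \<le> w k" by auto
    show "v \<in> {v. \<forall>y\<in>N0 \<union> Nb. u xi + v \<bullet> (y - xi) \<le> u y}"
    proof (intro CollectI ballI)
      fix y assume "y \<in> N0 \<union> Nb"
      then have "y - xi \<in> N" by (simp add: N_def)
      then have "v' \<bullet> (y - xi) \<le> w (y - xi)" by (rule v'(2))
      then show "u xi + v \<bullet> (y - xi) \<le> u y"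
        by (simp add: w_def v'(1) inner_add_left)
    qed
  qed
  finally have "measure lebesgue (nodal_subdifferential (N0 \<union> Nb) (restrict u (N0 \<union> Nb)) xi)
      = measure lebesgue {v. \<forall>k\<in>N. v \<bullet> k \<le> w k}"
    by (simp only: measure_translation)
  also have "\<bar>\<dots> - det M * lat.I\<bar> \<le> cell_const CARD('n) lam sep epsmax
        * eps * (det M * lat.I)"
  proof (rule lat.measure_node_cell[OF sym lam Lam(1) _ _ _ _ _ _ eps])
    show "Lam > 0" using lam Lam by simp
    show "sep > 0" using sigma \<gamma> by (simp add: sep_def)
    show "sep * h \<le> norm k" if k: "k \<in> L" "k \<noteq> 0" for k
    proof -
      have "2 / (\<gamma> / (8 * \<sigma>)) = 16 * \<sigma> / \<gamma>" by simp
      then have "h \<le> 2 * (16 * \<sigma> / \<gamma>) ^ CARD('n) * norm k"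
        using lat.lattice_separated[OF k] by simp
      then show ?thesis
        using sigma \<gamma> by (simp add: sep_def field_simps)
    qed
    show "5 / 2 * h \<le> \<rho>" using \<rho>h h by linarith
    show "Lam * h \<le> lam * \<rho> / 2" using Lam\<rho> lam Lam h mult_pos_pos[of Lam h] by linarith
    show "k \<in> N \<longleftrightarrow> k \<in> L" if "norm k < \<rho>" for k
    proof -
      have "\<rho> \<le> R * h" using h R by (simp add: \<rho>_def)
      then have "xi + k \<in> ball xi (R * h)" using that by (simp add: dist_norm)
      then have "k \<in> N \<longleftrightarrow> xi + k \<in> L" unfolding N_def using ball_lattice by blast
      also have "\<dots> \<longleftrightarrow> k \<in> L"
      proof -
        have "xi \<in> L" using xi lattice(1) by simp
        then show ?thesis by (metis Lplus add_diff_cancel_left' lattice(2))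
      qed
      finally show ?thesis .
    qed
    show "\<bar>w k - k \<bullet> (M *v k) / 2\<bar> \<le> eps * h\<^sup>2" if "norm k < \<rho>" for k
      using f[of k] that by (simp add: w_def \<rho>_def)
    show "w 0 = 0" by (simp add: w_def)
    show "Lam * h * norm k \<le> w k" if small: "eps \<le> lam / 2" and k: "k \<in> N" "\<rho> \<le> norm k" for k
    proof -
      have nk: "norm k > 0" using k \<rho>0 by linarith
      define t where "t = \<rho> / norm k"
      have t: "0 < t" "t \<le> 1" using k nk \<rho>0 by (auto simp: t_def)
      have ny: "norm (t *\<^sub>R k) = \<rho>" using nk \<rho>0 by (simp add: t_def)
      have "N0 \<union> Nb \<subseteq> closure \<Omega>"
        using nodes closure_subset by (auto simp: nodal_set_def frontier_def)
      then have mem: "xi \<in> closure \<Omega>" "xi + k \<in> closure \<Omega>"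
        using xi k by (auto simp: N_def)
      have "u ((1 - t) *\<^sub>R xi + t *\<^sub>R (xi + k)) \<le> (1 - t) * u xi + t * u (xi + k)"
        using u mem t by (intro convex_onD) auto
      moreover have "(1 - t) *\<^sub>R xi + t *\<^sub>R (xi + k) = xi + t *\<^sub>R k"
        by (simp add: scaleR_diff_left scaleR_add_right)
      ultimately have "w (t *\<^sub>R k) \<le> t * w k"
        by (simp add: w_def algebra_simps)
      moreover have "lam / 2 * (\<rho>\<^sup>2 - h\<^sup>2) \<le> w (t *\<^sub>R k)"
      proof -
        have "\<bar>w (t *\<^sub>R k) - (t *\<^sub>R k) \<bullet> (M *v (t *\<^sub>R k)) / 2\<bar> \<le> eps * h\<^sup>2"
          using f[of "t *\<^sub>R k"] ny by (simp add: w_def \<rho>_def)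
        moreover have "lam * \<rho>\<^sup>2 \<le> (t *\<^sub>R k) \<bullet> (M *v (t *\<^sub>R k))"
          using lam(2)[of "t *\<^sub>R k"] ny by simp
        moreover have "eps * h\<^sup>2 \<le> lam / 2 * h\<^sup>2" using small by (intro mult_right_mono) auto
        ultimately show ?thesis by (simp add: right_diff_distrib)
      qed
      \<comment> \<open>Since \<open>Lam * h \<le> 10 / 27 * lam * \<rho>\<close>, the claim reduces
        to \<open>10 / 27 * \<rho>\<^sup>2 \<le> (\<rho>\<^sup>2 - h\<^sup>2) / 2\<close>, which
        follows from \<open>\<rho> \<ge> 27 / 10 * h\<close>.\<close>
      moreover have "Lam * h * \<rho> \<le> lam / 2 * (\<rho>\<^sup>2 - h\<^sup>2)"
      proof -
        have "(27 / 10 * h)\<^sup>2 \<le> \<rho>\<^sup>2" using \<rho>h h by (intro power_mono) auto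
        then have "729 * h\<^sup>2 \<le> 100 * \<rho>\<^sup>2" by (simp add: power_mult_distrib power_divide)
        then have "20 * \<rho>\<^sup>2 \<le> 27 * (\<rho>\<^sup>2 - h\<^sup>2)"
        proof -
          have "20 * P \<le> 27 * (P - H)" if "729 * H \<le> 100 * P" "0 \<le> H" for P H :: real
            using that by argo
          then show ?thesis using \<open>729 * h\<^sup>2 \<le> 100 * \<rho>\<^sup>2\<close> zero_le_power2 by blast
        qed
        then have "10 / 27 * \<rho>\<^sup>2 \<le> 1 / 2 * (\<rho>\<^sup>2 - h\<^sup>2)" by simp
        then have "lam * (10 / 27 * \<rho>\<^sup>2) \<le> lam * (1 / 2 * (\<rho>\<^sup>2 - h\<^sup>2))"
          using lam(1) by (intro mult_left_mono) auto
        moreover have "27 / 10 * (Lam * h) * \<rho> \<le> lam * \<rho> * \<rho>"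
          using Lam\<rho> \<rho>0 by (intro mult_right_mono) auto
        ultimately show ?thesis by (simp add: power2_eq_square)
      qed
      ultimately have "Lam * h * \<rho> \<le> t * w k" by linarith
      then show ?thesis
        using nk \<rho>0 by (simp add: t_def field_simps)
    qed
  qed
  finally show ?thesis .
qed

end

section \<open>Hessians and determinants\<close>

text \<open>A product of \<open>n\<close> factors bounded by \<open>K\<close> has Lipschitz constant
  \<open>n * K ^ (n - 1)\<close>, here written with a division by \<open>K\<close>, and the Leibniz
  formula adds up \<open>fact n\<close> such products.\<close>

definition det_lipschitz_const :: "nat \<Rightarrow> real \<Rightarrow> real" where
  "det_lipschitz_const n K = fact n * (K ^ n * (real n / K))"

lemma det_lipschitz:
  fixes A B :: "real^'n::finite^'n"
  assumes K: "K > 0" and A: "\<And>i j. \<bar>A $ i $ j\<bar> \<le> K" and B: "\<And>i j. \<bar>B $ i $ j\<bar> \<le> K"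
    and e: "\<And>i j. \<bar>A $ i $ j - B $ i $ j\<bar> \<le> e"
  shows "\<bar>det A - det B\<bar> \<le> det_lipschitz_const CARD('n) K * e"
proof -
  let ?U = "UNIV :: 'n set"
  let ?P = "{p. p permutes ?U}"
  have prod: "\<bar>(\<Prod>i\<in>?U. A $ i $ p i) - (\<Prod>i\<in>?U. B $ i $ p i)\<bar> \<le> K ^ CARD('n) * (real CARD('n) / K) * e" for p :: "'n \<Rightarrow> 'n"
  proof -
    \<comment> \<open>Division by \<open>K\<close> makes all factors at most one; then a difference
      of products is at most the sum of the differences of the factors.\<close>
    have "\<bar>(\<Prod>i\<in>?U. A $ i $ p i / K) - (\<Prod>i\<in>?U. B $ i $ p i / K)\<bar>
        \<le> (\<Sum>i\<in>?U. \<bar>A $ i $ p i / K - B $ i $ p i / K\<bar>)"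
      using norm_prod_diff[of ?U "\<lambda>i. A $ i $ p i / K" "\<lambda>i. B $ i $ p i / K"] A B K by (simp add: abs_divide)
    also have "\<dots> \<le> (\<Sum>i\<in>?U. e / K)"
    proof (rule sum_mono)
      fix i
      have "\<bar>A $ i $ p i / K - B $ i $ p i / K\<bar> = \<bar>A $ i $ p i - B $ i $ p i\<bar> / K"
        using K by (simp add: abs_divide flip: diff_divide_distrib)
      then show "\<bar>A $ i $ p i / K - B $ i $ p i / K\<bar> \<le> e / K"
        using e K by (simp add: divide_right_mono)
    qed
    finally have "\<bar>(\<Prod>i\<in>?U. A $ i $ p i) - (\<Prod>i\<in>?U. B $ i $ p i)\<bar> / K ^ CARD('n) \<le> real CARD('n) * (e / K)"
      using K by (simp add: prod_dividef flip: diff_divide_distrib)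
    then have "\<bar>(\<Prod>i\<in>?U. A $ i $ p i) - (\<Prod>i\<in>?U. B $ i $ p i)\<bar> \<le> real CARD('n) * (e / K) * K ^ CARD('n)"
      using K by (simp add: pos_divide_le_eq)
    then show ?thesis by (simp add: mult_ac)
  qed
  have "det A - det B = (\<Sum>p\<in>?P. of_int (sign p) * ((\<Prod>i\<in>?U. A $ i $ p i) - (\<Prod>i\<in>?U. B $ i $ p i)))"
    by (simp add: det_def right_diff_distrib sum_subtractf)
  also have "\<bar>\<dots>\<bar> \<le> (\<Sum>p\<in>?P. \<bar>of_int (sign p) * ((\<Prod>i\<in>?U. A $ i $ p i) - (\<Prod>i\<in>?U. B $ i $ p i))\<bar>)"
    by (rule sum_abs)
  also have "\<dots> \<le> (\<Sum>p\<in>?P. K ^ CARD('n) * (real CARD('n) / K) * e)"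
  proof (rule sum_mono)
    fix p :: "'n \<Rightarrow> 'n"
    have "\<bar>of_int (sign p)\<bar> = (1::real)" by (simp add: sign_def)
    then show "\<bar>of_int (sign p) * ((\<Prod>i\<in>?U. A $ i $ p i) - (\<Prod>i\<in>?U. B $ i $ p i))\<bar> \<le> K ^ CARD('n) * (real CARD('n) / K) * e"
      using prod[of p] by (simp add: abs_mult)
  qed
  also have "\<dots> = det_lipschitz_const CARD('n) K * e"
    by (simp add: det_lipschitz_const_def card_permutations)
  finally show ?thesis .
qed

lemma det_lipschitz_const_nonneg: "K > 0 \<Longrightarrow> det_lipschitz_const n K \<ge> 0"
  by (simp add: det_lipschitz_const_def)

lemma det_bound:
  fixes A :: "real^'n::finite^'n"
  assumes K: "K > 0" and A: "\<And>i j. \<bar>A $ i $ j\<bar> \<le> K"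
  shows "\<bar>det A\<bar> \<le> det_lipschitz_const CARD('n) K * K"
proof -
  have "\<bar>det A - det (mat 0 :: real^'n^'n)\<bar> \<le> det_lipschitz_const CARD('n) K * K"
    by (rule det_lipschitz[OF K A]) (use K A in \<open>simp_all add: mat_def less_imp_le\<close>)
  then show ?thesis by (simp only: det_0 diff_zero)
qed

text \<open>Nonnegativity of the form at the sum and at the difference of two coordinate vectors
  bounds an off-diagonal entry by the mean of two diagonal ones.\<close>

lemma symmetric_entry_bound:
  fixes A :: "real^'n::finite^'n"
  assumes sym: "transpose A = A" and nonneg: "\<And>x. 0 \<le> x \<bullet> (A *v x)" and le: "\<And>x. x \<bullet> (A *v x) \<le> K * (norm x)\<^sup>2"
  shows "\<bar>A $ i $ j\<bar> \<le> K"
proof -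
  have ent: "axis i 1 \<bullet> (A *v axis j 1) = A $ i $ j" for i j
    by (simp add: inner_axis' matrix_vector_mul_component inner_axis)
  have "A $ j $ i = A $ i $ j"
    using sym by (metis transpose_def vec_lambda_beta)
  then have q: "(axis i 1 + s *\<^sub>R axis j 1) \<bullet> (A *v (axis i 1 + s *\<^sub>R axis j 1)) = A $ i $ i + 2 * s * A $ i $ j + s\<^sup>2 * A $ j $ j" for s
    by (simp add: matrix_vector_right_distrib inner_add_left inner_add_right ent matrix_vector_mult_scaleR power2_eq_square algebra_simps)
  have "A $ i $ i \<le> K" "A $ j $ j \<le> K"
    using le[of "axis i 1"] le[of "axis j 1"] by (simp_all add: ent)
  moreover have "0 \<le> A $ i $ i + 2 * A $ i $ j + A $ j $ j" "0 \<le> A $ i $ i - 2 * A $ i $ j + A $ j $ j"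
    using nonneg[of "axis i 1 + 1 *\<^sub>R axis j 1"] nonneg[of "axis i 1 + (- 1) *\<^sub>R axis j 1"] unfolding q by simp_all
  ultimately show ?thesis by linarith
qed

lemma norm_matrix_vector_le:
  fixes A :: "real^'n::finite^'m::finite"
  shows "norm (A *v x) \<le> norm A * norm x"
proof -
  have "norm (A *v x) = L2_set (\<lambda>i. \<bar>A $ i \<bullet> x\<bar>) UNIV"
    by (simp add: norm_vec_def matrix_vector_mul_component)
  also have "\<dots> \<le> L2_set (\<lambda>i. norm (A $ i) * norm x) UNIV"
    by (intro L2_set_mono) (auto simp: Cauchy_Schwarz_ineq2)
  also have "\<dots> = norm A * norm x"
    by (simp add: norm_vec_def[of A] L2_set_left_distrib)
  finally show ?thesis .
qed

lemma quadratic_form_norm_le: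
  fixes A :: "real^'n::finite^'n"
  shows "\<bar>x \<bullet> (A *v x)\<bar> \<le> norm A * (norm x)\<^sup>2"
proof -
  have "\<bar>x \<bullet> (A *v x)\<bar> \<le> norm x * norm (A *v x)"
    by (rule Cauchy_Schwarz_ineq2)
  also have "\<dots> \<le> norm x * (norm A * norm x)"
    by (intro mult_left_mono norm_matrix_vector_le) auto
  finally show ?thesis by (simp add: power2_eq_square mult_ac)
qed

lemma loewner_mat:
  fixes A :: "real^'n::finite^'n"
  shows "loewner_le (mat c) A \<longleftrightarrow> (\<forall>x. c * (norm x)\<^sup>2 \<le> x \<bullet> (A *v x))"
    and "loewner_le A (mat c) \<longleftrightarrow> (\<forall>x. x \<bullet> (A *v x) \<le> c * (norm x)\<^sup>2)"
proof -
  have "mat c = c *\<^sub>R (mat 1 :: real^'n^'n)"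
    by (simp add: mat_def vec_eq_iff)
  then have "x \<bullet> (mat c *v x) = c * (norm x)\<^sup>2" for x :: "real^'n"
    by (simp add: power2_norm_eq_inner flip: scaleR_matrix_vector_assoc)
  then show "loewner_le (mat c) A \<longleftrightarrow> (\<forall>x. c * (norm x)\<^sup>2 \<le> x \<bullet> (A *v x))"
    "loewner_le A (mat c) \<longleftrightarrow> (\<forall>x. x \<bullet> (A *v x) \<le> c * (norm x)\<^sup>2)"
    by (simp_all add: loewner_le_def)
qed

section \<open>Gradients, Hessians and second order expansions\<close>

lemma has_derivative_grad:
  assumes "u differentiable (at x)"
  shows "(u has_derivative (\<lambda>v. grad u x \<bullet> v)) (at x)"
proof -
  let ?D = "frechet_derivative u (at x)"
  have D: "(u has_derivative ?D) (at x)"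
    using assms by (simp add: frechet_derivative_works)
  then have lin: "linear ?D" by (rule has_derivative_linear)
  have "?D v = grad u x \<bullet> v" for v
  proof -
    have "?D v = ?D (\<Sum>i\<in>UNIV. v $ i *\<^sub>R axis i 1)"
      by (simp add: basis_expansion[of v, unfolded scalar_mult_eq_scaleR])
    also have "\<dots> = (\<Sum>i\<in>UNIV. v $ i * ?D (axis i 1))"
      by (simp add: linear_sum[OF lin] linear_cmul[OF lin])
    also have "\<dots> = grad u x \<bullet> v"
      by (simp add: grad_def partial_def inner_vec_def mult.commute)
    finally show ?thesis .
  qed
  then have "?D = (\<lambda>v. grad u x \<bullet> v)" by blast
  then show ?thesis using D by simp
qed

lemma has_derivative_hessian:
  assumes "grad u differentiable (at x)"
  shows "(grad u has_derivative (\<lambda>v. hessian u x *v v)) (at x)"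
proof -
  have D: "(grad u has_derivative frechet_derivative (grad u) (at x)) (at x)"
    using assms by (simp add: frechet_derivative_works)
  then have "linear (frechet_derivative (grad u) (at x))" by (rule has_derivative_linear)
  then show ?thesis using D by (simp add: hessian_def matrix_works)
qed

lemma real_derivative_along_line:
  fixes f :: "'a::real_inner \<Rightarrow> real"
  assumes "(f has_derivative (\<lambda>v. G \<bullet> v)) (at (p + s *\<^sub>R a))"
  shows "((\<lambda>s. f (p + s *\<^sub>R a)) has_real_derivative G \<bullet> a) (at s)"
proof -
  have "((\<lambda>s. p + s *\<^sub>R a) has_derivative (\<lambda>t. t *\<^sub>R a)) (at s)"
    by (auto intro!: derivative_eq_intros)
  then have "((\<lambda>s. f (p + s *\<^sub>R a)) has_derivative (\<lambda>t. G \<bullet> (t *\<^sub>R a))) (at s)"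
    by (rule has_derivative_compose) (use assms in auto)
  then show ?thesis
    by (simp add: has_field_derivative_def mult.commute[of _ "G \<bullet> a"] fun_eq_iff[symmetric] mult_commute_abs)
qed

text \<open>The mean value theorem in the direction \<open>a\<close> reduces the second difference
  to one difference of gradients, and both gradients are expanded at the same point
  \<open>x\<close>.\<close>

lemma second_difference_estimate:
  fixes f :: "real^'n::finite \<Rightarrow> real"
  assumes f: "\<And>y. y \<in> ball x d \<Longrightarrow> (f has_derivative (\<lambda>v. G y \<bullet> v)) (at y)"
    and A: "\<And>v. norm v < d \<Longrightarrow> norm (G (x + v) - G x - A *v v) \<le> e * norm v"
    and t: "0 < t" "t * (norm a + norm b) < d" and e: "e \<ge> 0"
  shows "\<bar>(f (x + t *\<^sub>R a + t *\<^sub>R b) - f (x + t *\<^sub>R a) - f (x + t *\<^sub>R b) + f x) - t\<^sup>2 * (a \<bullet> (A *v b))\<bar>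
     \<le> 2 * e * t\<^sup>2 * (norm a + norm b)\<^sup>2"
proof -
  define q where "q s = f (x + t *\<^sub>R b + s *\<^sub>R a) - f (x + s *\<^sub>R a)" for s
  have nb: "norm (t *\<^sub>R b + s *\<^sub>R a) \<le> t * (norm a + norm b)" "norm (s *\<^sub>R a) \<le> t * (norm a + norm b)"
    if "0 \<le> s" "s \<le> t" for s
  proof -
    have "s * norm a \<le> t * norm a" using that by (intro mult_right_mono) auto
    moreover have "norm (t *\<^sub>R b + s *\<^sub>R a) \<le> t * norm b + s * norm a"
      using norm_triangle_ineq[of "t *\<^sub>R b" "s *\<^sub>R a"] t that by simp
    moreover have "0 \<le> t * norm b" using t by simp
    moreover have "norm (s *\<^sub>R a) = s * norm a" using that by simp
    ultimately show "norm (t *\<^sub>R b + s *\<^sub>R a) \<le> t * (norm a + norm b)" "norm (s *\<^sub>R a) \<le> t * (norm a + norm b)"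
      unfolding distrib_left by linarith+
  qed
  have "(q has_real_derivative (G (x + t *\<^sub>R b + s *\<^sub>R a) - G (x + s *\<^sub>R a)) \<bullet> a) (at s)"
    if "0 \<le> s" "s \<le> t" for s
  proof -
    have "x + t *\<^sub>R b + s *\<^sub>R a \<in> ball x d"
    proof -
      have "dist (x + t *\<^sub>R b + s *\<^sub>R a) x = norm (t *\<^sub>R b + s *\<^sub>R a)"
        unfolding dist_norm add.assoc add_diff_cancel_left' ..
      then show ?thesis using nb(1)[OF that] t(2) by (simp add: dist_commute)
    qed
    moreover have "x + s *\<^sub>R a \<in> ball x d"
      using nb(2)[OF that] t(2) by (simp add: dist_norm)
    ultimately show ?thesis
      unfolding q_def inner_diff_left
      by (intro derivative_intros real_derivative_along_line f)
  qed
  then obtain s where s: "0 < s" "s < t" "q t - q 0 = (t - 0) * ((G (x + t *\<^sub>R b + s *\<^sub>R a) - G (x + s *\<^sub>R a)) \<bullet> a)"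
    using MVT2[OF t(1), of q "\<lambda>s. (G (x + t *\<^sub>R b + s *\<^sub>R a) - G (x + s *\<^sub>R a)) \<bullet> a"] by auto
  define v1 v2 where "v1 = t *\<^sub>R b + s *\<^sub>R a" and "v2 = s *\<^sub>R a"
  have v: "norm v1 \<le> t * (norm a + norm b)" "norm v2 \<le> t * (norm a + norm b)"
    using nb[of s] s by (simp_all add: v1_def v2_def)
  have "A *v v1 - A *v v2 = t *\<^sub>R (A *v b)"
    by (simp add: v1_def v2_def matrix_vector_right_distrib matrix_vector_mult_scaleR)
  then have "(G (x + v1) - G x - A *v v1) - (G (x + v2) - G x - A *v v2) = (G (x + v1) - G (x + v2)) - t *\<^sub>R (A *v b)"
    by (simp add: algebra_simps)
  then have "(G (x + v1) - G (x + v2)) \<bullet> a - t * (a \<bullet> (A *v b))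
      = ((G (x + v1) - G x - A *v v1) - (G (x + v2) - G x - A *v v2)) \<bullet> a"
    by (simp only: inner_diff_left inner_scaleR_left inner_commute[of a "A *v b"])
  also have "\<bar>\<dots>\<bar> \<le> norm ((G (x + v1) - G x - A *v v1) - (G (x + v2) - G x - A *v v2)) * norm a"
    by (rule Cauchy_Schwarz_ineq2)
  also have "\<dots> \<le> (e * (t * (norm a + norm b)) + e * (t * (norm a + norm b))) * norm a"
  proof (rule mult_right_mono)
    have 1: "norm (G (x + v1) - G x - A *v v1) \<le> e * (t * (norm a + norm b))"
      using A[of v1] v(1) t(2) mult_left_mono[OF v(1) e] by linarith
    have 2: "norm (G (x + v2) - G x - A *v v2) \<le> e * (t * (norm a + norm b))"
      using A[of v2] v(2) t(2) mult_left_mono[OF v(2) e] by linarith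
    show "norm ((G (x + v1) - G x - A *v v1) - (G (x + v2) - G x - A *v v2))
        \<le> e * (t * (norm a + norm b)) + e * (t * (norm a + norm b))"
      using norm_triangle_ineq4[of "G (x + v1) - G x - A *v v1" "G (x + v2) - G x - A *v v2"] 1 2 by linarith
  qed simp
  also have "\<dots> \<le> (e * (t * (norm a + norm b)) + e * (t * (norm a + norm b))) * (norm a + norm b)"
    using e t by (intro mult_left_mono) auto
  finally have *: "\<bar>(G (x + v1) - G (x + v2)) \<bullet> a - t * (a \<bullet> (A *v b))\<bar> \<le> 2 * e * t * (norm a + norm b)\<^sup>2"
    by (simp add: power2_eq_square algebra_simps)
  have "(f (x + t *\<^sub>R a + t *\<^sub>R b) - f (x + t *\<^sub>R a) - f (x + t *\<^sub>R b) + f x) = q t - q 0"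
    by (simp add: q_def add_ac)
  then have "(f (x + t *\<^sub>R a + t *\<^sub>R b) - f (x + t *\<^sub>R a) - f (x + t *\<^sub>R b) + f x) - t\<^sup>2 * (a \<bullet> (A *v b))
      = t * ((G (x + v1) - G (x + v2)) \<bullet> a - t * (a \<bullet> (A *v b)))"
    using s(3) by (simp add: v1_def v2_def add.assoc power2_eq_square right_diff_distrib)
  then show ?thesis
    using mult_left_mono[OF *, of t] t(1) by (simp add: abs_mult power2_eq_square mult_ac)
qed

text \<open>The second difference is symmetric in \<open>a\<close> and \<open>b\<close>. Divided by
  \<open>t\<^sup>2\<close> it approximates both \<open>a \<bullet> (A *v b)\<close> and
  \<open>b \<bullet> (A *v a)\<close>.\<close>

lemma second_derivative_symmetric:
  fixes f :: "real^'n::finite \<Rightarrow> real"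
  assumes S: "open S" "x \<in> S" and f: "\<And>y. y \<in> S \<Longrightarrow> (f has_derivative (\<lambda>v. G y \<bullet> v)) (at y)"
    and G: "(G has_derivative (\<lambda>v. A *v v)) (at x)"
  shows "transpose A = A"
proof -
  have "a \<bullet> (A *v b) = b \<bullet> (A *v a)" for a b :: "real^'n"
  proof (rule ccontr)
    assume ne: "a \<bullet> (A *v b) \<noteq> b \<bullet> (A *v a)"
    define c where "c = (norm a + norm b)\<^sup>2 + 1"
    \<comment> \<open>Chosen so that the two errors of the estimate together amount to at most half
      of the assumed gap.\<close>
    define e where "e = \<bar>a \<bullet> (A *v b) - b \<bullet> (A *v a)\<bar> / (8 * c)"
    have c: "c > 0" by (simp add: c_def add_nonneg_pos)
    have e: "e > 0" using ne c by (simp add: e_def)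
    obtain d1 where d1: "d1 > 0" "ball x d1 \<subseteq> S" using S open_contains_ball by blast
    obtain d2 where d2: "d2 > 0" "\<And>y. norm (y - x) < d2 \<Longrightarrow> norm (G y - G x - A *v (y - x)) \<le> e * norm (y - x)"
      using G e unfolding has_derivative_at_alt by blast
    define d where "d = min d1 d2"
    have d: "d > 0" using d1 d2 by (simp add: d_def)
    define t where "t = d / (norm a + norm b + 1)"
    have na: "norm a + norm b + 1 > 0" by (simp add: add_nonneg_pos)
    have t: "t > 0" using d na by (simp add: t_def)
    have "t * (norm a + norm b) < t * (norm a + norm b + 1)" using t by simp
    also have "\<dots> = d" using na by (simp add: t_def)
    finally have t2: "t * (norm a + norm b) < d" .
    have fd: "(f has_derivative (\<lambda>v. G y \<bullet> v)) (at y)" if "y \<in> ball x d" for y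
      using f d1(2) that by (auto simp: d_def)
    have Ad: "norm (G (x + v) - G x - A *v v) \<le> e * norm v" if "norm v < d" for v
      using d2(2)[of "x + v"] that by (simp add: d_def)
    let ?D = "\<lambda>a b. f (x + t *\<^sub>R a + t *\<^sub>R b) - f (x + t *\<^sub>R a) - f (x + t *\<^sub>R b) + f x"
    have 1: "\<bar>?D a b - t\<^sup>2 * (a \<bullet> (A *v b))\<bar> \<le> 2 * e * t\<^sup>2 * (norm a + norm b)\<^sup>2"
      using second_difference_estimate[OF fd Ad t t2] e by simp
    have 2: "\<bar>?D b a - t\<^sup>2 * (b \<bullet> (A *v a))\<bar> \<le> 2 * e * t\<^sup>2 * (norm a + norm b)\<^sup>2"
      using second_difference_estimate[OF fd Ad t, where a = b and b = a] t2 e by (simp add: add.commute)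
    have "?D a b = ?D b a" by (simp add: add_ac)
    then have "t\<^sup>2 * \<bar>a \<bullet> (A *v b) - b \<bullet> (A *v a)\<bar> \<le> 4 * e * t\<^sup>2 * (norm a + norm b)\<^sup>2"
      using 1 2 unfolding abs_le_iff by (simp add: abs_if right_diff_distrib split: if_splits)
    also have "\<dots> \<le> 4 * e * t\<^sup>2 * c"
      using e by (intro mult_left_mono) (auto simp: c_def)
    also have "\<dots> = t\<^sup>2 * (\<bar>a \<bullet> (A *v b) - b \<bullet> (A *v a)\<bar> / 2)"
      using c by (simp add: e_def)
    finally show False using t ne by simp
  qed
  then have "axis i 1 \<bullet> (A *v axis j 1) = axis j 1 \<bullet> (A *v axis i 1)" for i j by blast
  then show ?thesis
    by (simp add: transpose_def vec_eq_iff inner_axis' matrix_vector_mul_component inner_axis)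
qed

text \<open>The mean value theorem along the segment, applied twice; the factor \<open>1 / 2\<close>
  of the remainder is given away.\<close>

lemma second_order_taylor_bound:
  fixes u :: "real^'n::finite \<Rightarrow> real"
  assumes u: "\<And>s. \<lbrakk>0 \<le> s; s \<le> 1\<rbrakk> \<Longrightarrow> (u has_derivative (\<lambda>v. G (p + s *\<^sub>R y) \<bullet> v)) (at (p + s *\<^sub>R y))"
    and G: "\<And>s. \<lbrakk>0 \<le> s; s \<le> 1\<rbrakk> \<Longrightarrow> (G has_derivative (\<lambda>v. A (p + s *\<^sub>R y) *v v)) (at (p + s *\<^sub>R y))"
    and e: "\<And>s. \<lbrakk>0 \<le> s; s \<le> 1\<rbrakk> \<Longrightarrow> \<bar>y \<bullet> (A (p + s *\<^sub>R y) *v y) - y \<bullet> (M *v y)\<bar> \<le> e"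
  shows "\<bar>u (p + y) - u p - G p \<bullet> y - y \<bullet> (M *v y) / 2\<bar> \<le> e"
proof -
  define m where "m = y \<bullet> (M *v y)"
  define q where "q s = u (p + s *\<^sub>R y) - s * (G p \<bullet> y) - s\<^sup>2 / 2 * m" for s
  define r where "r s = G (p + s *\<^sub>R y) \<bullet> y - G p \<bullet> y - s * m" for s
  have q: "(q has_real_derivative r s) (at s)" if "0 \<le> s" "s \<le> 1" for s
    unfolding q_def r_def
    by (rule derivative_eq_intros real_derivative_along_line[OF u[OF that]] refl | simp)+
  have r: "(r has_real_derivative (y \<bullet> (A (p + s *\<^sub>R y) *v y) - m)) (at s)" if "0 \<le> s" "s \<le> 1" for s
  proof -
    have "((\<lambda>s. p + s *\<^sub>R y) has_derivative (\<lambda>t. t *\<^sub>R y)) (at s)"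
      by (auto intro!: derivative_eq_intros)
    then have "((\<lambda>s. G (p + s *\<^sub>R y)) has_derivative (\<lambda>t. A (p + s *\<^sub>R y) *v (t *\<^sub>R y))) (at s)"
      by (rule has_derivative_compose) (use G[OF that] in auto)
    then have "((\<lambda>s. G (p + s *\<^sub>R y) \<bullet> y) has_derivative (\<lambda>t. (A (p + s *\<^sub>R y) *v (t *\<^sub>R y)) \<bullet> y)) (at s)"
      by (rule has_derivative_inner_left)
    moreover have "(\<lambda>t. (A (p + s *\<^sub>R y) *v (t *\<^sub>R y)) \<bullet> y) = (*) (y \<bullet> (A (p + s *\<^sub>R y) *v y))"
      by (auto simp: matrix_vector_mult_scaleR inner_commute)
    ultimately have "((\<lambda>s. G (p + s *\<^sub>R y) \<bullet> y) has_real_derivative (y \<bullet> (A (p + s *\<^sub>R y) *v y))) (at s)"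
      by (simp add: has_field_derivative_def)
    then show ?thesis
      unfolding r_def by (auto intro!: derivative_eq_intros)
  qed
  obtain s where s: "0 < s" "s < 1" "q 1 - q 0 = (1 - 0) * r s"
    using MVT2[of 0 1 q r] q by auto
  obtain z where z: "0 < z" "z < s" "r s - r 0 = (s - 0) * (y \<bullet> (A (p + z *\<^sub>R y) *v y) - m)"
    using MVT2[of 0 s r "\<lambda>s. y \<bullet> (A (p + s *\<^sub>R y) *v y) - m"] r s by auto
  have "r 0 = 0" by (simp add: r_def)
  then have "\<bar>q 1 - q 0\<bar> = s * \<bar>y \<bullet> (A (p + z *\<^sub>R y) *v y) - m\<bar>"
    using s z by (simp add: abs_mult)
  also have "\<dots> \<le> 1 * e"
    using e[of z] s z by (intro mult_mono) (auto simp: m_def)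
  finally show ?thesis by (simp add: q_def m_def)
qed

section \<open>The estimate for Hoelder continuous Hessians\<close>

context lattice_mesh
begin

lemma holder_case:
  fixes u :: "real^'n \<Rightarrow> real"
  assumes u: "convex_on (closure \<Omega>) u" and lam: "lam > 0" "lam \<le> Lam" "3 * Lam \<le> lam * R"
    and \<alpha>: "0 < \<alpha>" "\<alpha> \<le> 1" and C2: "C2_holder \<alpha> (ball xi (R * h)) u"
    and bounds: "\<And>x. x \<in> ball xi (R * h) \<Longrightarrow> loewner_le (mat lam) (hessian u x) \<and> loewner_le (hessian u x) (mat Lam)"
  shows "\<bar>measure lebesgue (nodal_subdifferential (N0 \<union> Nb) (restrict u (N0 \<union> Nb)) xi)
            - (LINT x:\<Omega>|lebesgue. \<phi> xi x * det (hessian u x))\<bar>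
    \<le> (cell_const CARD('n) lam sep (Lam * R\<^sup>2) * R ^ 3 * (det_lipschitz_const CARD('n) Lam * Lam)
         + det_lipschitz_const CARD('n) Lam)
       * h powr \<alpha> * C2_holder_seminorm \<alpha> (ball xi (R * h)) u * (LINT x:\<Omega>|lebesgue. \<phi> xi x)"
proof -
  let ?B = "ball xi (R * h)"
  define H where "H = hessian u"
  define M where "M = H xi"
  define N where "N = C2_holder_seminorm \<alpha> ?B u"
  define D where "D = det_lipschitz_const CARD('n) Lam"
  define K where "K = cell_const CARD('n) lam sep (Lam * R\<^sup>2)"
  define F where "F x = det (H x)" for x
  have xiB: "xi \<in> ?B" using h R by simp
  have Lam0: "Lam > 0" using lam by simp
  have D0: "D \<ge> 0" unfolding D_def using Lam0 by (rule det_lipschitz_const_nonneg)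
  have K0: "K \<ge> 0" unfolding K_def using lam Lam0 by (intro cell_const_nonneg) auto
  have C2': "\<forall>x\<in>?B. u differentiable (at x)" "\<forall>x\<in>?B. grad u differentiable (at x)"
      "uniformly_continuous_on ?B (hessian u)" "bdd_above (holder_quotients \<alpha> ?B u)"
    using C2 by (auto simp: C2_holder_def)
  have d1: "(u has_derivative (\<lambda>v. grad u x \<bullet> v)) (at x)" if "x \<in> ?B" for x
    using C2'(1) that by (intro has_derivative_grad) blast
  have d2: "(grad u has_derivative (\<lambda>v. H x *v v)) (at x)" if "x \<in> ?B" for x
    unfolding H_def using C2'(2) that by (intro has_derivative_hessian) blast
  have sym: "transpose (H x) = H x" if "x \<in> ?B" for x
    using second_derivative_symmetric[OF open_ball that d1 d2[OF that]] by blast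
  have lo: "lam * (norm y)\<^sup>2 \<le> y \<bullet> (H x *v y)" and up: "y \<bullet> (H x *v y) \<le> Lam * (norm y)\<^sup>2" if "x \<in> ?B" for x y
    using bounds[OF that] by (auto simp: loewner_mat H_def)
  have nonneg: "0 \<le> y \<bullet> (H x *v y)" if "x \<in> ?B" for x y
    using lo[OF that, of y] lam by (meson less_imp_le mult_nonneg_nonneg order_trans zero_le_power2)
  have ent: "\<bar>H x $ i $ j\<bar> \<le> Lam" if "x \<in> ?B" for x i j
    using symmetric_entry_bound[OF sym[OF that] nonneg[OF that] up[OF that]] .
  have hq: "norm (H x - H y) \<le> N * dist x y powr \<alpha>" if "x \<in> ?B" "y \<in> ?B" for x y
  proof (cases "x = y")
    case False
    have "norm (H x - H y) / dist x y powr \<alpha> \<in> holder_quotients \<alpha> ?B u"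
      unfolding holder_quotients_def H_def using that False by blast
    then have "norm (H x - H y) / dist x y powr \<alpha> \<le> N"
      unfolding N_def C2_holder_seminorm_def using C2'(4) by (rule cSup_upper)
    then show ?thesis using False by (simp add: pos_divide_le_eq)
  qed simp
  have N0: "N \<ge> 0"
  proof -
    obtain y :: "real^'n" where y: "dist xi y = h" using vector_choose_dist[of h xi] h by auto
    then have "y \<in> ?B" using cball_subset(1) by auto
    then have "0 \<le> N * h powr \<alpha>"
      using hq[OF xiB, of y] y norm_ge_zero order_trans by metis
    then show ?thesis using h by (simp add: zero_le_mult_iff)
  qed
  define \<eta> where "\<eta> = min (N * R * h powr \<alpha>) Lam"
  have \<eta>0: "0 \<le> \<eta>" using N0 R Lam0 by (simp add: \<eta>_def)
  \<comment> \<open>By \<open>R \<ge> 1\<close> and \<open>\<alpha> \<le> 1\<close> the exponent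
    disappears from the constant.\<close>
  have Rh: "(R * h) powr \<alpha> \<le> R * h powr \<alpha>"
  proof -
    have "R powr \<alpha> \<le> R powr 1" using R \<alpha> by (intro powr_mono) auto
    then show ?thesis using R h by (simp add: powr_mult mult_right_mono)
  qed
  have main: "\<bar>measure lebesgue (nodal_subdifferential (N0 \<union> Nb) (restrict u (N0 \<union> Nb)) xi) - det M * lat.I\<bar>
      \<le> K * (\<eta> * R\<^sup>2) * (det M * lat.I)"
    unfolding K_def
  proof (rule measure_subdifferential[OF u _ lam(1)])
    show "transpose M = M" unfolding M_def by (rule sym[OF xiB])
    show "lam * (norm x)\<^sup>2 \<le> x \<bullet> (M *v x)" "x \<bullet> (M *v x) \<le> Lam * (norm x)\<^sup>2" for x
      unfolding M_def using lo[OF xiB] up[OF xiB] by auto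
    show "lam \<le> Lam" "3 * Lam \<le> lam * R" by fact+
    show "0 \<le> \<eta> * R\<^sup>2" using \<eta>0 by simp
    show "\<eta> * R\<^sup>2 \<le> Lam * R\<^sup>2" by (intro mult_right_mono) (auto simp: \<eta>_def)
    show "\<bar>u (xi + y) - u xi - grad u xi \<bullet> y - y \<bullet> (M *v y) / 2\<bar> \<le> \<eta> * R\<^sup>2 * h\<^sup>2"
      if y: "norm y \<le> 9 / 10 * R * h" for y
    proof -
      have Rh0: "R * h > 0" using R h by simp
      then have yR: "norm y < R * h" using y by linarith
      have inB: "xi + s *\<^sub>R y \<in> ?B" if "0 \<le> s" "s \<le> 1" for s
      proof -
        have "norm (s *\<^sub>R y) \<le> norm y" using that by (simp add: mult_left_le_one_le)
        then show ?thesis using yR by (simp add: dist_norm)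
      qed
      have "\<bar>u (xi + y) - u xi - grad u xi \<bullet> y - y \<bullet> (M *v y) / 2\<bar> \<le> \<eta> * (norm y)\<^sup>2"
      proof (rule second_order_taylor_bound[where G = "grad u" and A = H])
        fix s :: real assume s: "0 \<le> s" "s \<le> 1"
        note B = inB[OF s]
        show "(u has_derivative (\<lambda>v. grad u (xi + s *\<^sub>R y) \<bullet> v)) (at (xi + s *\<^sub>R y))"
          "(grad u has_derivative (\<lambda>v. H (xi + s *\<^sub>R y) *v v)) (at (xi + s *\<^sub>R y))"
          using d1[OF B] d2[OF B] by auto
        have "\<bar>y \<bullet> (H (xi + s *\<^sub>R y) *v y) - y \<bullet> (M *v y)\<bar> \<le> N * R * h powr \<alpha> * (norm y)\<^sup>2"
        proof -
          have "\<bar>y \<bullet> (H (xi + s *\<^sub>R y) *v y) - y \<bullet> (M *v y)\<bar> = \<bar>y \<bullet> ((H (xi + s *\<^sub>R y) - M) *v y)\<bar>"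
            by (simp add: matrix_vector_mult_diff_rdistrib inner_diff_right)
          also have "\<dots> \<le> norm (H (xi + s *\<^sub>R y) - M) * (norm y)\<^sup>2"
            by (rule quadratic_form_norm_le)
          also have "\<dots> \<le> (N * R * h powr \<alpha>) * (norm y)\<^sup>2"
          proof (rule mult_right_mono)
            have "norm (H (xi + s *\<^sub>R y) - M) \<le> N * dist (xi + s *\<^sub>R y) xi powr \<alpha>"
              unfolding M_def by (rule hq[OF B xiB])
            also have "\<dots> \<le> N * (R * h) powr \<alpha>"
              using B N0 \<alpha> by (intro mult_left_mono powr_mono2) (auto simp: dist_commute)
            also have "\<dots> \<le> N * (R * h powr \<alpha>)"
              using Rh N0 by (rule mult_left_mono)
            finally show "norm (H (xi + s *\<^sub>R y) - M) \<le> N * R * h powr \<alpha>" by (simp add: mult_ac)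
          qed simp
          finally show ?thesis .
        qed
        moreover have "\<bar>y \<bullet> (H (xi + s *\<^sub>R y) *v y) - y \<bullet> (M *v y)\<bar> \<le> Lam * (norm y)\<^sup>2"
          using nonneg[OF B, of y] up[OF B, of y] nonneg[OF xiB, of y] up[OF xiB, of y] unfolding M_def by linarith
        ultimately show "\<bar>y \<bullet> (H (xi + s *\<^sub>R y) *v y) - y \<bullet> (M *v y)\<bar> \<le> \<eta> * (norm y)\<^sup>2"
          by (simp add: \<eta>_def min_def)
      qed
      also have "\<dots> \<le> \<eta> * (R * h)\<^sup>2"
        using \<eta>0 yR by (intro mult_left_mono power_mono) auto
      finally show ?thesis by (simp add: power_mult_distrib)
    qed
  qed
  have detM: "\<bar>det M\<bar> \<le> D * Lam"
    unfolding D_def by (rule det_bound[OF Lam0]) (simp add: M_def ent[OF xiB])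
  have I0: "lat.I > 0" by (rule lat.I_pos)
  have e1: "\<bar>measure lebesgue (nodal_subdifferential (N0 \<union> Nb) (restrict u (N0 \<union> Nb)) xi) - det M * lat.I\<bar>
      \<le> K * (N * R * h powr \<alpha> * R\<^sup>2) * ((D * Lam) * lat.I)"
  proof (rule order_trans[OF main])
    show "K * (\<eta> * R\<^sup>2) * (det M * lat.I) \<le> K * (N * R * h powr \<alpha> * R\<^sup>2) * ((D * Lam) * lat.I)"
    proof (rule mult_mono)
      show "K * (\<eta> * R\<^sup>2) \<le> K * (N * R * h powr \<alpha> * R\<^sup>2)"
        using K0 by (intro mult_left_mono mult_right_mono) (auto simp: \<eta>_def)
      show "det M * lat.I \<le> D * Lam * lat.I"
        using detM I0 by (intro mult_right_mono) auto
      show "0 \<le> K * (N * R * h powr \<alpha> * R\<^sup>2)" using K0 N0 R by simp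
      have "det M > 0" using positive_definite_det_pos[OF lam(1)] lo[OF xiB] unfolding M_def by blast
      then show "0 \<le> det M * lat.I" using I0 by simp
    qed
  qed
  have contF: "continuous_on (cball xi h) F"
  proof -
    have "continuous_on (cball xi h) H"
      unfolding H_def using C2'(3) cball_subset(1) continuous_on_subset uniformly_continuous_imp_continuous by blast
    then show ?thesis
      unfolding F_def det_def by (intro continuous_intros)
  qed
  have intF: "set_integrable lebesgue (cball xi h) F"
  proof -
    have "integrable lborel (\<lambda>x. indicator (cball xi h) x *\<^sub>R F x)"
      using contF by (intro borel_integrable_compact) auto
    then show ?thesis by (simp add: set_integrable_def integrable_completion)
  qed
  have intphi: "set_integrable lebesgue (cball xi h) (\<lambda>x. \<phi> xi x * c)" for c
    using phi_integral(1) integrable_mult_indicator[of "cball xi h" lborel "\<lambda>x. \<phi> xi x * c"]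
    by (simp add: set_integrable_def integrable_completion)
  have "\<bar>(LINT x:\<Omega>|lebesgue. \<phi> xi x * F x) - det M * lat.I\<bar> \<le> (LINT x:cball xi h|lebesgue. \<phi> xi x * \<bar>F x - det M\<bar>)"
    by (rule phi_error(2)[OF intF])
  also have "\<dots> \<le> (LINT x:cball xi h|lebesgue. \<phi> xi x * (D * (N * h powr \<alpha>)))"
  proof (rule set_integral_mono[OF phi_error(1)[OF intF] intphi])
    fix x assume x: "x \<in> cball xi h"
    then have xB: "x \<in> ?B" using cball_subset(1) by blast
    have nH: "norm (H x - M) \<le> N * h powr \<alpha>"
    proof -
      have "norm (H x - M) \<le> N * dist x xi powr \<alpha>" unfolding M_def by (rule hq[OF xB xiB])
      also have "\<dots> \<le> N * h powr \<alpha>"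
        using x N0 \<alpha> by (intro mult_left_mono powr_mono2) (auto simp: dist_commute)
      finally show ?thesis .
    qed
    have "\<bar>F x - det M\<bar> \<le> D * (N * h powr \<alpha>)"
      unfolding F_def D_def
    proof (rule det_lipschitz[OF Lam0])
      show "\<bar>H x $ i $ j\<bar> \<le> Lam" "\<bar>M $ i $ j\<bar> \<le> Lam" for i j
        using ent[OF xB] ent[OF xiB] by (auto simp: M_def)
      show "\<bar>H x $ i $ j - M $ i $ j\<bar> \<le> N * h powr \<alpha>" for i j
        using component_le_norm_cart[of "(H x - M) $ i" j] Finite_Cartesian_Product.norm_nth_le[of "H x - M" i] nH by simp
    qed
    then show "\<phi> xi x * \<bar>F x - det M\<bar> \<le> \<phi> xi x * (D * (N * h powr \<alpha>))"
      using phi_bounds by (intro mult_left_mono) auto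
  qed
  also have "\<dots> = D * (N * h powr \<alpha>) * lat.I"
    using phi_lint[of "\<lambda>x. 1"] phi_lint_one by simp
  finally have e2: "\<bar>(LINT x:\<Omega>|lebesgue. \<phi> xi x * F x) - det M * lat.I\<bar> \<le> D * (N * h powr \<alpha>) * lat.I" .
  have "\<bar>measure lebesgue (nodal_subdifferential (N0 \<union> Nb) (restrict u (N0 \<union> Nb)) xi)
        - (LINT x:\<Omega>|lebesgue. \<phi> xi x * F x)\<bar>
      \<le> K * (N * R * h powr \<alpha> * R\<^sup>2) * ((D * Lam) * lat.I) + D * (N * h powr \<alpha>) * lat.I"
    using e1 e2 by linarith
  also have "\<dots> = (K * R ^ 3 * (D * Lam) + D) * h powr \<alpha> * N * lat.I"
    by (simp add: algebra_simps power2_eq_square power3_eq_cube)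
  finally show ?thesis
    by (simp add: K_def D_def N_def F_def H_def phi_lint_one)
qed

end

section \<open>Bump functions\<close>

text \<open>All derivatives of the flat function \<open>exp (- (1 / s))\<close> have this form, so
  one family carries the induction over the order of differentiation.\<close>

definition flat_exp :: "real poly \<Rightarrow> real \<Rightarrow> real" where
  "flat_exp p s = (if s > 0 then poly p (1 / s) * exp (- (1 / s)) else 0)"

lemma poly_exp_tendsto_0: "((\<lambda>y. poly p y * exp (- y)) \<longlongrightarrow> (0::real)) at_top"
proof -
  have "((\<lambda>y. \<Sum>i\<le>degree p. coeff p i * (y ^ i / exp y)) \<longlongrightarrow> (\<Sum>i\<le>degree p. coeff p i * 0)) at_top"
    by (intro tendsto_intros tendsto_power_div_exp_0)
  moreover have "(\<Sum>i\<le>degree p. coeff p i * (y ^ i / exp y)) = poly p y * exp (- y)" for y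
    by (simp add: poly_altdef exp_minus sum_distrib_right divide_inverse mult.assoc)
  ultimately show ?thesis by simp
qed

text \<open>In the variable \<open>y = 1 / s\<close>, differentiation multiplies by
  \<open>y\<^sup>2\<close> and replaces \<open>p\<close> by \<open>p - pderiv p\<close>. At
  \<open>s = 0\<close> the difference quotient from the right is again a polynomial in
  \<open>y\<close> times \<open>exp (- y)\<close>, which tends to zero.\<close>

lemma flat_exp_derivative:
  "(flat_exp p has_real_derivative flat_exp ([:0, 0, 1:] * (p - pderiv p)) s) (at s)"
proof -
  consider "s > 0" | "s < 0" | "s = 0" by linarith
  then show ?thesis
  proof cases
    case 1
    have "((\<lambda>s. poly p (1 / s) * exp (- (1 / s))) has_real_derivative
        (poly (pderiv p) (1 / s) * (- (1 / s\<^sup>2))) * exp (- (1 / s)) + (exp (- (1 / s)) * (1 / s\<^sup>2)) * poly p (1 / s)) (at s)"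
      using 1 by (auto intro!: derivative_eq_intros simp: power2_eq_square)
    then have "((\<lambda>s. poly p (1 / s) * exp (- (1 / s))) has_real_derivative flat_exp ([:0, 0, 1:] * (p - pderiv p)) s) (at s)"
      using 1 by (simp add: flat_exp_def power2_eq_square algebra_simps)
    then show ?thesis
      by (rule DERIV_cong_ev[THEN iffD1, rotated 3, OF _ refl _ refl])
         (use 1 eventually_nhds_in_open[of "{0<..}" s] in \<open>auto simp: flat_exp_def elim!: eventually_mono\<close>)
  next
    case 2
    have "((\<lambda>s. 0) has_real_derivative flat_exp ([:0, 0, 1:] * (p - pderiv p)) s) (at s)"
      using 2 by (simp add: flat_exp_def)
    then show ?thesis
      by (rule DERIV_cong_ev[THEN iffD1, rotated 3, OF _ refl _ refl])
         (use 2 eventually_nhds_in_open[of "{..<0}" s] in \<open>auto simp: flat_exp_def elim!: eventually_mono\<close>)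
  next
    case 3
    have "((\<lambda>t. flat_exp p t / t) \<longlongrightarrow> 0) (at 0)"
    proof (rule filterlim_split_at)
      show "((\<lambda>t. flat_exp p t / t) \<longlongrightarrow> 0) (at_left 0)"
        by (rule tendsto_eventually) (auto simp: eventually_at_filter flat_exp_def)
      have "((\<lambda>t. poly ([:0, 1:] * p) (inverse t) * exp (- inverse t)) \<longlongrightarrow> 0) (at_right (0::real))"
        by (rule filterlim_compose[OF poly_exp_tendsto_0 filterlim_inverse_at_top_right])
      then show "((\<lambda>t. flat_exp p t / t) \<longlongrightarrow> 0) (at_right 0)"
        by (rule Lim_transform_eventually)
           (auto simp: eventually_at_filter flat_exp_def divide_inverse algebra_simps)
    qed
    then show ?thesis
      by (simp add: 3 has_field_derivative_iff flat_exp_def)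
  qed
qed

text \<open>A class of functions of one variable that contains the factors of the bumps and is
  closed under differentiation. Products of rescaled flat functions are wanted, and the product rule
  brings in the sums.\<close>

inductive_set smooth1 :: "(real \<Rightarrow> real) set" where
  base: "(\<lambda>t. flat_exp p (c * t + d)) \<in> smooth1"
| mult: "\<lbrakk>f \<in> smooth1; g \<in> smooth1\<rbrakk> \<Longrightarrow> (\<lambda>t. f t * g t) \<in> smooth1"
| add: "\<lbrakk>f \<in> smooth1; g \<in> smooth1\<rbrakk> \<Longrightarrow> (\<lambda>t. f t + g t) \<in> smooth1"

lemma smooth1_has_derivative: "f \<in> smooth1 \<Longrightarrow> \<exists>g\<in>smooth1. \<forall>t. (f has_real_derivative g t) (at t)"
proof (induction rule: smooth1.induct)
  case (base p c d)
  have "((\<lambda>t. flat_exp p (c * t + d)) has_real_derivative flat_exp ([:0, 0, 1:] * (p - pderiv p)) (c * t + d) * c) (at t)" for t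
    by (rule DERIV_chain2[OF flat_exp_derivative]) (auto intro!: derivative_eq_intros)
  moreover have "flat_exp q s * c = flat_exp (smult c q) s" for q s
    by (simp add: flat_exp_def)
  ultimately have "((\<lambda>t. flat_exp p (c * t + d)) has_real_derivative flat_exp (smult c ([:0, 0, 1:] * (p - pderiv p))) (c * t + d)) (at t)" for t
    by metis
  then show ?case
    by (intro bexI[of _ "\<lambda>t. flat_exp (smult c ([:0, 0, 1:] * (p - pderiv p))) (c * t + d)"] allI smooth1.base)
next
  case (mult f g)
  then obtain f' g' where "f' \<in> smooth1" "g' \<in> smooth1"
    "\<And>t. (f has_real_derivative f' t) (at t)" "\<And>t. (g has_real_derivative g' t) (at t)" by blast
  then show ?case
    using mult by (intro bexI[of _ "\<lambda>t. f' t * g t + g' t * f t"] allI DERIV_mult smooth1.intros)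
next
  case (add f g)
  then obtain f' g' where "f' \<in> smooth1" "g' \<in> smooth1"
    "\<And>t. (f has_real_derivative f' t) (at t)" "\<And>t. (g has_real_derivative g' t) (at t)" by blast
  then show ?case
    by (intro bexI[of _ "\<lambda>t. f' t + g' t"] allI DERIV_add smooth1.intros)
qed

lemma smooth1_deriv: "f \<in> smooth1 \<Longrightarrow> deriv f \<in> smooth1"
  and smooth1_DERIV: "f \<in> smooth1 \<Longrightarrow> (f has_real_derivative deriv f t) (at t)"
proof -
  assume f: "f \<in> smooth1"
  obtain g where g: "g \<in> smooth1" "\<And>t. (f has_real_derivative g t) (at t)"
    using smooth1_has_derivative[OF f] by blast
  then have "deriv f = g" by (auto intro!: DERIV_imp_deriv)
  then show "deriv f \<in> smooth1" "(f has_real_derivative deriv f t) (at t)" using g by auto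
qed

text \<open>In product form a partial derivative changes a single factor, so iterated partial
  derivatives remain products.\<close>

definition prodfun :: "('n::finite \<Rightarrow> real \<Rightarrow> real) \<Rightarrow> real^'n \<Rightarrow> real" where
  "prodfun f x = (\<Prod>j\<in>UNIV. f j (x $ j))"

lemma prodfun_has_derivative:
  assumes f: "\<forall>j. f j \<in> smooth1"
  shows "(prodfun f has_derivative (\<lambda>v. \<Sum>i\<in>UNIV. v $ i * prodfun (f(i := deriv (f i))) x)) (at x)"
proof -
  have 1: "((\<lambda>x. f j (x $ j)) has_derivative (\<lambda>v. v $ j * deriv (f j) (x $ j))) (at x)" for j
  proof -
    have "(f j has_derivative (\<lambda>t. deriv (f j) (x $ j) * t)) (at (x $ j))"
      using smooth1_DERIV[of "f j"] f by (simp add: has_field_derivative_def)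
    moreover have "((\<lambda>x. x $ j) has_derivative (\<lambda>v. v $ j)) (at x)"
      by (rule bounded_linear_imp_has_derivative) (rule bounded_linear_vec_nth)
    ultimately show ?thesis
      using has_derivative_compose[of "\<lambda>x. x $ j" "\<lambda>v. v $ j" x UNIV "f j" "\<lambda>t. deriv (f j) (x $ j) * t"]
      by (simp add: mult.commute)
  qed
  have "((\<lambda>x. \<Prod>j\<in>UNIV. f j (x $ j)) has_derivative
      (\<lambda>v. \<Sum>i\<in>UNIV. (v $ i * deriv (f i) (x $ i)) * (\<Prod>j\<in>UNIV - {i}. f j (x $ j)))) (at x)"
    by (rule has_derivative_prod) (rule 1)
  moreover have "(v $ i * deriv (f i) (x $ i)) * (\<Prod>j\<in>UNIV - {i}. f j (x $ j)) = v $ i * prodfun (f(i := deriv (f i))) x" for v i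
    by (simp add: prodfun_def prod.remove[of UNIV i])
  ultimately show ?thesis by (simp add: prodfun_def[abs_def])
qed

lemma partial_prodfun:
  assumes "\<forall>j. f j \<in> smooth1"
  shows "partial i (prodfun f) = prodfun (f(i := deriv (f i)))"
proof
  fix x
  have "frechet_derivative (prodfun f) (at x) = (\<lambda>v. \<Sum>i\<in>UNIV. v $ i * prodfun (f(i := deriv (f i))) x)"
    using frechet_derivative_at[OF prodfun_has_derivative[OF assms]] by (rule sym)
  then show "partial i (prodfun f) x = prodfun (f(i := deriv (f i))) x"
    by (simp add: partial_def axis_def if_distrib[of "\<lambda>c. c * _"] cong: if_cong)
qed

lemma partials_prodfun:
  assumes "\<forall>j. f j \<in> smooth1"
  shows "\<exists>g. (\<forall>j. g j \<in> smooth1) \<and> partials is (prodfun f) = prodfun g"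
proof (induction "is")
  case Nil
  then show ?case using assms by (auto simp: partials_def)
next
  case (Cons i "is")
  then obtain g where g: "\<forall>j. g j \<in> smooth1" "partials is (prodfun f) = prodfun g" by blast
  define g' where "g' = g(i := deriv (g i))"
  have "partials (i # is) (prodfun f) = partial i (partials is (prodfun f))"
    by (simp add: partials_def)
  also have "\<dots> = prodfun g'"
    unfolding g(2) g'_def by (rule partial_prodfun[OF g(1)])
  moreover have "\<forall>j. g' j \<in> smooth1"
    using g(1) smooth1_deriv by (simp add: g'_def)
  ultimately show ?case by auto
qed

text \<open>Derivatives in different coordinates act on different factors.\<close>

lemma partials_prodfun_commute:
  assumes f: "\<forall>j. f j \<in> smooth1"
  shows "partials [i, j] (prodfun f) = partials [j, i] (prodfun f)"
proof (cases "i = j")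
  case False
  have 1: "\<forall>l. (f(k := deriv (f k))) l \<in> smooth1" for k
    using f smooth1_deriv by simp
  have "partials [k, l] (prodfun f) = prodfun (f(l := deriv (f l), k := deriv (f k)))" if "k \<noteq> l" for k l
  proof -
    have "partials [k, l] (prodfun f) = partial k (partial l (prodfun f))"
      by (simp add: partials_def)
    also have "\<dots> = prodfun (f(l := deriv (f l), k := deriv ((f(l := deriv (f l))) k)))"
      unfolding partial_prodfun[OF f] by (rule partial_prodfun[OF 1])
    also have "deriv ((f(l := deriv (f l))) k) = deriv (f k)"
      using that by simp
    finally show ?thesis .
  qed
  from this[of i j] this[of j i] show ?thesis
    using False by (simp add: fun_upd_twist[of j i])
qed simp

lemma prodfun_differentiable: "\<forall>j. f j \<in> smooth1 \<Longrightarrow> prodfun f differentiable (at x)"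
  using prodfun_has_derivative unfolding differentiable_def by blast

lemma partials_differentiable:
  assumes "\<forall>j. f j \<in> smooth1"
  shows "partials is (prodfun f) differentiable (at x)"
  using partials_prodfun[OF assms, of "is"] prodfun_differentiable by metis

definition bump_factor :: "real \<Rightarrow> real^'n::finite \<Rightarrow> real^'n \<Rightarrow> 'n \<Rightarrow> real \<Rightarrow> real" where
  "bump_factor c a b j t = flat_exp 1 (c * (t - a $ j)) * flat_exp 1 (c * (b $ j - t))"

text \<open>The parameter \<open>c\<close> steepens the factors: as it grows, each factor tends to
  one inside the box, while outside the bump stays zero. Bumps thus approximate the indicator of the
  box.\<close>

definition bump :: "real \<Rightarrow> real^'n::finite \<Rightarrow> real^'n \<Rightarrow> real^'n \<Rightarrow> real" where
  "bump c a b = prodfun (bump_factor c a b)"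

lemma bump_smooth1: "\<forall>j. bump_factor c a b j \<in> smooth1"
proof
  fix j
  define a' b' where "a' = a $ j" and "b' = b $ j"
  have "(\<lambda>t. flat_exp 1 (c * t + - (c * a'))) \<in> smooth1" "(\<lambda>t. flat_exp 1 ((- c) * t + c * b')) \<in> smooth1"
    by (rule smooth1.base)+
  then have "(\<lambda>t. flat_exp 1 (c * t + - (c * a')) * flat_exp 1 ((- c) * t + c * b')) \<in> smooth1"
    by (rule smooth1.mult)
  moreover have "bump_factor c a b j = (\<lambda>t. flat_exp 1 (c * t + - (c * a')) * flat_exp 1 ((- c) * t + c * b'))"
    by (auto simp: bump_factor_def a'_def b'_def algebra_simps)
  ultimately show "bump_factor c a b j \<in> smooth1" by simp
qed

lemma flat_exp_1_bounds: "0 \<le> flat_exp 1 s" "flat_exp 1 s \<le> 1"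
  by (auto simp: flat_exp_def)

lemma bump_bounds: "0 \<le> bump c a b x" "bump c a b x \<le> 1"
  unfolding bump_def prodfun_def bump_factor_def
  by (auto intro!: prod_nonneg prod_le_1 mult_nonneg_nonneg mult_le_one flat_exp_1_bounds)

lemma bump_outside: 
  assumes "c > 0" "x \<notin> box a b"
  shows "bump c a b x = 0"
proof -
  obtain j where "\<not> (a $ j < x $ j \<and> x $ j < b $ j)"
    using assms(2) by (auto simp: mem_box_cart)
  then have "flat_exp 1 (c * (x $ j - a $ j)) * flat_exp 1 (c * (b $ j - x $ j)) = 0"
    using assms(1) by (auto simp: flat_exp_def zero_less_mult_iff)
  then have "bump_factor c a b j (x $ j) = 0" by (simp add: bump_factor_def)
  then show ?thesis unfolding bump_def prodfun_def by (intro prod_zero) auto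
qed

lemma bump_tendsto_indicator: "(\<lambda>n. bump (real (Suc n)) a b x) \<longlonglongrightarrow> indicat_real (box a b) x"
proof (cases "x \<in> box a b")
  case True
  have 1: "(\<lambda>n. flat_exp 1 (real (Suc n) * s)) \<longlonglongrightarrow> 1" if "s > 0" for s
  proof -
    have "(\<lambda>n. exp (- (1 / real (Suc n) * (1 / s)))) \<longlonglongrightarrow> exp (- (0 * (1 / s)))"
      by (intro tendsto_intros LIMSEQ_Suc lim_const_over_n)
    then show ?thesis
      using that by (simp add: flat_exp_def zero_less_mult_iff)
  qed
  have "(\<lambda>n. bump (real (Suc n)) a b x) \<longlonglongrightarrow> (\<Prod>j\<in>(UNIV :: 'a set). 1 * 1)"
    unfolding bump_def prodfun_def bump_factor_def
    using True by (intro tendsto_intros 1) (auto simp: mem_box_cart)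
  then show ?thesis using True by simp
qed (simp add: bump_outside)

lemma bump_has_derivative:
  "(bump c a b has_derivative (\<lambda>v. \<Sum>i\<in>UNIV. v $ i * partial i (bump c a b) x)) (at x)"
  using prodfun_has_derivative[OF bump_smooth1, of c a b x]
  unfolding bump_def partial_prodfun[OF bump_smooth1] .

lemma bump_partial_has_derivative:
  "(partial i (bump c a b) has_derivative (\<lambda>v. \<Sum>j\<in>UNIV. v $ j * partials [j, i] (bump c a b) x)) (at x)"
proof -
  let ?f = "bump_factor c a b"
  let ?g = "?f(i := deriv (?f i))"
  have g: "\<forall>j. ?g j \<in> smooth1"
    using bump_smooth1[of c a b] smooth1_deriv by simp
  have "partial i (bump c a b) = prodfun ?g"
    unfolding bump_def by (rule partial_prodfun[OF bump_smooth1])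
  moreover have "partials [j, i] (bump c a b) = partial j (partial i (bump c a b))" for j
    by (simp add: partials_def)
  ultimately show ?thesis
    using prodfun_has_derivative[OF g, of x] by (simp only: partial_prodfun[OF g])
qed

lemma bump_partials_continuous: "continuous_on UNIV (partials is (bump c a b))"
  unfolding bump_def
  by (intro continuous_at_imp_continuous_on ballI differentiable_imp_continuous_within partials_differentiable bump_smooth1)

lemma partial_zero_on_open:
  assumes "open U" "x \<in> U" "\<And>y. y \<in> U \<Longrightarrow> f y = 0"
  shows "partial i f x = 0"
proof -
  have "(f has_derivative (\<lambda>v. 0)) (at x)"
    using assms by (intro has_derivative_transform_within_open[OF has_derivative_const[of 0] assms(1,2)]) auto
  then show ?thesis
    by (simp add: partial_def frechet_derivative_at[symmetric])
qed

lemma bump_partials_outside: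
  assumes "c > 0" "x \<notin> cbox a b"
  shows "partials is (bump c a b) x = 0"
  using assms(2)
proof (induction "is" arbitrary: x)
  case Nil
  then have "x \<notin> box a b" using box_subset_cbox[of a b] by blast
  then show ?case using bump_outside[OF assms(1)] by (simp add: partials_def)
next
  case (Cons i "is")
  have "partial i (partials is (bump c a b)) x = 0"
    using Cons by (intro partial_zero_on_open[of "- cbox a b"]) auto
  then show ?case by (simp add: partials_def)
qed

text \<open>Derivatives of bumps are included because passing from one weak derivative to the next
  tests with a differentiated bump.\<close>

lemma test_function_bump:
  assumes "c > 0" "cbox a b \<subseteq> S"
  shows "test_function S (partials is (bump c a b))"
proof -
  have cl: "closure {x. partials is (bump c a b) x \<noteq> 0} \<subseteq> cbox a b"
    using bump_partials_outside[OF assms(1)] by (intro closure_minimal) auto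
  moreover have "compact (closure {x. partials is (bump c a b) x \<noteq> 0})"
    using cl by (metis bounded_cbox bounded_subset closed_closure compact_eq_bounded_closed)
  moreover have "partials js (partials is (bump c a b)) = partials (js @ is) (bump c a b)" for js
    by (simp add: partials_def)
  ultimately show ?thesis
    using assms(2) partials_differentiable[OF bump_smooth1] by (auto simp: test_function_def bump_def)
qed

lemma bump_partials_bounded:
  assumes "c > 0"
  obtains B where "B \<ge> 0" "\<And>x. \<bar>partials is (bump c a b) x\<bar> \<le> B"
proof -
  have "compact (partials is (bump c a b) ` cbox a b)"
    by (intro compact_continuous_image continuous_on_subset[OF bump_partials_continuous]) auto
  then obtain B where B: "B > 0" "\<And>x. x \<in> cbox a b \<Longrightarrow> \<bar>partials is (bump c a b) x\<bar> \<le> B"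
    using compact_imp_bounded bounded_pos by (metis (no_types, lifting) imageI real_norm_def)
  have "\<bar>partials is (bump c a b) x\<bar> \<le> B" for x
    using B bump_partials_outside[OF assms, of x a b "is"] by (cases "x \<in> cbox a b") auto
  then show thesis using that B(1) by (meson less_imp_le)
qed

lemma bump_translate: "bump c (a + w) (b + w) x = bump c a b (x - w)"
  by (simp add: bump_def prodfun_def bump_factor_def algebra_simps)

section \<open>The fundamental lemma of the calculus of variations\<close>

lemma AE_zero_of_box_integrals:
  fixes v :: "'a::euclidean_space \<Rightarrow> real"
  assumes v: "integrable lborel v" and out: "\<And>x. x \<notin> box p q \<Longrightarrow> v x = 0"
    and box: "\<And>a b. (\<integral>x. indicat_real (box a b) x * v x \<partial>lborel) = 0"
  shows "AE x in lborel. v x = 0"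
proof (rule density_unique_real[OF v integrable_zero])
  fix A :: "'a set" assume "A \<in> sets lborel"
  have int: "set_integrable lborel B v" if "B \<in> sets borel" for B
    unfolding set_integrable_def using v that by (intro integrable_mult_indicator) auto
  \<comment> \<open>Boxes are stable under intersection and generate the Borel sets. The complement
    step of the induction needs the integral over the whole space, which is that over the box to
    which \<open>v\<close> is confined.\<close>
  have total: "(LINT x:UNIV|lborel. v x) = 0"
  proof -
    have "(LINT x:UNIV|lborel. v x) = (\<integral>x. indicat_real (box p q) x * v x \<partial>lborel)"
      unfolding set_lebesgue_integral_def using out by (intro Bochner_Integration.integral_cong) (auto simp: indicator_def)
    then show ?thesis using box by simp
  qed
  let ?G = "range (\<lambda>(a, b). box a b :: 'a set)"
  have sets_eq: "sigma_sets UNIV ?G = sets borel"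
    unfolding borel_eq_box by simp
  have "A \<in> sigma_sets UNIV ?G"
    using \<open>A \<in> sets lborel\<close> sets_eq by simp
  then have "(LINT x:A|lborel. v x) = 0"
  proof (rule sigma_sets_induct_disjoint[rotated 2])
    show "Int_stable ?G"
      by (auto simp: Int_stable_def box_Int_box)
    show "?G \<subseteq> Pow UNIV" by simp
    show "(LINT x:A|lborel. v x) = 0" if "A \<in> ?G" for A
      using that box by (auto simp: set_lebesgue_integral_def)
    show "(LINT x:{}|lborel. v x) = 0" by (simp add: set_lebesgue_integral_def)
    show "(LINT x:UNIV - A|lborel. v x) = 0" if "A \<in> sigma_sets UNIV ?G" "(LINT x:A|lborel. v x) = 0" for A
    proof -
      have A: "A \<in> sets borel" using that sets_eq by simp
      have "(LINT x:A \<union> (UNIV - A)|lborel. v x) = (LINT x:A|lborel. v x) + (LINT x:UNIV - A|lborel. v x)"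
        using A by (intro set_integral_Un int) auto
      then show ?thesis using total that(2) by simp
    qed
    show "(LINT x:(\<Union>i. A i)|lborel. v x) = 0"
      if "disjoint_family A" "range A \<subseteq> sigma_sets UNIV ?G" "\<And>i::nat. (LINT x:A i|lborel. v x) = 0" for A
    proof -
      have A: "A i \<in> sets borel" for i using that(2) sets_eq by blast
      have "(LINT x:(\<Union>i. A i)|lborel. v x) = (\<Sum>i. (LINT x:A i|lborel. v x))"
        using A that(1) by (intro lebesgue_integral_countable_add int sets.countable_UN) (auto simp: disjoint_family_on_def)
      then show ?thesis using that(3) by simp
    qed
  qed
  then show "(LINT x:A|lborel. v x) = (LINT x:A|lborel. 0)" by (simp add: set_lebesgue_integral_def)
qed

lemma AE_lborel_cbox_box: "AE x in lborel. x \<in> cbox a b \<longrightarrow> x \<in> box a (b :: 'a::euclidean_space)"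
proof (rule AE_I')
  have "negligible (cbox a b - box a b)" by (rule negligible_frontier_interval)
  then show "cbox a b - box a b \<in> null_sets lborel"
    by (simp add: negligible_iff_null_sets null_sets_completion_iff)
qed auto

lemma AE_open_of_cboxes:
  fixes U :: "'a::euclidean_space set"
  assumes "open U" and ae: "\<And>a b. cbox a b \<subseteq> U \<Longrightarrow> AE x in lborel. x \<in> cbox a b \<longrightarrow> P x"
  shows "AE x in lborel. x \<in> U \<longrightarrow> P x"
proof -
  obtain \<D> where \<D>: "countable \<D>" "\<D> \<subseteq> Pow U" "\<And>X. X \<in> \<D> \<Longrightarrow> \<exists>a b. X = cbox a b" "\<Union>\<D> = U"
    using open_countable_Union_open_cbox[OF assms(1)] by metis
  have "\<forall>X\<in>\<D>. AE x in lborel. x \<in> X \<longrightarrow> P x"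
  proof
    fix X assume X: "X \<in> \<D>"
    then obtain a b where ab: "X = cbox a b" using \<D>(3) by blast
    have "cbox a b \<subseteq> U" using \<D>(2) X ab by auto
    then show "AE x in lborel. x \<in> X \<longrightarrow> P x" unfolding ab by (rule ae)
  qed
  then have "AE x in lborel. \<forall>X\<in>\<D>. x \<in> X \<longrightarrow> P x"
    by (subst AE_ball_countable[OF \<D>(1)])
  then show ?thesis
    by (rule AE_mp) (use \<D>(4) in auto)
qed

lemma bump_measurable [measurable]: "partials is (bump c a b) \<in> borel_measurable borel"
  using bump_partials_continuous by (rule borel_measurable_continuous_onI)

lemma bump_measurable' [measurable]: "bump c a b \<in> borel_measurable borel"
  using bump_measurable[of "[]"] by (simp add: partials_def)

lemma integrable_mult_bump:
  fixes v :: "real^'n::finite \<Rightarrow> real"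
  assumes [measurable]: "v \<in> borel_measurable borel" and v: "integrable lborel (\<lambda>x. indicat_real (cbox a b) x * v x)" and c: "c > 0"
  shows "integrable lborel (\<lambda>x. v x * partials is (bump c a b) x)"
proof -
  obtain B where B: "B \<ge> 0" "\<And>x. \<bar>partials is (bump c a b) x\<bar> \<le> B"
    using bump_partials_bounded[OF c] by blast
  show ?thesis
  proof (rule Bochner_Integration.integrable_bound)
    show "integrable lborel (\<lambda>x. B * (indicat_real (cbox a b) x * v x))"
      using v by simp
    show "AE x in lborel. norm (v x * partials is (bump c a b) x) \<le> norm (B * (indicat_real (cbox a b) x * v x))"
    proof (rule AE_I2)
      fix x
      show "norm (v x * partials is (bump c a b) x) \<le> norm (B * (indicat_real (cbox a b) x * v x))"
      proof (cases "x \<in> cbox a b")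
        case True
        then show ?thesis
          using B mult_right_mono[OF B(2)[of x], of "\<bar>v x\<bar>"] by (simp add: abs_mult mult.commute)
      qed (simp add: bump_partials_outside[OF c])
    qed
  qed measurable
qed

lemma integrable_mult_bump0:
  fixes v :: "real^'n::finite \<Rightarrow> real"
  assumes "v \<in> borel_measurable borel" "integrable lborel (\<lambda>x. indicat_real (cbox a b) x * v x)" "c > 0"
  shows "integrable lborel (\<lambda>x. v x * bump c a b x)"
  using integrable_mult_bump[OF assms, of "[]"] by (simp add: partials_def)

text \<open>As the steepness grows, dominated convergence turns vanishing pairings with bumps into
  vanishing integrals over boxes. Closed boxes inside the open set suffice, since countably many of
  them exhaust it.\<close>

lemma fundamental_lemma:
  fixes v :: "real^'n::finite \<Rightarrow> real"
  assumes O: "open O'" and [measurable]: "v \<in> borel_measurable borel"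
    and int: "\<And>a b. cbox a b \<subseteq> O' \<Longrightarrow> integrable lborel (\<lambda>x. indicat_real (cbox a b) x * v x)"
    and zero: "\<And>c a b. \<lbrakk>c > 0; cbox a b \<subseteq> O'\<rbrakk> \<Longrightarrow> (\<integral>x. v x * bump c a b x \<partial>lborel) = 0"
  shows "AE x in lborel. x \<in> O' \<longrightarrow> v x = 0"
proof -
  have box: "(\<integral>x. indicat_real (box a b) x * v x \<partial>lborel) = 0" if ab: "cbox a b \<subseteq> O'" for a b
  proof -
    have "(\<lambda>n. \<integral>x. v x * bump (real (Suc n)) a b x \<partial>lborel) \<longlonglongrightarrow> (\<integral>x. indicat_real (box a b) x * v x \<partial>lborel)"
    proof (rule integral_dominated_convergence[where w = "\<lambda>x. \<bar>indicat_real (cbox a b) x * v x\<bar>"])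
      show "integrable lborel (\<lambda>x. \<bar>indicat_real (cbox a b) x * v x\<bar>)" using int[OF ab] by simp
      show "AE x in lborel. (\<lambda>n. v x * bump (real (Suc n)) a b x) \<longlonglongrightarrow> indicat_real (box a b) x * v x"
      proof (rule AE_I2)
        fix x
        show "(\<lambda>n. v x * bump (real (Suc n)) a b x) \<longlonglongrightarrow> indicat_real (box a b) x * v x"
          using tendsto_mult_left[OF bump_tendsto_indicator[of a b x], of "v x"] by (simp add: mult.commute)
      qed
      show "AE x in lborel. norm (v x * bump (real (Suc n)) a b x) \<le> \<bar>indicat_real (cbox a b) x * v x\<bar>" for n
      proof (rule AE_I2)
        fix x
        show "norm (v x * bump (real (Suc n)) a b x) \<le> \<bar>indicat_real (cbox a b) x * v x\<bar>"
        proof (cases "x \<in> box a b")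
          case True
          then have "x \<in> cbox a b" using box_subset_cbox by blast
          moreover have "\<bar>v x\<bar> * bump (real (Suc n)) a b x \<le> \<bar>v x\<bar> * 1"
            by (intro mult_left_mono bump_bounds) auto
          ultimately show ?thesis using bump_bounds(1)[of "real (Suc n)" a b x] by (simp add: abs_mult)
        qed (simp add: bump_outside)
      qed
    qed measurable
    moreover have "(\<lambda>n. \<integral>x. v x * bump (real (Suc n)) a b x \<partial>lborel) = (\<lambda>n. 0)"
      using zero[OF _ ab] by auto
    ultimately show ?thesis by (simp add: LIMSEQ_const_iff)
  qed
  have ae: "AE x in lborel. x \<in> cbox p q \<longrightarrow> v x = 0" if pq: "cbox p q \<subseteq> O'" for p q
  proof -
    have "AE x in lborel. indicat_real (box p q) x * v x = 0"
    proof (rule AE_zero_of_box_integrals[where p = p and q = q])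
      have "integrable lborel (\<lambda>x. indicat_real (box p q) x *\<^sub>R (indicat_real (cbox p q) x * v x))"
        using int[OF pq] by (intro integrable_mult_indicator) auto
      moreover have "(\<lambda>x. indicat_real (box p q) x *\<^sub>R (indicat_real (cbox p q) x * v x)) = (\<lambda>x. indicat_real (box p q) x * v x)"
        using box_subset_cbox[of p q] by (auto simp: indicator_def fun_eq_iff)
      ultimately show "integrable lborel (\<lambda>x. indicat_real (box p q) x * v x)" by simp
      show "(\<integral>x. indicat_real (box a b) x * (indicat_real (box p q) x * v x) \<partial>lborel) = 0" for a b
      proof -
        obtain r s where rs: "box a b \<inter> box p q = box r s" using box_Int_box by blast
        have eq: "(\<integral>x. indicat_real (box a b) x * (indicat_real (box p q) x * v x) \<partial>lborel)
            = (\<integral>x. indicat_real (box r s) x * v x \<partial>lborel)"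
          unfolding rs[symmetric] by (intro Bochner_Integration.integral_cong) (auto simp: indicator_def)
        show ?thesis
        proof (cases "box r s = {}")
          case False
          have "cbox r s \<subseteq> cbox p q"
            using rs closure_box[OF False] closure_minimal[of "box r s" "cbox p q"] box_subset_cbox[of p q] by blast
          then show ?thesis unfolding eq using pq by (intro box) blast
        qed (simp add: eq)
      qed
    qed simp
    with AE_lborel_cbox_box[of p q] show ?thesis
      by eventually_elim auto
  qed
  show ?thesis using O ae by (rule AE_open_of_cboxes)
qed

lemma partials_translate: "partials is (\<lambda>x. f (x - w)) = (\<lambda>x. partials is f (x - w))"
proof (induction "is")
  case (Cons i "is")
  \<comment> \<open>\<open>frechet_derivative\<close> selects from the derivative relation. As the
    two relations coincide, the selections agree even where no derivative exists.\<close>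
  have iff: "((\<lambda>x. g (x - w)) has_derivative D) (at x) \<longleftrightarrow> (g has_derivative D) (at (x - w))"
    for g :: "real^'a \<Rightarrow> real" and D x
  proof
    assume *: "((\<lambda>x. g (x - w)) has_derivative D) (at x)"
    have "((\<lambda>y. y + w) has_derivative (\<lambda>v. v)) (at (x - w))"
      by (auto intro!: derivative_eq_intros)
    from has_derivative_compose[OF this, of "\<lambda>x. g (x - w)" D] * show "(g has_derivative D) (at (x - w))"
      by simp
  next
    assume *: "(g has_derivative D) (at (x - w))"
    have "((\<lambda>y. y - w) has_derivative (\<lambda>v. v)) (at x)"
      by (auto intro!: derivative_eq_intros)
    from has_derivative_compose[OF this *] show "((\<lambda>x. g (x - w)) has_derivative D) (at x)"
      by simp
  qed
  have "partial i (\<lambda>x. partials is f (x - w)) x = partial i (partials is f) (x - w)" for x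
    by (simp add: partial_def frechet_derivative_def iff)
  moreover have "partials (i # is) F = partial i (partials is F)" for F :: "real^'a \<Rightarrow> real"
    by (simp add: partials_def)
  ultimately show ?case
    by (auto simp: Cons)
qed (simp add: partials_def)

lemma bump_partials_translate:
  "partials is (bump c (a + w) (b + w)) x = partials is (bump c a b) (x - w)"
proof -
  have "bump c (a + w) (b + w) = (\<lambda>x. bump c a b (x - w))"
    by (simp add: fun_eq_iff bump_translate)
  then show ?thesis by (simp add: partials_translate)
qed

section \<open>Weak derivatives along segments\<close>

text \<open>Unlike \<open>locally_integrable_on\<close> this asks for Borel measurability on the
  whole space and integrates with \<open>lborel\<close>, so that Fubini applies to
  \<open>v (x + t *\<^sub>R w)\<close> as a function of \<open>x\<close> and
  \<open>t\<close>.\<close>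

definition loc_int :: "'a::euclidean_space set \<Rightarrow> ('a \<Rightarrow> real) \<Rightarrow> bool" where
  "loc_int S v \<longleftrightarrow> v \<in> borel_measurable borel \<and>
     (\<forall>K. compact K \<and> K \<subseteq> S \<longrightarrow> integrable lborel (\<lambda>x. indicat_real K x * v x))"

lemma loc_intD: "loc_int S v \<Longrightarrow> v \<in> borel_measurable borel"
  "\<lbrakk>loc_int S v; compact K; K \<subseteq> S\<rbrakk> \<Longrightarrow> integrable lborel (\<lambda>x. indicat_real K x * v x)"
  by (auto simp: loc_int_def)

lemma loc_int_add: "\<lbrakk>loc_int S v; loc_int S w\<rbrakk> \<Longrightarrow> loc_int S (\<lambda>x. v x + w x)"
  by (auto simp: loc_int_def distrib_left)

lemma loc_int_cmult: "loc_int S v \<Longrightarrow> loc_int S (\<lambda>x. c * v x)"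
  by (auto simp: loc_int_def mult.left_commute)

lemma loc_int_sum: "(\<And>i. i \<in> A \<Longrightarrow> loc_int S (v i)) \<Longrightarrow> loc_int S (\<lambda>x. \<Sum>i\<in>A. v i x)"
proof (induction A rule: infinite_finite_induct)
  case (insert i A)
  then show ?case by (simp add: loc_int_add)
qed (auto simp: loc_int_def)

text \<open>The region swept by \<open>K\<close> along the vector \<open>w\<close>.\<close>

definition sheared :: "'a::real_vector \<Rightarrow> 'a set \<Rightarrow> 'a set" where
  "sheared w K = (\<lambda>(x, t). x + t *\<^sub>R w) ` (K \<times> {0..1})"

lemma compact_sheared: "compact K \<Longrightarrow> compact (sheared (w :: 'a::real_normed_vector) K)"
  unfolding sheared_def split_beta
  by (intro compact_continuous_image continuous_intros compact_Times) auto

lemma sheared_mem: "\<lbrakk>x \<in> K; 0 \<le> t; t \<le> 1\<rbrakk> \<Longrightarrow> x + t *\<^sub>R w \<in> sheared w K"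
  unfolding sheared_def by force

lemma convex_line_mem:
  assumes "convex S" "x \<in> S" "x + w \<in> S" "0 \<le> t" "t \<le> 1"
  shows "x + t *\<^sub>R w \<in> S"
proof -
  have "(1 - t) *\<^sub>R x + t *\<^sub>R (x + w) \<in> S"
    using assms by (intro convexD) auto
  then show ?thesis by (simp add: algebra_simps)
qed

lemma sheared_subset:
  assumes "convex S" "K \<subseteq> {x \<in> S. x + w \<in> S}"
  shows "sheared w K \<subseteq> S"
proof
  fix y assume "y \<in> sheared w K"
  then obtain x t where "y = x + t *\<^sub>R w" "x \<in> K" "0 \<le> t" "t \<le> 1"
    unfolding sheared_def by auto
  then show "y \<in> S"
    using assms(2) convex_line_mem[OF assms(1), of x w t] by auto
qed

lemma open_shift_Int: "open S \<Longrightarrow> open {x \<in> S. x + w \<in> (S :: 'a::real_normed_vector set)}"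
proof -
  assume S: "open S"
  have "open ((\<lambda>x. x + w) -` S)"
    using S by (intro open_vimage continuous_intros)
  moreover have "{x \<in> S. x + w \<in> S} = S \<inter> (\<lambda>x. x + w) -` S" by auto
  ultimately show ?thesis using S by (simp add: open_Int)
qed

lemma integral_lborel_shift:
  fixes F :: "'a::euclidean_space \<Rightarrow> real"
  assumes [measurable]: "F \<in> borel_measurable borel"
  shows "(\<integral>x. F (x + w) \<partial>lborel) = (\<integral>x. F x \<partial>lborel)"
    and "integrable lborel (\<lambda>x. F (x + w)) \<longleftrightarrow> integrable lborel F"
proof -
  have "(\<integral>x. F x \<partial>lborel) = (\<integral>x. F x \<partial>distr lborel borel ((+) w))"
    by (simp add: lborel_distr_plus)
  also have "\<dots> = (\<integral>x. F (w + x) \<partial>lborel)"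
    by (rule integral_distr) measurable
  finally show "(\<integral>x. F (x + w) \<partial>lborel) = (\<integral>x. F x \<partial>lborel)" by (simp add: add.commute)
  have "integrable lborel F \<longleftrightarrow> integrable (distr lborel borel ((+) w)) F"
    by (simp add: lborel_distr_plus)
  also have "\<dots> \<longleftrightarrow> integrable lborel (\<lambda>x. F (w + x))"
    by (rule integrable_distr_eq) measurable
  finally show "integrable lborel (\<lambda>x. F (x + w)) \<longleftrightarrow> integrable lborel F" by (simp add: add.commute)
qed

text \<open>For every \<open>t\<close> in the unit interval the shifted \<open>K\<close> stays in
  one compact subset of \<open>S\<close>, so by Tonelli the double integral of the absolute value is
  at most the integral of \<open>\<bar>W\<bar>\<close> over that set.\<close>

lemma shear_integrable:
  fixes W :: "'a::euclidean_space \<Rightarrow> real"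
  assumes S: "convex S" and W: "loc_int S W" and K: "compact K" "K \<subseteq> {x \<in> S. x + w \<in> S}"
  shows "integrable (lborel \<Otimes>\<^sub>M lborel) (\<lambda>(x, t). indicat_real K x * indicat_real {0..1} t * W (x + t *\<^sub>R w))"
proof (rule integrableI_bounded)
  have [measurable]: "W \<in> borel_measurable borel" by (rule loc_intD(1)[OF W])
  have [measurable]: "K \<in> sets borel" using K by (simp add: compact_imp_closed)
  let ?K = "sheared w K"
  have cK: "compact ?K" by (rule compact_sheared[OF K(1)])
  have [measurable]: "?K \<in> sets borel" using cK by (simp add: compact_imp_closed)
  show "(\<lambda>(x, t). indicat_real K x * indicat_real {0..1} t * W (x + t *\<^sub>R w)) \<in> borel_measurable (lborel \<Otimes>\<^sub>M lborel)"
    by measurable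
  define F where "F z = ennreal (norm (indicat_real ?K z * W z))" for z
  have [measurable]: "F \<in> borel_measurable borel" unfolding F_def by measurable
  have A: "(\<integral>\<^sup>+z. F z \<partial>lborel) < \<infinity>"
    using loc_intD(2)[OF W cK sheared_subset[OF S K(2)]] unfolding F_def integrable_iff_bounded by blast
  have "(\<integral>\<^sup>+p. ennreal (norm (case p of (x, t) \<Rightarrow> indicat_real K x * indicat_real {0..1} t * W (x + t *\<^sub>R w))) \<partial>(lborel \<Otimes>\<^sub>M lborel))
      = (\<integral>\<^sup>+t. \<integral>\<^sup>+x. ennreal (norm (indicat_real K x * indicat_real {0..1} t * W (x + t *\<^sub>R w))) \<partial>lborel \<partial>lborel)"
    by (subst lborel_pair.nn_integral_snd[symmetric]) auto
  also have "\<dots> \<le> (\<integral>\<^sup>+t. indicator {0..1::real} t * (\<integral>\<^sup>+z. F z \<partial>lborel) \<partial>lborel)"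
  proof (rule nn_integral_mono)
    fix t :: real
    show "(\<integral>\<^sup>+x. ennreal (norm (indicat_real K x * indicat_real {0..1} t * W (x + t *\<^sub>R w))) \<partial>lborel)
        \<le> indicator {0..1::real} t * (\<integral>\<^sup>+z. F z \<partial>lborel)"
    proof (cases "t \<in> {0..1}")
      case True
      have "(\<integral>\<^sup>+x. ennreal (norm (indicat_real K x * indicat_real {0..1} t * W (x + t *\<^sub>R w))) \<partial>lborel)
          \<le> (\<integral>\<^sup>+x. F (x + t *\<^sub>R w) \<partial>lborel)"
        using sheared_mem[of _ K t w] True
        by (intro nn_integral_mono) (auto simp: F_def indicator_def)
      then show ?thesis using True by (simp add: nn_integral_lborel_translate)
    qed simp
  qed
  also have "\<dots> = (\<integral>\<^sup>+z. F z \<partial>lborel)"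
    by (simp add: nn_integral_multc)
  also have "\<dots> < \<infinity>" by (rule A)
  finally show "(\<integral>\<^sup>+p. ennreal (norm (case p of (x, t) \<Rightarrow> indicat_real K x * indicat_real {0..1} t * W (x + t *\<^sub>R w))) \<partial>(lborel \<Otimes>\<^sub>M lborel)) < \<infinity>" .
qed

text \<open>The common core of the fundamental theorem, with kernel 1, and of the Taylor formula,
  with kernel \<open>1 - t\<close>. By Fubini and translation, the right side of \<open>id\<close>
  is the pairing of the segment integral \<open>J\<close> with the bump, so \<open>v0 - J\<close> is
  annihilated by all bumps.\<close>

lemma kernel_identity:
  fixes W v0 :: "real^'n::finite \<Rightarrow> real" and \<kappa> :: "real \<Rightarrow> real"
  assumes S: "convex S" "open S" and W: "loc_int S W"
    and v0: "v0 \<in> borel_measurable borel"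
      "\<And>a b. cbox a b \<subseteq> {x \<in> S. x + w \<in> S} \<Longrightarrow> integrable lborel (\<lambda>x. indicat_real (cbox a b) x * v0 x)"
    and \<kappa>: "\<kappa> \<in> borel_measurable borel" "\<And>t. \<lbrakk>0 \<le> t; t \<le> 1\<rbrakk> \<Longrightarrow> \<bar>\<kappa> t\<bar> \<le> 1"
    and id: "\<And>c a b. \<lbrakk>c > 0; cbox a b \<subseteq> {x \<in> S. x + w \<in> S}\<rbrakk> \<Longrightarrow>
      (\<integral>x. v0 x * bump c a b x \<partial>lborel)
        = (\<integral>t. indicat_real {0..1} t * \<kappa> t * (\<integral>z. W z * bump c (a + t *\<^sub>R w) (b + t *\<^sub>R w) z \<partial>lborel) \<partial>lborel)"
  shows "AE x in lborel. x \<in> {x \<in> S. x + w \<in> S} \<longrightarrow>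
      integrable lborel (\<lambda>t. indicat_real {0..1} t * W (x + t *\<^sub>R w)) \<and>
      v0 x = (\<integral>t. indicat_real {0..1} t * \<kappa> t * W (x + t *\<^sub>R w) \<partial>lborel)"
proof -
  let ?O = "{x \<in> S. x + w \<in> S}"
  have opO: "open ?O" by (rule open_shift_Int[OF S(2)])
  have [measurable]: "W \<in> borel_measurable borel" by (rule loc_intD(1)[OF W])
  note [measurable] = v0(1) \<kappa>(1)
  define J where "J x = (\<integral>t. indicat_real {0..1} t * \<kappa> t * W (x + t *\<^sub>R w) \<partial>lborel)" for x
  have J_meas [measurable]: "J \<in> borel_measurable borel"
    unfolding J_def by measurable
  have box: "(AE x in lborel. x \<in> cbox a b \<longrightarrow> integrable lborel (\<lambda>t. indicat_real {0..1} t * W (x + t *\<^sub>R w)))"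
      "integrable lborel (\<lambda>x. indicat_real (cbox a b) x * J x)"
      "c > 0 \<Longrightarrow> (\<integral>x. J x * bump c a b x \<partial>lborel)
        = (\<integral>t. indicat_real {0..1} t * \<kappa> t * (\<integral>z. W z * bump c (a + t *\<^sub>R w) (b + t *\<^sub>R w) z \<partial>lborel) \<partial>lborel)"
    if ab: "cbox a b \<subseteq> ?O" for a b c
  proof -
    note int = shear_integrable[OF S(1) W compact_cbox ab]
    have "AE x in lborel. integrable lborel (\<lambda>t. indicat_real (cbox a b) x * indicat_real {0..1} t * W (x + t *\<^sub>R w))"
      using lborel_pair.AE_integrable_fst[OF int] by simp
    then show "AE x in lborel. x \<in> cbox a b \<longrightarrow> integrable lborel (\<lambda>t. indicat_real {0..1} t * W (x + t *\<^sub>R w))"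
      by eventually_elim auto
    have int2: "integrable (lborel \<Otimes>\<^sub>M lborel) (\<lambda>(x, t). f x * (indicat_real (cbox a b) x * (indicat_real {0..1} t * \<kappa> t * W (x + t *\<^sub>R w))))"
      if [measurable]: "f \<in> borel_measurable borel" and f: "\<And>x. \<bar>f x\<bar> \<le> 1" for f
    proof (rule Bochner_Integration.integrable_bound[OF int])
      show "AE p in lborel \<Otimes>\<^sub>M lborel. norm (case p of (x, t) \<Rightarrow> f x * (indicat_real (cbox a b) x * (indicat_real {0..1} t * \<kappa> t * W (x + t *\<^sub>R w))))
         \<le> norm (case p of (x, t) \<Rightarrow> indicat_real (cbox a b) x * indicat_real {0..1} t * W (x + t *\<^sub>R w))"
      proof (rule AE_I2)
        fix p :: "(real^'n) \<times> real"
        obtain x t where p: "p = (x, t)" by fastforce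
        have "\<bar>f x\<bar> * \<bar>\<kappa> t\<bar> * \<bar>W (x + t *\<^sub>R w)\<bar> \<le> 1 * \<bar>W (x + t *\<^sub>R w)\<bar>" if "t \<in> {0..1}"
          using f[of x] \<kappa>(2)[of t] that by (intro mult_right_mono mult_le_one) auto
        then show "norm (case p of (x, t) \<Rightarrow> f x * (indicat_real (cbox a b) x * (indicat_real {0..1} t * \<kappa> t * W (x + t *\<^sub>R w))))
         \<le> norm (case p of (x, t) \<Rightarrow> indicat_real (cbox a b) x * indicat_real {0..1} t * W (x + t *\<^sub>R w))"
          unfolding p by (auto simp: indicator_def abs_mult mult.assoc)
      qed
    qed measurable
    show "integrable lborel (\<lambda>x. indicat_real (cbox a b) x * J x)"
      using lborel_pair.integrable_fst[OF int2[of "\<lambda>x. 1"]] by (simp add: J_def)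
    show "(\<integral>x. J x * bump c a b x \<partial>lborel)
        = (\<integral>t. indicat_real {0..1} t * \<kappa> t * (\<integral>z. W z * bump c (a + t *\<^sub>R w) (b + t *\<^sub>R w) z \<partial>lborel) \<partial>lborel)"
      if c: "c > 0"
    proof -
      \<comment> \<open>The bump carries the indicator of its box, which may therefore be inserted
        to make the integrand integrable on the product.\<close>
      have ib: "indicat_real (cbox a b) x * bump c a b x = bump c a b x" for x
        using bump_outside[OF c, of x a b] box_subset_cbox[of a b] by (auto simp: indicator_def)
      have "(\<integral>x. J x * bump c a b x \<partial>lborel)
          = (\<integral>x. (\<integral>t. bump c a b x * (indicat_real (cbox a b) x * (indicat_real {0..1} t * \<kappa> t * W (x + t *\<^sub>R w))) \<partial>lborel) \<partial>lborel)"
      proof (rule Bochner_Integration.integral_cong[OF refl])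
        fix x
        have "J x * bump c a b x = bump c a b x * (indicat_real (cbox a b) x * J x)"
          by (subst ib[symmetric]) simp
        then show "J x * bump c a b x
            = (\<integral>t. bump c a b x * (indicat_real (cbox a b) x * (indicat_real {0..1} t * \<kappa> t * W (x + t *\<^sub>R w))) \<partial>lborel)"
          by (simp only: Bochner_Integration.integral_mult_right_zero J_def)
      qed
      also have "\<dots> = (\<integral>t. (\<integral>x. bump c a b x * (indicat_real (cbox a b) x * (indicat_real {0..1} t * \<kappa> t * W (x + t *\<^sub>R w))) \<partial>lborel) \<partial>lborel)"
        by (rule lborel_pair.Fubini_integral[symmetric], rule int2) (auto simp: bump_bounds abs_le_iff intro: order_trans[OF _ bump_bounds(1)])
      also have "\<dots> = (\<integral>t. indicat_real {0..1} t * \<kappa> t * (\<integral>z. W z * bump c (a + t *\<^sub>R w) (b + t *\<^sub>R w) z \<partial>lborel) \<partial>lborel)"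
      proof (rule Bochner_Integration.integral_cong[OF refl])
        fix t
        have "(\<integral>x. bump c a b x * (indicat_real (cbox a b) x * (indicat_real {0..1} t * \<kappa> t * W (x + t *\<^sub>R w))) \<partial>lborel)
            = (\<integral>x. (indicat_real {0..1} t * \<kappa> t) * (W (x + t *\<^sub>R w) * bump c (a + t *\<^sub>R w) (b + t *\<^sub>R w) (x + t *\<^sub>R w)) \<partial>lborel)"
        proof (rule Bochner_Integration.integral_cong[OF refl])
          fix x
          show "bump c a b x * (indicat_real (cbox a b) x * (indicat_real {0..1} t * \<kappa> t * W (x + t *\<^sub>R w)))
              = (indicat_real {0..1} t * \<kappa> t) * (W (x + t *\<^sub>R w) * bump c (a + t *\<^sub>R w) (b + t *\<^sub>R w) (x + t *\<^sub>R w))"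
            using ib[of x] by (cases "x \<in> cbox a b") (auto simp: bump_translate)
        qed
        also have "\<dots> = indicat_real {0..1} t * \<kappa> t * (\<integral>x. W (x + t *\<^sub>R w) * bump c (a + t *\<^sub>R w) (b + t *\<^sub>R w) (x + t *\<^sub>R w) \<partial>lborel)"
          by simp
        also have "(\<integral>x. W (x + t *\<^sub>R w) * bump c (a + t *\<^sub>R w) (b + t *\<^sub>R w) (x + t *\<^sub>R w) \<partial>lborel)
            = (\<integral>z. W z * bump c (a + t *\<^sub>R w) (b + t *\<^sub>R w) z \<partial>lborel)"
          by (rule integral_lborel_shift) measurable
        finally show "(\<integral>x. bump c a b x * (indicat_real (cbox a b) x * (indicat_real {0..1} t * \<kappa> t * W (x + t *\<^sub>R w))) \<partial>lborel)
            = indicat_real {0..1} t * \<kappa> t * (\<integral>z. W z * bump c (a + t *\<^sub>R w) (b + t *\<^sub>R w) z \<partial>lborel)" .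
      qed
      finally show ?thesis .
    qed
  qed
  have "AE x in lborel. x \<in> ?O \<longrightarrow> v0 x - J x = 0"
  proof (rule fundamental_lemma[OF opO])
    show int: "integrable lborel (\<lambda>x. indicat_real (cbox a b) x * (v0 x - J x))" if "cbox a b \<subseteq> ?O" for a b
      using v0(2)[OF that] box(2)[OF that] by (simp add: right_diff_distrib)
    show "(\<integral>x. (v0 x - J x) * bump c a b x \<partial>lborel) = 0" if c: "c > 0" "cbox a b \<subseteq> ?O" for c a b
    proof -
      have "integrable lborel (\<lambda>x. v0 x * bump c a b x)" "integrable lborel (\<lambda>x. J x * bump c a b x)"
        using v0(2)[OF c(2)] box(2)[OF c(2)] c(1) by (auto intro!: integrable_mult_bump0)
      then have "(\<integral>x. (v0 x - J x) * bump c a b x \<partial>lborel) = (\<integral>x. v0 x * bump c a b x \<partial>lborel) - (\<integral>x. J x * bump c a b x \<partial>lborel)"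
        by (simp add: left_diff_distrib)
      also have "\<dots> = 0" unfolding id[OF c] box(3)[OF c(2,1)] by simp
      finally show ?thesis .
    qed
  qed measurable
  moreover have "AE x in lborel. x \<in> ?O \<longrightarrow> integrable lborel (\<lambda>t. indicat_real {0..1} t * W (x + t *\<^sub>R w))"
    using opO box(1) by (rule AE_open_of_cboxes)
  ultimately show ?thesis
  proof eventually_elim
    case (elim x)
    show ?case
      using elim by (simp add: J_def)
  qed
qed

text \<open>The exchange for integrals in which the segment average sits on the test function.
  \<open>Q\<close> is bounded and supported in \<open>K\<close>, so its shifted copies live on the
  swept compact set, where \<open>U\<close> is integrable.\<close>

lemma smear:
  fixes U Q :: "'a::euclidean_space \<Rightarrow> real" and \<kappa> :: "real \<Rightarrow> real"
  assumes S: "convex S" and U: "loc_int S U" and K: "compact K" "K \<subseteq> {x \<in> S. x + w \<in> S}"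
    and Q: "continuous_on UNIV Q" "\<And>x. x \<notin> K \<Longrightarrow> Q x = 0"
    and \<kappa>: "\<kappa> \<in> borel_measurable borel" "\<And>t. \<lbrakk>0 \<le> t; t \<le> 1\<rbrakk> \<Longrightarrow> \<bar>\<kappa> t\<bar> \<le> 1"
  shows "(\<integral>z. U z * (\<integral>t. indicat_real {0..1} t * \<kappa> t * Q (z - t *\<^sub>R w) \<partial>lborel) \<partial>lborel)
       = (\<integral>t. indicat_real {0..1} t * \<kappa> t * (\<integral>z. U z * Q (z - t *\<^sub>R w) \<partial>lborel) \<partial>lborel)"
proof -
  have [measurable]: "U \<in> borel_measurable borel" by (rule loc_intD(1)[OF U])
  have [measurable]: "Q \<in> borel_measurable borel" by (rule borel_measurable_continuous_onI[OF Q(1)])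
  note [measurable] = \<kappa>(1)
  let ?K = "sheared w K"
  have cK: "compact ?K" by (rule compact_sheared[OF K(1)])
  have [measurable]: "?K \<in> sets borel" using cK by (simp add: compact_imp_closed)
  have "compact (Q ` K)"
    by (intro compact_continuous_image continuous_on_subset[OF Q(1)] K) auto
  then obtain B where B: "B > 0" "\<And>x. x \<in> K \<Longrightarrow> \<bar>Q x\<bar> \<le> B"
    using compact_imp_bounded bounded_pos by (metis (no_types, lifting) imageI real_norm_def)
  have QB: "\<bar>Q x\<bar> \<le> B" for x
    using B Q(2)[of x] by (cases "x \<in> K") auto
  have int0: "integrable lborel (\<lambda>z. indicat_real ?K z * U z)"
    by (rule loc_intD(2)[OF U cK sheared_subset[OF S K(2)]])
  have int01: "integrable lborel (indicat_real {0..1::real})" by simp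
  have base: "integrable (lborel \<Otimes>\<^sub>M lborel) (\<lambda>(z, t). (indicat_real ?K z * U z) * indicat_real {0..1::real} t)"
  proof (rule lborel_pair.Fubini_integrable)
    have "integrable lborel (\<lambda>z. \<bar>indicat_real ?K z * U z\<bar>)"
      using int0 by (rule integrable_abs)
    then show "integrable lborel (\<lambda>z. \<integral>t. norm (case (z, t) of (z, t) \<Rightarrow> (indicat_real ?K z * U z) * indicat_real {0..1::real} t) \<partial>lborel)"
      by (simp add: abs_mult)
  qed (use int01 in auto)
  have "integrable (lborel \<Otimes>\<^sub>M lborel) (\<lambda>(z, t). U z * (indicat_real {0..1} t * \<kappa> t * Q (z - t *\<^sub>R w)))"
  proof (rule Bochner_Integration.integrable_bound)
    show "integrable (lborel \<Otimes>\<^sub>M lborel) (\<lambda>p. B * (case p of (z, t) \<Rightarrow> (indicat_real ?K z * U z) * indicat_real {0..1::real} t))"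
      using base by (rule integrable_mult_right)
    show "AE p in lborel \<Otimes>\<^sub>M lborel. norm (case p of (z, t) \<Rightarrow> U z * (indicat_real {0..1} t * \<kappa> t * Q (z - t *\<^sub>R w)))
        \<le> norm (B * (case p of (z, t) \<Rightarrow> (indicat_real ?K z * U z) * indicat_real {0..1} t))"
    proof (rule AE_I2)
      fix p :: "'a \<times> real"
      obtain z t where p: "p = (z, t)" by fastforce
      show "norm (case p of (z, t) \<Rightarrow> U z * (indicat_real {0..1} t * \<kappa> t * Q (z - t *\<^sub>R w)))
        \<le> norm (B * (case p of (z, t) \<Rightarrow> (indicat_real ?K z * U z) * indicat_real {0..1} t))"
      proof (cases "t \<in> {0..1} \<and> z - t *\<^sub>R w \<in> K")
        case True
        then have "z \<in> ?K" using sheared_mem[of "z - t *\<^sub>R w" K t w] by auto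
        moreover have "\<bar>U z\<bar> * (\<bar>\<kappa> t\<bar> * \<bar>Q (z - t *\<^sub>R w)\<bar>) \<le> \<bar>U z\<bar> * (1 * B)"
          using True \<kappa>(2)[of t] QB B by (intro mult_left_mono mult_mono) auto
        ultimately show ?thesis using True B by (simp add: p abs_mult mult.commute)
      next
        case False
        then have "indicat_real {0..1} t * \<kappa> t * Q (z - t *\<^sub>R w) = 0"
          using Q(2) by (auto simp: indicator_def)
        then show ?thesis
          unfolding p prod.case by (simp only: mult_zero_right norm_zero norm_ge_zero)
      qed
    qed
  qed measurable
  from lborel_pair.Fubini_integral[OF this]
  have "(\<integral>z. (\<integral>t. U z * (indicat_real {0..1} t * \<kappa> t * Q (z - t *\<^sub>R w)) \<partial>lborel) \<partial>lborel)
      = (\<integral>t. (\<integral>z. U z * (indicat_real {0..1} t * \<kappa> t * Q (z - t *\<^sub>R w)) \<partial>lborel) \<partial>lborel)"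
    by simp
  moreover have "(\<integral>z. U z * (indicat_real {0..1} t * \<kappa> t * Q (z - t *\<^sub>R w)) \<partial>lborel)
      = indicat_real {0..1} t * \<kappa> t * (\<integral>z. U z * Q (z - t *\<^sub>R w) \<partial>lborel)" for t
    by (simp add: mult.left_commute[of "U _"])
  ultimately show ?thesis by simp
qed

lemma bump_line_derivative:
  "((\<lambda>t. bump c a b (z - t *\<^sub>R w)) has_real_derivative - (\<Sum>k\<in>UNIV. w $ k * partials [k] (bump c a b) (z - t *\<^sub>R w))) (at t)"
  "((\<lambda>t. partials [k] (bump c a b) (z - t *\<^sub>R w)) has_real_derivative
     - (\<Sum>j\<in>UNIV. w $ j * partials [j, k] (bump c a b) (z - t *\<^sub>R w))) (at t)"
proof -
  have line: "((\<lambda>t. z - t *\<^sub>R w) has_derivative (\<lambda>s. - (s *\<^sub>R w))) (at t)" for t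
    by (auto intro!: derivative_eq_intros)
  have p1: "partials [k] (bump c a b) = partial k (bump c a b)" for k
    by (simp add: partials_def)
  have eq: "(\<lambda>s. \<Sum>i\<in>UNIV. (- (s *\<^sub>R w)) $ i * f i) = (*) (- (\<Sum>i\<in>UNIV. w $ i * f i))" for f :: "'a \<Rightarrow> real"
    by (auto simp: fun_eq_iff sum_negf sum_distrib_left mult_ac)
  show "((\<lambda>t. bump c a b (z - t *\<^sub>R w)) has_real_derivative - (\<Sum>k\<in>UNIV. w $ k * partials [k] (bump c a b) (z - t *\<^sub>R w))) (at t)"
    using has_derivative_compose[OF line bump_has_derivative]
    unfolding has_field_derivative_def p1 eq .
  show "((\<lambda>t. partials [k] (bump c a b) (z - t *\<^sub>R w)) has_real_derivative
     - (\<Sum>j\<in>UNIV. w $ j * partials [j, k] (bump c a b) (z - t *\<^sub>R w))) (at t)"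
    using has_derivative_compose[OF line bump_partial_has_derivative]
    unfolding has_field_derivative_def p1 eq .
qed

lemma continuous_partials_line [continuous_intros]:
  "continuous_on A (\<lambda>t. partials is (bump c a b) (z - t *\<^sub>R w))"
  by (rule continuous_on_compose2[OF bump_partials_continuous]) (auto intro!: continuous_intros)

lemma isCont_partials_line:
  "isCont (\<lambda>t. partials is (bump c a b) (z - t *\<^sub>R w)) t"
  using continuous_partials_line[of UNIV "is" c a b z w] by (simp add: continuous_on_eq_continuous_at)

lemma shifted_cbox_subset:
  fixes a b w :: "'a::euclidean_space"
  assumes "convex S" "cbox a b \<subseteq> {x \<in> S. x + w \<in> S}" "0 \<le> t" "t \<le> 1"
  shows "cbox (a + t *\<^sub>R w) (b + t *\<^sub>R w) \<subseteq> S"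
proof
  fix z assume "z \<in> cbox (a + t *\<^sub>R w) (b + t *\<^sub>R w)"
  then have "z - t *\<^sub>R w \<in> cbox a b"
    by (auto simp: mem_box inner_diff_left inner_add_left algebra_simps)
  then have "z - t *\<^sub>R w + t *\<^sub>R w \<in> S"
    using assms by (intro convex_line_mem[OF assms(1), of _ w]) auto
  then show "z \<in> S" by simp
qed

lemma loc_int_box: "\<lbrakk>loc_int S v; cbox a b \<subseteq> S\<rbrakk> \<Longrightarrow> integrable lborel (\<lambda>x. indicat_real (cbox a b) x * v x)"
  by (rule loc_intD(2)) auto

lemma loc_int_mult_partials:
  fixes v :: "real^'n::finite \<Rightarrow> real"
  assumes "loc_int S v" "cbox a b \<subseteq> S" "c > 0"
  shows "integrable lborel (\<lambda>x. v x * partials is (bump c a b) x)" "integrable lborel (\<lambda>x. v x * bump c a b x)"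
  using integrable_mult_bump[OF loc_intD(1)[OF assms(1)] loc_int_box[OF assms(1,2)] assms(3)]
    integrable_mult_bump0[OF loc_intD(1)[OF assms(1)] loc_int_box[OF assms(1,2)] assms(3)] by auto

lemma pairing_shift:
  fixes v :: "real^'n::finite \<Rightarrow> real"
  assumes S: "convex S" and v: "loc_int S v" and ab: "cbox a b \<subseteq> {x \<in> S. x + w \<in> S}" and c: "c > 0"
  shows "(\<integral>x. v (x + w) * bump c a b x \<partial>lborel) = (\<integral>z. v z * bump c a b (z - w) \<partial>lborel)"
    and "integrable lborel (\<lambda>x. v (x + w) * bump c a b x)" "integrable lborel (\<lambda>z. v z * bump c a b (z - w))"
    and "integrable lborel (\<lambda>x. indicat_real (cbox a b) x * v (x + w))"
proof -
  have [measurable]: "v \<in> borel_measurable borel" by (rule loc_intD(1)[OF v])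
  have sub: "cbox (a + w) (b + w) \<subseteq> S"
    using shifted_cbox_subset[OF S ab, of 1] by simp
  have "integrable lborel (\<lambda>z. v z * bump c (a + w) (b + w) z)"
    by (rule loc_int_mult_partials(2)[OF v sub c])
  then show i: "integrable lborel (\<lambda>z. v z * bump c a b (z - w))" by (simp add: bump_translate)
  show "(\<integral>x. v (x + w) * bump c a b x \<partial>lborel) = (\<integral>z. v z * bump c a b (z - w) \<partial>lborel)"
    using integral_lborel_shift(1)[of "\<lambda>z. v z * bump c a b (z - w)" w] by simp
  show "integrable lborel (\<lambda>x. v (x + w) * bump c a b x)"
    using integral_lborel_shift(2)[of "\<lambda>z. v z * bump c a b (z - w)" w] i by simp
  have "integrable lborel (\<lambda>z. indicat_real (cbox (a + w) (b + w)) z * v z)"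
    by (rule loc_int_box[OF v sub])
  moreover have "indicat_real (cbox (a + w) (b + w)) (x + w) = indicat_real (cbox a b) x" for x
    by (auto simp: indicator_def mem_box inner_add_left)
  ultimately show "integrable lborel (\<lambda>x. indicat_real (cbox a b) x * v (x + w))"
    using integral_lborel_shift(2)[of "\<lambda>z. indicat_real (cbox (a + w) (b + w)) z * v z" w] by simp
qed

text \<open>The increment of \<open>v\<close> paired with a bump is \<open>v\<close> paired with an
  increment of the bump. To the latter the classical theorem applies along the segment, and the weak
  derivatives move the gradient of the bump back onto \<open>v\<close>.\<close>

theorem weak_ftc:
  fixes v :: "real^'n::finite \<Rightarrow> real" and V :: "'n \<Rightarrow> real^'n \<Rightarrow> real"
  assumes S: "convex S" "open S" and v: "loc_int S v" and V: "\<And>k. loc_int S (V k)"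
    and weak: "\<And>k c a b. \<lbrakk>c > 0; cbox a b \<subseteq> S\<rbrakk> \<Longrightarrow>
      (\<integral>x. v x * partials [k] (bump c a b) x \<partial>lborel) = - (\<integral>x. V k x * bump c a b x \<partial>lborel)"
  shows "AE x in lborel. x \<in> {x \<in> S. x + w \<in> S} \<longrightarrow>
      integrable lborel (\<lambda>t. indicat_real {0..1} t * (\<Sum>k\<in>UNIV. w $ k * V k (x + t *\<^sub>R w))) \<and>
      v (x + w) - v x = (\<integral>t. indicat_real {0..1} t * 1 * (\<Sum>k\<in>UNIV. w $ k * V k (x + t *\<^sub>R w)) \<partial>lborel)"
proof -
  let ?O = "{x \<in> S. x + w \<in> S}"
  define W where "W x = (\<Sum>k\<in>UNIV. w $ k * V k x)" for x
  have W: "loc_int S W"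
    unfolding W_def by (intro loc_int_sum loc_int_cmult V)
  have [measurable]: "v \<in> borel_measurable borel" by (rule loc_intD(1)[OF v])
  have "AE x in lborel. x \<in> ?O \<longrightarrow>
      integrable lborel (\<lambda>t. indicat_real {0..1} t * W (x + t *\<^sub>R w)) \<and>
      v (x + w) - v x = (\<integral>t. indicat_real {0..1} t * 1 * W (x + t *\<^sub>R w) \<partial>lborel)"
  proof (rule kernel_identity[OF S W])
    show "(\<lambda>x. v (x + w) - v x) \<in> borel_measurable borel" by measurable
    show "integrable lborel (\<lambda>x. indicat_real (cbox a b) x * (v (x + w) - v x))" if ab: "cbox a b \<subseteq> ?O" for a b
    proof -
      have "cbox a b \<subseteq> S" using ab by blast
      then show ?thesis
        using pairing_shift(4)[OF S(1) v ab, of 1] loc_int_box[OF v] by (simp add: right_diff_distrib)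
    qed
    fix c :: real and a b :: "real^'n" assume c: "c > 0" and ab: "cbox a b \<subseteq> ?O"
    have abS: "cbox a b \<subseteq> S" using ab by blast
    define Q where "Q x = - (\<Sum>k\<in>UNIV. w $ k * partials [k] (bump c a b) x)" for x
    have Q: "continuous_on UNIV Q" "\<And>x. x \<notin> cbox a b \<Longrightarrow> Q x = 0"
      unfolding Q_def
      by (auto intro!: continuous_intros bump_partials_continuous simp: bump_partials_outside[OF c])
    have classical: "bump c a b (z - w) - bump c a b z = (\<integral>t. indicat_real {0..1} t * 1 * Q (z - t *\<^sub>R w) \<partial>lborel)" for z
    proof -
      have "(\<integral>t. Q (z - t *\<^sub>R w) * indicator {0..1} t \<partial>lborel) = bump c a b (z - 1 *\<^sub>R w) - bump c a b (z - 0 *\<^sub>R w)"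
      proof (rule integral_FTC_Icc_real)
        fix t :: real
        show "((\<lambda>t. bump c a b (z - t *\<^sub>R w)) has_real_derivative Q (z - t *\<^sub>R w)) (at t)"
          unfolding Q_def by (rule bump_line_derivative)
        show "isCont (\<lambda>t. Q (z - t *\<^sub>R w)) t"
          unfolding Q_def by (intro continuous_intros isCont_partials_line)
      qed simp
      then show ?thesis by (simp add: mult.commute)
    qed
    have "(\<integral>x. (v (x + w) - v x) * bump c a b x \<partial>lborel)
        = (\<integral>x. v (x + w) * bump c a b x \<partial>lborel) - (\<integral>x. v x * bump c a b x \<partial>lborel)"
      using pairing_shift(2)[OF S(1) v ab c] loc_int_mult_partials(2)[OF v abS c] by (simp add: left_diff_distrib)
    also have "\<dots> = (\<integral>z. v z * (bump c a b (z - w) - bump c a b z) \<partial>lborel)"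
      using pairing_shift(1,3)[OF S(1) v ab c] loc_int_mult_partials(2)[OF v abS c] by (simp add: right_diff_distrib)
    also have "\<dots> = (\<integral>z. v z * (\<integral>t. indicat_real {0..1} t * 1 * Q (z - t *\<^sub>R w) \<partial>lborel) \<partial>lborel)"
      by (simp only: classical)
    also have "\<dots> = (\<integral>t. indicat_real {0..1} t * 1 * (\<integral>z. v z * Q (z - t *\<^sub>R w) \<partial>lborel) \<partial>lborel)"
      by (rule smear[OF S(1) v compact_cbox ab Q]) auto
    also have "\<dots> = (\<integral>t. indicat_real {0..1} t * 1 * (\<integral>z. W z * bump c (a + t *\<^sub>R w) (b + t *\<^sub>R w) z \<partial>lborel) \<partial>lborel)"
    proof (rule Bochner_Integration.integral_cong[OF refl])
      fix t :: real
      show "indicat_real {0..1} t * 1 * (\<integral>z. v z * Q (z - t *\<^sub>R w) \<partial>lborel)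
          = indicat_real {0..1} t * 1 * (\<integral>z. W z * bump c (a + t *\<^sub>R w) (b + t *\<^sub>R w) z \<partial>lborel)"
      proof (cases "t \<in> {0..1}")
        case True
        let ?a = "a + t *\<^sub>R w" and ?b = "b + t *\<^sub>R w"
        have sub: "cbox ?a ?b \<subseteq> S"
          using shifted_cbox_subset[OF S(1) ab] True by simp
        have "(\<integral>z. v z * Q (z - t *\<^sub>R w) \<partial>lborel) = (\<integral>z. (\<Sum>k\<in>UNIV. - (w $ k) * (v z * partials [k] (bump c ?a ?b) z)) \<partial>lborel)"
          by (simp add: Q_def bump_partials_translate sum_distrib_left sum_negf mult_ac)
        also have "\<dots> = (\<Sum>k\<in>UNIV. - (w $ k) * (\<integral>z. v z * partials [k] (bump c ?a ?b) z \<partial>lborel))"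
          using loc_int_mult_partials(1)[OF v sub c] by (subst Bochner_Integration.integral_sum) auto
        also have "\<dots> = (\<Sum>k\<in>UNIV. w $ k * (\<integral>z. V k z * bump c ?a ?b z \<partial>lborel))"
          by (simp add: weak[OF c sub])
        also have "\<dots> = (\<integral>z. (\<Sum>k\<in>UNIV. w $ k * (V k z * bump c ?a ?b z)) \<partial>lborel)"
          using loc_int_mult_partials(2)[OF V sub c] by (subst Bochner_Integration.integral_sum) auto
        also have "\<dots> = (\<integral>z. W z * bump c ?a ?b z \<partial>lborel)"
          by (simp add: W_def sum_distrib_right mult.assoc)
        finally show ?thesis by simp
      qed simp
    qed
    finally show "(\<integral>x. (v (x + w) - v x) * bump c a b x \<partial>lborel)
        = (\<integral>t. indicat_real {0..1} t * 1 * (\<integral>z. W z * bump c (a + t *\<^sub>R w) (b + t *\<^sub>R w) z \<partial>lborel) \<partial>lborel)" .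
  qed auto
  then show ?thesis by (simp add: W_def)
qed

text \<open>The method of \<open>weak_ftc\<close> with the second order Taylor formula of the bump.
  The first order term of \<open>u\<close> corresponds to the term \<open>P\<close> of the bump,
  with the opposite sign that integration by parts produces.\<close>

theorem weak_taylor:
  fixes u :: "real^'n::finite \<Rightarrow> real" and w1 :: "'n \<Rightarrow> real^'n \<Rightarrow> real" and w2 :: "'n \<Rightarrow> 'n \<Rightarrow> real^'n \<Rightarrow> real"
  assumes S: "convex S" "open S" and u: "loc_int S u" and w1: "\<And>k. loc_int S (w1 k)" and w2: "\<And>j k. loc_int S (w2 j k)"
    and weak1: "\<And>k c a b. \<lbrakk>c > 0; cbox a b \<subseteq> S\<rbrakk> \<Longrightarrow>
      (\<integral>x. u x * partials [k] (bump c a b) x \<partial>lborel) = - (\<integral>x. w1 k x * bump c a b x \<partial>lborel)"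
    and weak2: "\<And>j k c a b. \<lbrakk>c > 0; cbox a b \<subseteq> S\<rbrakk> \<Longrightarrow>
      (\<integral>x. u x * partials [j, k] (bump c a b) x \<partial>lborel) = (\<integral>x. w2 j k x * bump c a b x \<partial>lborel)"
  shows "AE x in lborel. x \<in> {x \<in> S. x + w \<in> S} \<longrightarrow>
      integrable lborel (\<lambda>t. indicat_real {0..1} t * (\<Sum>j\<in>UNIV. \<Sum>k\<in>UNIV. w $ j * w $ k * w2 j k (x + t *\<^sub>R w))) \<and>
      u (x + w) - u x - (\<Sum>k\<in>UNIV. w $ k * w1 k x)
        = (\<integral>t. indicat_real {0..1} t * (1 - t) * (\<Sum>j\<in>UNIV. \<Sum>k\<in>UNIV. w $ j * w $ k * w2 j k (x + t *\<^sub>R w)) \<partial>lborel)"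
proof -
  let ?O = "{x \<in> S. x + w \<in> S}"
  define W where "W x = (\<Sum>j\<in>UNIV. \<Sum>k\<in>UNIV. (w $ j * w $ k) * w2 j k x)" for x
  define G where "G x = (\<Sum>k\<in>UNIV. w $ k * w1 k x)" for x
  have W: "loc_int S W"
    unfolding W_def by (intro loc_int_sum loc_int_cmult w2)
  have G: "loc_int S G"
    unfolding G_def by (intro loc_int_sum loc_int_cmult w1)
  have [measurable]: "u \<in> borel_measurable borel" "G \<in> borel_measurable borel"
    by (rule loc_intD(1)[OF u] loc_intD(1)[OF G])+
  have "AE x in lborel. x \<in> ?O \<longrightarrow>
      integrable lborel (\<lambda>t. indicat_real {0..1} t * W (x + t *\<^sub>R w)) \<and>
      u (x + w) - u x - G x = (\<integral>t. indicat_real {0..1} t * (1 - t) * W (x + t *\<^sub>R w) \<partial>lborel)"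
  proof (rule kernel_identity[OF S W])
    show "(\<lambda>x. u (x + w) - u x - G x) \<in> borel_measurable borel" by measurable
    show "integrable lborel (\<lambda>x. indicat_real (cbox a b) x * (u (x + w) - u x - G x))" if ab: "cbox a b \<subseteq> ?O" for a b
    proof -
      have "cbox a b \<subseteq> S" using ab by blast
      then show ?thesis
        using pairing_shift(4)[OF S(1) u ab, of 1] loc_int_box[OF u] loc_int_box[OF G] by (simp add: right_diff_distrib)
    qed
    fix c :: real and a b :: "real^'n" assume c: "c > 0" and ab: "cbox a b \<subseteq> ?O"
    have abS: "cbox a b \<subseteq> S" using ab by blast
    define P where "P x = (\<Sum>k\<in>UNIV. w $ k * partials [k] (bump c a b) x)" for x
    define Q where "Q x = (\<Sum>j\<in>UNIV. \<Sum>k\<in>UNIV. (w $ j * w $ k) * partials [j, k] (bump c a b) x)" for x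
    have Q: "continuous_on UNIV Q" "\<And>x. x \<notin> cbox a b \<Longrightarrow> Q x = 0"
      unfolding Q_def
      by (auto intro!: continuous_intros bump_partials_continuous simp: bump_partials_outside[OF c])
    have classical: "bump c a b (z - w) - bump c a b z + P z = (\<integral>t. indicat_real {0..1} t * (1 - t) * Q (z - t *\<^sub>R w) \<partial>lborel)" for z
    proof -
      \<comment> \<open>An antiderivative of \<open>(1 - t) * Q (z - t *\<^sub>R w)\<close>, found
        by integrating the second derivative along the segment by parts.\<close>
      define F where "F t = (1 - t) * (- P (z - t *\<^sub>R w)) + bump c a b (z - t *\<^sub>R w)" for t
      have "(\<integral>t. ((1 - t) * Q (z - t *\<^sub>R w)) * indicator {0..1} t \<partial>lborel) = F 1 - F 0"
      proof (rule integral_FTC_Icc_real)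
        fix t :: real
        have dP: "((\<lambda>t. - P (z - t *\<^sub>R w)) has_real_derivative Q (z - t *\<^sub>R w)) (at t)"
        proof -
          have "((\<lambda>t. - (\<Sum>k\<in>UNIV. w $ k * partials [k] (bump c a b) (z - t *\<^sub>R w))) has_real_derivative
              - (\<Sum>k\<in>UNIV. w $ k * (- (\<Sum>j\<in>UNIV. w $ j * partials [j, k] (bump c a b) (z - t *\<^sub>R w))))) (at t)"
            by (intro DERIV_minus DERIV_sum DERIV_cmult bump_line_derivative)
          moreover have "- (\<Sum>k\<in>UNIV. w $ k * (- (\<Sum>j\<in>UNIV. w $ j * partials [j, k] (bump c a b) (z - t *\<^sub>R w)))) = Q (z - t *\<^sub>R w)"
            unfolding Q_def by (subst sum.swap) (simp add: sum_negf sum_distrib_left mult_ac)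
          ultimately show ?thesis by (simp add: P_def)
        qed
        have "((\<lambda>t. bump c a b (z - t *\<^sub>R w)) has_real_derivative - P (z - t *\<^sub>R w)) (at t)"
          unfolding P_def by (rule bump_line_derivative)
        moreover have "((\<lambda>t. (1 - t) * (- P (z - t *\<^sub>R w))) has_real_derivative
            (- 1) * (- P (z - t *\<^sub>R w)) + Q (z - t *\<^sub>R w) * (1 - t)) (at t)"
          by (rule DERIV_mult[OF _ dP]) (auto intro!: derivative_eq_intros)
        ultimately show "(F has_real_derivative (1 - t) * Q (z - t *\<^sub>R w)) (at t)"
          unfolding F_def using DERIV_add by (force simp: mult.commute)
        show "isCont (\<lambda>t. (1 - t) * Q (z - t *\<^sub>R w)) t"
          unfolding Q_def by (intro continuous_intros isCont_partials_line)
      qed simp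
      then show ?thesis by (simp add: F_def mult_ac)
    qed
    have iP: "integrable lborel (\<lambda>x. u x * P x)" and eP: "(\<integral>x. u x * P x \<partial>lborel) = - (\<integral>x. G x * bump c a b x \<partial>lborel)"
    proof -
      have uP: "u x * P x = (\<Sum>k\<in>UNIV. w $ k * (u x * partials [k] (bump c a b) x))" for x
        by (simp add: P_def sum_distrib_left mult_ac)
      have Gb: "G x * bump c a b x = (\<Sum>k\<in>UNIV. w $ k * (w1 k x * bump c a b x))" for x
        by (simp add: G_def sum_distrib_right mult.assoc)
      note i1 = loc_int_mult_partials(1)[OF u abS c] and i2 = loc_int_mult_partials(2)[OF w1 abS c]
      show "integrable lborel (\<lambda>x. u x * P x)"
        unfolding uP using i1 by auto
      have "(\<integral>x. u x * P x \<partial>lborel) = (\<Sum>k\<in>UNIV. w $ k * (\<integral>x. u x * partials [k] (bump c a b) x \<partial>lborel))"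
        unfolding uP using i1 by (subst Bochner_Integration.integral_sum) auto
      also have "\<dots> = - (\<Sum>k\<in>UNIV. w $ k * (\<integral>x. w1 k x * bump c a b x \<partial>lborel))"
        by (simp add: weak1[OF c abS] sum_negf)
      also have "(\<Sum>k\<in>UNIV. w $ k * (\<integral>x. w1 k x * bump c a b x \<partial>lborel)) = (\<integral>x. G x * bump c a b x \<partial>lborel)"
        unfolding Gb using i2 by (subst Bochner_Integration.integral_sum) auto
      finally show "(\<integral>x. u x * P x \<partial>lborel) = - (\<integral>x. G x * bump c a b x \<partial>lborel)" .
    qed
    have "(\<integral>x. (u (x + w) - u x - G x) * bump c a b x \<partial>lborel)
        = (\<integral>x. u (x + w) * bump c a b x \<partial>lborel) - (\<integral>x. u x * bump c a b x \<partial>lborel) - (\<integral>x. G x * bump c a b x \<partial>lborel)"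
      using pairing_shift(2)[OF S(1) u ab c] loc_int_mult_partials(2)[OF u abS c] loc_int_mult_partials(2)[OF G abS c]
      by (simp add: left_diff_distrib)
    also have "\<dots> = (\<integral>z. u z * (bump c a b (z - w) - bump c a b z + P z) \<partial>lborel)"
      using pairing_shift(1,3)[OF S(1) u ab c] loc_int_mult_partials(2)[OF u abS c] iP eP
      by (simp add: right_diff_distrib distrib_left)
    also have "\<dots> = (\<integral>z. u z * (\<integral>t. indicat_real {0..1} t * (1 - t) * Q (z - t *\<^sub>R w) \<partial>lborel) \<partial>lborel)"
      by (simp only: classical)
    also have "\<dots> = (\<integral>t. indicat_real {0..1} t * (1 - t) * (\<integral>z. u z * Q (z - t *\<^sub>R w) \<partial>lborel) \<partial>lborel)"
      by (rule smear[OF S(1) u compact_cbox ab Q]) auto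
    also have "\<dots> = (\<integral>t. indicat_real {0..1} t * (1 - t) * (\<integral>z. W z * bump c (a + t *\<^sub>R w) (b + t *\<^sub>R w) z \<partial>lborel) \<partial>lborel)"
    proof (rule Bochner_Integration.integral_cong[OF refl])
      fix t :: real
      show "indicat_real {0..1} t * (1 - t) * (\<integral>z. u z * Q (z - t *\<^sub>R w) \<partial>lborel)
          = indicat_real {0..1} t * (1 - t) * (\<integral>z. W z * bump c (a + t *\<^sub>R w) (b + t *\<^sub>R w) z \<partial>lborel)"
      proof (cases "t \<in> {0..1}")
        case True
        let ?a = "a + t *\<^sub>R w" and ?b = "b + t *\<^sub>R w"
        have sub: "cbox ?a ?b \<subseteq> S"
          using shifted_cbox_subset[OF S(1) ab] True by simp
        note i1 = loc_int_mult_partials(1)[OF u sub c] and i2 = loc_int_mult_partials(2)[OF w2 sub c]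
        have "(\<integral>z. u z * Q (z - t *\<^sub>R w) \<partial>lborel) = (\<integral>z. (\<Sum>j\<in>UNIV. \<Sum>k\<in>UNIV. (w $ j * w $ k) * (u z * partials [j, k] (bump c ?a ?b) z)) \<partial>lborel)"
          by (simp add: Q_def bump_partials_translate sum_distrib_left mult_ac)
        also have "\<dots> = (\<Sum>j\<in>UNIV. \<Sum>k\<in>UNIV. (w $ j * w $ k) * (\<integral>z. u z * partials [j, k] (bump c ?a ?b) z \<partial>lborel))"
          using i1 by (subst Bochner_Integration.integral_sum, force, subst Bochner_Integration.integral_sum) auto
        also have "\<dots> = (\<Sum>j\<in>UNIV. \<Sum>k\<in>UNIV. (w $ j * w $ k) * (\<integral>z. w2 j k z * bump c ?a ?b z \<partial>lborel))"
          by (simp add: weak2[OF c sub])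
        also have "\<dots> = (\<integral>z. (\<Sum>j\<in>UNIV. \<Sum>k\<in>UNIV. (w $ j * w $ k) * (w2 j k z * bump c ?a ?b z)) \<partial>lborel)"
          using i2 by (subst Bochner_Integration.integral_sum, force, subst Bochner_Integration.integral_sum) auto
        also have "\<dots> = (\<integral>z. W z * bump c ?a ?b z \<partial>lborel)"
          by (simp add: W_def sum_distrib_right mult.assoc)
        finally show ?thesis by simp
      qed simp
    qed
    finally show "(\<integral>x. (u (x + w) - u x - G x) * bump c a b x \<partial>lborel)
        = (\<integral>t. indicat_real {0..1} t * (1 - t) * (\<integral>z. W z * bump c (a + t *\<^sub>R w) (b + t *\<^sub>R w) z \<partial>lborel) \<partial>lborel)" .
  qed auto
  then show ?thesis by (simp add: W_def G_def)
qed

text \<open>Lebesgue measurable functions do not compose with translations jointly measurably, so every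
  locally integrable function is replaced by a Borel function that agrees with it almost everywhere.\<close>

definition borel_rep :: "'a::euclidean_space set \<Rightarrow> ('a \<Rightarrow> real) \<Rightarrow> ('a \<Rightarrow> real) \<Rightarrow> bool" where
  "borel_rep S v v' \<longleftrightarrow> loc_int S v' \<and> (\<lambda>x. indicat_real S x * v x) \<in> borel_measurable lebesgue \<and>
     (AE x in lborel. x \<in> S \<longrightarrow> v x = v' x)"

lemma ex_borel_rep:
  fixes v :: "real^'n::finite \<Rightarrow> real"
  assumes v: "locally_integrable_on (ball z r) v" and r: "r > 0"
  shows "\<exists>v'. borel_rep (ball z r) v v'"
proof -
  let ?S = "ball z r"
  \<comment> \<open>Closed balls that exhaust the open one: local integrability speaks of compact
    sets, and the limit gives measurability on the whole ball.\<close>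
  define K where "K n = cball z (r - r / (real n + 2))" for n
  have Ksub: "compact (K n)" "K n \<subseteq> ?S" for n
  proof -
    have "r / (real n + 2) > 0" using r by simp
    then show "compact (K n)" "K n \<subseteq> ?S" by (auto simp: K_def)
  qed
  have intK: "integrable lebesgue (\<lambda>x. indicat_real C x * v x)" if "compact C" "C \<subseteq> ?S" for C
    using v that unfolding locally_integrable_on_def set_integrable_def by auto
  have meas: "(\<lambda>x. indicat_real ?S x * v x) \<in> borel_measurable lebesgue"
  proof (rule borel_measurable_LIMSEQ_real)
    show "(\<lambda>x. indicat_real (K n) x * v x) \<in> borel_measurable lebesgue" for n
      by (rule borel_measurable_integrable[OF intK[OF Ksub]])
    fix x :: "real^'n"
    show "(\<lambda>n. indicat_real (K n) x * v x) \<longlonglongrightarrow> indicat_real ?S x * v x"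
    proof (cases "x \<in> ?S")
      case True
      have "(\<lambda>n. r / real (n + 2)) \<longlonglongrightarrow> 0"
        by (rule LIMSEQ_ignore_initial_segment[OF lim_const_over_n])
      then have "(\<lambda>n. r - r / (real n + 2)) \<longlonglongrightarrow> r - 0"
        by (intro tendsto_diff tendsto_const) (simp add: add.commute)
      then have "eventually (\<lambda>n. dist z x < r - r / (real n + 2)) sequentially"
        using True by (intro order_tendstoD(1)) auto
      then have "eventually (\<lambda>n. indicat_real (K n) x * v x = indicat_real ?S x * v x) sequentially"
        by (rule eventually_mono) (use True in \<open>auto simp: K_def\<close>)
      then show ?thesis by (rule tendsto_eventually)
    next
      case False
      then have "x \<notin> K n" for n using Ksub(2) by blast
      then show ?thesis using False by simp
    qed
  qed
  obtain v' where v': "v' \<in> borel_measurable lborel" "AE x in lborel. indicat_real ?S x * v x = v' x"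
    using completion_ex_borel_measurable_real[OF meas] by blast
  have ae: "AE x in lborel. x \<in> ?S \<longrightarrow> v x = v' x"
    using v'(2) by eventually_elim auto
  have "loc_int ?S v'"
    unfolding loc_int_def
  proof (intro conjI allI impI)
    show [measurable]: "v' \<in> borel_measurable borel" using v'(1) by simp
    fix C assume C: "compact C \<and> C \<subseteq> ?S"
    then have [measurable]: "C \<in> sets borel" by (simp add: compact_imp_closed)
    have "AE x in lebesgue. indicat_real C x * v x = indicat_real C x * v' x"
      using AE_completion[OF ae] by eventually_elim (use C in \<open>auto simp: indicator_def\<close>)
    then have "integrable lebesgue (\<lambda>x. indicat_real C x * v' x)"
    proof (rule integrable_cong_AE_imp[rotated 2])
      show "integrable lebesgue (\<lambda>x. indicat_real C x * v x)" using intK C by blast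
      show "(\<lambda>x. indicat_real C x * v' x) \<in> borel_measurable lebesgue"
        by (intro measurable_completion) simp
    qed
    then show "integrable lborel (\<lambda>x. indicat_real C x * v' x)"
      by (subst (asm) integrable_completion) auto
  qed
  then show ?thesis using meas ae by (auto simp: borel_rep_def)
qed

text \<open>For continuous functions the representative is explicit and agrees with \<open>u\<close>
  everywhere in the ball, so that the final estimate for \<open>u\<close> holds at every
  point.\<close>

lemma borel_rep_continuous:
  fixes u :: "real^'n::finite \<Rightarrow> real"
  assumes u: "continuous_on (ball z r) u"
  shows "borel_rep (ball z r) u (\<lambda>x. indicat_real (ball z r) x * u x)"
proof -
  let ?S = "ball z r"
  have m: "(\<lambda>x. indicat_real ?S x * u x) \<in> borel_measurable borel"
    using borel_measurable_continuous_on_indicator[OF _ u] by simp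
  have "integrable lborel (\<lambda>x. indicat_real K x * (indicat_real ?S x * u x))" if K: "compact K" "K \<subseteq> ?S" for K
  proof -
    have "integrable lborel (\<lambda>x. indicator K x *\<^sub>R u x)"
      using K continuous_on_subset[OF u] by (intro borel_integrable_compact) auto
    moreover have "(\<lambda>x. indicator K x *\<^sub>R u x) = (\<lambda>x. indicat_real K x * (indicat_real ?S x * u x))"
      using K(2) by (auto simp: indicator_def fun_eq_iff)
    ultimately show ?thesis by simp
  qed
  then show ?thesis
    using m unfolding borel_rep_def loc_int_def by (auto intro!: AE_I2 measurable_completion)
qed

lemma borel_rep_pairing:
  fixes v :: "real^'n::finite \<Rightarrow> real"
  assumes rep: "borel_rep S v v'" and S: "open S" and c: "c > 0" and ab: "cbox a b \<subseteq> S"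
  shows "(LINT x:S|lebesgue. v x * partials is (bump c a b) x) = (\<integral>x. v' x * partials is (bump c a b) x \<partial>lborel)"
proof -
  let ?F = "partials is (bump c a b)"
  have v': "loc_int S v'" and m: "(\<lambda>x. indicat_real S x * v x) \<in> borel_measurable lebesgue"
    and ae: "AE x in lborel. x \<in> S \<longrightarrow> v x = v' x"
    using rep by (auto simp: borel_rep_def)
  have [measurable]: "v' \<in> borel_measurable borel" by (rule loc_intD(1)[OF v'])
  have F: "?F \<in> borel_measurable lebesgue"
    by (intro measurable_completion) simp
  have F0: "?F x = 0" if "x \<notin> S" for x
    using bump_partials_outside[OF c] ab that by blast
  have "(LINT x:S|lebesgue. v x * ?F x) = (\<integral>x. (indicat_real S x * v x) * ?F x \<partial>lebesgue)"
    by (simp add: set_lebesgue_integral_def mult.assoc)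
  also have "\<dots> = (\<integral>x. v' x * ?F x \<partial>lebesgue)"
  proof (rule integral_cong_AE)
    show "(\<lambda>x. indicat_real S x * v x * ?F x) \<in> borel_measurable lebesgue"
      using m F by (rule borel_measurable_times)
    show "(\<lambda>x. v' x * ?F x) \<in> borel_measurable lebesgue"
      by (intro measurable_completion) simp
    show "AE x in lebesgue. indicat_real S x * v x * ?F x = v' x * ?F x"
      using AE_completion[OF ae] by eventually_elim (use F0 in \<open>auto simp: indicator_def\<close>)
  qed
  also have "\<dots> = (\<integral>x. v' x * ?F x \<partial>lborel)"
    by (rule integral_completion) simp
  finally show ?thesis .
qed

lemma weak_deriv_pairing:
  fixes u :: "real^'n::finite \<Rightarrow> real"
  assumes V: "is_weak_deriv S u is V" and reps: "borel_rep S u u'" "borel_rep S V V'"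
    and S: "open S" and c: "c > 0" and ab: "cbox a b \<subseteq> S"
  shows "(\<integral>x. u' x * partials is (bump c a b) x \<partial>lborel) = (- 1) ^ length is * (\<integral>x. V' x * bump c a b x \<partial>lborel)"
proof -
  have t: "test_function S (bump c a b)"
    using test_function_bump[OF c ab, of "[]"] by (simp add: partials_def)
  have "(LINT x:S|lebesgue. u x * partials is (bump c a b) x) = (- 1) ^ length is * (LINT x:S|lebesgue. V x * bump c a b x)"
    using V t by (simp add: is_weak_deriv_def)
  then show ?thesis
    using borel_rep_pairing[OF reps(1) S c ab, of "is"] borel_rep_pairing[OF reps(2) S c ab, of "[]"]
    by (simp add: partials_def)
qed

text \<open>Both weak derivatives refer to \<open>u\<close>. Since the last entry of a list is
  differentiated first, testing with \<open>partials [i]\<close> of a bump is testing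
  \<open>u\<close> with one derivative more.\<close>

lemma weak_deriv_chain:
  fixes u :: "real^'n::finite \<Rightarrow> real"
  assumes v: "is_weak_deriv S u is v" and V: "is_weak_deriv S u (is @ [i]) V"
    and reps: "borel_rep S v v'" "borel_rep S V V'" and S: "open S" and c: "c > 0" and ab: "cbox a b \<subseteq> S"
  shows "(\<integral>x. v' x * partials [i] (bump c a b) x \<partial>lborel) = - (\<integral>x. V' x * bump c a b x \<partial>lborel)"
proof -
  have t: "test_function S (bump c a b)" "test_function S (partials [i] (bump c a b))"
    using test_function_bump[OF c ab, of "[]"] test_function_bump[OF c ab, of "[i]"] by (simp_all add: partials_def)
  have comp: "partials is (partials [i] (bump c a b)) = partials (is @ [i]) (bump c a b)"
    by (simp add: partials_def)
  have "(LINT x:S|lebesgue. u x * partials (is @ [i]) (bump c a b) x) = (- 1) ^ length is * (LINT x:S|lebesgue. v x * partials [i] (bump c a b) x)"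
    using v t(2) unfolding is_weak_deriv_def comp[symmetric] by blast
  moreover have "(LINT x:S|lebesgue. u x * partials (is @ [i]) (bump c a b) x) = (- 1) ^ length (is @ [i]) * (LINT x:S|lebesgue. V x * bump c a b x)"
    using V t(1) unfolding is_weak_deriv_def by blast
  ultimately have "(- 1) ^ length is * (LINT x:S|lebesgue. v x * partials [i] (bump c a b) x)
      = (- 1) ^ length is * (- (LINT x:S|lebesgue. V x * bump c a b x))"
    by simp
  moreover have "(- 1 :: real) ^ length is \<noteq> 0" by simp
  ultimately have "(LINT x:S|lebesgue. v x * partials [i] (bump c a b) x) = - (LINT x:S|lebesgue. V x * bump c a b x)"
    by (metis mult_left_cancel)
  then show ?thesis
    using borel_rep_pairing[OF reps(1) S c ab, of "[i]"] borel_rep_pairing[OF reps(2) S c ab, of "[]"]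
    by (simp add: partials_def)
qed

text \<open>The mixed derivatives of a bump commute, so \<open>V\<close> and \<open>W\<close> have
  the same pairings with all bumps.\<close>

lemma mixed_weak_deriv_symmetric:
  fixes u' :: "real^'n::finite \<Rightarrow> real"
  assumes S: "open S" and li: "loc_int S V" "loc_int S W"
    and V: "\<And>c a b. \<lbrakk>c > 0; cbox a b \<subseteq> S\<rbrakk> \<Longrightarrow> (\<integral>x. u' x * partials [i, j] (bump c a b) x \<partial>lborel) = (\<integral>x. V x * bump c a b x \<partial>lborel)"
    and W: "\<And>c a b. \<lbrakk>c > 0; cbox a b \<subseteq> S\<rbrakk> \<Longrightarrow> (\<integral>x. u' x * partials [j, i] (bump c a b) x \<partial>lborel) = (\<integral>x. W x * bump c a b x \<partial>lborel)"
  shows "AE x in lborel. x \<in> S \<longrightarrow> V x = W x"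
proof -
  have [measurable]: "V \<in> borel_measurable borel" "W \<in> borel_measurable borel"
    by (rule loc_intD(1)[OF li(1)], rule loc_intD(1)[OF li(2)])
  have box: "integrable lborel (\<lambda>x. indicat_real (cbox a b) x * V x)" "integrable lborel (\<lambda>x. indicat_real (cbox a b) x * W x)"
    if "cbox a b \<subseteq> S" for a b
    using loc_intD(2)[OF li(1), of "cbox a b"] loc_intD(2)[OF li(2), of "cbox a b"] that by auto
  have "AE x in lborel. x \<in> S \<longrightarrow> V x - W x = 0"
  proof (rule fundamental_lemma[OF S])
    show "integrable lborel (\<lambda>x. indicat_real (cbox a b) x * (V x - W x))" if "cbox a b \<subseteq> S" for a b
      using box[OF that] by (simp add: right_diff_distrib)
    show "(\<integral>x. (V x - W x) * bump c a b x \<partial>lborel) = 0" if c: "c > 0" "cbox a b \<subseteq> S" for c a b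
    proof -
      have "(\<integral>x. (V x - W x) * bump c a b x \<partial>lborel) = (\<integral>x. V x * bump c a b x \<partial>lborel) - (\<integral>x. W x * bump c a b x \<partial>lborel)"
        using integrable_mult_bump0[OF _ box(1)[OF c(2)] c(1)] integrable_mult_bump0[OF _ box(2)[OF c(2)] c(1)]
        by (simp add: left_diff_distrib)
      also have "\<dots> = 0"
        unfolding V[OF c, symmetric] W[OF c, symmetric]
        using partials_prodfun_commute[OF bump_smooth1, of i j c a b] by (simp add: bump_def)
      finally show ?thesis .
    qed
  qed measurable
  then show ?thesis by eventually_elim simp
qed

section \<open>Weak Taylor estimate\<close>

lemma nn_integral_lborel_affine:
  fixes F :: "'a::euclidean_space \<Rightarrow> ennreal"
  assumes [measurable]: "F \<in> borel_measurable borel" and s: "s > 0"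
  shows "(\<integral>\<^sup>+z. F z \<partial>lborel) = ennreal (s ^ DIM('a)) * (\<integral>\<^sup>+y. F (x + s *\<^sub>R y) \<partial>lborel)"
proof -
  have "(\<integral>\<^sup>+z. F z \<partial>lborel) = (\<integral>\<^sup>+z. F z \<partial>density (distr lborel borel (\<lambda>y. x + s *\<^sub>R y)) (\<lambda>_. ennreal (\<bar>s\<bar> ^ DIM('a))))"
    using lborel_affine[of s x] s by simp
  also have "\<dots> = (\<integral>\<^sup>+z. ennreal (s ^ DIM('a)) * F z \<partial>distr lborel borel (\<lambda>y. x + s *\<^sub>R y))"
    using s by (subst nn_integral_density) auto
  also have "\<dots> = (\<integral>\<^sup>+y. ennreal (s ^ DIM('a)) * F (x + s *\<^sub>R y) \<partial>lborel)"
    by (subst nn_integral_distr) auto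
  also have "\<dots> = ennreal (s ^ DIM('a)) * (\<integral>\<^sup>+y. F (x + s *\<^sub>R y) \<partial>lborel)"
    by (subst nn_integral_cmult) auto
  finally show ?thesis .
qed

text \<open>Either \<open>m \<le> c\<close>, or each of \<open>n - 1\<close> factors
  \<open>m / c\<close> exceeds one. With \<open>c\<close> chosen suitably this does the work of
  Hoelder's inequality when an integral of \<open>m ^ n\<close> is under control.\<close>

lemma le_young_power:
  fixes m c :: real
  assumes "c > 0" "m \<ge> 0" "n \<ge> 1"
  shows "m \<le> c + m ^ n / c ^ (n - 1)"
proof (cases "m \<le> c")
  case True
  have "0 \<le> m ^ n / c ^ (n - 1)" using assms by simp
  then show ?thesis using True by linarith
next
  case False
  have "m * c ^ (n - 1) \<le> m * m ^ (n - 1)"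
    using False assms by (intro mult_left_mono power_mono) auto
  also have "\<dots> = m ^ n" using assms by (cases n) auto
  finally have "m \<le> m ^ n / c ^ (n - 1)"
    using assms by (simp add: pos_le_divide_eq)
  then show ?thesis using assms by linarith
qed

text \<open>Contracting the ball towards \<open>x\<close> by the factor \<open>s\<close> costs \<open>s ^ (- n)\<close> in the integral; with the
  weight \<open>s\<close> of the Taylor remainder the exponent \<open>n\<close> is just enough.\<close>

lemma contraction_bound:
  fixes m :: "'a::euclidean_space \<Rightarrow> real"
  assumes [measurable]: "m \<in> borel_measurable borel" and m0: "\<And>x. m x \<ge> 0"
    and sub: "S' \<subseteq> S" "convex S'" "S \<in> sets borel" "S' \<in> sets borel" and x: "x \<in> S'"
    and s: "0 < s" "s \<le> 1" and E: "E > 0" and A: "A \<ge> 0" "emeasure lborel S' \<le> ennreal A"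
    and bound: "(\<integral>\<^sup>+z. indicator S z * ennreal (m z ^ DIM('a)) \<partial>lborel) \<le> ennreal (B * E ^ DIM('a))" and B: "B \<ge> 0"
  shows "ennreal s * (\<integral>\<^sup>+y. indicator S' y * ennreal (m (x + s *\<^sub>R (y - x))) \<partial>lborel) \<le> ennreal (E * (A + B))"
proof -
  let ?n = "DIM('a)"
  note [measurable] = sub(3,4)
  \<comment> \<open>Balances the two terms: each becomes a constant multiple of
    \<open>E / s\<close>.\<close>
  define c where "c = E / s"
  have c: "c > 0" using E s by (simp add: c_def)
  have inS: "x + s *\<^sub>R (y - x) \<in> S" if "y \<in> S'" for y
  proof -
    have "(1 - s) *\<^sub>R x + s *\<^sub>R y \<in> S'"
      using sub(2) x that s by (intro convexD) auto
    then show ?thesis using sub(1) by (auto simp: algebra_simps)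
  qed
  define F where "F z = indicator S z * ennreal (m z ^ ?n)" for z
  have [measurable]: "F \<in> borel_measurable borel" unfolding F_def by measurable
  have "(\<integral>\<^sup>+y. indicator S' y * ennreal (m (x + s *\<^sub>R (y - x))) \<partial>lborel)
      \<le> (\<integral>\<^sup>+y. ennreal c * indicator S' y + ennreal (1 / c ^ (?n - 1)) * F ((x - s *\<^sub>R x) + s *\<^sub>R y) \<partial>lborel)"
  proof (rule nn_integral_mono)
    fix y
    have eq: "(x - s *\<^sub>R x) + s *\<^sub>R y = x + s *\<^sub>R (y - x)" by (simp add: algebra_simps)
    show "indicator S' y * ennreal (m (x + s *\<^sub>R (y - x)))
        \<le> ennreal c * indicator S' y + ennreal (1 / c ^ (?n - 1)) * F ((x - s *\<^sub>R x) + s *\<^sub>R y)"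
    proof (cases "y \<in> S'")
      case True
      let ?m = "m (x + s *\<^sub>R (y - x))"
      have "ennreal ?m \<le> ennreal (c + 1 / c ^ (?n - 1) * ?m ^ ?n)"
        using le_young_power[OF c m0[of "x + s *\<^sub>R (y - x)"], of ?n] by (intro ennreal_leI) simp
      also have "\<dots> = ennreal c + ennreal (1 / c ^ (?n - 1)) * ennreal (?m ^ ?n)"
        using c m0 by (simp add: ennreal_mult[symmetric] flip: ennreal_plus)
      finally show ?thesis using True inS[OF True] by (simp add: F_def eq)
    qed simp
  qed
  also have "\<dots> = ennreal c * emeasure lborel S' + ennreal (1 / c ^ (?n - 1)) * (\<integral>\<^sup>+y. F ((x - s *\<^sub>R x) + s *\<^sub>R y) \<partial>lborel)"
    by (subst nn_integral_add) (auto simp: nn_integral_cmult)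
  finally have 1: "(\<integral>\<^sup>+y. indicator S' y * ennreal (m (x + s *\<^sub>R (y - x))) \<partial>lborel)
      \<le> ennreal c * emeasure lborel S' + ennreal (1 / c ^ (?n - 1)) * (\<integral>\<^sup>+y. F ((x - s *\<^sub>R x) + s *\<^sub>R y) \<partial>lborel)" .
  have "ennreal (s ^ ?n) * (\<integral>\<^sup>+y. F ((x - s *\<^sub>R x) + s *\<^sub>R y) \<partial>lborel) \<le> ennreal (B * E ^ ?n)"
    using nn_integral_lborel_affine[of F s "x - s *\<^sub>R x"] bound s by (simp add: F_def)
  then have "ennreal (1 / s ^ ?n) * (ennreal (s ^ ?n) * (\<integral>\<^sup>+y. F ((x - s *\<^sub>R x) + s *\<^sub>R y) \<partial>lborel)) \<le> ennreal (1 / s ^ ?n) * ennreal (B * E ^ ?n)"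
    by (rule mult_left_mono) simp
  then have "(\<integral>\<^sup>+y. F ((x - s *\<^sub>R x) + s *\<^sub>R y) \<partial>lborel) \<le> ennreal (1 / s ^ ?n * (B * E ^ ?n))"
    using s B E by (simp add: mult.assoc[symmetric] ennreal_mult[symmetric])
  then have 2: "ennreal (1 / c ^ (?n - 1)) * (\<integral>\<^sup>+y. F ((x - s *\<^sub>R x) + s *\<^sub>R y) \<partial>lborel)
      \<le> ennreal (1 / c ^ (?n - 1)) * ennreal (1 / s ^ ?n * (B * E ^ ?n))"
    by (rule mult_left_mono) simp
  have "(\<integral>\<^sup>+y. indicator S' y * ennreal (m (x + s *\<^sub>R (y - x))) \<partial>lborel)
      \<le> ennreal c * ennreal A + ennreal (1 / c ^ (?n - 1)) * ennreal (1 / s ^ ?n * (B * E ^ ?n))"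
    by (rule order_trans[OF 1 add_mono[OF mult_left_mono[OF A(2)] 2]]) simp
  then have "ennreal s * (\<integral>\<^sup>+y. indicator S' y * ennreal (m (x + s *\<^sub>R (y - x))) \<partial>lborel)
      \<le> ennreal s * (ennreal c * ennreal A + ennreal (1 / c ^ (?n - 1)) * ennreal (1 / s ^ ?n * (B * E ^ ?n)))"
    by (rule mult_left_mono) simp
  also have "\<dots> = ennreal (s * (c * A + 1 / c ^ (?n - 1) * (1 / s ^ ?n * (B * E ^ ?n))))"
    using s c A B E by (simp add: ennreal_mult[symmetric] flip: ennreal_plus)
  also have "s * (c * A + 1 / c ^ (?n - 1) * (1 / s ^ ?n * (B * E ^ ?n))) = E * (A + B)"
  proof -
    obtain k where k: "?n = Suc k" using DIM_positive[where 'a='a] by (cases ?n) auto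
    have "1 / c ^ k * (1 / s ^ Suc k * (B * E ^ Suc k)) = B * E / s"
      using s E by (simp add: c_def power_divide field_simps)
    then have "s * (c * A + 1 / c ^ (?n - 1) * (1 / s ^ ?n * (B * E ^ ?n))) = s * (c * A + B * E / s)"
      by (simp only: k diff_Suc_1)
    also have "\<dots> = E * (A + B)" using s by (simp add: c_def algebra_simps)
    finally show ?thesis .
  qed
  finally show ?thesis .
qed

text \<open>A nonempty open set contains a ball of positive measure. This turns almost everywhere
  bounds for continuous functions into pointwise ones.\<close>

lemma open_AE_empty:
  fixes U :: "'a::euclidean_space set"
  assumes "open U" "AE x in lborel. x \<notin> U"
  shows "U = {}"
proof (rule ccontr)
  assume "U \<noteq> {}"
  then obtain x e where e: "e > 0" "ball x e \<subseteq> U"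
    using assms(1) open_contains_ball by blast
  have "AE y in lborel. y \<notin> ball x e"
    using assms(2) by eventually_elim (use e in blast)
  then have "ball x e \<in> null_sets lborel"
    by (simp add: AE_iff_null_sets)
  then have "measure lborel (ball x e) = 0"
    by (simp add: measure_def null_setsD1)
  then show False using content_ball_pos[OF e(1), of x] by simp
qed

text \<open>The exceptional set of points \<open>y\<close> varies with the shift \<open>a\<close>.
  Tonelli gathers the shifts: for almost every \<open>x\<close> the property holds for almost every
  \<open>y\<close> with the shift \<open>a = x - y\<close>. The value zero encodes success, so that
  a vanishing integral expresses the claim.\<close>

lemma AE_lborel_reflect_shift:
  fixes H :: "'a::euclidean_space \<Rightarrow> 'a \<Rightarrow> ennreal"
  assumes [measurable]: "case_prod H \<in> borel_measurable (borel \<Otimes>\<^sub>M borel)"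
    and ae: "\<And>a. AE y in lborel. H (y + a) y = 0"
  shows "AE x in lborel. AE y in lborel. H x y = 0"
proof -
  have [measurable]: "case_prod H \<in> borel_measurable (lborel \<Otimes>\<^sub>M lborel)"
    using assms(1) by (simp cong: measurable_cong_sets sets_pair_measure_cong)
  have "(\<integral>\<^sup>+x. \<integral>\<^sup>+y. H x y \<partial>lborel \<partial>lborel) = (\<integral>\<^sup>+y. \<integral>\<^sup>+x. H x y \<partial>lborel \<partial>lborel)"
    by (rule lborel_pair.Fubini'[symmetric]) measurable
  also have "\<dots> = (\<integral>\<^sup>+y. \<integral>\<^sup>+a. H (y + a) y \<partial>lborel \<partial>lborel)"
  proof (rule nn_integral_cong)
    fix y
    have "(\<integral>\<^sup>+a. H (a + y) y \<partial>lborel) = (\<integral>\<^sup>+x. H x y \<partial>lborel)"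
      by (rule nn_integral_lborel_translate) measurable
    then show "(\<integral>\<^sup>+x. H x y \<partial>lborel) = (\<integral>\<^sup>+a. H (y + a) y \<partial>lborel)" by (simp add: add.commute)
  qed
  also have "\<dots> = (\<integral>\<^sup>+a. \<integral>\<^sup>+y. H (y + a) y \<partial>lborel \<partial>lborel)"
    by (rule lborel_pair.Fubini'[of "\<lambda>a y. H (y + a) y"]) measurable
  also have "\<dots> = (\<integral>\<^sup>+a. 0 \<partial>(lborel :: 'a measure))"
    by (intro nn_integral_cong) (use ae in \<open>simp add: nn_integral_0_iff_AE\<close>)
  finally have "(\<integral>\<^sup>+x. \<integral>\<^sup>+y. H x y \<partial>lborel \<partial>lborel) = 0" by simp
  then have "AE x in lborel. (\<integral>\<^sup>+y. H x y \<partial>lborel) = 0"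
    by (subst (asm) nn_integral_0_iff_AE) auto
  then show ?thesis
    by eventually_elim (subst (asm) nn_integral_0_iff_AE, auto)
qed

definition mat_of :: "('n::finite \<Rightarrow> 'n \<Rightarrow> real^'n \<Rightarrow> real) \<Rightarrow> real^'n \<Rightarrow> real^'n^'n" where
  "mat_of w x = (\<chi> j k. w j k x)"

lemma mat_of_form: "a \<bullet> (mat_of w x *v a) = (\<Sum>j\<in>UNIV. \<Sum>k\<in>UNIV. a $ j * a $ k * w j k x)"
  by (simp add: mat_of_def inner_vec_def matrix_vector_mult_def sum_distrib_left mult_ac)

lemma norm_mat_of_measurable:
  fixes M :: "real^'n::finite^'n"
  assumes [measurable]: "\<And>j k. w j k \<in> borel_measurable borel"
  shows "(\<lambda>x. norm (mat_of w x - M)) \<in> borel_measurable borel"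
  unfolding norm_vec_def L2_set_def mat_of_def by simp

lemma loc_int_mult_continuous:
  fixes v :: "'a::euclidean_space \<Rightarrow> real"
  assumes v: "loc_int S v" and f: "continuous_on UNIV f"
  shows "loc_int S (\<lambda>x. v x * f x)"
  unfolding loc_int_def
proof (intro conjI allI impI)
  have [measurable]: "v \<in> borel_measurable borel" "f \<in> borel_measurable borel"
    by (rule loc_intD(1)[OF v], rule borel_measurable_continuous_onI[OF f])
  show "(\<lambda>x. v x * f x) \<in> borel_measurable borel" by measurable
  fix K assume K: "compact K \<and> K \<subseteq> S"
  then have [measurable]: "K \<in> sets borel" by (simp add: compact_imp_closed)
  have "compact (f ` K)"
    using K by (intro compact_continuous_image continuous_on_subset[OF f]) auto
  then obtain B where B: "B > 0" "\<And>x. x \<in> K \<Longrightarrow> \<bar>f x\<bar> \<le> B"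
    using compact_imp_bounded bounded_pos by (metis (no_types, lifting) imageI real_norm_def)
  show "integrable lborel (\<lambda>x. indicat_real K x * (v x * f x))"
  proof (rule Bochner_Integration.integrable_bound)
    show "integrable lborel (\<lambda>x. B * (indicat_real K x * v x))"
      using loc_intD(2)[OF v] K by simp
    show "AE x in lborel. norm (indicat_real K x * (v x * f x)) \<le> norm (B * (indicat_real K x * v x))"
    proof (rule AE_I2)
      fix x
      show "norm (indicat_real K x * (v x * f x)) \<le> norm (B * (indicat_real K x * v x))"
        using mult_right_mono[OF B(2)[of x], of "\<bar>v x\<bar>"] B(1)
        by (cases "x \<in> K") (auto simp: abs_mult mult.commute)
    qed
  qed measurable
qed

lemma loc_int_continuous:
  fixes f :: "'a::euclidean_space \<Rightarrow> real"
  assumes f: "continuous_on UNIV f"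
  shows "loc_int S f"
proof -
  have "loc_int S (\<lambda>x::'a. 1)"
    unfolding loc_int_def
  proof (intro conjI allI impI)
    fix K :: "'a set" assume "compact K \<and> K \<subseteq> S"
    then have "emeasure lborel K < \<infinity>" "K \<in> sets borel"
      using emeasure_bounded_finite compact_imp_bounded by (auto simp: compact_imp_closed)
    then show "integrable lborel (\<lambda>x. indicat_real K x * 1)"
      by (simp add: integrable_indicator_iff)
  qed simp
  from loc_int_mult_continuous[OF this f] show ?thesis by simp
qed

text \<open>The kernel \<open>1 - t\<close> has integral \<open>1 / 2\<close>, so the quadratic term
  of \<open>M\<close> can be placed under the integral, and only the deviation of the Hessian from
  \<open>M\<close> remains.\<close>

lemma taylor_remainder_bound:
  fixes w2 :: "'n::finite \<Rightarrow> 'n \<Rightarrow> real^'n \<Rightarrow> real" and M :: "real^'n^'n"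
  assumes meas: "\<And>j k. w2 j k \<in> borel_measurable borel"
    and int: "integrable lborel (\<lambda>t. indicat_real {0..1} t * (\<Sum>j\<in>UNIV. \<Sum>k\<in>UNIV. a $ j * a $ k * w2 j k (y + t *\<^sub>R a)))"
    and eq: "D = (\<integral>t. indicat_real {0..1} t * (1 - t) * (\<Sum>j\<in>UNIV. \<Sum>k\<in>UNIV. a $ j * a $ k * w2 j k (y + t *\<^sub>R a)) \<partial>lborel)"
  shows "ennreal \<bar>D - a \<bullet> (M *v a) / 2\<bar>
      \<le> ennreal ((norm a)\<^sup>2) * (\<integral>\<^sup>+t. indicator {0..1} t * ennreal ((1 - t) * norm (mat_of w2 (y + t *\<^sub>R a) - M)) \<partial>lborel)"
proof -
  note [measurable] = meas norm_mat_of_measurable[of w2 M, OF meas]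
  define W where "W t = a \<bullet> (mat_of w2 (y + t *\<^sub>R a) *v a)" for t
  have W_eq: "W t = (\<Sum>j\<in>UNIV. \<Sum>k\<in>UNIV. a $ j * a $ k * w2 j k (y + t *\<^sub>R a))" for t
    by (simp add: W_def mat_of_form)
  have [measurable]: "W \<in> borel_measurable borel" unfolding W_eq[abs_def] by measurable
  have i1: "integrable lborel (\<lambda>t. indicat_real {0..1} t * (1 - t) * W t)"
  proof (rule Bochner_Integration.integrable_bound)
    show "integrable lborel (\<lambda>t. indicat_real {0..1} t * W t)" using int by (simp add: W_eq)
    show "AE t in lborel. norm (indicat_real {0..1} t * (1 - t) * W t) \<le> norm (indicat_real {0..1} t * W t)"
      by (intro AE_I2) (auto simp: indicator_def abs_mult mult_left_le_one_le)
  qed measurable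
  have half: "has_bochner_integral lborel (\<lambda>t. (1 - t) * indicator {0..1} t) (1 / 2 :: real)"
  proof -
    have "has_bochner_integral lborel (\<lambda>t. (1 - t) * indicator {0..1} t) ((1 - 1\<^sup>2 / 2) - (0 - 0\<^sup>2 / 2) :: real)"
      by (rule has_bochner_integral_FTC_Icc_real) (auto intro!: derivative_eq_intros continuous_intros)
    then show ?thesis by simp
  qed
  let ?c = "a \<bullet> (M *v a)"
  have i2: "integrable lborel (\<lambda>t. indicat_real {0..1} t * (1 - t) * ?c)"
    using half by (auto simp: has_bochner_integral_iff mult.commute)
  have e2: "(\<integral>t. indicat_real {0..1} t * (1 - t) * ?c \<partial>lborel) = ?c / 2"
    using half by (auto simp: has_bochner_integral_iff mult.commute)
  have "D - ?c / 2 = (\<integral>t. indicat_real {0..1} t * (1 - t) * W t - indicat_real {0..1} t * (1 - t) * ?c \<partial>lborel)"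
    using i1 i2 e2 by (simp add: eq W_eq)
  also have "\<dots> = (\<integral>t. indicat_real {0..1} t * (1 - t) * (W t - ?c) \<partial>lborel)"
    by (simp add: right_diff_distrib)
  finally have D: "D - ?c / 2 = (\<integral>t. indicat_real {0..1} t * (1 - t) * (W t - ?c) \<partial>lborel)" .
  have i3: "integrable lborel (\<lambda>t. indicat_real {0..1} t * (1 - t) * (W t - ?c))"
    using Bochner_Integration.integrable_diff[OF i1 i2] by (simp add: right_diff_distrib)
  have "ennreal \<bar>D - ?c / 2\<bar> \<le> (\<integral>\<^sup>+t. ennreal \<bar>indicat_real {0..1} t * (1 - t) * (W t - ?c)\<bar> \<partial>lborel)"
    unfolding D using integral_norm_bound_ennreal[OF i3] by simp
  also have "\<dots> \<le> (\<integral>\<^sup>+t. ennreal ((norm a)\<^sup>2) * (indicator {0..1} t * ennreal ((1 - t) * norm (mat_of w2 (y + t *\<^sub>R a) - M))) \<partial>lborel)"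
  proof (rule nn_integral_mono)
    fix t :: real
    show "ennreal \<bar>indicat_real {0..1} t * (1 - t) * (W t - ?c)\<bar>
        \<le> ennreal ((norm a)\<^sup>2) * (indicator {0..1} t * ennreal ((1 - t) * norm (mat_of w2 (y + t *\<^sub>R a) - M)))"
    proof (cases "t \<in> {0..1}")
      case True
      have "W t - ?c = a \<bullet> ((mat_of w2 (y + t *\<^sub>R a) - M) *v a)"
        by (simp add: W_def matrix_vector_mult_diff_rdistrib inner_diff_right)
      then have "\<bar>W t - ?c\<bar> \<le> norm (mat_of w2 (y + t *\<^sub>R a) - M) * (norm a)\<^sup>2"
        using quadratic_form_norm_le by metis
      then have "(1 - t) * \<bar>W t - ?c\<bar> \<le> (1 - t) * (norm (mat_of w2 (y + t *\<^sub>R a) - M) * (norm a)\<^sup>2)"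
        using True by (intro mult_left_mono) auto
      then have "ennreal \<bar>(1 - t) * (W t - ?c)\<bar> \<le> ennreal ((norm a)\<^sup>2 * ((1 - t) * norm (mat_of w2 (y + t *\<^sub>R a) - M)))"
        using True by (intro ennreal_leI) (simp add: abs_mult mult_ac)
      then show ?thesis using True by (simp add: ennreal_mult)
    qed simp
  qed
  also have "\<dots> = ennreal ((norm a)\<^sup>2) * (\<integral>\<^sup>+t. indicator {0..1} t * ennreal ((1 - t) * norm (mat_of w2 (y + t *\<^sub>R a) - M)) \<partial>lborel)"
    by (rule nn_integral_cmult) measurable
  finally show ?thesis .
qed

text \<open>Expand at every point \<open>y\<close> of the smaller ball and average over
  \<open>y\<close>. With the quadratic form of \<open>M\<close> removed, each expansion is affine in
  \<open>x\<close>, and so is their average; the distance of \<open>u\<close> to it is bounded by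
  averaged Taylor remainders, hence by \<open>contraction_bound\<close>. The factor
  \<open>4 * \<rho>\<^sup>2\<close> bounds the squared distance of two points, and continuity of
  \<open>u\<close> removes the exceptional set.\<close>

theorem weak_sup_bound:
  fixes u :: "real^'n::finite \<Rightarrow> real" and w1 :: "'n \<Rightarrow> real^'n \<Rightarrow> real" and w2 :: "'n \<Rightarrow> 'n \<Rightarrow> real^'n \<Rightarrow> real"
    and M :: "real^'n^'n"
  assumes u: "loc_int (ball z r) u" "continuous_on (ball z r) u"
    and w1: "\<And>k. loc_int (ball z r) (w1 k)" and w2: "\<And>j k. loc_int (ball z r) (w2 j k)"
    and weak1: "\<And>k c a b. \<lbrakk>c > 0; cbox a b \<subseteq> ball z r\<rbrakk> \<Longrightarrow>
      (\<integral>x. u x * partials [k] (bump c a b) x \<partial>lborel) = - (\<integral>x. w1 k x * bump c a b x \<partial>lborel)"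
    and weak2: "\<And>j k c a b. \<lbrakk>c > 0; cbox a b \<subseteq> ball z r\<rbrakk> \<Longrightarrow>
      (\<integral>x. u x * partials [j, k] (bump c a b) x \<partial>lborel) = (\<integral>x. w2 j k x * bump c a b x \<partial>lborel)"
    and sym: "transpose M = M" and E: "E > 0" and \<rho>: "0 < \<rho>" "\<rho> < r"
    and bound: "(\<integral>\<^sup>+x. indicator (ball z r) x * ennreal (norm (mat_of w2 x - M) ^ CARD('n)) \<partial>lborel)
        \<le> ennreal (measure lborel (ball z r) * E ^ CARD('n))"
  obtains \<alpha> p where "\<And>x. x \<in> ball z \<rho> \<Longrightarrow>
      \<bar>u x - x \<bullet> (M *v x) / 2 - \<alpha> - p \<bullet> x\<bar> \<le> 4 * \<rho>\<^sup>2 * (1 + (r / \<rho>) ^ CARD('n)) * E"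
proof -
  let ?S = "ball z r" and ?S' = "ball z \<rho>"
  have S: "convex ?S" "open ?S" by auto
  have sub: "?S' \<subseteq> ?S" using \<rho> by auto
  have csub: "cball z \<rho> \<subseteq> ?S" using \<rho> by auto
  have u_meas [measurable]: "u \<in> borel_measurable borel" by (rule loc_intD(1)[OF u(1)])
  have w1_meas [measurable]: "w1 k \<in> borel_measurable borel" for k by (rule loc_intD(1)[OF w1])
  have w2_meas: "w2 j k \<in> borel_measurable borel" for j k by (rule loc_intD(1)[OF w2])
  define m where "m x = norm (mat_of w2 x - M)" for x
  have m_meas [measurable]: "m \<in> borel_measurable borel"
    unfolding m_def by (rule norm_mat_of_measurable[OF w2_meas])
  have contq: "continuous_on A (\<lambda>x. x \<bullet> (M *v x) / 2)" for A
    by (intro continuous_intros) auto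
  have [measurable]: "(\<lambda>x. x \<bullet> (M *v x)) \<in> borel_measurable borel"
    by (intro borel_measurable_continuous_onI continuous_intros)
  define R where "R y a = ennreal ((norm a)\<^sup>2) * (\<integral>\<^sup>+t. indicator {0..1} t * ennreal ((1 - t) * m (y + t *\<^sub>R a)) \<partial>lborel)" for y a
  define L where "L y a = ennreal \<bar>u (y + a) - u y - (\<Sum>k\<in>UNIV. a $ k * w1 k y) - a \<bullet> (M *v a) / 2\<bar>" for y a
  have R_meas [measurable]: "case_prod R \<in> borel_measurable (borel \<Otimes>\<^sub>M borel)"
    unfolding R_def by measurable
  have L_meas [measurable]: "case_prod L \<in> borel_measurable (borel \<Otimes>\<^sub>M borel)"
  proof -
    have 1: "(\<lambda>x. snd x $ k) \<in> borel_measurable ((borel :: (real^'n) measure) \<Otimes>\<^sub>M (borel :: (real^'n) measure))" for k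
      by (rule measurable_compose[OF measurable_snd]) (intro borel_measurable_continuous_onI continuous_intros)
    have 2: "(\<lambda>x. w1 k (fst x)) \<in> borel_measurable (borel \<Otimes>\<^sub>M (borel :: (real^'n) measure))" for k
      by (rule measurable_compose[OF measurable_fst w1_meas])
    have 3: "(\<lambda>x. snd x \<bullet> (M *v snd x) / 2) \<in> borel_measurable ((borel :: (real^'n) measure) \<Otimes>\<^sub>M borel)"
      by (rule measurable_compose[OF measurable_snd]) (intro borel_measurable_continuous_onI contq)
    have 4: "(\<lambda>x. \<Sum>k\<in>UNIV. snd x $ k * w1 k (fst x)) \<in> borel_measurable (borel \<Otimes>\<^sub>M (borel :: (real^'n) measure))"
      by (intro borel_measurable_sum borel_measurable_times 1 2)
    note [measurable] = 3 4
    show ?thesis unfolding L_def by measurable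
  qed
  \<comment> \<open>Marks the pairs at which the remainder estimate fails.\<close>
  define H :: "real^'n \<Rightarrow> real^'n \<Rightarrow> ennreal" where
    "H x y = (if x \<in> ?S \<and> y \<in> ?S \<and> \<not> L y (x - y) \<le> R y (x - y) then 1 else 0)" for x y
  have "AE x in lborel. AE y in lborel. H x y = 0"
  proof (rule AE_lborel_reflect_shift)
    show "case_prod H \<in> borel_measurable (borel \<Otimes>\<^sub>M borel)"
    proof -
      have pm: "(\<lambda>x. (snd x, fst x - snd x)) \<in> (borel :: (real^'n) measure) \<Otimes>\<^sub>M (borel :: (real^'n) measure) \<rightarrow>\<^sub>M borel \<Otimes>\<^sub>M borel"
        by measurable
      have 1: "(\<lambda>x. L (snd x) (fst x - snd x)) \<in> borel_measurable (borel \<Otimes>\<^sub>M borel)"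
        using measurable_compose[OF pm L_meas] by simp
      have 2: "(\<lambda>x. R (snd x) (fst x - snd x)) \<in> borel_measurable (borel \<Otimes>\<^sub>M borel)"
        using measurable_compose[OF pm R_meas] by simp
      have 3: "Measurable.pred ((borel :: (real^'n) measure) \<Otimes>\<^sub>M (borel :: (real^'n) measure)) (\<lambda>x. fst x \<in> ?S)"
        by (rule measurable_compose[OF measurable_fst]) simp
      have 4: "Measurable.pred ((borel :: (real^'n) measure) \<Otimes>\<^sub>M (borel :: (real^'n) measure)) (\<lambda>x. snd x \<in> ?S)"
        by (rule measurable_compose[OF measurable_snd]) simp
      note [measurable] = 1 2 3 4
      show ?thesis unfolding H_def split_beta by measurable
    qed
    fix a :: "real^'n"
    have "AE y in lborel. y \<in> {x \<in> ?S. x + a \<in> ?S} \<longrightarrow>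
      integrable lborel (\<lambda>t. indicat_real {0..1} t * (\<Sum>j\<in>UNIV. \<Sum>k\<in>UNIV. a $ j * a $ k * w2 j k (y + t *\<^sub>R a))) \<and>
      u (y + a) - u y - (\<Sum>k\<in>UNIV. a $ k * w1 k y)
        = (\<integral>t. indicat_real {0..1} t * (1 - t) * (\<Sum>j\<in>UNIV. \<Sum>k\<in>UNIV. a $ j * a $ k * w2 j k (y + t *\<^sub>R a)) \<partial>lborel)"
      by (rule weak_taylor[OF S u(1) w1 w2 weak1 weak2])
    then show "AE y in lborel. H (y + a) y = 0"
    proof eventually_elim
      case (elim y)
      have "L y a \<le> R y a" if "y \<in> ?S" "y + a \<in> ?S"
        unfolding L_def R_def m_def
        using elim that by (intro taylor_remainder_bound[OF w2_meas]) auto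
      then show ?case by (simp add: H_def)
    qed
  qed
  then have ae1: "AE x in lborel. x \<in> ?S' \<longrightarrow> (AE y in lborel. y \<in> ?S' \<longrightarrow> L y (x - y) \<le> R y (x - y))"
  proof eventually_elim
    case (elim x)
    show ?case
    proof
      assume x: "x \<in> ?S'"
      from elim show "AE y in lborel. y \<in> ?S' \<longrightarrow> L y (x - y) \<le> R y (x - y)"
        by eventually_elim (use x sub in \<open>auto simp: H_def split: if_splits\<close>)
    qed
  qed
  define A where "A = measure lborel ?S'"
  define B where "B = measure lborel ?S"
  have A0: "A > 0" unfolding A_def by (rule content_ball_pos[OF \<rho>(1)])
  have AE_A: "emeasure lborel ?S' = ennreal A"
    unfolding A_def using emeasure_bounded_finite[of ?S'] by (simp add: emeasure_eq_ennreal_measure)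
  have BA: "B / A = (r / \<rho>) ^ CARD('n)"
  proof -
    have "B = r ^ CARD('n) * measure lborel (ball (0::real^'n) 1)" "A = \<rho> ^ CARD('n) * measure lborel (ball (0::real^'n) 1)"
      unfolding A_def B_def using content_ball_conv_unit_ball[of r z] content_ball_conv_unit_ball[of \<rho> z] \<rho> by auto
    then show ?thesis using A0 by (simp add: power_divide)
  qed
  define f where "f x = u x - x \<bullet> (M *v x) / 2" for x
  define g where "g k y = w1 k y - (M *v y) $ k" for k y
  \<comment> \<open>The first order expansion of \<open>f\<close> at \<open>y\<close>, with
    \<open>g\<close> in the role of its weak gradient.\<close>
  define aff where "aff y x = f y + (\<Sum>k\<in>UNIV. (x $ k - y $ k) * g k y)" for y x
  have fl: "L y (x - y) = ennreal \<bar>f x - aff y x\<bar>" for x y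
  proof -
    have c: "x \<bullet> (M *v y) = y \<bullet> (M *v x)" by (rule inner_matrix_vector_commute[OF sym])
    have g: "(\<Sum>k\<in>UNIV. (x $ k - y $ k) * g k y) = (\<Sum>k\<in>UNIV. (x - y) $ k * w1 k y) - (x - y) \<bullet> (M *v y)"
      by (simp add: g_def inner_vec_def sum_subtractf right_diff_distrib)
    have q: "(x - y) \<bullet> (M *v (x - y)) = x \<bullet> (M *v x) - 2 * (y \<bullet> (M *v x)) + y \<bullet> (M *v y)"
      by (simp add: matrix_vector_mult_diff_distrib inner_diff_left inner_diff_right c)
    have l: "(x - y) \<bullet> (M *v y) = y \<bullet> (M *v x) - y \<bullet> (M *v y)"
      by (simp add: inner_diff_left c)
    have "u (y + (x - y)) - u y - (\<Sum>k\<in>UNIV. (x - y) $ k * w1 k y) - (x - y) \<bullet> (M *v (x - y)) / 2 = f x - aff y x"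
      unfolding f_def aff_def g q l by (simp add: field_simps)
    then show ?thesis by (simp add: L_def)
  qed
  have li_f: "loc_int ?S f"
    using loc_int_add[OF u(1) loc_int_cmult[OF loc_int_continuous[OF contq], of _ "-1"]] by (simp add: f_def[abs_def])
  have cont_comp: "continuous_on UNIV (\<lambda>y. (M *v y) $ k)" for k
    by (intro continuous_intros)
  have li_g: "loc_int ?S (g k)" for k
    using loc_int_add[OF w1[of k] loc_int_cmult[OF loc_int_continuous[OF cont_comp[of k]], of _ "-1"]] by (simp add: g_def[abs_def])
  have li_gy: "loc_int ?S (\<lambda>y. g k y * y $ k)" for k
    by (rule loc_int_mult_continuous[OF li_g]) (intro continuous_intros)
  \<comment> \<open>The functions are only locally integrable on the large ball. Averages are
    therefore taken over the smaller ball, whose closure is a compact subset of the large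
    one.\<close>
  have intS': "integrable lborel (\<lambda>x. indicat_real ?S' x * v x)" if v: "loc_int ?S v" for v
  proof -
    have "integrable lborel (\<lambda>x. indicat_real ?S' x *\<^sub>R (indicat_real (cball z \<rho>) x * v x))"
      using loc_intD(2)[OF v compact_cball csub] by (intro integrable_mult_indicator) auto
    moreover have "(\<lambda>x. indicat_real ?S' x *\<^sub>R (indicat_real (cball z \<rho>) x * v x)) = (\<lambda>x. indicat_real ?S' x * v x)"
      by (auto simp: indicator_def)
    ultimately show ?thesis by simp
  qed
  define \<alpha> where "\<alpha> = ((\<integral>y. indicat_real ?S' y * f y \<partial>lborel) - (\<Sum>k\<in>UNIV. \<integral>y. indicat_real ?S' y * (g k y * y $ k) \<partial>lborel)) / A"
  define p where "p = (\<chi> k. (\<integral>y. indicat_real ?S' y * g k y \<partial>lborel) / A)"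
  have aff_split: "indicat_real ?S' y * aff y x = indicat_real ?S' y * f y
      + ((\<Sum>k\<in>UNIV. x $ k * (indicat_real ?S' y * g k y)) - (\<Sum>k\<in>UNIV. indicat_real ?S' y * (g k y * y $ k)))" for x y
    by (simp add: aff_def distrib_left sum_distrib_left left_diff_distrib right_diff_distrib sum_subtractf mult_ac)
  have int_aff: "integrable lborel (\<lambda>y. indicat_real ?S' y * aff y x)" for x
    unfolding aff_split using intS'[OF li_f] intS'[OF li_g] intS'[OF li_gy]
    by (intro Bochner_Integration.integrable_add Bochner_Integration.integrable_diff Bochner_Integration.integrable_sum integrable_mult_right)
  have avg: "(\<integral>y. indicat_real ?S' y * aff y x \<partial>lborel) = A * (\<alpha> + p \<bullet> x)" for x
  proof -
    have "(\<integral>y. indicat_real ?S' y * aff y x \<partial>lborel) = (\<integral>y. indicat_real ?S' y * f y \<partial>lborel)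
      + ((\<Sum>k\<in>UNIV. x $ k * (\<integral>y. indicat_real ?S' y * g k y \<partial>lborel)) - (\<Sum>k\<in>UNIV. \<integral>y. indicat_real ?S' y * (g k y * y $ k) \<partial>lborel))"
    proof -
      have i2: "integrable lborel (\<lambda>y. \<Sum>k\<in>UNIV. x $ k * (indicat_real ?S' y * g k y))"
        using intS'[OF li_g] by (intro Bochner_Integration.integrable_sum integrable_mult_right)
      have i3: "integrable lborel (\<lambda>y. \<Sum>k\<in>UNIV. indicat_real ?S' y * (g k y * y $ k))"
        using intS'[OF li_gy] by (intro Bochner_Integration.integrable_sum)
      have e2: "(\<integral>y. (\<Sum>k\<in>UNIV. x $ k * (indicat_real ?S' y * g k y)) \<partial>lborel)
          = (\<Sum>k\<in>UNIV. x $ k * (\<integral>y. indicat_real ?S' y * g k y \<partial>lborel))"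
        using intS'[OF li_g] by (subst Bochner_Integration.integral_sum) auto
      have e3: "(\<integral>y. (\<Sum>k\<in>UNIV. indicat_real ?S' y * (g k y * y $ k)) \<partial>lborel)
          = (\<Sum>k\<in>UNIV. \<integral>y. indicat_real ?S' y * (g k y * y $ k) \<partial>lborel)"
        using intS'[OF li_gy] by (rule Bochner_Integration.integral_sum)
      show ?thesis
        unfolding aff_split
        by (simp only: Bochner_Integration.integral_add[OF intS'[OF li_f] Bochner_Integration.integrable_diff[OF i2 i3]]
            Bochner_Integration.integral_diff[OF i2 i3] e2 e3)
    qed
    moreover have "A * (p \<bullet> x) = (\<Sum>k\<in>UNIV. x $ k * (\<integral>y. indicat_real ?S' y * g k y \<partial>lborel))"
      using A0 by (simp add: p_def inner_vec_def sum_distrib_left mult.commute)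
    ultimately show ?thesis
      using A0 by (simp add: \<alpha>_def distrib_left)
  qed
  define K where "K = 4 * \<rho>\<^sup>2 * (1 + (r / \<rho>) ^ CARD('n)) * E"
  have AK: "4 * \<rho>\<^sup>2 * (E * (A + B)) = A * K"
    using A0 BA by (simp add: K_def field_simps)
  have B0: "B \<ge> 0" by (simp add: B_def)
  have K0: "K \<ge> 0" using E \<rho> by (simp add: K_def)
  have ae2: "AE x in lborel. x \<in> ?S' \<longrightarrow> \<bar>f x - \<alpha> - p \<bullet> x\<bar> \<le> K"
    using ae1
  proof eventually_elim
    case (elim x)
    show ?case
    proof
      assume x: "x \<in> ?S'"
      then have ae: "AE y in lborel. y \<in> ?S' \<longrightarrow> ennreal \<bar>f x - aff y x\<bar> \<le> R y (x - y)"
        using elim by (simp add: fl)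
      have G1: "(\<lambda>(y, t). indicator ?S' y * (indicator {0..1} t * ennreal ((1 - t) * m (y + t *\<^sub>R (x - y)))))
          \<in> borel_measurable ((lborel :: (real^'n) measure) \<Otimes>\<^sub>M (lborel :: real measure))"
      proof -
        have 1: "(\<lambda>q. indicator ?S' (fst q) :: ennreal) \<in> borel_measurable ((lborel :: (real^'n) measure) \<Otimes>\<^sub>M (lborel :: real measure))"
          by (rule measurable_compose[OF measurable_fst borel_measurable_indicator]) simp
        have 2: "(\<lambda>q. indicator {0..1} (snd q) * ennreal ((1 - snd q) * m (fst q + snd q *\<^sub>R (x - fst q))))
            \<in> borel_measurable ((lborel :: (real^'n) measure) \<Otimes>\<^sub>M (lborel :: real measure))"
          by measurable
        show ?thesis
          using borel_measurable_times_ennreal[OF 1 2] by (simp add: split_beta)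
      qed
      have G2: "(\<lambda>(t, y). indicator ?S' y * (indicator {0..1} t * ennreal ((1 - t) * m (y + t *\<^sub>R (x - y)))))
          \<in> borel_measurable ((lborel :: real measure) \<Otimes>\<^sub>M (lborel :: (real^'n) measure))"
        using measurable_compose[OF measurable_pair_swap' G1] by (simp add: split_beta)
      have int1: "integrable lborel (\<lambda>y. indicat_real ?S' y * f x)"
        by (intro integrable_mult_left) (simp add: integrable_indicator_iff AE_A)
      have int2: "integrable lborel (\<lambda>y. indicat_real ?S' y * (f x - aff y x))"
        using Bochner_Integration.integrable_diff[OF int1 int_aff[of x]] by (simp add: right_diff_distrib)
      have "A * (f x - \<alpha> - p \<bullet> x) = (\<integral>y. indicat_real ?S' y * f x \<partial>lborel) - (\<integral>y. indicat_real ?S' y * aff y x \<partial>lborel)"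
        unfolding avg by (simp add: A_def algebra_simps)
      also have "\<dots> = (\<integral>y. indicat_real ?S' y * (f x - aff y x) \<partial>lborel)"
        using int1 int_aff[of x] by (simp add: right_diff_distrib)
      finally have "ennreal \<bar>A * (f x - \<alpha> - p \<bullet> x)\<bar> \<le> (\<integral>\<^sup>+y. ennreal \<bar>indicat_real ?S' y * (f x - aff y x)\<bar> \<partial>lborel)"
        using integral_norm_bound_ennreal[OF int2] by simp
      also have "\<dots> \<le> (\<integral>\<^sup>+y. indicator ?S' y * R y (x - y) \<partial>lborel)"
        by (rule nn_integral_mono_AE) (use ae in eventually_elim, auto simp: indicator_def)
      also have "\<dots> \<le> (\<integral>\<^sup>+y. ennreal (4 * \<rho>\<^sup>2) * (\<integral>\<^sup>+t. indicator ?S' y * (indicator {0..1} t * ennreal ((1 - t) * m (y + t *\<^sub>R (x - y)))) \<partial>lborel) \<partial>lborel)"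
      proof (rule nn_integral_mono)
        fix y
        show "indicator ?S' y * R y (x - y) \<le> ennreal (4 * \<rho>\<^sup>2) * (\<integral>\<^sup>+t. indicator ?S' y * (indicator {0..1} t * ennreal ((1 - t) * m (y + t *\<^sub>R (x - y)))) \<partial>lborel)"
        proof (cases "y \<in> ?S'")
          case True
          have "norm (x - y) \<le> 2 * \<rho>"
            using x True dist_triangle[of x y z] by (simp add: dist_norm dist_commute norm_minus_commute)
          then have "(norm (x - y))\<^sup>2 \<le> (2 * \<rho>)\<^sup>2" by (intro power_mono) auto
          then have "ennreal ((norm (x - y))\<^sup>2) \<le> ennreal (4 * \<rho>\<^sup>2)" by (intro ennreal_leI) (simp add: power_mult_distrib)
          then show ?thesis using True by (simp add: R_def mult_right_mono)
        qed simp
      qed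
      also have "\<dots> = ennreal (4 * \<rho>\<^sup>2) * (\<integral>\<^sup>+y. \<integral>\<^sup>+t. indicator ?S' y * (indicator {0..1} t * ennreal ((1 - t) * m (y + t *\<^sub>R (x - y)))) \<partial>lborel \<partial>lborel)"
        by (rule nn_integral_cmult) (use lborel.borel_measurable_nn_integral[OF G1] in simp)
      also have "(\<integral>\<^sup>+y. \<integral>\<^sup>+t. indicator ?S' y * (indicator {0..1} t * ennreal ((1 - t) * m (y + t *\<^sub>R (x - y)))) \<partial>lborel \<partial>lborel)
          = (\<integral>\<^sup>+t. \<integral>\<^sup>+y. indicator ?S' y * (indicator {0..1} t * ennreal ((1 - t) * m (y + t *\<^sub>R (x - y)))) \<partial>lborel \<partial>lborel)"
        by (rule lborel_pair.Fubini'[of "\<lambda>t y. indicator ?S' y * (indicator {0..1} t * ennreal ((1 - t) * m (y + t *\<^sub>R (x - y))))"]) (rule G2)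
      also have "\<dots> \<le> (\<integral>\<^sup>+t. indicator {0..1::real} t * ennreal (E * (A + B)) \<partial>lborel)"
      proof (rule nn_integral_mono)
        fix t :: real
        show "(\<integral>\<^sup>+y. indicator ?S' y * (indicator {0..1} t * ennreal ((1 - t) * m (y + t *\<^sub>R (x - y)))) \<partial>lborel)
            \<le> indicator {0..1} t * ennreal (E * (A + B))"
        \<comment> \<open>At \<open>t = 1\<close> the contraction factor \<open>1 - t\<close> is
          zero and the ball collapses to \<open>x\<close>; there the weight vanishes as
          well.\<close>
        proof (cases "t \<in> {0..<1}")
          case True
          define s where "s = 1 - t"
          have s: "0 < s" "s \<le> 1" using True by (auto simp: s_def)
          have pt: "y + t *\<^sub>R (x - y) = x + s *\<^sub>R (y - x)" for y by (simp add: s_def algebra_simps)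
          have "(\<integral>\<^sup>+y. indicator ?S' y * (indicator {0..1} t * ennreal ((1 - t) * m (y + t *\<^sub>R (x - y)))) \<partial>lborel)
              = (\<integral>\<^sup>+y. ennreal s * (indicator ?S' y * ennreal (m (x + s *\<^sub>R (y - x)))) \<partial>lborel)"
            using True s by (intro nn_integral_cong) (auto simp: pt s_def[symmetric] ennreal_mult m_def indicator_def)
          also have "\<dots> = ennreal s * (\<integral>\<^sup>+y. indicator ?S' y * ennreal (m (x + s *\<^sub>R (y - x))) \<partial>lborel)"
          proof (rule nn_integral_cmult)
            have "(\<lambda>y. m (x + s *\<^sub>R (y - x))) \<in> borel_measurable borel"
              by (rule measurable_compose[OF _ m_meas]) measurable
            then show "(\<lambda>y. indicator ?S' y * ennreal (m (x + s *\<^sub>R (y - x)))) \<in> borel_measurable lborel"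
              by (intro borel_measurable_times_ennreal borel_measurable_indicator measurable_compose[OF _ measurable_ennreal]) simp_all
          qed
          also have "\<dots> \<le> ennreal (E * (A + B))"
            using bound A0 B0 s E x sub AE_A norm_mat_of_measurable[OF w2_meas, where M = M]
            by (intro contraction_bound[where S = ?S]) (auto simp: m_def B_def)
          finally show ?thesis using True by simp
        next
          case False
          then have "indicator ?S' y * (indicator {0..1} t * ennreal ((1 - t) * m (y + t *\<^sub>R (x - y)))) = 0" for y
            by (cases "t = 1") (auto simp: indicator_def)
          then have "(\<integral>\<^sup>+y. indicator ?S' y * (indicator {0..1} t * ennreal ((1 - t) * m (y + t *\<^sub>R (x - y)))) \<partial>lborel)
              = (\<integral>\<^sup>+y. 0 \<partial>(lborel :: (real^'n) measure))"
            by (intro nn_integral_cong)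
          then show ?thesis by (simp only: nn_integral_const mult_zero_left zero_le)
        qed
      qed
      also have "\<dots> = ennreal (E * (A + B))"
        by (simp add: nn_integral_multc)
      finally have "ennreal \<bar>A * (f x - \<alpha> - p \<bullet> x)\<bar> \<le> ennreal (4 * \<rho>\<^sup>2) * ennreal (E * (A + B))"
        by (simp add: mult_left_mono)
      also have "\<dots> = ennreal (A * K)"
        using E A0 B0 by (simp add: ennreal_mult[symmetric] AK)
      finally have "\<bar>A * (f x - \<alpha> - p \<bullet> x)\<bar> \<le> A * K"
        using A0 K0 by (simp add: ennreal_le_iff)
      then show "\<bar>f x - \<alpha> - p \<bullet> x\<bar> \<le> K"
        using A0 by (simp add: abs_mult)
    qed
  qed
  have "{x \<in> ?S'. K < \<bar>f x - \<alpha> - p \<bullet> x\<bar>} = {}"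
  proof (rule open_AE_empty)
    have "continuous_on ?S' (\<lambda>x. \<bar>f x - \<alpha> - p \<bullet> x\<bar>)"
      unfolding f_def
      by (intro continuous_intros continuous_on_subset[OF u(2) sub] contq)
    then have "\<forall>U. open U \<longrightarrow> open ((\<lambda>x. \<bar>f x - \<alpha> - p \<bullet> x\<bar>) -` U \<inter> ?S')"
      by (simp only: continuous_on_open_vimage[OF open_ball])
    then have "open ((\<lambda>x. \<bar>f x - \<alpha> - p \<bullet> x\<bar>) -` {K<..} \<inter> ?S')"
      by (simp only: open_greaterThan)
    moreover have "(\<lambda>x. \<bar>f x - \<alpha> - p \<bullet> x\<bar>) -` {K<..} \<inter> ?S' = {x \<in> ?S'. K < \<bar>f x - \<alpha> - p \<bullet> x\<bar>}" by auto
    ultimately show "open {x \<in> ?S'. K < \<bar>f x - \<alpha> - p \<bullet> x\<bar>}" by (simp only:)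
    show "AE x in lborel. x \<notin> {x \<in> ?S'. K < \<bar>f x - \<alpha> - p \<bullet> x\<bar>}"
      using ae2 by eventually_elim auto
  qed
  then have "\<bar>f x - \<alpha> - p \<bullet> x\<bar> \<le> K" if "x \<in> ?S'" for x
    unfolding Collect_empty_eq using that by (auto simp only: not_less simp_thms)
  then show thesis
    unfolding f_def K_def by (rule that)
qed

section \<open>Mean oscillation of weak Hessians\<close>

lemma young_powr:
  fixes y c :: real
  assumes "c > 0" "y \<ge> 0" "real n < p"
  shows "y ^ n \<le> c ^ n + y powr p * c powr (real n - p)"
proof (cases "y \<le> c")
  case True
  have "y ^ n \<le> c ^ n" using True assms by (intro power_mono) auto
  moreover have "0 \<le> y powr p * c powr (real n - p)" by simp
  ultimately show ?thesis by linarith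
next
  case False
  then have y: "y > 0" using assms by simp
  have "y ^ n = y powr p * y powr (real n - p)"
    using y by (simp add: powr_add[symmetric] powr_realpow)
  also have "\<dots> \<le> y powr p * c powr (real n - p)"
    using False assms by (intro mult_left_mono powr_mono2') auto
  finally show ?thesis using assms by (smt (verit) zero_le_power)
qed

text \<open>On finite measure an Lq bound with \<open>q > n\<close> controls the integral of the
  \<open>n\<close>-th power. The factor 2 is the price of \<open>young_powr\<close> in place of
  Hoelder's inequality and leaves the constant independent of \<open>q\<close>. For infinite
  \<open>q\<close> the exponent \<open>\<delta>\<close> is zero.\<close>

lemma Lq_norm_imp_power_bound:
  fixes f :: "'a \<Rightarrow> real"
  assumes "finite_measure \<mu>" and f: "f \<in> borel_measurable \<mu>" and q: "1 \<le> q"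
    and \<delta>: "\<delta> = enn2real (of_nat n / q)" "\<delta> < 1" and n: "n \<ge> 1"
    and K: "K > 0" "Lq_norm q \<mu> f \<le> ennreal K" and m: "m = measure \<mu> (space \<mu>)" "m > 0"
  shows "(\<integral>\<^sup>+x. ennreal (\<bar>f x\<bar> ^ n) \<partial>\<mu>) \<le> ennreal (2 * m powr (1 - \<delta>) * K ^ n)"
proof -
  interpret finite_measure \<mu> by fact
  have em: "emeasure \<mu> (space \<mu>) = ennreal m" by (simp add: m emeasure_eq_measure)
  show ?thesis
  proof (cases "q = \<infinity>")
    case True
    have "AE x in \<mu>. ennreal \<bar>f x\<bar> \<le> esssup \<mu> (\<lambda>x. ennreal \<bar>f x\<bar>)" by (rule esssup_AE)
    then have "AE x in \<mu>. ennreal (\<bar>f x\<bar> ^ n) \<le> ennreal (K ^ n)"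
    proof eventually_elim
      case (elim x)
      have "ennreal \<bar>f x\<bar> \<le> ennreal K"
        using elim K(2) True by (auto simp: Lq_norm_def)
      then have "\<bar>f x\<bar> \<le> K" using K(1) by (simp add: ennreal_le_iff)
      then show ?case by (intro ennreal_leI power_mono) auto
    qed
    then have "(\<integral>\<^sup>+x. ennreal (\<bar>f x\<bar> ^ n) \<partial>\<mu>) \<le> (\<integral>\<^sup>+x. ennreal (K ^ n) \<partial>\<mu>)"
      by (rule nn_integral_mono_AE)
    also have "\<dots> = ennreal (K ^ n * m)"
      using K m by (simp add: em ennreal_mult)
    also have "\<dots> \<le> ennreal (2 * m powr (1 - \<delta>) * K ^ n)"
      using True K m by (intro ennreal_leI) (simp add: \<delta>)
    finally show ?thesis .
  next
    case False
    define p where "p = enn2real q"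
    have qp: "q = ennreal p"
      using False unfolding p_def infinity_ennreal_def by (simp add: less_top)
    have p1: "p \<ge> 1" using q unfolding qp by (metis ennreal_1 ennreal_le_iff2 ennreal_ge_1)
    have "of_nat n / q = ennreal (real n / p)"
      using p1 by (simp add: qp divide_ennreal ennreal_of_nat_eq_real_of_nat)
    then have \<delta>p: "\<delta> = real n / p" using p1 by (simp add: \<delta>)
    then have np: "real n < p" using \<delta>(2) p1 pos_divide_less_eq[of p "real n" 1] by simp
    define I where "I = (\<integral>\<^sup>+x. ennreal (\<bar>f x\<bar> powr p) \<partial>\<mu>)"
    have L: "Lq_norm q \<mu> f = (if I = \<infinity> then \<infinity> else ennreal (enn2real I powr (1 / p)))"
      using False by (simp add: Lq_norm_def I_def p_def Let_def)
    then have I: "I \<noteq> \<infinity>" using K(2) by (auto simp: top_unique)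
    define i where "i = enn2real I"
    have Ii: "I = ennreal i" using I unfolding i_def infinity_ennreal_def by (simp add: less_top)
    have i0: "i \<ge> 0" by (simp add: i_def)
    have "i powr (1 / p) \<le> K" using L K I by (simp add: i_def ennreal_le_iff)
    then have "(i powr (1 / p)) powr p \<le> K powr p"
      using p1 by (intro powr_mono2) auto
    then have iK: "i \<le> K powr p" using p1 i0 by (simp add: powr_powr)
    \<comment> \<open>The value at which both terms of \<open>young_powr\<close> integrate to the
      same bound.\<close>
    define c where "c = K * m powr (- (1 / p))"
    have c: "c > 0" using K m by (simp add: c_def)
    have [measurable]: "f \<in> borel_measurable \<mu>" by fact
    have "(\<integral>\<^sup>+x. ennreal (\<bar>f x\<bar> ^ n) \<partial>\<mu>)
        \<le> (\<integral>\<^sup>+x. ennreal (c ^ n) + ennreal (c powr (real n - p)) * ennreal (\<bar>f x\<bar> powr p) \<partial>\<mu>)"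
    proof (rule nn_integral_mono)
      fix x
      have "\<bar>f x\<bar> ^ n \<le> c ^ n + c powr (real n - p) * \<bar>f x\<bar> powr p"
        using young_powr[OF c _ np, of "\<bar>f x\<bar>"] by (simp add: mult.commute)
      then have "ennreal (\<bar>f x\<bar> ^ n) \<le> ennreal (c ^ n + c powr (real n - p) * \<bar>f x\<bar> powr p)"
        by (rule ennreal_leI)
      also have "\<dots> = ennreal (c ^ n) + ennreal (c powr (real n - p)) * ennreal (\<bar>f x\<bar> powr p)"
        using c by (simp add: ennreal_mult[symmetric] flip: ennreal_plus)
      finally show "ennreal (\<bar>f x\<bar> ^ n) \<le> ennreal (c ^ n) + ennreal (c powr (real n - p)) * ennreal (\<bar>f x\<bar> powr p)" .
    qed
    also have "\<dots> = ennreal (c ^ n) * ennreal m + ennreal (c powr (real n - p)) * I"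
      by (simp add: nn_integral_add nn_integral_cmult em I_def)
    also have "\<dots> = ennreal (c ^ n * m + c powr (real n - p) * i)"
      using c m i0 by (simp add: Ii ennreal_mult[symmetric] flip: ennreal_plus)
    also have "\<dots> \<le> ennreal (2 * m powr (1 - \<delta>) * K ^ n)"
    proof (rule ennreal_leI)
      have cn: "c powr s = K powr s * m powr (- s / p)" for s
        using K m by (simp add: c_def powr_mult powr_powr)
      have "c ^ n * m = m powr (1 - \<delta>) * K ^ n"
      proof -
        have "c ^ n = K ^ n * m powr (- \<delta>)"
          using cn[of "real n"] c K by (simp add: powr_realpow \<delta>p)
        moreover have "m powr (- \<delta>) * m = m powr (1 - \<delta>)"
          using m by (simp add: powr_mult_base' powr_diff powr_minus_divide)
        ultimately show ?thesis by simp
      qed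
      moreover have "c powr (real n - p) * i \<le> m powr (1 - \<delta>) * K ^ n"
      proof -
        have "c powr (real n - p) * i \<le> c powr (real n - p) * K powr p"
          using iK by (intro mult_left_mono) auto
        also have "\<dots> = (K powr (real n - p) * K powr p) * m powr (- (real n - p) / p)"
          by (simp add: cn)
        also have "K powr (real n - p) * K powr p = K ^ n"
          using K by (simp add: powr_add[symmetric] powr_realpow)
        also have "- (real n - p) / p = 1 - \<delta>"
          using p1 by (simp add: \<delta>p field_simps)
        finally show ?thesis by (simp add: mult.commute)
      qed
      moreover have "2 * m powr (1 - \<delta>) * K ^ n = m powr (1 - \<delta>) * K ^ n + m powr (1 - \<delta>) * K ^ n"
        by simp
      ultimately show "c ^ n * m + c powr (real n - p) * i \<le> 2 * m powr (1 - \<delta>) * K ^ n" by linarith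
    qed
    finally show ?thesis .
  qed
qed

text \<open>Moves the \<open>n\<close>-th power inside the average over a segment; the integral on
  the right may be infinite.\<close>

lemma power_average_le:
  fixes G :: "real \<Rightarrow> real"
  assumes [measurable]: "G \<in> borel_measurable borel" and G0: "\<And>t. G t \<ge> 0"
    and T: "0 \<le> T" "ennreal T \<le> (\<integral>\<^sup>+t. indicator {0..1} t * ennreal (G t) \<partial>lborel)" and n: "n \<ge> 1"
  shows "ennreal (T ^ n) \<le> (\<integral>\<^sup>+t. indicator {0..1} t * ennreal (G t ^ n) \<partial>lborel)"
proof (cases "T = 0")
  case False
  then have T0: "T > 0" using T by simp
  text \<open>Jensen's inequality: integrate the tangent line of \<open>g ^ n\<close> at \<open>T\<close>.\<close>
  have tangent: "real n * T ^ (n - 1) * g \<le> g ^ n + (real n - 1) * T ^ n" if "g \<ge> 0" for g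
  proof -
    have "1 + real n * (g / T - 1) \<le> (1 + (g / T - 1)) ^ n"
      using that T0 by (intro Bernoulli_inequality) simp
    then have "T ^ n * (1 + real n * (g / T - 1)) \<le> T ^ n * (g / T) ^ n"
      using T0 by (intro mult_left_mono) auto
    moreover have "T ^ n * (g / T) ^ n = g ^ n" using T0 by (simp add: power_divide)
    moreover have "T ^ n * (g / T) = T ^ (n - 1) * g"
      using T0 n by (cases n) auto
    moreover have "T ^ n * (1 + real n * (x - 1)) = T ^ n + real n * (T ^ n * x) - real n * T ^ n" for x
      by (simp add: algebra_simps)
    ultimately have "T ^ n + real n * (T ^ (n - 1) * g) - real n * T ^ n \<le> g ^ n" by metis
    then show ?thesis by (simp add: algebra_simps)
  qed
  have "ennreal (real n * T ^ (n - 1)) * ennreal T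
      \<le> ennreal (real n * T ^ (n - 1)) * (\<integral>\<^sup>+t. indicator {0..1} t * ennreal (G t) \<partial>lborel)"
    using T(2) by (rule mult_left_mono) simp
  also have "\<dots> = (\<integral>\<^sup>+t. ennreal (real n * T ^ (n - 1)) * (indicator {0..1} t * ennreal (G t)) \<partial>lborel)"
    by (rule nn_integral_cmult[symmetric]) measurable
  also have "\<dots> \<le> (\<integral>\<^sup>+t. indicator {0..1} t * ennreal (G t ^ n) + ennreal ((real n - 1) * T ^ n) * indicator {0..1} t \<partial>lborel)"
  proof (rule nn_integral_mono)
    fix t :: real
    have "ennreal (real n * T ^ (n - 1)) * ennreal (G t) = ennreal (real n * T ^ (n - 1) * G t)"
      using T0 G0 by (simp add: ennreal_mult)
    also have "\<dots> \<le> ennreal (G t ^ n + (real n - 1) * T ^ n)"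
      by (rule ennreal_leI[OF tangent[OF G0]])
    also have "\<dots> = ennreal (G t ^ n) + ennreal ((real n - 1) * T ^ n)"
      using G0 n T0 by (intro ennreal_plus) auto
    finally show "ennreal (real n * T ^ (n - 1)) * (indicator {0..1} t * ennreal (G t))
        \<le> indicator {0..1} t * ennreal (G t ^ n) + ennreal ((real n - 1) * T ^ n) * indicator {0..1} t"
      by (simp add: indicator_def)
  qed
  also have "\<dots> = (\<integral>\<^sup>+t. indicator {0..1} t * ennreal (G t ^ n) \<partial>lborel) + ennreal ((real n - 1) * T ^ n)"
    by (subst nn_integral_add) (auto simp: nn_integral_cmult)
  finally have *: "ennreal (real n * T ^ (n - 1)) * ennreal T
      \<le> (\<integral>\<^sup>+t. indicator {0..1} t * ennreal (G t ^ n) \<partial>lborel) + ennreal ((real n - 1) * T ^ n)" .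
  have "ennreal (real n * T ^ (n - 1)) * ennreal T = ennreal (T ^ n) + ennreal ((real n - 1) * T ^ n)"
  proof -
    have "real n * T ^ (n - 1) * T = T ^ n + (real n - 1) * T ^ n"
      using n by (cases n) (auto simp: algebra_simps)
    then show ?thesis
      using T0 n by (simp add: ennreal_mult[symmetric] flip: ennreal_plus)
  qed
  with * have "ennreal ((real n - 1) * T ^ n) + ennreal (T ^ n)
      \<le> ennreal ((real n - 1) * T ^ n) + (\<integral>\<^sup>+t. indicator {0..1} t * ennreal (G t ^ n) \<partial>lborel)"
    by (simp only: add.commute)
  then show ?thesis
    by (simp only: ennreal_add_left_cancel_le ennreal_neq_top simp_thms infinity_ennreal_def)
qed (use n in \<open>simp add: power_0_left\<close>)

lemma norm_matrix_le_entries: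
  fixes A :: "real^'n::finite^'n"
  assumes "\<And>i j. \<bar>A $ i $ j\<bar> \<le> e"
  shows "norm A \<le> real (CARD('n)\<^sup>2) * e"
proof -
  have "norm (A $ i) \<le> (\<Sum>j\<in>UNIV. \<bar>A $ i $ j\<bar>)" for i by (rule norm_le_l1_cart)
  also have "(\<Sum>j\<in>UNIV. \<bar>A $ i $ j\<bar>) \<le> real CARD('n) * e" for i
    using sum_bounded_above[of UNIV "\<lambda>j. \<bar>A $ i $ j\<bar>" e] assms by simp
  finally have 1: "norm (A $ i) \<le> real CARD('n) * e" for i .
  have "norm A \<le> (\<Sum>i\<in>UNIV. norm (A $ i))"
    unfolding norm_vec_def by (rule L2_set_le_sum) simp
  also have "\<dots> \<le> real CARD('n) * (real CARD('n) * e)"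
    using sum_bounded_above[of UNIV "\<lambda>i. norm (A $ i)" "real CARD('n) * e"] 1 by simp
  finally show ?thesis by (simp add: power2_eq_square mult.assoc)
qed

lemma L2_set_member_le:
  assumes "finite A" "i \<in> A"
  shows "\<bar>f i\<bar> \<le> L2_set f A"
proof -
  have "L2_set f {i} \<le> L2_set f A"
    unfolding L2_set_def using assms by (intro real_sqrt_le_mono sum_mono2) auto
  then show ?thesis by (simp add: L2_set_def)
qed

lemma finite_lists_length: "finite {is :: 'n::finite list. length is = k}"
  using finite_lists_length_eq[of "UNIV :: 'n set" k] by simp

lemma nn_integral_lebesgue_on:
  assumes "S \<in> sets borel"
  shows "(\<integral>\<^sup>+x. f x \<partial>lebesgue_on S) = (\<integral>\<^sup>+x. indicator S x * f x \<partial>lborel)"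
proof -
  have "(\<integral>\<^sup>+x. f x \<partial>lebesgue_on S) = (\<integral>\<^sup>+x. f x * indicator S x \<partial>lebesgue)"
    using assms by (intro nn_integral_restrict_space) simp
  then show ?thesis by (simp add: nn_integral_completion mult.commute)
qed

text \<open>A constant of the dimension alone. The cube counts entries and third derivatives, and
  the maximum absorbs powers of the volume of the unit ball with exponents between -2 and 0.\<close>

definition osc_const :: "'n::finite itself \<Rightarrow> real" where
  "osc_const TYPE('n) = 16 * max 1 (1 / (measure lborel (ball (0::real^'n) 1))\<^sup>2) * real (CARD('n)) ^ 3"

lemma osc_const_pos: "osc_const TYPE('n::finite) > 0"
  by (simp add: osc_const_def)

text \<open>Common bookkeeping of the two oscillation bounds: \<open>e\<close> is the power of the
  diameter \<open>2 * r\<close>, and \<open>\<epsilon>\<close> the power lost in the volume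
  \<open>B\<close>. Fractional order uses \<open>e = \<delta> + \<theta>\<close> and
  \<open>\<epsilon> = 2 * \<delta>\<close>, order 3 uses \<open>e = 1\<close> and
  \<open>\<epsilon> = \<delta>\<close>. As \<open>B\<close> is proportional to \<open>r ^ n\<close>,
  the \<open>n\<close>-th root scales like \<open>r powr (e - \<epsilon>)\<close>.\<close>

lemma oscillation_arith:
  fixes r \<delta> \<theta> K v :: real and n k :: nat
  assumes n: "n \<ge> 1" and r: "r > 0" and \<delta>: "0 \<le> \<delta>" "\<delta> \<le> 1" and \<theta>: "0 \<le> \<theta>" "\<theta> \<le> 1" and K: "K > 0" and v: "v > 0"
    and k: "k \<le> 3" and e: "0 \<le> e" "e \<le> 2" and B: "B = r ^ n * v"
    and \<epsilon>: "0 \<le> \<epsilon>" "\<epsilon> \<le> 2" "e - \<epsilon> = \<theta> - \<delta>"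
  shows "(real n ^ k * (2 * (2 * r) powr e)) ^ n * (2 * (B\<^sup>2 * B powr (- \<epsilon> )) * K ^ n)
    \<le> B\<^sup>2 * ((16 * max 1 (1 / v\<^sup>2) * real n ^ 3) * r powr (\<theta> - \<delta>) * K) ^ n"
proof -
  have BB: "B powr (- \<epsilon>) = v powr (- \<epsilon>) * (r powr (- \<epsilon>)) ^ n"
    using r v by (simp add: B powr_mult powr_realpow[symmetric] powr_powr mult.commute)
  define V where "V = max 1 (1 / v\<^sup>2)"
  have V1: "V \<ge> 1" by (simp add: V_def)
  have vV: "v powr (- \<epsilon>) \<le> V"
  proof (cases "v \<ge> 1")
    case True
    then have "v powr (- \<epsilon>) \<le> v powr 0" using \<epsilon> by (intro powr_mono) auto
    then show ?thesis using V1 v by simp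
  next
    case False
    then have "v powr (- \<epsilon>) \<le> v powr (- 2)" using \<epsilon> v by (intro powr_mono') auto
    also have "\<dots> = 1 / v\<^sup>2" using v by (simp add: powr_minus_divide powr_numeral)
    finally show ?thesis by (simp add: V_def)
  qed
  have V2: "2 * V \<le> (2 * V) ^ n" using V1 n by (intro self_le_power) auto
  have nk: "real n ^ k \<le> real n ^ 3" using n k by (intro power_increasing) auto
  have two: "2 * (2 * r) powr e \<le> 4 * (2 * r powr e)"
  proof -
    have "2 powr e \<le> (2::real) powr 2" using e by (intro powr_mono) auto
    then have "2 powr e * r powr e \<le> 4 * r powr e" by (intro mult_right_mono) auto
    then show ?thesis using r by (simp add: powr_mult)
  qed
  have "(real n ^ k * (2 * (2 * r) powr e)) ^ n * (2 * (B\<^sup>2 * B powr (- \<epsilon>)) * K ^ n)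
      \<le> (real n ^ 3 * (4 * (2 * r powr e))) ^ n * (2 * (B\<^sup>2 * (V * (r powr (- \<epsilon>)) ^ n)) * K ^ n)"
  proof (rule mult_mono)
    show "(real n ^ k * (2 * (2 * r) powr e)) ^ n \<le> (real n ^ 3 * (4 * (2 * r powr e))) ^ n"
      by (rule power_mono[OF mult_mono[OF nk two]]) auto
    show "2 * (B\<^sup>2 * B powr (- \<epsilon>)) * K ^ n \<le> 2 * (B\<^sup>2 * (V * (r powr (- \<epsilon>)) ^ n)) * K ^ n"
      unfolding BB using vV K by (intro mult_right_mono mult_left_mono) auto
  qed (use K in auto)
  also have "\<dots> = B\<^sup>2 * ((2 * V) * (8 * real n ^ 3 * (r powr e * r powr (- \<epsilon>)) * K) ^ n)"
  proof -
    have eq: "(x * b * K) ^ n = x ^ n * b ^ n * K ^ n" for x b by (simp only: power_mult_distrib)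
    have 1: "real n ^ 3 * (4 * (2 * r powr e)) = 8 * real n ^ 3 * r powr e" by simp
    have 2: "8 * real n ^ 3 * (r powr e * r powr (- \<epsilon>)) * K = (8 * real n ^ 3 * r powr e) * r powr (- \<epsilon>) * K"
      by (simp only: mult.assoc)
    show ?thesis unfolding 1 2 eq by (simp only: mult_ac)
  qed
  also have "r powr e * r powr (- \<epsilon>) = r powr (\<theta> - \<delta>)"
    using \<epsilon>(3) by (simp add: powr_add[symmetric])
  also have "B\<^sup>2 * ((2 * V) * (8 * real n ^ 3 * r powr (\<theta> - \<delta>) * K) ^ n)
      \<le> B\<^sup>2 * ((2 * V) ^ n * (8 * real n ^ 3 * r powr (\<theta> - \<delta>) * K) ^ n)"
    using V2 K by (intro mult_left_mono mult_right_mono) auto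
  also have "\<dots> = B\<^sup>2 * ((16 * V * real n ^ 3) * r powr (\<theta> - \<delta>) * K) ^ n"
    unfolding power_mult_distrib[symmetric] by (simp add: mult.assoc)
  finally show ?thesis by (simp only: V_def)
qed

text \<open>The seminorm already contains the differences of the Hessian at two points. Multiply by
  the denominator, at most \<open>(2 * r) powr e\<close>, and pass from exponent \<open>q\<close> to
  \<open>n\<close> on the product of the ball with itself, whose measure is
  \<open>B\<^sup>2\<close>.\<close>

lemma oscillation_fractional:
  fixes u :: "real^'n::finite \<Rightarrow> real" and W :: "'n list \<Rightarrow> real^'n \<Rightarrow> real"
  assumes r: "r > 0" and s: "nat \<lfloor>s\<rfloor> = 2" "s \<noteq> 2" "2 < s" "s < 3"
    and q: "1 \<le> q" and \<delta>: "\<delta> = enn2real (of_nat CARD('n) / q)" "s - \<delta> > 2"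
    and W: "\<And>is. length is = 2 \<Longrightarrow> borel_rep (ball z r) (weak_deriv (ball z r) u is) (W is)"
    and K: "K > 0" "sobolev_seminorm s q (ball z r) u \<le> ennreal K"
  shows "(\<integral>\<^sup>+x. indicator (ball z r) x * (\<integral>\<^sup>+y. indicator (ball z r) y *
           ennreal (norm (mat_of (\<lambda>j k. W [j, k]) x - mat_of (\<lambda>j k. W [j, k]) y) ^ CARD('n)) \<partial>lborel) \<partial>lborel)
      \<le> ennreal ((measure lborel (ball z r))\<^sup>2 * (osc_const TYPE('n) * r powr (s - 2 - \<delta>) * K) ^ CARD('n))"
proof -
  let ?S = "ball z r" and ?n = "CARD('n)" and ?L = "{is :: 'n list. length is = 2}"
  define wd where "wd = weak_deriv ?S u"
  define e where "e = \<delta> + (s - 2)"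
  define B where "B = measure lborel ?S"
  have n1: "?n \<ge> 1" by simp
  have \<delta>0: "\<delta> \<ge> 0" by (simp add: \<delta>)
  have B: "B = r ^ ?n * measure lborel (ball (0::real^'n) 1)" "B > 0"
    unfolding B_def using content_ball_conv_unit_ball[of r z] content_ball_pos[of r z] r by auto
  have lm: "?S \<in> lmeasurable" by simp
  interpret fm: finite_measure "lebesgue_on ?S" by (rule finite_measure_lebesgue_on[OF lm])
  define D where "D = (\<lambda>(x, y). L2_set (\<lambda>is. wd is x - wd is y) ?L / dist x y powr e)"
  have wd_meas: "wd is \<in> borel_measurable (lebesgue_on ?S)" if "length is = 2" for "is"
  proof -
    have "(\<lambda>x. indicat_real ?S x * wd is x) \<in> borel_measurable (lebesgue_on ?S)"
      using W[OF that] unfolding borel_rep_def wd_def by (intro measurable_restrict_space1) auto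
    then show ?thesis
      by (rule measurable_cong[THEN iffD1, rotated]) simp
  qed
  have id: "(\<lambda>x. x) \<in> lebesgue_on ?S \<rightarrow>\<^sub>M borel"
    by (intro measurable_restrict_space1 measurable_completion) simp
  have D_meas: "D \<in> borel_measurable (lebesgue_on ?S \<Otimes>\<^sub>M lebesgue_on ?S)"
  proof -
    have 1: "(\<lambda>p. wd is (fst p)) \<in> borel_measurable (lebesgue_on ?S \<Otimes>\<^sub>M lebesgue_on ?S)"
      "(\<lambda>p. wd is (snd p)) \<in> borel_measurable (lebesgue_on ?S \<Otimes>\<^sub>M lebesgue_on ?S)" if "length is = 2" for "is"
      by (rule measurable_compose[OF measurable_fst wd_meas[OF that]], rule measurable_compose[OF measurable_snd wd_meas[OF that]])
    have 2: "(\<lambda>p. dist (fst p) (snd p)) \<in> borel_measurable (lebesgue_on ?S \<Otimes>\<^sub>M lebesgue_on ?S)"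
      by (intro borel_measurable_dist measurable_compose[OF measurable_fst id] measurable_compose[OF measurable_snd id])
    have "(\<lambda>p. L2_set (\<lambda>is. wd is (fst p) - wd is (snd p)) ?L / dist (fst p) (snd p) powr e)
        \<in> borel_measurable (lebesgue_on ?S \<Otimes>\<^sub>M lebesgue_on ?S)"
      unfolding L2_set_def
      by (intro borel_measurable_divide borel_measurable_sqrt borel_measurable_sum borel_measurable_power
          borel_measurable_diff powr_real_measurable 2 borel_measurable_const) (use 1 in auto)
    then show ?thesis by (simp add: D_def split_beta)
  qed
  have sem: "Lq_norm q (lebesgue_on ?S \<Otimes>\<^sub>M lebesgue_on ?S) D \<le> ennreal K"
  proof -
    have "s - real 2 \<noteq> 0" using s by simp
    then have "sobolev_seminorm s q ?S u = Lq_norm q (lebesgue_on ?S \<Otimes>\<^sub>M lebesgue_on ?S) D"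
      unfolding sobolev_seminorm_def s(1) Let_def D_def wd_def e_def \<delta>(1) by simp
    then show ?thesis using K(2) by simp
  qed
  have space: "measure (lebesgue_on ?S \<Otimes>\<^sub>M lebesgue_on ?S) (space (lebesgue_on ?S \<Otimes>\<^sub>M lebesgue_on ?S)) = B\<^sup>2"
  proof -
    have em: "emeasure (lebesgue_on ?S) ?S = ennreal B"
    proof -
      have "emeasure (lebesgue_on ?S) ?S = emeasure lebesgue ?S"
        by (intro emeasure_restrict_space) auto
      also have "\<dots> = emeasure lborel ?S" by simp
      also have "\<dots> = ennreal (measure lborel ?S)"
        using emeasure_bounded_finite[of ?S] by (intro emeasure_eq_ennreal_measure) auto
      finally show ?thesis by (simp only: B_def)
    qed
    have "emeasure (lebesgue_on ?S \<Otimes>\<^sub>M lebesgue_on ?S) (?S \<times> ?S) = ennreal B * ennreal B"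
      by (subst fm.emeasure_pair_measure_Times) (auto simp: em sets_restrict_space)
    then show ?thesis
      using B(2) by (simp add: space_pair_measure measure_def power2_eq_square ennreal_mult[symmetric])
  qed
  have pair: "(\<integral>\<^sup>+p. ennreal (\<bar>D p\<bar> ^ ?n) \<partial>(lebesgue_on ?S \<Otimes>\<^sub>M lebesgue_on ?S)) \<le> ennreal (2 * (B\<^sup>2) powr (1 - \<delta>) * K ^ ?n)"
    by (rule Lq_norm_imp_power_bound[OF finite_measure_pair_measure[OF fm.finite_measure_axioms fm.finite_measure_axioms] D_meas q \<delta>(1) _ n1 K(1) sem])
      (use \<delta> s B r space in auto)
  define c where "c = (real ?n ^ 2 * (2 * (2 * r) powr e)) ^ ?n"
  have c0: "c \<ge> 0" by (simp add: c_def)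
  have ae: "AE x in lborel. x \<in> ?S \<longrightarrow> (\<forall>is\<in>?L. wd is x = W is x)"
  proof -
    have "AE x in lborel. \<forall>is\<in>?L. x \<in> ?S \<longrightarrow> wd is x = W is x"
    proof (rule AE_finite_allI[OF finite_lists_length])
      fix "is" :: "'n list" assume "is \<in> ?L"
      then have "borel_rep ?S (wd is) (W is)" using W by (simp add: wd_def)
      then show "AE x in lborel. x \<in> ?S \<longrightarrow> wd is x = W is x" unfolding borel_rep_def by (elim conjE)
    qed
    then show ?thesis by eventually_elim blast
  qed
  have point: "norm (mat_of (\<lambda>j k. W [j, k]) x - mat_of (\<lambda>j k. W [j, k]) y) ^ ?n \<le> c * \<bar>D (x, y)\<bar> ^ ?n"
    if x: "x \<in> ?S" "\<forall>is\<in>?L. wd is x = W is x" and y: "y \<in> ?S" "\<forall>is\<in>?L. wd is y = W is y" for x y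
  \<comment> \<open>On the diagonal the quotient \<open>D\<close> has the default value of a
    division by zero, but there the left side vanishes too.\<close>
  proof (cases "x = y")
    case True
    then show ?thesis using c0 by (simp add: power_0_left)
  next
    case False
    define l where "l = L2_set (\<lambda>is. wd is x - wd is y) ?L"
    have l0: "l \<ge> 0" by (simp add: l_def L2_set_nonneg)
    have dpos: "dist x y powr e > 0" using False by simp
    have d2: "dist x y \<le> 2 * r"
      using x(1) y(1) dist_triangle[of x y z] by (simp add: dist_commute)
    have e0: "e \<ge> 0" using \<delta>0 s by (simp add: e_def)
    have lD: "l = \<bar>D (x, y)\<bar> * dist x y powr e"
      using dpos l0 by (simp add: D_def l_def[symmetric] abs_divide)
    also have "\<dots> \<le> \<bar>D (x, y)\<bar> * (2 * r) powr e"
      using d2 e0 by (intro mult_left_mono powr_mono2) auto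
    also have "\<dots> \<le> \<bar>D (x, y)\<bar> * (2 * (2 * r) powr e)"
      by (intro mult_left_mono) auto
    finally have l: "l \<le> \<bar>D (x, y)\<bar> * (2 * (2 * r) powr e)" .
    have "norm (mat_of (\<lambda>j k. W [j, k]) x - mat_of (\<lambda>j k. W [j, k]) y) \<le> real (?n\<^sup>2) * l"
    proof (rule norm_matrix_le_entries)
      fix i j
      have "\<bar>wd [i, j] x - wd [i, j] y\<bar> \<le> l"
        unfolding l_def by (rule L2_set_member_le[OF finite_lists_length, where i = "[i, j]" and f = "\<lambda>is. wd is x - wd is y"]) simp
      then show "\<bar>(mat_of (\<lambda>j k. W [j, k]) x - mat_of (\<lambda>j k. W [j, k]) y) $ i $ j\<bar> \<le> l"
        using x(2) y(2) by (simp add: mat_of_def)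
    qed
    also have "\<dots> \<le> real (?n\<^sup>2) * (\<bar>D (x, y)\<bar> * (2 * (2 * r) powr e))"
      using l by (intro mult_left_mono) auto
    finally have "norm (mat_of (\<lambda>j k. W [j, k]) x - mat_of (\<lambda>j k. W [j, k]) y) ^ ?n
        \<le> (real (?n\<^sup>2) * (\<bar>D (x, y)\<bar> * (2 * (2 * r) powr e))) ^ ?n"
      by (intro power_mono) auto
    then show ?thesis by (simp add: c_def power_mult_distrib mult_ac)
  qed
  have "(\<integral>\<^sup>+x. indicator ?S x * (\<integral>\<^sup>+y. indicator ?S y *
           ennreal (norm (mat_of (\<lambda>j k. W [j, k]) x - mat_of (\<lambda>j k. W [j, k]) y) ^ ?n) \<partial>lborel) \<partial>lborel)
      \<le> (\<integral>\<^sup>+x. indicator ?S x * (\<integral>\<^sup>+y. indicator ?S y * ennreal (c * \<bar>D (x, y)\<bar> ^ ?n) \<partial>lborel) \<partial>lborel)"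
  proof (rule nn_integral_mono_AE)
    show "AE x in lborel. indicator ?S x * (\<integral>\<^sup>+y. indicator ?S y *
           ennreal (norm (mat_of (\<lambda>j k. W [j, k]) x - mat_of (\<lambda>j k. W [j, k]) y) ^ ?n) \<partial>lborel)
        \<le> indicator ?S x * (\<integral>\<^sup>+y. indicator ?S y * ennreal (c * \<bar>D (x, y)\<bar> ^ ?n) \<partial>lborel)"
      using ae
    proof eventually_elim
      case (elim x)
      show ?case
      proof (cases "x \<in> ?S")
        case True
        have "(\<integral>\<^sup>+y. indicator ?S y *
           ennreal (norm (mat_of (\<lambda>j k. W [j, k]) x - mat_of (\<lambda>j k. W [j, k]) y) ^ ?n) \<partial>lborel)
          \<le> (\<integral>\<^sup>+y. indicator ?S y * ennreal (c * \<bar>D (x, y)\<bar> ^ ?n) \<partial>lborel)"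
        proof (rule nn_integral_mono_AE)
          show "AE y in lborel. indicator ?S y *
             ennreal (norm (mat_of (\<lambda>j k. W [j, k]) x - mat_of (\<lambda>j k. W [j, k]) y) ^ ?n)
            \<le> indicator ?S y * ennreal (c * \<bar>D (x, y)\<bar> ^ ?n)"
            using ae
          proof eventually_elim
            case (elim y)
            show ?case
            proof (cases "y \<in> ?S")
              case y: True
              have "norm (mat_of (\<lambda>j k. W [j, k]) x - mat_of (\<lambda>j k. W [j, k]) y) ^ ?n \<le> c * \<bar>D (x, y)\<bar> ^ ?n"
                by (rule point[OF True _ y]) (use elim \<open>x \<in> ?S \<longrightarrow> _\<close> True y in auto)
              then show ?thesis using y by (simp add: ennreal_leI)
            qed simp
          qed
        qed
        then show ?thesis by (rule mult_left_mono) simp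
      qed simp
    qed
  qed
  also have "\<dots> = (\<integral>\<^sup>+x. \<integral>\<^sup>+y. ennreal (c * \<bar>D (x, y)\<bar> ^ ?n) \<partial>lebesgue_on ?S \<partial>lebesgue_on ?S)"
    by (simp add: nn_integral_lebesgue_on)
  also have "\<dots> = (\<integral>\<^sup>+p. ennreal (c * \<bar>D p\<bar> ^ ?n) \<partial>(lebesgue_on ?S \<Otimes>\<^sub>M lebesgue_on ?S))"
    by (rule fm.nn_integral_fst) (use D_meas in measurable)
  also have "\<dots> = (\<integral>\<^sup>+p. ennreal c * ennreal (\<bar>D p\<bar> ^ ?n) \<partial>(lebesgue_on ?S \<Otimes>\<^sub>M lebesgue_on ?S))"
    using c0 by (simp add: ennreal_mult)
  also have "\<dots> = ennreal c * (\<integral>\<^sup>+p. ennreal (\<bar>D p\<bar> ^ ?n) \<partial>(lebesgue_on ?S \<Otimes>\<^sub>M lebesgue_on ?S))"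
    by (rule nn_integral_cmult) (use D_meas in measurable)
  also have "\<dots> \<le> ennreal c * ennreal (2 * (B\<^sup>2) powr (1 - \<delta>) * K ^ ?n)"
    using pair by (rule mult_left_mono) simp
  also have "\<dots> = ennreal (c * (2 * (B\<^sup>2 * B powr (- (2 * \<delta>))) * K ^ ?n))"
  proof -
    have "(B\<^sup>2) powr (1 - \<delta>) = B powr (2 * (1 - \<delta>))"
      using B(2) by (simp add: powr_powr flip: powr_numeral)
    also have "\<dots> = B powr 2 * B powr (- (2 * \<delta>))"
      by (simp add: powr_add[symmetric] algebra_simps)
    also have "B powr 2 = B\<^sup>2" using B(2) by (simp add: powr_numeral)
    finally show ?thesis using c0 K by (simp add: ennreal_mult)
  qed
  also have "\<dots> \<le> ennreal (B\<^sup>2 * (osc_const TYPE('n) * r powr ((s - 2) - \<delta>) * K) ^ ?n)"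
    unfolding c_def osc_const_def
    by (intro ennreal_leI oscillation_arith)
      (use r \<delta>0 \<delta> s K B n1 content_ball_pos[of 1 "0::real^'n"] in \<open>auto simp: e_def\<close>)
  finally show ?thesis by (simp add: B_def)
qed

text \<open>Substitute \<open>y = x + a\<close> and fix the shift \<open>a\<close> first: the
  segment bound holds for almost every \<open>x\<close>, and its integral over \<open>x\<close> is
  moved back along the segment, which stays in the ball by convexity. Each shift costs one integral
  of \<open>F\<close>, and the relevant shifts fill a ball of radius \<open>2 * r\<close>.\<close>

lemma shift_oscillation:
  fixes F :: "'a::euclidean_space \<Rightarrow> ennreal" and N :: "'a \<times> 'a \<Rightarrow> ennreal"
  assumes N: "N \<in> borel_measurable (borel \<Otimes>\<^sub>M borel)" and F: "F \<in> borel_measurable borel"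
    and le: "\<And>a. norm a < 2 * r \<Longrightarrow> AE x in lborel. x \<in> ball z r \<longrightarrow> x + a \<in> ball z r \<longrightarrow>
      N (x, x + a) \<le> (\<integral>\<^sup>+t. indicator {0..1} t * F (x + t *\<^sub>R a) \<partial>lborel)"
  shows "(\<integral>\<^sup>+x. indicator (ball z r) x * (\<integral>\<^sup>+y. indicator (ball z r) y * N (x, y) \<partial>lborel) \<partial>lborel)
    \<le> emeasure lborel (ball (0::'a) (2 * r)) * (\<integral>\<^sup>+x. indicator (ball z r) x * F x \<partial>lborel)"
proof -
  let ?S = "ball z r"
  define J where "J = (\<integral>\<^sup>+x. indicator ?S x * F x \<partial>lborel)"
  have ind [measurable]: "(indicator ?S :: 'a \<Rightarrow> ennreal) \<in> borel_measurable borel"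
    by (rule borel_measurable_indicator) simp
  note [measurable] = N F
  have Nshift [measurable]: "(\<lambda>p. N (fst p, snd p + fst p)) \<in> borel_measurable (borel \<Otimes>\<^sub>M borel)"
    by (rule measurable_compose[OF _ N]) measurable
  have Nx [measurable]: "(\<lambda>y. N (x, y)) \<in> borel_measurable borel" for x
    by (rule measurable_compose[OF _ N]) measurable
  have Fshift [measurable]: "(\<lambda>p. F (fst p + snd p *\<^sub>R a)) \<in> borel_measurable (borel \<Otimes>\<^sub>M borel)" for a
    by (rule measurable_compose[OF _ F]) measurable
  have ind1 [measurable]: "(\<lambda>p. indicator ?S (fst p) :: ennreal) \<in> borel_measurable (borel \<Otimes>\<^sub>M (borel :: 'b::euclidean_space measure))"
    by (rule measurable_compose[OF measurable_fst ind])
  have ind2 [measurable]: "(\<lambda>p. indicator ?S (snd p + fst p) :: ennreal) \<in> borel_measurable (borel \<Otimes>\<^sub>M borel)"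
    by (rule measurable_compose[OF _ ind]) measurable
  have ind3 [measurable]: "(\<lambda>p. indicator ?S (fst p + snd p *\<^sub>R a) :: ennreal) \<in> borel_measurable (borel \<Otimes>\<^sub>M borel)" for a
    by (rule measurable_compose[OF _ ind]) measurable
  have ind4 [measurable]: "(\<lambda>p. indicator {0..1::real} (snd p) :: ennreal) \<in> borel_measurable ((borel :: 'a measure) \<Otimes>\<^sub>M borel)"
    by (rule measurable_compose[OF measurable_snd]) simp
  have "(\<integral>\<^sup>+x. indicator ?S x * (\<integral>\<^sup>+y. indicator ?S y * N (x, y) \<partial>lborel) \<partial>lborel)
      = (\<integral>\<^sup>+x. indicator ?S x * (\<integral>\<^sup>+a. indicator ?S (a + x) * N (x, a + x) \<partial>lborel) \<partial>lborel)"
  proof -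
    have "(\<integral>\<^sup>+a. indicator ?S (a + x) * N (x, a + x) \<partial>lborel) = (\<integral>\<^sup>+y. indicator ?S y * N (x, y) \<partial>lborel)" for x
      by (rule nn_integral_lborel_translate[where F = "\<lambda>y. indicator ?S y * N (x, y)"]) measurable
    then show ?thesis by simp
  qed
  also have "\<dots> = (\<integral>\<^sup>+x. \<integral>\<^sup>+a. indicator ?S x * (indicator ?S (a + x) * N (x, a + x)) \<partial>lborel \<partial>lborel)"
  proof (rule nn_integral_cong)
    fix x
    have "(\<lambda>a. indicator ?S (a + x) * N (x, a + x)) \<in> borel_measurable borel"
      by (intro borel_measurable_times_ennreal measurable_compose[OF _ ind] measurable_compose[OF _ Nx]) measurable
    then show "indicator ?S x * (\<integral>\<^sup>+a. indicator ?S (a + x) * N (x, a + x) \<partial>lborel)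
        = (\<integral>\<^sup>+a. indicator ?S x * (indicator ?S (a + x) * N (x, a + x)) \<partial>lborel)"
      by (intro nn_integral_cmult[symmetric]) simp
  qed
  also have "\<dots> = (\<integral>\<^sup>+a. \<integral>\<^sup>+x. indicator ?S x * (indicator ?S (a + x) * N (x, a + x)) \<partial>lborel \<partial>lborel)"
  proof (rule lborel_pair.Fubini'[symmetric])
    have "(\<lambda>p. indicator ?S (fst p) * (indicator ?S (snd p + fst p) * N (fst p, snd p + fst p))) \<in> borel_measurable (borel \<Otimes>\<^sub>M borel)"
      by (intro borel_measurable_times_ennreal ind1 ind2 Nshift)
    then show "(\<lambda>(x, a). indicator ?S x * (indicator ?S (a + x) * N (x, a + x))) \<in> borel_measurable (lborel \<Otimes>\<^sub>M lborel)"
      by (simp add: split_beta cong: measurable_cong_sets)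
  qed
  also have "\<dots> \<le> (\<integral>\<^sup>+a. indicator (ball (0::'a) (2 * r)) a * J \<partial>lborel)"
  proof (rule nn_integral_mono)
    fix a :: 'a
    show "(\<integral>\<^sup>+x. indicator ?S x * (indicator ?S (a + x) * N (x, a + x)) \<partial>lborel) \<le> indicator (ball 0 (2 * r)) a * J"
    proof (cases "norm a < 2 * r")
      case True
      have "(\<integral>\<^sup>+x. indicator ?S x * (indicator ?S (a + x) * N (x, a + x)) \<partial>lborel)
          \<le> (\<integral>\<^sup>+x. \<integral>\<^sup>+t. indicator {0..1} t * (indicator ?S (x + t *\<^sub>R a) * F (x + t *\<^sub>R a)) \<partial>lborel \<partial>lborel)"
      proof (rule nn_integral_mono_AE)
        show "AE x in lborel. indicator ?S x * (indicator ?S (a + x) * N (x, a + x))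
            \<le> (\<integral>\<^sup>+t. indicator {0..1} t * (indicator ?S (x + t *\<^sub>R a) * F (x + t *\<^sub>R a)) \<partial>lborel)"
          using le[OF True]
        proof eventually_elim
          case (elim x)
          show ?case
          proof (cases "x \<in> ?S \<and> a + x \<in> ?S")
            case xa: True
            have "N (x, x + a) \<le> (\<integral>\<^sup>+t. indicator {0..1} t * F (x + t *\<^sub>R a) \<partial>lborel)"
              using elim xa by (simp only: add.commute[of x a] simp_thms)
            also have "\<dots> = (\<integral>\<^sup>+t. indicator {0..1} t * (indicator ?S (x + t *\<^sub>R a) * F (x + t *\<^sub>R a)) \<partial>lborel)"
            proof (rule nn_integral_cong)
              fix t :: real
              show "indicator {0..1} t * F (x + t *\<^sub>R a) = indicator {0..1} t * (indicator ?S (x + t *\<^sub>R a) * F (x + t *\<^sub>R a))"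
              proof (cases "t \<in> {0..1}")
                case True
                have "(1 - t) *\<^sub>R x + t *\<^sub>R (a + x) \<in> ?S"
                  using xa True by (intro convexD_alt[OF convex_ball]) auto
                then have "x + t *\<^sub>R a \<in> ?S" by (simp add: algebra_simps del: mem_ball)
                then show ?thesis by (simp del: mem_ball)
              qed simp
            qed
            finally show ?thesis using xa by (simp add: add.commute[of a x] del: mem_ball)
          next
            case False
            then have "indicator ?S x * (indicator ?S (a + x) * N (x, a + x)) = 0"
              by (auto simp del: mem_ball)
            then show ?thesis by (simp only: zero_le)
          qed
        qed
      qed
      also have "\<dots> = (\<integral>\<^sup>+t. \<integral>\<^sup>+x. indicator {0..1} t * (indicator ?S (x + t *\<^sub>R a) * F (x + t *\<^sub>R a)) \<partial>lborel \<partial>lborel)"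
      proof (rule lborel_pair.Fubini'[symmetric])
        have "(\<lambda>p. indicator {0..1} (snd p) * (indicator ?S (fst p + snd p *\<^sub>R a) * F (fst p + snd p *\<^sub>R a))) \<in> borel_measurable (borel \<Otimes>\<^sub>M borel)"
          by (intro borel_measurable_times_ennreal ind4 ind3 Fshift)
        then show "(\<lambda>(x, t). indicator {0..1} t * (indicator ?S (x + t *\<^sub>R a) * F (x + t *\<^sub>R a))) \<in> borel_measurable (lborel \<Otimes>\<^sub>M lborel)"
          by (simp add: split_beta cong: measurable_cong_sets)
      qed
      also have "\<dots> = (\<integral>\<^sup>+t. indicator {0..1::real} t * J \<partial>lborel)"
      proof (rule nn_integral_cong)
        fix t :: real
        have m: "(\<lambda>x. indicator ?S x * F x) \<in> borel_measurable borel" by measurable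
        have "(\<integral>\<^sup>+x. indicator {0..1} t * (indicator ?S (x + t *\<^sub>R a) * F (x + t *\<^sub>R a)) \<partial>lborel)
            = indicator {0..1} t * (\<integral>\<^sup>+x. indicator ?S (x + t *\<^sub>R a) * F (x + t *\<^sub>R a) \<partial>lborel)"
        proof (rule nn_integral_cmult)
          show "(\<lambda>x. indicator ?S (x + t *\<^sub>R a) * F (x + t *\<^sub>R a)) \<in> borel_measurable lborel"
            by (intro borel_measurable_times_ennreal measurable_compose[OF _ ind] measurable_compose[OF _ F]) measurable
        qed
        also have "(\<integral>\<^sup>+x. indicator ?S (x + t *\<^sub>R a) * F (x + t *\<^sub>R a) \<partial>lborel) = J"
          unfolding J_def by (rule nn_integral_lborel_translate[OF m])
        finally show "(\<integral>\<^sup>+x. indicator {0..1} t * (indicator ?S (x + t *\<^sub>R a) * F (x + t *\<^sub>R a)) \<partial>lborel) = indicator {0..1} t * J" .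
      qed
      also have "\<dots> = J" by (simp add: nn_integral_multc)
      finally show ?thesis using True by simp
    next
      case False
      have "indicator ?S x * (indicator ?S (a + x) * N (x, a + x)) = 0" for x
      proof -
        have "\<not> (x \<in> ?S \<and> a + x \<in> ?S)"
        proof
          assume "x \<in> ?S \<and> a + x \<in> ?S"
          then have "dist x (a + x) < 2 * r" using dist_triangle[of x "a + x" z] by (simp add: dist_commute)
          then show False using False by (simp add: dist_norm)
        qed
        then show ?thesis by (auto simp del: mem_ball)
      qed
      then show ?thesis by (simp only: nn_integral_const mult_zero_left zero_le)
    qed
  qed
  also have "\<dots> = (\<integral>\<^sup>+a. indicator (ball (0::'a) (2 * r)) a \<partial>lborel) * J"
    by (rule nn_integral_multc) (rule borel_measurable_indicator, simp)
  also have "(\<integral>\<^sup>+a. indicator (ball (0::'a) (2 * r)) a \<partial>lborel) = emeasure lborel (ball (0::'a) (2 * r))"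
    by (rule nn_integral_indicator) simp
  finally show ?thesis by (simp only: J_def)
qed

lemma norm_mat_of_diff_measurable:
  assumes w: "\<And>j k. w j k \<in> borel_measurable borel"
  shows "(\<lambda>p. norm (mat_of w (fst p) - mat_of w (snd p))) \<in> borel_measurable (borel \<Otimes>\<^sub>M borel)"
proof -
  have "(\<lambda>p. w j k (fst p)) \<in> borel_measurable (borel \<Otimes>\<^sub>M borel)" "(\<lambda>p. w j k (snd p)) \<in> borel_measurable (borel \<Otimes>\<^sub>M borel)" for j k
    by (rule measurable_compose[OF measurable_fst w], rule measurable_compose[OF measurable_snd w])
  note [measurable] = this
  show ?thesis unfolding norm_vec_def L2_set_def mat_of_def vector_minus_component vec_lambda_beta by measurable
qed

text \<open>At order 3 the seminorm controls the third derivatives, and \<open>weak_ftc\<close>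
  writes increments of the Hessian as segment averages of them. The \<open>n\<close>-th power passes
  inside the average by Jensen's inequality, and \<open>shift_oscillation\<close> integrates over
  all pairs of points.\<close>

lemma oscillation_integer:
  fixes u :: "real^'n::finite \<Rightarrow> real" and W :: "'n list \<Rightarrow> real^'n \<Rightarrow> real"
  assumes r: "r > 0" and q: "1 \<le> q" and \<delta>: "\<delta> = enn2real (of_nat CARD('n) / q)" "\<delta> < 1"
    and wd: "\<And>is. length is \<le> 3 \<Longrightarrow> is_weak_deriv (ball z r) u is (weak_deriv (ball z r) u is)"
    and W: "\<And>is. length is \<le> 3 \<Longrightarrow> borel_rep (ball z r) (weak_deriv (ball z r) u is) (W is)"
    and K: "K > 0" "sobolev_seminorm 3 q (ball z r) u \<le> ennreal K"
  shows "(\<integral>\<^sup>+x. indicator (ball z r) x * (\<integral>\<^sup>+y. indicator (ball z r) y *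
           ennreal (norm (mat_of (\<lambda>j k. W [j, k]) x - mat_of (\<lambda>j k. W [j, k]) y) ^ CARD('n)) \<partial>lborel) \<partial>lborel)
      \<le> ennreal ((measure lborel (ball z r))\<^sup>2 * (osc_const TYPE('n) * r powr (1 - \<delta>) * K) ^ CARD('n))"
proof -
  let ?S = "ball z r" and ?n = "CARD('n)" and ?L = "{is :: 'n list. length is = 3}"
  define wd where "wd = weak_deriv ?S u"
  define B where "B = measure lborel ?S"
  have n1: "?n \<ge> 1" by simp
  have \<delta>0: "\<delta> \<ge> 0" by (simp add: \<delta>)
  have B: "B = r ^ ?n * measure lborel (ball (0::real^'n) 1)" "B > 0"
    unfolding B_def using content_ball_conv_unit_ball[of r z] content_ball_pos[of r z] r by auto
  have lm: "?S \<in> lmeasurable" by simp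
  interpret fm: finite_measure "lebesgue_on ?S" by (rule finite_measure_lebesgue_on[OF lm])
  have Wl: "loc_int ?S (W is)" if "length is \<le> 3" for "is"
    using W[OF that] by (simp add: borel_rep_def)
  have Wm [measurable]: "W is \<in> borel_measurable borel" if "length is \<le> 3" for "is"
    by (rule loc_intD(1)[OF Wl[OF that]])
  have wd_meas: "wd is \<in> borel_measurable (lebesgue_on ?S)" if "length is = 3" for "is"
  proof -
    have "(\<lambda>x. indicat_real ?S x * wd is x) \<in> borel_measurable (lebesgue_on ?S)"
      using W[of "is"] that unfolding borel_rep_def wd_def by (intro measurable_restrict_space1) auto
    then show ?thesis
      by (rule measurable_cong[THEN iffD1, rotated]) simp
  qed
  define D where "D = (\<lambda>x. L2_set (\<lambda>is. wd is x) ?L)"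
  define T where "T = (\<lambda>x. L2_set (\<lambda>is. W is x) ?L)"
  have T0: "T x \<ge> 0" for x by (simp add: T_def L2_set_nonneg)
  have T_meas [measurable]: "T \<in> borel_measurable borel"
    unfolding T_def L2_set_def by (intro measurable_compose[OF _ borel_measurable_sqrt] borel_measurable_sum borel_measurable_power) (use Wm in auto)
  have D_meas: "D \<in> borel_measurable (lebesgue_on ?S)"
    unfolding D_def L2_set_def by (intro measurable_compose[OF _ borel_measurable_sqrt] borel_measurable_sum borel_measurable_power) (use wd_meas in auto)
  have sem: "Lq_norm q (lebesgue_on ?S) D \<le> ennreal K"
    using K(2) unfolding sobolev_seminorm_def Let_def D_def wd_def by simp
  have em: "emeasure (lebesgue_on ?S) ?S = ennreal B"
  proof -
    have "emeasure (lebesgue_on ?S) ?S = emeasure lebesgue ?S"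
      by (intro emeasure_restrict_space) auto
    also have "\<dots> = emeasure lborel ?S" by simp
    also have "\<dots> = ennreal (measure lborel ?S)"
      using emeasure_bounded_finite[of ?S] by (intro emeasure_eq_ennreal_measure) auto
    finally show ?thesis by (simp only: B_def)
  qed
  have space: "B = measure (lebesgue_on ?S) (space (lebesgue_on ?S))"
    using em B(2) by (simp add: measure_def)
  have "(\<integral>\<^sup>+x. ennreal (\<bar>D x\<bar> ^ ?n) \<partial>lebesgue_on ?S) \<le> ennreal (2 * B powr (1 - \<delta>) * K ^ ?n)"
    by (rule Lq_norm_imp_power_bound[OF fm.finite_measure_axioms D_meas q \<delta>(1) _ n1 K(1) sem space B(2)])
      (use \<delta> in simp)
  moreover have "(\<integral>\<^sup>+x. ennreal (\<bar>D x\<bar> ^ ?n) \<partial>lebesgue_on ?S) = (\<integral>\<^sup>+x. indicator ?S x * ennreal (T x ^ ?n) \<partial>lborel)"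
    unfolding nn_integral_lebesgue_on[OF borel_open[OF open_ball]]
  proof (rule nn_integral_cong_AE)
    have "AE x in lborel. \<forall>is\<in>?L. x \<in> ?S \<longrightarrow> wd is x = W is x"
    proof (rule AE_finite_allI[OF finite_lists_length])
      fix "is" :: "'n list" assume "is \<in> ?L"
      then have "borel_rep ?S (wd is) (W is)" using W by (simp add: wd_def)
      then show "AE x in lborel. x \<in> ?S \<longrightarrow> wd is x = W is x" unfolding borel_rep_def by (elim conjE)
    qed
    then show "AE x in lborel. indicator ?S x * ennreal (\<bar>D x\<bar> ^ ?n) = indicator ?S x * ennreal (T x ^ ?n)"
    proof eventually_elim
      case (elim x)
      show ?case
      proof (cases "x \<in> ?S")
        case True
        then have "D x = T x" using elim unfolding D_def T_def by (intro L2_set_cong) auto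
        then show ?thesis using T0[of x] by simp
      qed simp
    qed
  qed
  ultimately have T_int: "(\<integral>\<^sup>+x. indicator ?S x * ennreal (T x ^ ?n) \<partial>lborel) \<le> ennreal (2 * B powr (1 - \<delta>) * K ^ ?n)"
    by simp
  \<comment> \<open>The square of \<open>n\<close> counts the entries of the Hessian, another
    \<open>n\<close> the third derivatives in each increment, and \<open>2 * r\<close> bounds the
    components of the shift.\<close>
  define c where "c = real ?n ^ 3 * (2 * r)"
  have c0: "c \<ge> 0" using r by (simp add: c_def)
  define H where "H = mat_of (\<lambda>j k. W [j, k])"
  have H_meas: "(\<lambda>p. norm (H (fst p) - H (snd p))) \<in> borel_measurable (borel \<Otimes>\<^sub>M borel)"
    unfolding H_def by (rule norm_mat_of_diff_measurable) (simp add: Wm)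
  have increment: "AE x in lborel. x \<in> ?S \<longrightarrow> x + a \<in> ?S \<longrightarrow>
      ennreal (norm (H x - H (x + a)) ^ ?n)
        \<le> (\<integral>\<^sup>+t. indicator {0..1} t * ennreal ((c * T (x + t *\<^sub>R a)) ^ ?n) \<partial>lborel)"
    if a: "norm a < 2 * r" for a
  proof -
    have "AE x in lborel. \<forall>is\<in>{is :: 'n list. length is = 2}. x \<in> {x \<in> ?S. x + a \<in> ?S} \<longrightarrow>
      integrable lborel (\<lambda>t. indicat_real {0..1} t * (\<Sum>i\<in>UNIV. a $ i * W (is @ [i]) (x + t *\<^sub>R a))) \<and>
      W is (x + a) - W is x = (\<integral>t. indicat_real {0..1} t * 1 * (\<Sum>i\<in>UNIV. a $ i * W (is @ [i]) (x + t *\<^sub>R a)) \<partial>lborel)"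
    proof (rule AE_finite_allI[OF finite_lists_length])
      fix "is" :: "'n list" assume "is \<in> {is. length is = 2}"
      then have l: "length is \<le> 3" "\<And>i. length (is @ [i]) \<le> 3" by auto
      show "AE x in lborel. x \<in> {x \<in> ?S. x + a \<in> ?S} \<longrightarrow>
      integrable lborel (\<lambda>t. indicat_real {0..1} t * (\<Sum>i\<in>UNIV. a $ i * W (is @ [i]) (x + t *\<^sub>R a))) \<and>
      W is (x + a) - W is x = (\<integral>t. indicat_real {0..1} t * 1 * (\<Sum>i\<in>UNIV. a $ i * W (is @ [i]) (x + t *\<^sub>R a)) \<partial>lborel)"
        by (rule weak_ftc[OF convex_ball open_ball Wl[OF l(1)] Wl[OF l(2)]])
          (rule weak_deriv_chain[OF wd[OF l(1)] wd[OF l(2)] W[OF l(1)] W[OF l(2)] open_ball])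
    qed
    then show ?thesis
    proof eventually_elim
      case (elim x)
      show ?case
      proof (intro impI)
        assume x: "x \<in> ?S" "x + a \<in> ?S"
        define G where "G t = c * T (x + t *\<^sub>R a)" for t
        have G_meas [measurable]: "G \<in> borel_measurable borel"
          unfolding G_def[abs_def] by (intro borel_measurable_times borel_measurable_const measurable_compose[OF _ T_meas]) measurable
        have G0: "G t \<ge> 0" for t using c0 T0 by (simp add: G_def)
        define I where "I = (\<integral>\<^sup>+t. indicator {0..1} t * ennreal (G t) \<partial>lborel)"
        have "ennreal (norm (H x - H (x + a))) \<le> I"
        \<comment> \<open>An infinite average leaves nothing to prove; a finite one bounds each
          entry by a real number.\<close>
        proof (cases "I = \<infinity>")
          case False
          then have I: "I = ennreal (enn2real I)" by (simp add: less_top)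
          have m0: "G t = real (?n\<^sup>2) * (real ?n * (2 * r) * T (x + t *\<^sub>R a))" for t
            by (simp add: G_def c_def power2_eq_square power3_eq_cube)
          have entry: "\<bar>W [j, k] (x + a) - W [j, k] x\<bar> \<le> enn2real I / real (?n\<^sup>2)" for j k
          proof -
            let ?f = "\<lambda>t. indicat_real {0..1} t * (\<Sum>i\<in>UNIV. a $ i * W ([j, k] @ [i]) (x + t *\<^sub>R a))"
            have e: "integrable lborel ?f" "W [j, k] (x + a) - W [j, k] x = (\<integral>t. ?f t \<partial>lborel)"
              using elim[THEN bspec, of "[j, k]"] x by auto
            have "ennreal \<bar>W [j, k] (x + a) - W [j, k] x\<bar> \<le> (\<integral>\<^sup>+t. ennreal (norm (?f t)) \<partial>lborel)"
              using integral_norm_bound_ennreal[OF e(1)] by (simp add: e(2))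
            also have "\<dots> \<le> (\<integral>\<^sup>+t. ennreal (1 / real (?n\<^sup>2)) * (indicator {0..1} t * ennreal (G t)) \<partial>lborel)"
            proof (rule nn_integral_mono)
              fix t :: real
              have "\<bar>\<Sum>i\<in>UNIV. a $ i * W ([j, k] @ [i]) (x + t *\<^sub>R a)\<bar> \<le> (\<Sum>i\<in>(UNIV::'n set). 2 * r * T (x + t *\<^sub>R a))"
              proof (rule order_trans[OF sum_abs sum_mono])
                fix i
                have "\<bar>W ([j, k] @ [i]) (x + t *\<^sub>R a)\<bar> \<le> T (x + t *\<^sub>R a)"
                  unfolding T_def by (rule L2_set_member_le[OF finite_lists_length, where f = "\<lambda>is. W is (x + t *\<^sub>R a)"]) simp
                moreover have "\<bar>a $ i\<bar> \<le> 2 * r" using component_le_norm_cart[of a i] a by linarith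
                ultimately show "\<bar>a $ i * W ([j, k] @ [i]) (x + t *\<^sub>R a)\<bar> \<le> 2 * r * T (x + t *\<^sub>R a)"
                  unfolding abs_mult using r by (intro mult_mono) auto
              qed
              also have "\<dots> = 1 / real (?n\<^sup>2) * G t" by (simp add: m0)
              finally have "norm (?f t) \<le> 1 / real (?n\<^sup>2) * (indicat_real {0..1} t * G t)"
                by (cases "t \<in> {0..1}") auto
              then have "ennreal (norm (?f t)) \<le> ennreal (1 / real (?n\<^sup>2) * (indicat_real {0..1} t * G t))"
                by (rule ennreal_leI)
              also have "\<dots> = ennreal (1 / real (?n\<^sup>2)) * (indicator {0..1} t * ennreal (G t))"
                using G0[of t] by (subst ennreal_mult) (auto simp: indicator_def)
              finally show "ennreal (norm (?f t)) \<le> ennreal (1 / real (?n\<^sup>2)) * (indicator {0..1} t * ennreal (G t))" .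
            qed
            also have "\<dots> = ennreal (1 / real (?n\<^sup>2)) * I"
              unfolding I_def by (rule nn_integral_cmult) measurable
            also have "\<dots> = ennreal (enn2real I / real (?n\<^sup>2))"
              by (subst I) (simp add: ennreal_mult[symmetric])
            finally show ?thesis by (subst (asm) ennreal_le_iff) auto
          qed
          have "norm (H x - H (x + a)) \<le> real (?n\<^sup>2) * (enn2real I / real (?n\<^sup>2))"
            by (rule norm_matrix_le_entries) (use entry in \<open>simp add: H_def mat_of_def abs_minus_commute\<close>)
          then have "norm (H x - H (x + a)) \<le> enn2real I" by simp
          then show ?thesis by (subst I) (rule ennreal_leI)
        qed simp
        then show "ennreal (norm (H x - H (x + a)) ^ ?n)
            \<le> (\<integral>\<^sup>+t. indicator {0..1} t * ennreal ((c * T (x + t *\<^sub>R a)) ^ ?n) \<partial>lborel)"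
          unfolding I_def G_def[symmetric] by (intro power_average_le G_meas G0 n1) auto
      qed
    qed
  qed
  have "(\<integral>\<^sup>+x. indicator ?S x * (\<integral>\<^sup>+y. indicator ?S y * ennreal (norm (H x - H y) ^ ?n) \<partial>lborel) \<partial>lborel)
      \<le> emeasure lborel (ball (0::real^'n) (2 * r)) * (\<integral>\<^sup>+x. indicator ?S x * ennreal ((c * T x) ^ ?n) \<partial>lborel)"
  proof (rule shift_oscillation[where N = "\<lambda>p. ennreal (norm (H (fst p) - H (snd p)) ^ ?n)" and F = "\<lambda>x. ennreal ((c * T x) ^ ?n)", unfolded fst_conv snd_conv])
    show "(\<lambda>p. ennreal (norm (H (fst p) - H (snd p)) ^ ?n)) \<in> borel_measurable (borel \<Otimes>\<^sub>M borel)"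
      by (intro measurable_compose[OF _ measurable_ennreal] borel_measurable_power H_meas)
    show "(\<lambda>x. ennreal ((c * T x) ^ ?n)) \<in> borel_measurable borel" by measurable
  qed (rule increment)
  also have "(\<integral>\<^sup>+x. indicator ?S x * ennreal ((c * T x) ^ ?n) \<partial>lborel)
      = ennreal (c ^ ?n) * (\<integral>\<^sup>+x. indicator ?S x * ennreal (T x ^ ?n) \<partial>lborel)"
  proof -
    have "(\<lambda>x. indicator ?S x :: ennreal) \<in> borel_measurable borel" by (rule borel_measurable_indicator) simp
    then have "(\<lambda>x. indicator ?S x * ennreal (T x ^ ?n)) \<in> borel_measurable lborel" by simp
    then have "ennreal (c ^ ?n) * (\<integral>\<^sup>+x. indicator ?S x * ennreal (T x ^ ?n) \<partial>lborel)
        = (\<integral>\<^sup>+x. ennreal (c ^ ?n) * (indicator ?S x * ennreal (T x ^ ?n)) \<partial>lborel)"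
      by (rule nn_integral_cmult[symmetric])
    also have "\<dots> = (\<integral>\<^sup>+x. indicator ?S x * ennreal ((c * T x) ^ ?n) \<partial>lborel)"
      using c0 T0 by (intro nn_integral_cong) (simp add: power_mult_distrib ennreal_mult mult_ac)
    finally show ?thesis by simp
  qed
  also have "emeasure lborel (ball (0::real^'n) (2 * r)) = ennreal (2 ^ ?n * B)"
  proof -
    have "emeasure lborel (ball (0::real^'n) (2 * r)) = ennreal (measure lborel (ball (0::real^'n) (2 * r)))"
      using emeasure_bounded_finite[of "ball (0::real^'n) (2 * r)"] by (intro emeasure_eq_ennreal_measure) auto
    also have "measure lborel (ball (0::real^'n) (2 * r)) = 2 ^ ?n * B"
      using content_ball_conv_unit_ball[of "2 * r" "0::real^'n"] r by (simp add: B(1) power_mult_distrib)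
    finally show ?thesis .
  qed
  also have "ennreal (2 ^ ?n * B) * (ennreal (c ^ ?n) * (\<integral>\<^sup>+x. indicator ?S x * ennreal (T x ^ ?n) \<partial>lborel))
      \<le> ennreal (2 ^ ?n * B) * (ennreal (c ^ ?n) * ennreal (2 * B powr (1 - \<delta>) * K ^ ?n))"
    using T_int by (intro mult_left_mono) auto
  also have "\<dots> = ennreal ((real ?n ^ 3 * (2 * (2 * r) powr 1)) ^ ?n * (2 * (B\<^sup>2 * B powr (- \<delta>)) * K ^ ?n))"
  proof -
    have 1: "B powr (1 - \<delta>) = B * B powr (- \<delta>)"
      using B(2) powr_add[of B 1 "- \<delta>"] by simp
    have 2: "(real ?n ^ 3 * (2 * (2 * r) powr 1)) ^ ?n = 2 ^ ?n * c ^ ?n"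
    proof -
      have "real ?n ^ 3 * (2 * (2 * r) powr 1) = 2 * c" using r by (simp add: c_def)
      then show ?thesis by (simp only: power_mult_distrib)
    qed
    have mult3: "ennreal x * (ennreal y * ennreal w) = ennreal (x * (y * w))" if "x \<ge> 0" "y \<ge> 0" "w \<ge> 0" for x y w
      using that by (simp add: ennreal_mult)
    have "2 ^ ?n * B * (c ^ ?n * (2 * (B * B powr (- \<delta>)) * K ^ ?n)) = 2 ^ ?n * c ^ ?n * (2 * (B\<^sup>2 * B powr (- \<delta>)) * K ^ ?n)"
      by (simp only: power2_eq_square mult_ac)
    then show ?thesis
      unfolding 1 2 by (subst mult3) (use B(2) c0 K in auto)
  qed
  also have "\<dots> \<le> ennreal (B\<^sup>2 * (osc_const TYPE('n) * r powr (1 - \<delta>) * K) ^ ?n)"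
    unfolding osc_const_def
    by (intro ennreal_leI oscillation_arith)
      (use r \<delta>0 \<delta> K B n1 content_ball_pos[of 1 "0::real^'n"] in auto)
  finally show ?thesis by (simp add: B_def H_def)
qed

section \<open>The Sobolev case\<close>

text \<open>If \<open>g\<close> exceeded twice its average wherever \<open>P\<close> holds, hence
  almost everywhere in \<open>S\<close>, its integral would be too large. Twice the average makes
  the contradiction strict.\<close>

lemma exists_below_twice_average:
  fixes g :: "'a::euclidean_space \<Rightarrow> ennreal"
  assumes S: "S \<in> sets borel" "emeasure lborel S = ennreal B" "B > 0" and P: "AE x in lborel. x \<in> S \<longrightarrow> P x"
    and le: "(\<integral>\<^sup>+x. indicator S x * g x \<partial>lborel) \<le> ennreal (B * (B * c))" and c: "c > 0"
  obtains x where "x \<in> S" "P x" "g x \<le> ennreal (B * (2 * c))"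
proof (rule ccontr)
  note wit = that
  assume no: "\<not> thesis"
  have large: "ennreal (B * (2 * c)) \<le> g x" if "x \<in> S" "P x" for x
    using no wit[OF that] linear by blast
  have "ennreal (B * (2 * c)) * ennreal B = (\<integral>\<^sup>+x. ennreal (B * (2 * c)) * indicator S x \<partial>lborel)"
    using S by (subst nn_integral_cmult_indicator) auto
  also have "\<dots> \<le> (\<integral>\<^sup>+x. indicator S x * g x \<partial>lborel)"
  proof (rule nn_integral_mono_AE)
    show "AE x in lborel. ennreal (B * (2 * c)) * indicator S x \<le> indicator S x * g x"
      using P
    proof eventually_elim
      case (elim x)
      then show ?case using large[of x] by (cases "x \<in> S") auto
    qed
  qed
  also note le
  finally have "B * (2 * c) * B \<le> B * (B * c)"
    using S(3) c by (simp add: ennreal_mult[symmetric] ennreal_le_iff)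
  then show False using S(3) c by (simp add: mult_ac)
qed

text \<open>Twice the constant \<open>4 * \<rho>\<^sup>2 * (1 + (r / \<rho>) ^ n)\<close> of
  \<open>weak_sup_bound\<close>, in units of \<open>h\<^sup>2\<close> and with
  \<open>\<rho> \<le> R * h\<close> and \<open>r / \<rho> \<le> 2\<close>. It is doubled because the
  estimate is used both at \<open>xi\<close> and at \<open>xi + y\<close>.\<close>

definition taylor_const :: "nat \<Rightarrow> real \<Rightarrow> real" where
  "taylor_const n R = 8 * R\<^sup>2 * (1 + 2 ^ n)"

text \<open>The first summand is the error of the subdifferential, cut off at the size of a
  difference of two Hessians. The second compares determinants over the ball, whose volume is at
  most \<open>2 * (R / b) ^ n\<close> times the integral of the hat function.\<close>

definition weak_const :: "nat \<Rightarrow> real \<Rightarrow> real \<Rightarrow> real \<Rightarrow> real \<Rightarrow> real \<Rightarrow> real" where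
  "weak_const n lam Lam R s b =
     cell_const n lam s (taylor_const n R * (2 * real (n\<^sup>2) * Lam)) * taylor_const n R * (det_lipschitz_const n Lam * Lam)
       + 4 * det_lipschitz_const n Lam * (R / b) ^ n"

context lattice_mesh
begin

text \<open>The last bound lets an error integrated over the whole ball be charged to the integral
  of the hat function.\<close>

lemma ball_measure:
  shows "emeasure lborel (ball xi (R * h)) = ennreal (measure lborel (ball xi (R * h)))"
    and "measure lborel (ball xi (R * h)) > 0"
    and "measure lborel (ball xi (R * h)) \<le> 2 * (R / (\<gamma> / (8 * \<sigma>))) ^ CARD('n) * lat.I"
proof -
  show "emeasure lborel (ball xi (R * h)) = ennreal (measure lborel (ball xi (R * h)))"
    using emeasure_bounded_finite[of "ball xi (R * h)"] by (intro emeasure_eq_ennreal_measure) auto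
  have Rh: "R * h > 0" using h R by simp
  show "measure lborel (ball xi (R * h)) > 0" using content_ball_pos[OF Rh] by simp
  let ?v = "measure lborel (ball (0::real^'n) 1)" and ?b = "\<gamma> / (8 * \<sigma>)"
  have b: "?b > 0" using \<gamma> sigma by simp
  have "measure lborel (ball xi (R * h)) = (R * h) ^ CARD('n) * ?v"
    using content_ball_conv_unit_ball[of "R * h" xi] Rh by simp
  also have "(R * h) ^ CARD('n) = (R / ?b) ^ CARD('n) * (?b * h) ^ CARD('n)"
  proof -
    have "R / b * (b * h) = R * h" if "b > 0" for b using that by simp
    from this[OF b] show ?thesis by (simp only: power_mult_distrib[symmetric])
  qed
  also have "\<dots> * ?v = 2 * (R / ?b) ^ CARD('n) * (?v * (?b * h) ^ CARD('n) / 2)" by simp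
  also have "\<dots> \<le> 2 * (R / ?b) ^ CARD('n) * lat.I"
    using lat.I_lower R \<gamma> sigma by (intro mult_left_mono) auto
  finally show "measure lborel (ball xi (R * h)) \<le> 2 * (R / ?b) ^ CARD('n) * lat.I" .
qed

text \<open>\<open>M\<close> is a symmetric matrix within the ellipticity bounds from which the weak
  Hessian deviates by at most \<open>E1\<close> in the mean of order \<open>n\<close>. The error
  splits at \<open>det M * lat.I\<close>, as in the Hoelder case.\<close>

lemma weak_case:
  fixes u :: "real^'n \<Rightarrow> real" and w1 :: "'n \<Rightarrow> real^'n \<Rightarrow> real" and w2 :: "'n \<Rightarrow> 'n \<Rightarrow> real^'n \<Rightarrow> real"
    and M :: "real^'n^'n" and H :: "real^'n \<Rightarrow> real^'n^'n"
  defines "B \<equiv> ball xi (R * h)"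
  assumes u: "convex_on (closure \<Omega>) u" and cont: "continuous_on B u"
    and lam: "lam > 0" "lam \<le> Lam" "3 * Lam \<le> lam * R"
    and w1: "\<And>k. loc_int B (w1 k)" and w2: "\<And>j k. loc_int B (w2 j k)"
    and weak1: "\<And>k c a b. \<lbrakk>c > 0; cbox a b \<subseteq> B\<rbrakk> \<Longrightarrow>
      (\<integral>x. indicat_real B x * u x * partials [k] (bump c a b) x \<partial>lborel) = - (\<integral>x. w1 k x * bump c a b x \<partial>lborel)"
    and weak2: "\<And>j k c a b. \<lbrakk>c > 0; cbox a b \<subseteq> B\<rbrakk> \<Longrightarrow>
      (\<integral>x. indicat_real B x * u x * partials [j, k] (bump c a b) x \<partial>lborel) = (\<integral>x. w2 j k x * bump c a b x \<partial>lborel)"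
    and sym: "transpose M = M" and Mlo: "\<And>x. lam * (norm x)\<^sup>2 \<le> x \<bullet> (M *v x)" and Mup: "\<And>x. x \<bullet> (M *v x) \<le> Lam * (norm x)\<^sup>2"
    and H: "AE x in lborel. x \<in> B \<longrightarrow> H x = mat_of w2 x \<and> (\<forall>i j. \<bar>mat_of w2 x $ i $ j\<bar> \<le> Lam)"
    and E1: "E1 > 0"
      "(\<integral>\<^sup>+x. indicator B x * ennreal (norm (mat_of w2 x - M) ^ CARD('n)) \<partial>lborel) \<le> ennreal (measure lborel B * E1 ^ CARD('n))"
  shows "\<bar>measure lebesgue (nodal_subdifferential (N0 \<union> Nb) (restrict u (N0 \<union> Nb)) xi)
            - (LINT x:\<Omega>|lebesgue. \<phi> xi x * det (H x))\<bar>
    \<le> weak_const CARD('n) lam Lam R sep (\<gamma> / (8 * \<sigma>)) * E1 * (LINT x:\<Omega>|lebesgue. \<phi> xi x)"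
proof -
  let ?n = "CARD('n)"
  define V where "V = measure lborel B"
  define D where "D = det_lipschitz_const ?n Lam"
  define \<kappa> where "\<kappa> = taylor_const ?n R"
  define Emax where "Emax = 2 * real (?n\<^sup>2) * Lam"
  \<comment> \<open>The cut at \<open>Emax\<close> again makes the constant independent of
    \<open>u\<close>; it is justified by the bounds on the entries, valid for almost every
    point.\<close>
  define E where "E = min E1 Emax"
  define A where "A x = mat_of w2 x" for x
  have Lam0: "Lam > 0" using lam by simp
  have Rh: "R * h > 0" using h R by simp
  have xiB: "xi \<in> B" using Rh by (simp add: B_def)
  have D0: "D \<ge> 0" unfolding D_def using Lam0 by (rule det_lipschitz_const_nonneg)
  have Emax0: "Emax > 0" using Lam0 by (simp add: Emax_def)
  have E0: "E > 0" "E \<le> E1" "E \<le> Emax" using E1 Emax0 by (auto simp: E_def)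
  have \<kappa>0: "\<kappa> > 0" using R by (simp add: \<kappa>_def taylor_const_def add_pos_nonneg)
  have V: "emeasure lborel B = ennreal V" "V > 0" "V \<le> 2 * (R / (\<gamma> / (8 * \<sigma>))) ^ ?n * lat.I"
    using ball_measure by (simp_all only: V_def B_def)
  have w2m: "w2 j k \<in> borel_measurable borel" for j k by (rule loc_intD(1)[OF w2])
  have nm [measurable]: "(\<lambda>x. norm (A x - M)) \<in> borel_measurable borel"
    unfolding A_def by (rule norm_mat_of_measurable) (rule w2m)
  have indB: "(\<lambda>x. indicator B x :: ennreal) \<in> borel_measurable borel"
    by (rule borel_measurable_indicator) (simp add: B_def)
  have Mnonneg: "0 \<le> x \<bullet> (M *v x)" for x
    using Mlo[of x] lam by (meson less_imp_le mult_nonneg_nonneg order_trans zero_le_power2)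
  have Ment: "\<bar>M $ i $ j\<bar> \<le> Lam" for i j
    using symmetric_entry_bound[OF sym Mnonneg Mup] .
  have bound: "(\<integral>\<^sup>+x. indicator B x * ennreal (norm (A x - M) ^ ?n) \<partial>lborel) \<le> ennreal (V * E ^ ?n)"
  proof (cases "E1 \<le> Emax")
    case True
    then show ?thesis using E1(2) by (simp add: E_def A_def V_def)
  next
    case False
    have "(\<integral>\<^sup>+x. indicator B x * ennreal (norm (A x - M) ^ ?n) \<partial>lborel)
        \<le> (\<integral>\<^sup>+x. ennreal (Emax ^ ?n) * indicator B x \<partial>lborel)"
    proof (rule nn_integral_mono_AE)
      show "AE x in lborel. indicator B x * ennreal (norm (A x - M) ^ ?n) \<le> ennreal (Emax ^ ?n) * indicator B x"
        using H
      proof eventually_elim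
        case (elim x)
        show ?case
        proof (cases "x \<in> B")
          case True
          have "norm (A x - M) \<le> real (?n\<^sup>2) * (2 * Lam)"
          proof (rule norm_matrix_le_entries)
            fix i j
            have "\<bar>A x $ i $ j\<bar> \<le> Lam" using elim True by (simp add: A_def)
            then show "\<bar>(A x - M) $ i $ j\<bar> \<le> 2 * Lam" using Ment[of i j] by simp
          qed
          then have "norm (A x - M) ^ ?n \<le> Emax ^ ?n"
            by (intro power_mono) (auto simp: Emax_def mult_ac)
          then show ?thesis using True by (simp add: ennreal_leI)
        qed simp
      qed
    qed
    also have "\<dots> = ennreal (Emax ^ ?n) * ennreal V"
      using V(1) by (subst nn_integral_cmult_indicator) (auto simp: B_def)
    also have "\<dots> = ennreal (V * E ^ ?n)"
      using False V(2) Emax0 by (simp add: E_def ennreal_mult[symmetric] mult.commute)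
    finally show ?thesis .
  qed
  \<comment> \<open>A radius between \<open>9 / 10 * R * h\<close>, up to which the Taylor estimate
    is wanted, and that of the full ball.\<close>
  define \<rho> where "\<rho> = 19 / 20 * (R * h)"
  have \<rho>: "0 < \<rho>" "\<rho> < R * h" using Rh by (auto simp: \<rho>_def)
  have cont': "continuous_on B (\<lambda>x. indicat_real B x * u x)"
    using cont by (rule continuous_on_eq) simp
  have li: "loc_int B (\<lambda>x. indicat_real B x * u x)"
    using borel_rep_continuous[OF cont[unfolded B_def]] by (simp add: borel_rep_def B_def)
  obtain a p where ap0: "\<And>x. x \<in> ball xi \<rho> \<Longrightarrow>
      \<bar>indicat_real B x * u x - x \<bullet> (M *v x) / 2 - a - p \<bullet> x\<bar> \<le> 4 * \<rho>\<^sup>2 * (1 + (R * h / \<rho>) ^ ?n) * E"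
  proof (rule weak_sup_bound[OF li[unfolded B_def] cont'[unfolded B_def] w1[unfolded B_def] w2[unfolded B_def]
        weak1[unfolded B_def] weak2[unfolded B_def] sym E0(1) \<rho> bound[unfolded B_def V_def A_def], folded B_def])
    fix a p
    assume "\<And>x. x \<in> ball xi \<rho> \<Longrightarrow>
      \<bar>indicat_real B x * u x - x \<bullet> (M *v x) / 2 - a - p \<bullet> x\<bar> \<le> 4 * \<rho>\<^sup>2 * (1 + (R * h / \<rho>) ^ ?n) * E"
    then show thesis by (rule that)
  qed
  have ap: "\<bar>u x - x \<bullet> (M *v x) / 2 - a - p \<bullet> x\<bar> \<le> \<kappa> / 2 * E * h\<^sup>2" if "x \<in> ball xi \<rho>" for x
  proof -
    have "x \<in> B" using that \<rho> by (simp add: B_def)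
    then have "\<bar>u x - x \<bullet> (M *v x) / 2 - a - p \<bullet> x\<bar> \<le> 4 * \<rho>\<^sup>2 * (1 + (R * h / \<rho>) ^ ?n) * E"
      using ap0[OF that] by simp
    also have "\<dots> \<le> 4 * (R * h)\<^sup>2 * (1 + 2 ^ ?n) * E"
    proof (intro mult_right_mono mult_mono add_mono power_mono mult_left_mono)
      show "R * h / \<rho> \<le> 2" using Rh by (simp add: \<rho>_def)
    qed (use \<rho> E0 Rh in auto)
    also have "\<dots> = \<kappa> / 2 * E * h\<^sup>2" by (simp add: \<kappa>_def taylor_const_def power_mult_distrib)
    finally show ?thesis .
  qed
  \<comment> \<open>The quadratic form of \<open>weak_sup_bound\<close> is centred at the origin of
    the space. Recentring it at \<open>xi\<close> adds \<open>M *v xi\<close> to the linear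
    part.\<close>
  define p' where "p' = p + M *v xi"
  have taylor: "\<bar>u (xi + y) - u xi - p' \<bullet> y - y \<bullet> (M *v y) / 2\<bar> \<le> \<kappa> * E * h\<^sup>2" if "norm y \<le> 9 / 10 * R * h" for y
  proof -
    have "xi \<in> ball xi \<rho>" "xi + y \<in> ball xi \<rho>" using that \<rho> Rh by (auto simp: dist_norm \<rho>_def)
    note 1 = ap[OF this(1)] ap[OF this(2)]
    have "xi \<bullet> (M *v y) = y \<bullet> (M *v xi)" using inner_commute dot_lmul_matrix[of xi M y] sym
      by (metis vector_transpose_matrix transpose_matrix_vector)
    then have "(xi + y) \<bullet> (M *v (xi + y)) / 2 = xi \<bullet> (M *v xi) / 2 + y \<bullet> (M *v xi) + y \<bullet> (M *v y) / 2"
      by (simp add: matrix_vector_right_distrib inner_add_left inner_add_right)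
    moreover have "p' \<bullet> y = p \<bullet> y + y \<bullet> (M *v xi)"
      by (simp add: p'_def inner_add_left inner_commute[of "M *v xi" y])
    ultimately have "u (xi + y) - u xi - p' \<bullet> y - y \<bullet> (M *v y) / 2
        = (u (xi + y) - (xi + y) \<bullet> (M *v (xi + y)) / 2 - a - p \<bullet> (xi + y)) - (u xi - xi \<bullet> (M *v xi) / 2 - a - p \<bullet> xi)"
      using inner_add_right[of p xi y] by linarith
    moreover have "\<kappa> * E * h\<^sup>2 = \<kappa> / 2 * E * h\<^sup>2 + \<kappa> / 2 * E * h\<^sup>2" by simp
    ultimately show ?thesis using 1 by linarith
  qed
  define C where "C = cell_const ?n lam sep (\<kappa> * Emax)"
  have C0: "C \<ge> 0" unfolding C_def using lam Lam0 \<kappa>0 Emax0 by (intro cell_const_nonneg) auto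
  have I0: "lat.I > 0" by (rule lat.I_pos)
  have detM: "\<bar>det M\<bar> \<le> D * Lam" unfolding D_def by (rule det_bound[OF Lam0 Ment])
  have detM0: "det M > 0" using positive_definite_det_pos[OF lam(1) Mlo] .
  have "\<bar>measure lebesgue (nodal_subdifferential (N0 \<union> Nb) (restrict u (N0 \<union> Nb)) xi) - det M * lat.I\<bar>
      \<le> C * (\<kappa> * E) * (det M * lat.I)"
    unfolding C_def
    by (rule measure_subdifferential[OF u sym lam(1) Mlo Mup lam(2,3) _ _ taylor]) (use \<kappa>0 E0 in auto)
  also have "\<dots> \<le> C * (\<kappa> * E1) * (D * Lam * lat.I)"
    using C0 D0 Lam0 \<kappa>0 E0 E1 detM detM0 I0 by (intro mult_mono mult_left_mono mult_nonneg_nonneg) auto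
  finally have e1: "\<bar>measure lebesgue (nodal_subdifferential (N0 \<union> Nb) (restrict u (N0 \<union> Nb)) xi) - det M * lat.I\<bar>
      \<le> C * (\<kappa> * E1) * (D * Lam * lat.I)" .
  define F where "F x = det (H x)" for x
  have detA [measurable]: "(\<lambda>x. det (A x)) \<in> borel_measurable borel"
    unfolding det_def A_def mat_of_def using w2m by simp
  have AE_H: "AE x in lebesgue. x \<in> B \<longrightarrow> H x = A x \<and> (\<forall>i j. \<bar>A x $ i $ j\<bar> \<le> Lam)"
    unfolding A_def by (rule AE_completion[OF H])
  have cB: "cball xi h \<subseteq> B" unfolding B_def by (rule cball_subset(1))
  have intF: "set_integrable lebesgue (cball xi h) F"
  proof -
    have cb: "integrable lebesgue (\<lambda>x. D * Lam * indicat_real (cball xi h) x)"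
      using emeasure_bounded_finite[OF bounded_cball, of xi h]
      by (intro integrable_mult_right) (simp add: integrable_indicator_iff)
    have m: "(\<lambda>x. indicat_real (cball xi h) x *\<^sub>R det (A x)) \<in> borel_measurable lebesgue"
      by (intro measurable_completion borel_measurable_scaleR borel_measurable_indicator) (use detA in \<open>simp_all del: mem_cball\<close>)
    have ae: "AE x in lebesgue. indicat_real (cball xi h) x *\<^sub>R det (A x) = indicat_real (cball xi h) x *\<^sub>R F x"
      using AE_H
    proof eventually_elim
      case (elim x)
      then show ?case using cB by (cases "x \<in> cball xi h") (auto simp: F_def simp del: mem_cball)
    qed
    show ?thesis
      unfolding set_integrable_def
    proof (rule Bochner_Integration.integrable_bound[OF cb])
      show "(\<lambda>x. indicat_real (cball xi h) x *\<^sub>R F x) \<in> borel_measurable lebesgue"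
        by (rule borel_measurable_AE[OF m ae])
      show "AE x in lebesgue. norm (indicat_real (cball xi h) x *\<^sub>R F x) \<le> norm (D * Lam * indicat_real (cball xi h) x)"
        using AE_H
      proof eventually_elim
        case (elim x)
        show ?case
        proof (cases "x \<in> cball xi h")
          case True
          then have "H x = A x" "\<And>i j. \<bar>A x $ i $ j\<bar> \<le> Lam" using elim cB by auto
          then have "\<bar>F x\<bar> \<le> D * Lam" unfolding F_def D_def using det_bound[OF Lam0, of "A x"] by simp
          then show ?thesis using True by (simp del: mem_cball)
        qed simp
      qed
    qed
  qed
  \<comment> \<open>The determinant is Lipschitz in \<open>norm (A x - M)\<close>, of which only the
    \<open>n\<close>-th power is controlled. \<open>le_young_power\<close> with \<open>c = E\<close>
    turns that control into \<open>2 * E * V\<close> for the first power.\<close>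
  have e2: "\<bar>(LINT x:\<Omega>|lebesgue. \<phi> xi x * F x) - det M * lat.I\<bar> \<le> D * (2 * E * V)"
  proof -
    have int: "integrable lebesgue (\<lambda>x. indicat_real (cball xi h) x *\<^sub>R (\<phi> xi x * \<bar>F x - det M\<bar>))"
      using phi_error(1)[OF intF] by (simp add: set_integrable_def)
    have nn: "0 \<le> indicat_real (cball xi h) x *\<^sub>R (\<phi> xi x * \<bar>F x - det M\<bar>)" for x
      using phi_bounds(1)[of x] by (simp del: mem_cball)
    have "ennreal (LINT x:cball xi h|lebesgue. \<phi> xi x * \<bar>F x - det M\<bar>)
        = (\<integral>\<^sup>+x. ennreal (indicat_real (cball xi h) x *\<^sub>R (\<phi> xi x * \<bar>F x - det M\<bar>)) \<partial>lebesgue)"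
      unfolding set_lebesgue_integral_def by (rule nn_integral_eq_integral[symmetric, OF int]) (use nn in simp)
    also have "\<dots> \<le> (\<integral>\<^sup>+x. ennreal D * (ennreal E * indicator B x + ennreal (1 / E ^ (?n - 1)) * (indicator B x * ennreal (norm (A x - M) ^ ?n))) \<partial>lebesgue)"
    proof (rule nn_integral_mono_AE)
      show "AE x in lebesgue. ennreal (indicat_real (cball xi h) x *\<^sub>R (\<phi> xi x * \<bar>F x - det M\<bar>))
          \<le> ennreal D * (ennreal E * indicator B x + ennreal (1 / E ^ (?n - 1)) * (indicator B x * ennreal (norm (A x - M) ^ ?n)))"
        using AE_H
      proof eventually_elim
        case (elim x)
        show ?case
        proof (cases "x \<in> cball xi h")
          case True
          then have xB: "x \<in> B" using cB by blast
          then have HA: "H x = A x" "\<And>i j. \<bar>A x $ i $ j\<bar> \<le> Lam" using elim by auto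
          have "\<bar>F x - det M\<bar> \<le> D * norm (A x - M)"
            unfolding F_def D_def HA(1)
          proof (rule det_lipschitz[OF Lam0 HA(2) Ment])
            fix i j
            have "\<bar>(A x - M) $ i $ j\<bar> \<le> norm ((A x - M) $ i)" by (rule component_le_norm_cart)
            also have "\<dots> \<le> norm (A x - M)" by (rule Finite_Cartesian_Product.norm_nth_le)
            finally show "\<bar>A x $ i $ j - M $ i $ j\<bar> \<le> norm (A x - M)" by simp
          qed
          also have "\<dots> \<le> D * (E + norm (A x - M) ^ ?n / E ^ (?n - 1))"
            using D0 by (intro mult_left_mono le_young_power E0) auto
          finally have 1: "\<bar>F x - det M\<bar> \<le> D * (E + norm (A x - M) ^ ?n / E ^ (?n - 1))" .
          have "\<phi> xi x * \<bar>F x - det M\<bar> \<le> 1 * \<bar>F x - det M\<bar>"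
            using phi_bounds[of x] by (intro mult_right_mono) auto
          also note 1
          finally have "\<phi> xi x * \<bar>F x - det M\<bar> \<le> D * (E + (1 / E ^ (?n - 1)) * norm (A x - M) ^ ?n)" by simp
          then have "ennreal (\<phi> xi x * \<bar>F x - det M\<bar>) \<le> ennreal (D * (E + (1 / E ^ (?n - 1)) * norm (A x - M) ^ ?n))"
            by (rule ennreal_leI)
          also have "\<dots> = ennreal D * (ennreal E + ennreal (1 / E ^ (?n - 1)) * ennreal (norm (A x - M) ^ ?n))"
            using D0 E0 by (simp only: ennreal_mult ennreal_plus mult_nonneg_nonneg add_nonneg_nonneg less_imp_le zero_le_divide_1_iff zero_le_power norm_ge_zero)
          finally show ?thesis using True xB by (simp del: mem_cball)
        next
          case False
          then show ?thesis by (simp del: mem_cball)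
        qed
      qed
    qed
    also have "\<dots> = (\<integral>\<^sup>+x. ennreal D * (ennreal E * indicator B x + ennreal (1 / E ^ (?n - 1)) * (indicator B x * ennreal (norm (A x - M) ^ ?n))) \<partial>lborel)"
      by (rule nn_integral_completion)
    also have "\<dots> = ennreal D * (ennreal E * ennreal V + ennreal (1 / E ^ (?n - 1)) * (\<integral>\<^sup>+x. indicator B x * ennreal (norm (A x - M) ^ ?n) \<partial>lborel))"
    proof -
      have Bs: "B \<in> sets lborel" by (simp add: B_def)
      have m1: "(\<lambda>x. indicator B x * ennreal (norm (A x - M) ^ ?n)) \<in> borel_measurable lborel"
        using indB by simp
      have m2: "(\<lambda>x. ennreal E * indicator B x) \<in> borel_measurable lborel" using indB by simp
      have m3: "(\<lambda>x. ennreal (1 / E ^ (?n - 1)) * (indicator B x * ennreal (norm (A x - M) ^ ?n))) \<in> borel_measurable lborel"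
        using m1 by simp
      show ?thesis
        by (simp only: nn_integral_cmult[OF borel_measurable_add[OF m2 m3]] nn_integral_add[OF m2 m3]
            nn_integral_cmult[OF m1] nn_integral_cmult_indicator[OF Bs] V(1))
    qed
    also have "\<dots> \<le> ennreal D * (ennreal E * ennreal V + ennreal (1 / E ^ (?n - 1)) * ennreal (V * E ^ ?n))"
      by (intro mult_left_mono add_left_mono bound) auto
    also have "\<dots> = ennreal (D * (E * V + 1 / E ^ (?n - 1) * (V * E ^ ?n)))"
      using D0 E0 V(2) by (simp only: ennreal_mult ennreal_plus mult_nonneg_nonneg add_nonneg_nonneg less_imp_le zero_le_divide_1_iff zero_le_power)
    also have "E * V + 1 / E ^ (?n - 1) * (V * E ^ ?n) = 2 * E * V"
    proof -
      have "E ^ ?n = E * E ^ (?n - 1)" by (simp flip: power_Suc)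
      then show ?thesis using E0 by simp
    qed
    finally have "(LINT x:cball xi h|lebesgue. \<phi> xi x * \<bar>F x - det M\<bar>) \<le> D * (2 * E * V)"
      using D0 E0 V(2) by (subst (asm) ennreal_le_iff) auto
    then show ?thesis using phi_error(2)[OF intF, of "det M"] by linarith
  qed
  have "D * (2 * E * V) \<le> D * (2 * E1 * (2 * (R / (\<gamma> / (8 * \<sigma>))) ^ ?n * lat.I))"
    using D0 E0 E1 V by (intro mult_left_mono mult_mono) auto
  then have "\<bar>measure lebesgue (nodal_subdifferential (N0 \<union> Nb) (restrict u (N0 \<union> Nb)) xi) - (LINT x:\<Omega>|lebesgue. \<phi> xi x * F x)\<bar>
      \<le> C * (\<kappa> * E1) * (D * Lam * lat.I) + D * (2 * E1 * (2 * (R / (\<gamma> / (8 * \<sigma>))) ^ ?n * lat.I))"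
    using e1 e2 by linarith
  also have "\<dots> = weak_const ?n lam Lam R sep (\<gamma> / (8 * \<sigma>)) * E1 * lat.I"
  proof -
    have wc: "weak_const ?n lam Lam R sep (\<gamma> / (8 * \<sigma>)) = C * \<kappa> * (D * Lam) + 4 * D * (R / (\<gamma> / (8 * \<sigma>))) ^ ?n"
      by (simp only: weak_const_def C_def Emax_def \<kappa>_def D_def)
    have "C * (\<kappa> * E1) * (D * Lam * I) + D * (2 * E1 * (2 * X * I)) = (C * \<kappa> * (D * Lam) + 4 * D * X) * E1 * I" for X I
      by (simp add: algebra_simps)
    then show ?thesis unfolding wc .
  qed
  finally show ?thesis by (simp only: F_def phi_lint_one)
qed

end

text \<open>The Sobolev estimate is proved for all \<open>K\<close> above the seminorm, so that
  positivity of \<open>K\<close> is at hand even when the seminorm vanishes.\<close>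

lemma le_of_forall_greater:
  fixes a c s :: real
  assumes c: "c \<ge> 0" and le: "\<And>K. K > s \<Longrightarrow> a \<le> c * K"
  shows "a \<le> c * s"
proof (cases "c = 0")
  case True
  then show ?thesis using le[of "s + 1"] by simp
next
  case False
  have "a / c \<le> s"
  proof (rule dense_ge)
    fix K assume "s < K"
    then show "a / c \<le> K" using le[of K] c False by (simp add: pos_divide_le_eq mult.commute)
  qed
  then show ?thesis using c False by (simp add: pos_divide_le_eq mult.commute)
qed

text \<open>The conditions on \<open>s\<close> leave order 3 and the orders strictly between 2 and
  3.\<close>

lemma sobolev_oscillation:
  fixes u :: "real^'n::finite \<Rightarrow> real" and W :: "'n list \<Rightarrow> real^'n \<Rightarrow> real"
  assumes r: "r > 0" and q: "1 \<le> q" and \<delta>: "\<delta> = enn2real (of_nat CARD('n) / q)" and s: "s - \<delta> > 2" "s \<le> 3"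
    and wd: "\<And>is. length is \<le> nat \<lfloor>s\<rfloor> \<Longrightarrow> is_weak_deriv (ball z r) u is (weak_deriv (ball z r) u is)"
    and W: "\<And>is. length is \<le> nat \<lfloor>s\<rfloor> \<Longrightarrow> borel_rep (ball z r) (weak_deriv (ball z r) u is) (W is)"
    and K: "K > 0" "sobolev_seminorm s q (ball z r) u \<le> ennreal K"
  shows "(\<integral>\<^sup>+x. indicator (ball z r) x * (\<integral>\<^sup>+y. indicator (ball z r) y *
           ennreal (norm (mat_of (\<lambda>j k. W [j, k]) x - mat_of (\<lambda>j k. W [j, k]) y) ^ CARD('n)) \<partial>lborel) \<partial>lborel)
      \<le> ennreal ((measure lborel (ball z r))\<^sup>2 * (osc_const TYPE('n) * r powr (s - 2 - \<delta>) * K) ^ CARD('n))"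
proof (cases "s = 3")
  case True
  then have n3: "nat \<lfloor>s\<rfloor> = 3" by simp
  have "\<delta> < 1" using s by linarith
  moreover have "s - 2 - \<delta> = 1 - \<delta>" using True by simp
  ultimately show ?thesis
    using oscillation_integer[OF r q \<delta> _ wd[unfolded n3] W[unfolded n3] K[unfolded True]] by (simp only:)
next
  case False
  have "\<delta> \<ge> 0" by (simp add: \<delta>)
  then have s2: "2 < s" "s < 3" using s False by auto
  then have n2: "nat \<lfloor>s\<rfloor> = 2" by (simp add: floor_eq_iff nat_eq_iff)
  show ?thesis
    by (rule oscillation_fractional[OF r n2 _ s2 q \<delta> s(1) W[unfolded n2] K]) (use s2 in auto)
qed

context lattice_mesh
begin

lemma sobolev_case:
  fixes u :: "real^'n \<Rightarrow> real"
  defines "B \<equiv> ball xi (R * h)"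
  assumes u: "convex_on (closure \<Omega>) u" and cont: "continuous_on (closure \<Omega>) u"
    and lam: "lam > 0" "lam \<le> Lam" "3 * Lam \<le> lam * R"
    and q: "1 \<le> q" and s: "s - enn2real (of_nat CARD('n) / q) > 2" "s \<le> 3" and sob: "in_sobolev s q B u"
    and bounds: "AE x in lebesgue_on B. loewner_le (mat lam) (weak_hessian B u x) \<and> loewner_le (weak_hessian B u x) (mat Lam)"
  shows "\<bar>measure lebesgue (nodal_subdifferential (N0 \<union> Nb) (restrict u (N0 \<union> Nb)) xi)
            - (LINT x:\<Omega>|lebesgue. \<phi> xi x * det (weak_hessian B u x))\<bar>
    \<le> weak_const CARD('n) lam Lam R sep (\<gamma> / (8 * \<sigma>)) * (2 * osc_const TYPE('n) * R)
       * h powr (s - 2 - enn2real (of_nat CARD('n) / q)) * enn2real (sobolev_seminorm s q B u)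
       * (LINT x:\<Omega>|lebesgue. \<phi> xi x)"
proof -
  let ?n = "CARD('n)"
  define \<delta> where "\<delta> = enn2real (of_nat ?n / q)"
  define \<beta> where "\<beta> = s - 2 - \<delta>"
  define V where "V = measure lborel B"
  define H where "H = weak_hessian B u"
  have \<delta>0: "\<delta> \<ge> 0" by (simp add: \<delta>_def)
  have s': "s - \<delta> > 2" using s(1) by (simp add: \<delta>_def)
  have \<beta>: "0 < \<beta>" "\<beta> \<le> 1" using s s' \<delta>0 by (auto simp: \<beta>_def)
  have fl: "2 \<le> nat \<lfloor>s\<rfloor>" using s' \<delta>0 by linarith
  have Rh: "R * h > 0" using h R by simp
  have Lam0: "Lam > 0" using lam by simp
  have oB: "open B" by (simp add: B_def)
  have Bsub: "B \<subseteq> closure \<Omega>" unfolding B_def using ball_subset(3) closure_subset by blast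
  have contB: "continuous_on B u" using cont Bsub by (rule continuous_on_subset)
  have wd: "is_weak_deriv B u is (weak_deriv B u is)" if "length is \<le> nat \<lfloor>s\<rfloor>" for "is"
    unfolding weak_deriv_def
    by (rule someI_ex[of "is_weak_deriv B u is"]) (rule sob[unfolded in_sobolev_def, THEN conjunct1, THEN spec, THEN mp, OF that, THEN conjunct1])
  \<comment> \<open>Representatives are chosen for all lists at once; lists that are too long are
    excused by the implication.\<close>
  have "\<forall>is. \<exists>w. length is \<le> nat \<lfloor>s\<rfloor> \<longrightarrow> borel_rep B (weak_deriv B u is) w"
  proof (intro allI)
    fix "is"
    show "\<exists>w. length is \<le> nat \<lfloor>s\<rfloor> \<longrightarrow> borel_rep B (weak_deriv B u is) w"
    proof (cases "length is \<le> nat \<lfloor>s\<rfloor>")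
      case True
      then have "locally_integrable_on B (weak_deriv B u is)"
        using wd[OF True] unfolding is_weak_deriv_def by (elim conjE)
      from ex_borel_rep[OF this[unfolded B_def] Rh] show ?thesis unfolding B_def by (elim exE) (rule exI, rule impI)
    qed simp
  qed
  then obtain W where "\<forall>is. length is \<le> nat \<lfloor>s\<rfloor> \<longrightarrow> borel_rep B (weak_deriv B u is) (W is)"
    unfolding choice_iff by (elim exE)
  then have W: "borel_rep B (weak_deriv B u is) (W is)" if "length is \<le> nat \<lfloor>s\<rfloor>" for "is" using that by simp
  define w2 where "w2 = (\<lambda>j k. W [j, k])"
  define A where "A = mat_of w2"
  have Wl: "loc_int B (W is)" if "length is \<le> 2" for "is"
    using W[of "is"] that fl by (simp add: borel_rep_def)
  have pairing: "(\<integral>x. indicat_real B x * u x * partials is (bump c a b) x \<partial>lborel) = (- 1) ^ length is * (\<integral>x. W is x * bump c a b x \<partial>lborel)"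
    if "length is \<le> 2" "c > 0" "cbox a b \<subseteq> B" for "is" c a b
    using weak_deriv_pairing[OF wd borel_rep_continuous[OF contB[unfolded B_def], folded B_def] W oB that(2,3), of "is"] that(1) fl by simp
  have ae: "AE x in lborel. x \<in> B \<longrightarrow> H x = A x \<and> transpose (A x) = A x \<and>
      (\<forall>y. lam * (norm y)\<^sup>2 \<le> y \<bullet> (A x *v y)) \<and> (\<forall>y. y \<bullet> (A x *v y) \<le> Lam * (norm y)\<^sup>2)"
  proof -
    have b1: "AE x in lborel. x \<in> B \<longrightarrow> loewner_le (mat lam) (H x) \<and> loewner_le (H x) (mat Lam)"
    proof -
      have "AE x in lebesgue. x \<in> B \<longrightarrow> loewner_le (mat lam) (H x) \<and> loewner_le (H x) (mat Lam)"
        using bounds oB by (subst (asm) AE_restrict_space_iff) (auto simp: H_def)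
      then show ?thesis by (simp only: AE_completion_iff)
    qed
    have b2: "AE x in lborel. \<forall>is\<in>{is :: 'n list. length is = 2}. x \<in> B \<longrightarrow> weak_deriv B u is x = W is x"
    proof (rule AE_finite_allI[OF finite_lists_length])
      fix "is" :: "'n list" assume "is \<in> {is. length is = 2}"
      then have "borel_rep B (weak_deriv B u is) (W is)" using W fl by simp
      then show "AE x in lborel. x \<in> B \<longrightarrow> weak_deriv B u is x = W is x" unfolding borel_rep_def by (elim conjE)
    qed
    \<comment> \<open>The ellipticity bounds do not see the antisymmetric part of a matrix, so
      symmetry of the weak Hessian is derived separately.\<close>
    have b3: "AE x in lborel. \<forall>j\<in>UNIV. \<forall>k\<in>UNIV. x \<in> B \<longrightarrow> w2 j k x = w2 k j x"
    proof (intro AE_finite_allI finite)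
      fix j k
      show "AE x in lborel. x \<in> B \<longrightarrow> w2 j k x = w2 k j x"
        unfolding w2_def by (rule mixed_weak_deriv_symmetric[OF oB Wl Wl, where u' = "\<lambda>x. indicat_real B x * u x" and i = j and j = k])
          (use pairing[of "[j, k]"] pairing[of "[k, j]"] in auto)
    qed
    from b1 b2 b3 show ?thesis
    proof eventually_elim
      case (elim x)
      show ?case
      proof
        assume x: "x \<in> B"
        have HA: "H x = A x"
          using elim(2) x by (simp add: H_def weak_hessian_def A_def mat_of_def w2_def vec_eq_iff)
        moreover have "transpose (A x) = A x"
          using elim(3) x by (simp add: A_def mat_of_def transpose_def vec_eq_iff)
        moreover have "(\<forall>y. lam * (norm y)\<^sup>2 \<le> y \<bullet> (A x *v y)) \<and> (\<forall>y. y \<bullet> (A x *v y) \<le> Lam * (norm y)\<^sup>2)"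
          using elim(1) x by (auto simp: HA loewner_mat)
        ultimately show "H x = A x \<and> transpose (A x) = A x \<and>
      (\<forall>y. lam * (norm y)\<^sup>2 \<le> y \<bullet> (A x *v y)) \<and> (\<forall>y. y \<bullet> (A x *v y) \<le> Lam * (norm y)\<^sup>2)" by blast
      qed
    qed
  qed
  have ent: "\<bar>A x $ i $ j\<bar> \<le> Lam"
    if "transpose (A x) = A x" "\<forall>y. lam * (norm y)\<^sup>2 \<le> y \<bullet> (A x *v y)" "\<forall>y. y \<bullet> (A x *v y) \<le> Lam * (norm y)\<^sup>2" for x i j
  proof (rule symmetric_entry_bound[OF that(1)])
    fix y
    show "0 \<le> y \<bullet> (A x *v y)"
      using that(2) lam by (meson less_imp_le mult_nonneg_nonneg order_trans zero_le_power2)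
    show "y \<bullet> (A x *v y) \<le> Lam * (norm y)\<^sup>2" using that(3) by blast
  qed
  define sem where "sem = enn2real (sobolev_seminorm s q B u)"
  define c where "c = weak_const ?n lam Lam R sep (\<gamma> / (8 * \<sigma>)) * (2 * osc_const TYPE('n) * R) * h powr \<beta> * lat.I"
  have wc0: "weak_const ?n lam Lam R sep (\<gamma> / (8 * \<sigma>)) \<ge> 0"
  proof -
    have "taylor_const ?n R \<ge> 0" by (simp add: taylor_const_def)
    then show ?thesis
      unfolding weak_const_def using lam Lam0 R \<gamma> sigma det_lipschitz_const_nonneg[OF Lam0, of ?n]
      by (intro add_nonneg_nonneg mult_nonneg_nonneg cell_const_nonneg) auto
  qed
  have osc0: "osc_const TYPE('n) > 0" by (rule osc_const_pos)
  have I0: "lat.I > 0" by (rule lat.I_pos)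
  have "\<bar>measure lebesgue (nodal_subdifferential (N0 \<union> Nb) (restrict u (N0 \<union> Nb)) xi)
            - (LINT x:\<Omega>|lebesgue. \<phi> xi x * det (H x))\<bar> \<le> c * sem"
  proof (rule le_of_forall_greater)
    show "c \<ge> 0" unfolding c_def using wc0 osc0 R I0 by (intro mult_nonneg_nonneg) auto
    fix K assume K: "K > sem"
    have "sem \<ge> 0" by (simp add: sem_def)
    then have K0: "K > 0" using K by simp
    have "sobolev_seminorm s q B u = ennreal sem"
      using sob unfolding sem_def in_sobolev_def by (simp add: less_top)
    then have Kle: "sobolev_seminorm s q B u \<le> ennreal K" using K by (simp add: ennreal_leI)
    \<comment> \<open>The mean oscillation of the Hessian over the ball of radius
      \<open>R * h\<close>, as bounded by \<open>sobolev_oscillation\<close>.\<close>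
    define \<epsilon> where "\<epsilon> = osc_const TYPE('n) * (R * h) powr \<beta> * K"
    have "(R * h) powr \<beta> > 0" using Rh by (metis less_irrefl powr_gt_zero)
    then have \<epsilon>0: "\<epsilon> > 0" using osc0 K0 by (simp add: \<epsilon>_def)
    have V: "emeasure lborel B = ennreal V" "V > 0" using ball_measure by (simp_all only: V_def B_def)
    have osc: "(\<integral>\<^sup>+x. indicator B x * (\<integral>\<^sup>+y. indicator B y * ennreal (norm (A x - A y) ^ ?n) \<partial>lborel) \<partial>lborel)
        \<le> ennreal (V * (V * \<epsilon> ^ ?n))"
      using sobolev_oscillation[OF Rh q \<delta>_def s' s(2) wd[unfolded B_def] W[unfolded B_def] K0 Kle[unfolded B_def]]
      by (simp only: A_def w2_def V_def \<epsilon>_def \<beta>_def B_def power2_eq_square mult.assoc)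
    \<comment> \<open>The Hessian at this point serves as \<open>M\<close>: a single point has to
      combine symmetry and ellipticity, valid almost everywhere, with a small oscillation.\<close>
    obtain x0 where x0: "x0 \<in> B" "H x0 = A x0 \<and> transpose (A x0) = A x0 \<and>
      (\<forall>y. lam * (norm y)\<^sup>2 \<le> y \<bullet> (A x0 *v y)) \<and> (\<forall>y. y \<bullet> (A x0 *v y) \<le> Lam * (norm y)\<^sup>2)"
      "(\<integral>\<^sup>+y. indicator B y * ennreal (norm (A x0 - A y) ^ ?n) \<partial>lborel) \<le> ennreal (V * (2 * \<epsilon> ^ ?n))"
      by (rule exists_below_twice_average[OF borel_open[OF oB] V ae osc]) (use \<epsilon>0 in auto)
    have "(\<integral>\<^sup>+y. indicator B y * ennreal (norm (A y - A x0) ^ ?n) \<partial>lborel) \<le> ennreal (V * (2 * \<epsilon>) ^ ?n)"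
    proof -
      have "2 * \<epsilon> ^ ?n \<le> 2 ^ ?n * \<epsilon> ^ ?n"
        using \<epsilon>0 self_le_power[of "2::real" ?n] by (intro mult_right_mono) auto
      then have "V * (2 * \<epsilon> ^ ?n) \<le> V * (2 * \<epsilon>) ^ ?n"
        using V(2) by (intro mult_left_mono) (auto simp: power_mult_distrib)
      then show ?thesis
        using x0(3) ennreal_leI order_trans by (simp only: norm_minus_commute[of "A _" "A x0"]) blast
    qed
    then have "\<bar>measure lebesgue (nodal_subdifferential (N0 \<union> Nb) (restrict u (N0 \<union> Nb)) xi)
            - (LINT x:\<Omega>|lebesgue. \<phi> xi x * det (H x))\<bar>
      \<le> weak_const ?n lam Lam R sep (\<gamma> / (8 * \<sigma>)) * (2 * \<epsilon>) * (LINT x:\<Omega>|lebesgue. \<phi> xi x)"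
      unfolding A_def V_def B_def
    proof (intro weak_case[where ?w1.0 = "\<lambda>k. W [k]" and M = "A x0", unfolded A_def] u lam)
      show "continuous_on (ball xi (R * h)) u" using contB by (simp only: B_def)
      show "loc_int (ball xi (R * h)) (W [k])" "loc_int (ball xi (R * h)) (w2 j k)" for j k
        using Wl[of "[k]"] Wl[of "[j, k]"] by (simp_all add: B_def w2_def)
      show "(\<integral>x. indicat_real (ball xi (R * h)) x * u x * partials [k] (bump c a b) x \<partial>lborel) = - (\<integral>x. W [k] x * bump c a b x \<partial>lborel)"
        if "c > 0" "cbox a b \<subseteq> ball xi (R * h)" for k c a b
        using pairing[of "[k]" c a b] that by (simp add: B_def)
      show "(\<integral>x. indicat_real (ball xi (R * h)) x * u x * partials [j, k] (bump c a b) x \<partial>lborel) = (\<integral>x. w2 j k x * bump c a b x \<partial>lborel)"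
        if "c > 0" "cbox a b \<subseteq> ball xi (R * h)" for j k c a b
        using pairing[of "[j, k]" c a b] that by (simp add: B_def w2_def)
      show "AE x in lborel. x \<in> ball xi (R * h) \<longrightarrow> H x = mat_of w2 x \<and> (\<forall>i j. \<bar>mat_of w2 x $ i $ j\<bar> \<le> Lam)"
        using ae unfolding A_def[symmetric] B_def[symmetric] by eventually_elim (use ent in blast)
      show "transpose (mat_of w2 x0) = mat_of w2 x0" using x0(2) unfolding A_def by blast
      show "lam * (norm x)\<^sup>2 \<le> x \<bullet> (mat_of w2 x0 *v x)" "x \<bullet> (mat_of w2 x0 *v x) \<le> Lam * (norm x)\<^sup>2" for x
        using x0(2) unfolding A_def by blast+
      show "2 * \<epsilon> > 0" using \<epsilon>0 by simp
    qed
    also have "\<dots> \<le> weak_const ?n lam Lam R sep (\<gamma> / (8 * \<sigma>)) * (2 * (osc_const TYPE('n) * (R * h powr \<beta>) * K)) * lat.I"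
    proof -
      have "(R * h) powr \<beta> \<le> R * h powr \<beta>"
      proof -
        have "R powr \<beta> \<le> R powr 1" using R \<beta> by (intro powr_mono) auto
        then show ?thesis using R h by (simp add: powr_mult mult_right_mono)
      qed
      then show ?thesis
        unfolding phi_lint_one \<epsilon>_def using wc0 osc0 K0 I0 by (intro mult_right_mono mult_left_mono) auto
    qed
    also have "\<dots> = c * K" by (simp only: c_def mult_ac)
    finally show "\<bar>measure lebesgue (nodal_subdifferential (N0 \<union> Nb) (restrict u (N0 \<union> Nb)) xi)
            - (LINT x:\<Omega>|lebesgue. \<phi> xi x * det (H x))\<bar> \<le> c * K" .
  qed
  then have "\<bar>measure lebesgue (nodal_subdifferential (N0 \<union> Nb) (restrict u (N0 \<union> Nb)) xi)
            - (LINT x:\<Omega>|lebesgue. \<phi> xi x * det (H x))\<bar>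
      \<le> weak_const ?n lam Lam R sep (\<gamma> / (8 * \<sigma>)) * (2 * osc_const TYPE('n) * R) * h powr \<beta> * sem * lat.I"
    by (simp only: c_def mult_ac)
  then show ?thesis by (simp only: H_def phi_lint_one sem_def \<beta>_def \<delta>_def)
qed

end

text \<open>The supremum of a set of quotients is nonnegative only if the set has a member, so two
  distinct points of the ball are exhibited.\<close>

lemma C2_holder_seminorm_nonneg:
  fixes u :: "real^'n::finite \<Rightarrow> real"
  assumes "r > 0" "C2_holder \<alpha> (ball z r) u"
  shows "C2_holder_seminorm \<alpha> (ball z r) u \<ge> 0"
proof -
  obtain y where "dist z y = r / 2" using vector_choose_dist[of "r / 2" z] assms(1) by auto
  then have "norm (hessian u z - hessian u y) / dist z y powr \<alpha> \<in> holder_quotients \<alpha> (ball z r) u"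
    unfolding holder_quotients_def using assms(1) by fastforce
  then have "norm (hessian u z - hessian u y) / dist z y powr \<alpha> \<le> C2_holder_seminorm \<alpha> (ball z r) u"
    unfolding C2_holder_seminorm_def using assms(2) by (intro cSup_upper) (auto simp: C2_holder_def)
  moreover have "0 \<le> norm (hessian u z - hessian u y) / dist z y powr \<alpha>" by simp
  ultimately show ?thesis by linarith
qed

lemma translation_invariant_nodes_lattice:
  fixes \<Omega> :: "(real^'n::finite) set"
  assumes "translation_invariant_nodes \<Omega> h N0 Nb"
  obtains L where "countable L" "\<And>k l. \<lbrakk>k \<in> L; l \<in> L\<rbrakk> \<Longrightarrow> k - l \<in> L" "N0 = L \<inter> \<Omega>"
proof -
  obtain e :: "'n \<Rightarrow> real^'n" where e: "N0 = {h *\<^sub>R (\<Sum>j\<in>UNIV. real_of_int (k j) *\<^sub>R e j) |k. True} \<inter> \<Omega>"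
    using assms unfolding translation_invariant_nodes_def by (elim exE conjE)
  define p where "p k = h *\<^sub>R (\<Sum>j\<in>UNIV. real_of_int (k j) *\<^sub>R e j)" for k
  show thesis
  proof (rule that[of "range p"])
    show "countable (range p)" by simp
    show "N0 = range p \<inter> \<Omega>" unfolding e p_def by (simp add: full_SetCompr_eq)
    fix k l assume "k \<in> range p" "l \<in> range p"
    then obtain a b where "k = p a" "l = p b" by (elim rangeE)
    then have "k - l = p (\<lambda>j. a j - b j)"
      by (simp add: p_def scaleR_diff_right[symmetric] scaleR_diff_left sum_subtractf)
    then show "k - l \<in> range p" by (simp only: rangeI)
  qed
qed

theorem proposition5p4:
  fixes lam Lam \<gamma> \<sigma> :: real
  assumes "CARD('n::finite) \<ge> 2"
    and "0 < lam" and "lam \<le> Lam"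
    and "0 < \<gamma>" and "\<gamma> \<le> 1"
  shows "\<exists>C>0. \<forall>(\<Omega> :: (real^'n) set) N0 Nb \<T> \<phi> h xi u.
     h > 0 \<and> uniformly_convex_domain \<Omega> \<and> nodal_set \<Omega> N0 Nb \<and>
     conforming_mesh \<Omega> (N0 \<union> Nb) \<T> \<and> quasi_uniform \<gamma> h N0 \<T> \<and> shape_regular \<sigma> \<T> \<and>
     translation_invariant_nodes \<Omega> h N0 Nb \<and>
     (\<forall>z \<in> N0 \<union> Nb. hat_function \<T> (N0 \<union> Nb) z (\<phi> z)) \<and>
     translation_invariant_basis \<T> h N0 \<phi> \<and>
     xi \<in> N0 \<and> infdist xi (frontier (\<Union>\<T>)) \<ge> Lam / lam * \<sigma>\<^sup>2 * h \<and>
     continuous_on (closure \<Omega>) u \<and> convex_on (closure \<Omega>) u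
     \<longrightarrow>
     (let B = ball xi (Lam / lam * \<sigma>\<^sup>2 * h);
          Nu = restrict u (N0 \<union> Nb);
          err = (\<lambda>H. \<bar>measure lebesgue (nodal_subdifferential (N0 \<union> Nb) Nu xi)
                      - (LINT x:\<Omega>|lebesgue. \<phi> xi x * det (H x))\<bar>)
      in
      (\<forall>\<alpha>. 0 < \<alpha> \<and> \<alpha> \<le> 1 \<and> C2_holder \<alpha> B u \<and>
          (\<forall>x\<in>B. loewner_le (mat lam) (hessian u x) \<and> loewner_le (hessian u x) (mat Lam)) \<longrightarrow>
          err (hessian u)
            \<le> C * h powr \<alpha> * C2_holder_seminorm \<alpha> B u * (LINT x:\<Omega>|lebesgue. \<phi> xi x)) \<and>
      (\<forall>s q. 1 \<le> q \<and> s - enn2real (of_nat CARD('n) / q) > 2 \<and> s \<le> 3 \<and> in_sobolev s q B u \<and>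
          (AE x in lebesgue_on B. loewner_le (mat lam) (weak_hessian B u x) \<and>
                                  loewner_le (weak_hessian B u x) (mat Lam)) \<longrightarrow>
          err (weak_hessian B u)
            \<le> C * h powr (s - 2 - enn2real (of_nat CARD('n) / q))
                * enn2real (sobolev_seminorm s q B u) * (LINT x:\<Omega>|lebesgue. \<phi> xi x)))"
proof -
  define R where "R = Lam / lam * \<sigma>\<^sup>2"
  define S where "S = 1 / (2 * (16 * \<sigma> / \<gamma>) ^ CARD('n))"
  define C1 where "C1 = cell_const CARD('n) lam S (Lam * R\<^sup>2) * R ^ 3 * (det_lipschitz_const CARD('n) Lam * Lam)
    + det_lipschitz_const CARD('n) Lam"
  define C2 where "C2 = weak_const CARD('n) lam Lam R S (\<gamma> / (8 * \<sigma>)) * (2 * osc_const TYPE('n) * R)"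
  \<comment> \<open>The entry 1 provides positivity for every choice of the parameters.\<close>
  define C where "C = max 1 (max C1 C2)"
  have C: "C > 0" "C1 \<le> C" "C2 \<le> C" by (auto simp: C_def)
  show ?thesis
    unfolding R_def[symmetric]
  proof (intro exI conjI allI impI, rule C(1), unfold Let_def, intro conjI allI impI)
    fix \<Omega> :: "(real^'n) set" and N0 Nb \<T> \<phi> h xi u
    assume asm: "h > 0 \<and> uniformly_convex_domain \<Omega> \<and> nodal_set \<Omega> N0 Nb \<and>
     conforming_mesh \<Omega> (N0 \<union> Nb) \<T> \<and> quasi_uniform \<gamma> h N0 \<T> \<and> shape_regular \<sigma> \<T> \<and>
     translation_invariant_nodes \<Omega> h N0 Nb \<and>
     (\<forall>z \<in> N0 \<union> Nb. hat_function \<T> (N0 \<union> Nb) z (\<phi> z)) \<and>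
     translation_invariant_basis \<T> h N0 \<phi> \<and>
     xi \<in> N0 \<and> infdist xi (frontier (\<Union>\<T>)) \<ge> R * h \<and>
     continuous_on (closure \<Omega>) u \<and> convex_on (closure \<Omega>) u"
    then have h: "h > 0" and mesh: "conforming_mesh \<Omega> (N0 \<union> Nb) \<T>" "shape_regular \<sigma> \<T>" and xi: "xi \<in> N0"
      and u: "continuous_on (closure \<Omega>) u" "convex_on (closure \<Omega>) u"
      by simp_all
    obtain L where L: "countable L" "\<And>k l. \<lbrakk>k \<in> L; l \<in> L\<rbrakk> \<Longrightarrow> k - l \<in> L" "N0 = L \<inter> \<Omega>"
      using translation_invariant_nodes_lattice[of \<Omega> h N0 Nb] asm by blast
    have dim: "DIM(real^'n) \<ge> 2" using assms(1) by simp
    \<comment> \<open>For smaller \<sigma> no mesh satisfies the hypotheses; a single cell, which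
      exists because \<open>xi\<close> is a vertex, yields the bound.\<close>
    have \<sigma>2: "\<sigma>\<^sup>2 \<ge> 3"
    proof -
      obtain T where "T \<in> \<T>" using mesh(1) xi unfolding conforming_mesh_def by blast
      then show ?thesis using shape_regular_ge(2)[OF mesh(1) _ dim mesh(2)] by blast
    qed
    have R3: "R \<ge> 3" "3 * Lam \<le> lam * R"
    proof -
      have "1 * 3 \<le> Lam / lam * \<sigma>\<^sup>2"
        using assms \<sigma>2 by (intro mult_mono) (auto simp: field_simps)
      then show "R \<ge> 3" by (simp add: R_def)
      have "3 * Lam \<le> \<sigma>\<^sup>2 * Lam" using assms \<sigma>2 by (intro mult_right_mono) auto
      then show "3 * Lam \<le> lam * R" using assms by (simp add: R_def mult.commute)
    qed
    interpret lattice_mesh \<Omega> N0 Nb L \<T> \<phi> h R \<gamma> \<sigma> xi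
    proof unfold_locales
      show "open \<Omega>" "convex \<Omega>" using asm by (simp_all add: uniformly_convex_domain_def)
    qed (use asm L R3 dim assms in auto)
    have sep: "sep = S" by (simp add: sep_def S_def)
    have int0: "(LINT x:\<Omega>|lebesgue. \<phi> xi x) \<ge> 0" unfolding phi_lint_one using lat.I_pos by simp
    have Rh: "R * h > 0" using R3 h by simp
    {
      fix \<alpha> :: real
      assume a: "0 < \<alpha> \<and> \<alpha> \<le> 1 \<and> C2_holder \<alpha> (ball xi (R * h)) u \<and>
        (\<forall>x\<in>ball xi (R * h). loewner_le (mat lam) (hessian u x) \<and> loewner_le (hessian u x) (mat Lam))"
      have "\<bar>measure lebesgue (nodal_subdifferential (N0 \<union> Nb) (restrict u (N0 \<union> Nb)) xi)
            - (LINT x:\<Omega>|lebesgue. \<phi> xi x * det (hessian u x))\<bar>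
          \<le> C1 * h powr \<alpha> * C2_holder_seminorm \<alpha> (ball xi (R * h)) u * (LINT x:\<Omega>|lebesgue. \<phi> xi x)"
        unfolding C1_def sep[symmetric] by (rule holder_case[OF u(2) assms(2,3) R3(2)]) (use a in auto)
      also have "\<dots> \<le> C * h powr \<alpha> * C2_holder_seminorm \<alpha> (ball xi (R * h)) u * (LINT x:\<Omega>|lebesgue. \<phi> xi x)"
        using C(2) int0 C2_holder_seminorm_nonneg[OF Rh] a by (intro mult_right_mono) auto
      finally show "\<bar>measure lebesgue (nodal_subdifferential (N0 \<union> Nb) (restrict u (N0 \<union> Nb)) xi)
            - (LINT x:\<Omega>|lebesgue. \<phi> xi x * det (hessian u x))\<bar>
          \<le> C * h powr \<alpha> * C2_holder_seminorm \<alpha> (ball xi (R * h)) u * (LINT x:\<Omega>|lebesgue. \<phi> xi x)" .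
    next
      fix s q
      assume a: "1 \<le> q \<and> s - enn2real (of_nat CARD('n) / q) > 2 \<and> s \<le> 3 \<and> in_sobolev s q (ball xi (R * h)) u \<and>
        (AE x in lebesgue_on (ball xi (R * h)). loewner_le (mat lam) (weak_hessian (ball xi (R * h)) u x) \<and>
           loewner_le (weak_hessian (ball xi (R * h)) u x) (mat Lam))"
      have "\<bar>measure lebesgue (nodal_subdifferential (N0 \<union> Nb) (restrict u (N0 \<union> Nb)) xi)
            - (LINT x:\<Omega>|lebesgue. \<phi> xi x * det (weak_hessian (ball xi (R * h)) u x))\<bar>
          \<le> C2 * h powr (s - 2 - enn2real (of_nat CARD('n) / q))
            * enn2real (sobolev_seminorm s q (ball xi (R * h)) u) * (LINT x:\<Omega>|lebesgue. \<phi> xi x)"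
        unfolding C2_def sep[symmetric] by (rule sobolev_case[OF u(2,1) assms(2,3) R3(2)]) (use a in \<open>simp_all only: simp_thms\<close>)
      also have "\<dots> \<le> C * h powr (s - 2 - enn2real (of_nat CARD('n) / q))
            * enn2real (sobolev_seminorm s q (ball xi (R * h)) u) * (LINT x:\<Omega>|lebesgue. \<phi> xi x)"
        using C(3) int0 by (intro mult_right_mono) auto
      finally show "\<bar>measure lebesgue (nodal_subdifferential (N0 \<union> Nb) (restrict u (N0 \<union> Nb)) xi)
            - (LINT x:\<Omega>|lebesgue. \<phi> xi x * det (weak_hessian (ball xi (R * h)) u x))\<bar>
          \<le> C * h powr (s - 2 - enn2real (of_nat CARD('n) / q))
            * enn2real (sobolev_seminorm s q (ball xi (R * h)) u) * (LINT x:\<Omega>|lebesgue. \<phi> xi x)" .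
    }
  qed
qed

end
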